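(* Let $k\ge 1$, let $[\bar z_1,\dots,\bar z_k]\in\pi_k(X_{2k})$, and let $S_i,N_i,N_i^c,R_i,R_i^c$ ($1\le i\le k+1$) be the associated operators and subspaces described in the context. Assume that the sum operator $$[S_1\cdots S_{k+1}]\in L[N_0\times\cdots\times N_k,\bar B],\qquad (n_0,\dots,n_k)\mapsto S_1n_0+\cdots+S_{k+1}n_k,$$ is surjective, i.e. $R_{k+1}^c=\{0\}$. Then there exists a smooth family $z(\varepsilon,\bar n)$, $\bar n=(n_1,\dots,n_{k+1})\in N_1\times\cdots\times N_{k+1}$, of solution curves of $G[z]=0$, that is, $G[z(\varepsilon,\bar n)]=0$, defined for $\bar n$ in an arbitrary given bounded subset of $N_1\times\cdots\times N_{k+1}$ and all $\varepsilon\in\mathbb K$ with $|\varepsilon|$ sufficiently small (depending on the bounded set), with the following properties. (i) $$z(\varepsilon,\bar n)=\varepsilon\bar z_1+\cdots+\tfrac1{k!}\varepsilon^k\bar z_k+\tfrac1{(k+1)!}\varepsilon^{k+1}z_{k+1}(\varepsilon,\bar n)+\cdots+\tfrac1{(2k+1)!}\varepsilon^{2k+1}z_{2k+1}(\varepsilon,\bar n)$$ with smooth $B$-valued functions $z_{k+1},\dots,z_{2k+1}$. (ii) $[\bar z_1,\dots,\bar z_k,z_{k+1}(0,\bar n),\dots,z_{2k}(0,\bar n),z_{2k+1}(0,\bar n)]\in\bar X_{2k+1}$ and $[\bar z_1,\dots,\bar z_k,z_{k+1}(\varepsilon,\bar n),\dots,z_{2k}(\varepsilon,\bar n)]\in\bar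 X_{2k}$. (iii) There are a constant vector $\hat I_{k+1}\in B^{k+1}$, constant operator matrices $\hat M_{k+1},\hat L_{k+1}\in GL[B^{k+1},B^{k+1}]$ and smooth functions $n_i^c(\varepsilon,\bar n)\in N_i^c$, $i=1,\dots,k+1$, with $(n_1^c,\dots,n_{k+1}^c)(0,\bar n)=0$, such that $$\begin{pmatrix}z_{2k+1}\\ \vdots\\ z_{k+1}\end{pmatrix}(\varepsilon,\bar n)=\hat I_{k+1}+\hat M_{k+1}\cdot\left[\begin{pmatrix}n_1^c\\ \vdots\\ n_{k+1}^c\end{pmatrix}(\varepsilon,\bar n)+\hat L_{k+1}\cdot\begin{pmatrix}n_1\\ \vdots\\ n_{k+1}\end{pmatrix}\right].$$ (iv) If $N^c:=N_1^c\oplus N_2^c\oplus\cdots\oplus N_{k+1}^c$ is finite dimensional, then the determinant (with respect to fixed bases) of the linearization $G_{n^c}[z(\varepsilon,\bar n)]:=G'[z(\varepsilon,\bar n)]|_{N^c}\in L[N^c,\bar B]$ satisfies $$\det\{G_{n^c}[z(\varepsilon,\bar n)]\}=c\cdot\varepsilon^{\chi}+O(|\varepsilon|^{\chi+1}),\quad c\ne0,\qquad \chi=1\cdot\dim N_2^c+\cdots+k\cdot\dim N_{k+1}^c .$$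
   Context: $\mathbb K\in\{\mathbb R,\mathbb C\}$; $B,\bar B$ are Banach spaces over $\mathbb K$; $G:B\to\bar B$ is analytic near $0$ with $G[0]=0$. $L[\cdot,\cdot]$ denotes bounded linear operators and $GL$ the invertible ones. System of undetermined coefficients: $T^i[z_1,\dots,z_i]:=\frac{d^i}{d\varepsilon^i}\big|_{\varepsilon=0}G\big[\sum_{j=1}^{i}\frac1{j!}\varepsilon^jz_j\big]$. $X_n\subset B^n$ is the set of $[z_1,\dots,z_n]$ with $T^1[z_1]=0,\dots,T^n[z_1,\dots,z_n]=0$. $\pi_l$ denotes truncation to the first $l$ components. For a fixed $[\bar z_1,\dots,\bar z_k]\in\pi_k(X_{2k})$ and $n\ge k$, $\bar X_n:=\{[z_1,\dots,z_n]\in X_n: z_1=\bar z_1,\dots,z_k=\bar z_k\}$. Operators and decompositions: define $A_0,\dots,A_k\in L[B,\bar B]$ as the coefficients of $\varepsilon^0,\dots,\varepsilon^k$ in the expansion $G'\big[\sum_{j=1}^k\frac1{j!}\varepsilon^j\bar z_j\big]=\sum_{i\ge0}\varepsilon^iA_i$ (so $A_0=G'[0]$). Put $N_0:=B$, $R_0^c:=\bar B$, $S_1:=A_0$. Recursively for $i=1,\dots,k+1$, $N_i\subset N_{i-1}$ is the kernel and $R_i\subset R_{i-1}^c$ the range of $S_i\in L[N_{i-1},R_{i-1}^c]$; it is a standing assumption that there are direct sums of closed subspaces $N_{i-1}=N_i^c\oplus N_i$ and $R_{i-1}^c=R_i\oplus R_i^c$, with $S_i:N_i^c\to R_i$ a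 continuous bijection (the complements $N_i^c,R_i^c$ are fixed once and for all). Thus $B=N_1^c\oplus\cdots\oplus N_{k+1}^c\oplus N_{k+1}$ and $\bar B=R_1\oplus\cdots\oplus R_{k+1}\oplus R_{k+1}^c$. For $1\le i\le k$ the next operator $S_{i+1}\in L[N_i,R_i^c]$ is defined as follows: for $v_0\in N_i$ there exist $v_1,\dots,v_{i-1}\in B$ with $\sum_{j=0}^{s}A_jv_{s-j}=0$ for $s=0,\dots,i-1$, and $$S_{i+1}v_0:=\tfrac{(2i)!}{i!}\,P_{R_i^c}\sum_{j=1}^{i}A_jv_{i-j},$$ where $P_{R_i^c}$ is the projection onto $R_i^c$ along $R_1\oplus\cdots\oplus R_i$; this does not depend on the choice of $v_1,\dots,v_{i-1}$. For example $S_2=P_{R_1^c}\circ2G''[0]\bar z_1|_{N_1}$ and $S_3=P_{R_2^c}\circ[6G''[0]\bar z_2+6G'''[0]\bar z_1^2-12\,G''[0]\bar z_1\circ S_1^{-1}P_{R_1}\circ G''[0]\bar z_1]|_{N_2}$, where $S_1^{-1}:R_1\to N_1^c$ and $P_{R_1}$ is the projection onto $R_1$. *)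

theory Defs
  imports "HOL-Analysis.Analysis" "Jordan_Normal_Form.Determinant"
begin

no_notation vec_index (infixl "$" 100)

text \<open>
  Banach spaces over \<open>'k\<close>, which stands for the real or the complex numbers: up to isometric
  isomorphism these are the only instances of the sort below (commutative finite-dimensional
  real division algebras with a multiplicative norm). The scalar multiplication is a parameter,
  since there is no library class of complex Banach spaces; the locale makes it compatible with
  the real Banach space structure of the type.
\<close>

locale banach_over = vector_space scale
  for scale :: "'k::{real_normed_field,euclidean_space} \<Rightarrow> 'b::banach \<Rightarrow> 'b" +
  assumes scale_of_real: "scale (of_real r) x = r *\<^sub>R x"
    and norm_scale: "norm (scale c x) = norm c * norm x"

lemma banach_over_real: "banach_over (scaleR :: real \<Rightarrow> 'b::banach \<Rightarrow> 'b)"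
  by unfold_locales (auto simp: algebra_simps)

lemma banach_over_complex: "banach_over ((*) :: complex \<Rightarrow> complex \<Rightarrow> complex)"
  by unfold_locales (auto simp: algebra_simps norm_mult scaleR_conv_of_real)

definition scale_vec :: "('k \<Rightarrow> 'b \<Rightarrow> 'b) \<Rightarrow> 'k \<Rightarrow> 'b ^ 'n \<Rightarrow> 'b ^ 'n" where
  "scale_vec s c x = (\<chi> i. s c (x $ i))"

definition scale_prod :: "('k \<Rightarrow> 'b \<Rightarrow> 'b) \<Rightarrow> 'k::times \<Rightarrow> 'k \<times> 'b \<Rightarrow> 'k \<times> 'b" where
  "scale_prod s c p = (c * fst p, s c (snd p))"

subsection \<open>Linear and multilinear maps over the scalar field\<close>

definition bounded_klinear ::
  "('k \<Rightarrow> 'e::real_normed_vector \<Rightarrow> 'e) \<Rightarrow> ('k \<Rightarrow> 'f::real_normed_vector \<Rightarrow> 'f) \<Rightarrow> ('e \<Rightarrow> 'f) \<Rightarrow> bool" where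
  "bounded_klinear sE sF f \<longleftrightarrow> bounded_linear f \<and> (\<forall>c x. f (sE c x) = sF c (f x))"

definition GL :: "('k \<Rightarrow> 'e::real_normed_vector \<Rightarrow> 'e) \<Rightarrow> ('e \<Rightarrow> 'e) set" where
  "GL s = {f. bounded_klinear s s f \<and> (\<exists>g. bounded_klinear s s g \<and> f \<circ> g = id \<and> g \<circ> f = id)}"

text \<open>
  An \<open>m\<close>-linear map on the subspace \<open>V\<close> takes the list of its \<open>m\<close> arguments.
\<close>

definition bounded_multilinear_on ::
  "('k \<Rightarrow> 'e::real_normed_vector \<Rightarrow> 'e) \<Rightarrow> ('k \<Rightarrow> 'f::real_normed_vector \<Rightarrow> 'f) \<Rightarrow> 'e set \<Rightarrow> nat
    \<Rightarrow> ('e list \<Rightarrow> 'f) \<Rightarrow> bool" where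
  "bounded_multilinear_on sE sF V m f \<longleftrightarrow>
     (\<forall>vs i x y c. length vs = m \<and> set vs \<subseteq> V \<and> i < m \<and> x \<in> V \<and> y \<in> V \<longrightarrow>
        f (vs[i := x + y]) = f (vs[i := x]) + f (vs[i := y]) \<and>
        f (vs[i := sE c x]) = sF c (f (vs[i := x]))) \<and>
     (\<exists>C. \<forall>vs. length vs = m \<and> set vs \<subseteq> V \<longrightarrow> norm (f vs) \<le> C * prod_list (map norm vs))"

subsection \<open>Analytic and smooth maps between Banach spaces\<close>

text \<open>
  Analyticity at \<open>x\<close>: near \<open>x\<close> the map is the sum of a power series of bounded symmetric
  multilinear maps \<open>a m\<close> with positive radius of normal convergence.
\<close>

definition analytic_at_point ::
  "('k \<Rightarrow> 'e::real_normed_vector \<Rightarrow> 'e) \<Rightarrow> ('k \<Rightarrow> 'f::real_normed_vector \<Rightarrow> 'f) \<Rightarrow> ('e \<Rightarrow> 'f) \<Rightarrow> 'e \<Rightarrow> bool" where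
  "analytic_at_point sE sF G x \<longleftrightarrow>
     (\<exists>a r C. r > 0 \<and>
        (\<forall>m. bounded_multilinear_on sE sF UNIV m (a m)) \<and>
        (\<forall>m vs ws. length vs = m \<and> mset vs = mset ws \<longrightarrow> a m vs = a m ws) \<and>
        (\<forall>m vs. length vs = m \<longrightarrow> norm (a m vs) \<le> C / r ^ m * prod_list (map norm vs)) \<and>
        (\<forall>h. norm h < r \<longrightarrow> (\<lambda>m. a m (replicate m h)) sums G (x + h)))"

definition analytic_near ::
  "('k \<Rightarrow> 'e::real_normed_vector \<Rightarrow> 'e) \<Rightarrow> ('k \<Rightarrow> 'f::real_normed_vector \<Rightarrow> 'f) \<Rightarrow> ('e \<Rightarrow> 'f) \<Rightarrow> 'e \<Rightarrow> bool" where
  "analytic_near sE sF G x \<longleftrightarrow>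
     (\<exists>U. open U \<and> x \<in> U \<and> (\<forall>y\<in>U. analytic_at_point sE sF G y))"

text \<open>
  Infinite Frechet differentiability over \<open>'k\<close> of a map on a relatively open subset \<open>W\<close> of the
  subspace \<open>V\<close>: \<open>D m x\<close> is the \<open>m\<close>-th derivative at \<open>x\<close>, and \<open>D (Suc m)\<close> is the derivative of
  \<open>D m\<close> with respect to the operator norm of \<open>m\<close>-linear maps on \<open>V\<close>. All derivatives are
  taken along \<open>V\<close> only.
\<close>

definition smooth_on_subspace ::
  "('k \<Rightarrow> 'e::real_normed_vector \<Rightarrow> 'e) \<Rightarrow> ('k \<Rightarrow> 'f::real_normed_vector \<Rightarrow> 'f) \<Rightarrow> 'e set \<Rightarrow> 'e set
    \<Rightarrow> ('e \<Rightarrow> 'f) \<Rightarrow> bool" where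
  "smooth_on_subspace sE sF V W f \<longleftrightarrow>
     openin (top_of_set V) W \<and>
     (\<exists>D. (\<forall>x\<in>W. D 0 x [] = f x) \<and>
        (\<forall>m. \<forall>x\<in>W. bounded_multilinear_on sE sF V m (D m x)) \<and>
        (\<forall>m. \<forall>x\<in>W. \<forall>e>0. \<exists>d>0. \<forall>h\<in>V. norm h < d \<and> x + h \<in> W \<longrightarrow>
           (\<forall>vs. length vs = m \<and> set vs \<subseteq> V \<longrightarrow>
              norm (D m (x + h) vs - D m x vs - D (Suc m) x (h # vs))
                \<le> e * norm h * prod_list (map norm vs))))"

definition kderiv ::
  "('k::real_normed_field \<Rightarrow> 'f::real_normed_vector \<Rightarrow> 'f) \<Rightarrow> ('k \<Rightarrow> 'f) \<Rightarrow> 'k \<Rightarrow> 'f" where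
  "kderiv s f x = (THE D. (f has_derivative (\<lambda>h. s h D)) (at x))"

subsection \<open>The system of undetermined coefficients\<close>

text \<open>A tuple \<open>[z\<^sub>1, \<dots>, z\<^sub>n]\<close> is a list, so \<open>z\<^sub>j\<close> is \<open>zs ! (j - 1)\<close> and \<open>\<pi>\<^sub>l\<close> is \<open>take l\<close>.\<close>

definition curve :: "('k::real_normed_field \<Rightarrow> 'b::real_normed_vector \<Rightarrow> 'b) \<Rightarrow> 'b list \<Rightarrow> 'k \<Rightarrow> 'b" where
  "curve sB zs \<epsilon> = (\<Sum>j=1..length zs. sB (\<epsilon> ^ j / fact j) (zs ! (j - 1)))"

definition T ::
  "('k::real_normed_field \<Rightarrow> 'b::real_normed_vector \<Rightarrow> 'b) \<Rightarrow> ('k \<Rightarrow> 'c::real_normed_vector \<Rightarrow> 'c)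
    \<Rightarrow> ('b \<Rightarrow> 'c) \<Rightarrow> 'b list \<Rightarrow> 'c" where
  "T sB sC G zs = (kderiv sC ^^ length zs) (\<lambda>\<epsilon>. G (curve sB zs \<epsilon>)) 0"

definition X ::
  "('k::real_normed_field \<Rightarrow> 'b::real_normed_vector \<Rightarrow> 'b) \<Rightarrow> ('k \<Rightarrow> 'c::real_normed_vector \<Rightarrow> 'c)
    \<Rightarrow> ('b \<Rightarrow> 'c) \<Rightarrow> nat \<Rightarrow> 'b list set" where
  "X sB sC G n = {zs. length zs = n \<and> (\<forall>i\<in>{1..n}. T sB sC G (take i zs) = 0)}"

definition Xbar ::
  "('k::real_normed_field \<Rightarrow> 'b::real_normed_vector \<Rightarrow> 'b) \<Rightarrow> ('k \<Rightarrow> 'c::real_normed_vector \<Rightarrow> 'c)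
    \<Rightarrow> ('b \<Rightarrow> 'c) \<Rightarrow> 'b list \<Rightarrow> nat \<Rightarrow> 'b list set" where
  "Xbar sB sC G zbar n = {zs \<in> X sB sC G n. take (length zbar) zs = zbar}"

text \<open>
  \<open>A\<^sub>i\<close>: the coefficient of \<open>\<epsilon>\<^sup>i\<close> in the Taylor expansion of \<open>G'\<close> along the curve given by
  \<open>zbar\<close>. The real Frechet derivative of an analytic map is its derivative over \<open>'k\<close>.
\<close>

definition expansion_coeff ::
  "('k::real_normed_field \<Rightarrow> 'b::real_normed_vector \<Rightarrow> 'b) \<Rightarrow> ('k \<Rightarrow> 'c::real_normed_vector \<Rightarrow> 'c)
    \<Rightarrow> ('b \<Rightarrow> 'c) \<Rightarrow> 'b list \<Rightarrow> nat \<Rightarrow> 'b \<Rightarrow> 'c" where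
  "expansion_coeff sB sC G zbar i v =
     sC (1 / fact i) ((kderiv sC ^^ i) (\<lambda>\<epsilon>. frechet_derivative G (at (curve sB zbar \<epsilon>)) v) 0)"

subsection \<open>The operators and decompositions\<close>

definition subspace_sum :: "nat set \<Rightarrow> (nat \<Rightarrow> 'b::comm_monoid_add set) \<Rightarrow> 'b set" where
  "subspace_sum I V = {(\<Sum>i\<in>I. v i) | v. \<forall>i\<in>I. v i \<in> V i}"

definition closed_subspace :: "('k::field \<Rightarrow> 'b::real_normed_vector \<Rightarrow> 'b) \<Rightarrow> 'b set \<Rightarrow> bool" where
  "closed_subspace s V \<longleftrightarrow> module.subspace s V \<and> closed V"

definition direct_sum :: "'b::ab_group_add set \<Rightarrow> 'b set \<Rightarrow> 'b set \<Rightarrow> bool" where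
  "direct_sum V W U \<longleftrightarrow> U = {v + w | v w. v \<in> V \<and> w \<in> W} \<and> V \<inter> W = {0}"

definition proj_along :: "'b::ab_group_add set \<Rightarrow> 'b set \<Rightarrow> 'b \<Rightarrow> 'b" where
  "proj_along V W y = (THE r. r \<in> V \<and> y - r \<in> W)"

text \<open>
  \<open>S i\<close> is a total function of which only the values on \<open>N (i - 1)\<close> matter. The last clause
  prescribes \<open>S (Suc i)\<close> for every admissible choice of \<open>v\<^sub>1, \<dots>, v\<^bsub>i-1\<^esub>\<close>; such a choice always
  exists, and the value does not depend on it.
\<close>

definition decomposition ::
  "('k::real_normed_field \<Rightarrow> 'b::real_normed_vector \<Rightarrow> 'b) \<Rightarrow> ('k \<Rightarrow> 'c::real_normed_vector \<Rightarrow> 'c)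
    \<Rightarrow> (nat \<Rightarrow> 'b \<Rightarrow> 'c) \<Rightarrow> nat \<Rightarrow> (nat \<Rightarrow> 'b \<Rightarrow> 'c) \<Rightarrow> (nat \<Rightarrow> 'b set) \<Rightarrow> (nat \<Rightarrow> 'b set)
    \<Rightarrow> (nat \<Rightarrow> 'c set) \<Rightarrow> (nat \<Rightarrow> 'c set) \<Rightarrow> bool" where
  "decomposition sB sC A k S N Nc R Rc \<longleftrightarrow>
     N 0 = UNIV \<and> Rc 0 = UNIV \<and> S 1 = A 0 \<and>
     (\<forall>i\<in>{1..k+1}.
        N i = {v \<in> N (i - 1). S i v = 0} \<and>
        R i = S i ` N (i - 1) \<and>
        closed_subspace sB (Nc i) \<and> closed_subspace sB (N i) \<and>
        closed_subspace sC (R i) \<and> closed_subspace sC (Rc i) \<and>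
        direct_sum (Nc i) (N i) (N (i - 1)) \<and>
        direct_sum (R i) (Rc i) (Rc (i - 1)) \<and>
        continuous_on (Nc i) (S i) \<and> bij_betw (S i) (Nc i) (R i)) \<and>
     (\<forall>i\<in>{1..k}. \<forall>v. v 0 \<in> N i \<and> (\<forall>s<i. (\<Sum>j=0..s. A j (v (s - j))) = 0) \<longrightarrow>
        S (Suc i) (v 0) =
          sC (fact (2 * i) / fact i)
            (proj_along (Rc i) (subspace_sum {1..i} R) (\<Sum>j=1..i. A j (v (i - j)))))"

text \<open>
  The parameter space \<open>N\<^sub>1 \<times> \<dots> \<times> N\<^bsub>k+1\<^esub>\<close> as a subspace of \<open>B\<^bsup>k+1\<^esup>\<close>, which is the type
  \<open>'b ^ 'n\<close> whose components are numbered from \<open>1\<close> to \<open>k+1\<close> by \<open>ix\<close>.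
\<close>

definition param_space :: "('n \<Rightarrow> nat) \<Rightarrow> (nat \<Rightarrow> 'b set) \<Rightarrow> ('b ^ 'n) set" where
  "param_space ix N = {n. \<forall>i. n $ i \<in> N (ix i)}"

subsection \<open>Finite dimension, bases and determinants\<close>

definition finite_dim :: "('k::field \<Rightarrow> 'b::ab_group_add \<Rightarrow> 'b) \<Rightarrow> 'b set \<Rightarrow> bool" where
  "finite_dim s V \<longleftrightarrow> (\<exists>F. finite F \<and> V \<subseteq> module.span s F)"

definition is_basis :: "('k::field \<Rightarrow> 'b::ab_group_add \<Rightarrow> 'b) \<Rightarrow> 'b set \<Rightarrow> 'b list \<Rightarrow> bool" where
  "is_basis s V bs \<longleftrightarrow>
     distinct bs \<and> \<not> module.dependent s (set bs) \<and> module.span s (set bs) = V"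

definition det_wrt :: "('k::field \<Rightarrow> 'c::ab_group_add \<Rightarrow> 'c) \<Rightarrow> 'b list \<Rightarrow> 'c list \<Rightarrow> ('b \<Rightarrow> 'c) \<Rightarrow> 'k" where
  "det_wrt sC bs cs f =
     Determinant.det (mat (length cs) (length bs)
       (\<lambda>(i, j). module.representation sC (set cs) (f (bs ! j)) (cs ! i)))"

end

theory Submission
  imports Defs
begin

text \<open>
  On \<open>N\<^sub>i\<close> there are linear maps \<open>v \<mapsto> (v, E\<^sub>1 v, \<dots>, E\<^bsub>i-1\<^esub> v)\<close> that solve the first \<open>i\<close> rows of the
  triangular system \<open>\<Sum>\<^sub>j A\<^sub>j v\<^bsub>s-j\<^esub> = 0\<close> and whose defect in the next row equals \<open>S\<^bsub>i+1\<^esub> v\<close> modulo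
  \<open>R\<^sub>1 \<oplus> \<dots> \<oplus> R\<^sub>i\<close>, up to a factor. Since \<open>\<Sum>R\<^sub>i\<close> is the whole space, these defects yield a linear
  isomorphism between \<open>N\<^sub>1\<^sup>c \<times> \<dots> \<times> N\<^bsub>k+1\<^esub>\<^sup>c\<close> and the target space. Hence the coefficients of
  \<open>\<epsilon>\<^bsup>k+1\<^esup>, \<dots>, \<epsilon>\<^bsup>2k+1\<^esup>\<close> can be parametrized affinely by \<open>n\<^sub>1, \<dots>, n\<^bsub>k+1\<^esub>\<close> and a vector \<open>y\<close> such that
  all coefficients of \<open>G[z]\<close> below \<open>\<epsilon>\<^bsup>2k+1\<^esup>\<close> vanish and that of \<open>\<epsilon>\<^bsup>2k+1\<^esup>\<close> is \<open>y\<close>; the terms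
  quadratic in the new coefficients have order at least \<open>2k+2\<close>. Division by \<open>\<epsilon>\<^bsup>2k+1\<^esup>\<close> turns \<open>G[z] = 0\<close> into
  \<open>y = \<epsilon> F (\<epsilon>, n, y)\<close>, which the implicit function theorem solves uniformly for bounded \<open>n\<close>.

  For the determinant, \<open>G'[z]\<close> maps \<open>v + \<epsilon> E\<^sub>1 v + \<epsilon>\<^sup>2 E\<^sub>2 v + \<dots>\<close> with \<open>v \<in> N\<^bsub>i+1\<^esub>\<^sup>c\<close> to \<open>\<epsilon>\<^sup>i\<close> times the
  defect of \<open>v\<close> plus \<open>O(\<epsilon>\<^bsup>i+1\<^esup>)\<close>; the perturbed vectors form a basis with transition determinant
  \<open>1 + O(\<epsilon>)\<close>, and the defects of a basis of \<open>N\<^sup>c\<close> are a basis of the target space.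
\<close>

section \<open>Banach spaces over the scalar field\<close>

text \<open>The obstacle that shapes the proof is smoothness of every order over the scalar field,
  along a subspace of a product of Banach spaces. Operator-valued derivatives would live in a space
  that changes with the order. Here all derivatives form one function of a point and a list of
  directions; it is built from directional derivatives with bounds, and multilinearity, Taylor
  estimates and Frechet differentiability are recovered from the bounds on the next orders. To
  differentiate a formula arbitrarily often it then suffices to find a language of terms, each of
  them bounded, in which the derivative of a term is a finite sum of terms. Products, compositions
  with the power series and the implicitly defined solution are all treated in this way.

  The domain of the solution is not a product, since the radius in \<epsilon> depends on the bound
  for the parameters. The solution is constructed on the sets \<open>Wm m\<close>, one for each
  natural bound \<open>m\<close>, and uniqueness of the fixed point makes the pieces agree.
  Surjectivity of the sum operator is used in the form \<open>Rc (k+1) = {0}\<close>, which makes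
  back substitution solve for every right-hand side.\<close>

context banach_over
begin

lemma bounded_bilinear_scale: "bounded_bilinear scale"
proof
  show "\<exists>K. \<forall>a b. norm (scale a b) \<le> norm a * norm b * K"
    by (rule exI[of _ 1]) (simp add: norm_scale)
  show "scale (r *\<^sub>R a) b = r *\<^sub>R scale a b" for r a b
    by (metis scale_of_real scale_scale scaleR_conv_of_real)
  show "scale a (r *\<^sub>R b) = r *\<^sub>R scale a b" for r a b
    by (metis scale_of_real scale_scale mult.commute)
qed (simp_all add: scale_left_distrib scale_right_distrib)

lemmas scale_has_derivative [derivative_intros] =
  bounded_bilinear.FDERIV[OF bounded_bilinear_scale]

lemma bounded_linear_scale_left: "bounded_linear (\<lambda>c. scale c x)"
  by (rule bounded_bilinear.bounded_linear_left[OF bounded_bilinear_scale])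

lemma bounded_linear_scale_right: "bounded_linear (scale c)"
  by (rule bounded_bilinear.bounded_linear_right[OF bounded_bilinear_scale])

lemma tendsto_scale:
  "(f \<longlongrightarrow> a) F \<Longrightarrow> (g \<longlongrightarrow> b) F \<Longrightarrow> ((\<lambda>x. scale (f x) (g x)) \<longlongrightarrow> scale a b) F"
  by (rule bounded_bilinear.tendsto[OF bounded_bilinear_scale])

lemma scale_scaleR: "scale c (r *\<^sub>R x) = r *\<^sub>R scale c x"
  by (rule bounded_bilinear.scaleR_right[OF bounded_bilinear_scale])

end

lemma banach_over_times:
  "banach_over ((*) :: 'k::{real_normed_field,euclidean_space} \<Rightarrow> 'k \<Rightarrow> 'k)"
  by unfold_locales (auto simp: algebra_simps norm_mult scaleR_conv_of_real)

definition scale_pair ::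
  "('k \<Rightarrow> 'e \<Rightarrow> 'e) \<Rightarrow> ('k \<Rightarrow> 'f \<Rightarrow> 'f) \<Rightarrow> 'k \<Rightarrow> 'e \<times> 'f \<Rightarrow> 'e \<times> 'f" where
  "scale_pair s t c p = (s c (fst p), t c (snd p))"

lemma fst_scale_pair [simp]: "fst (scale_pair s t c p) = s c (fst p)"
  and snd_scale_pair [simp]: "snd (scale_pair s t c p) = t c (snd p)"
  by (simp_all add: scale_pair_def)

lemma scale_prod_eq_pair: "scale_prod s = scale_pair (*) s"
  by (auto simp: scale_prod_def scale_pair_def fun_eq_iff)

lemma banach_over_pair:
  assumes "banach_over s" and "banach_over t"
  shows "banach_over (scale_pair s t)"
proof -
  interpret s: banach_over s by fact
  interpret t: banach_over t by fact
  show ?thesis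
  proof unfold_locales
    show "norm (scale_pair s t c x) = norm c * norm x" for c x
      by (simp add: norm_prod_def s.norm_scale t.norm_scale power_mult_distrib
          distrib_left[symmetric] real_sqrt_mult)
  qed (auto simp: scale_pair_def s.scale_right_distrib t.scale_right_distrib s.scale_of_real
      t.scale_of_real s.scale_left_distrib t.scale_left_distrib prod_eq_iff)
qed

lemma banach_over_vec:
  assumes "banach_over s"
  shows "banach_over (scale_vec s :: 'k::{real_normed_field,euclidean_space} \<Rightarrow> 'b::banach ^ 'n \<Rightarrow> 'b ^ 'n)"
proof -
  interpret s: banach_over s by fact
  show ?thesis
  proof unfold_locales
    show "norm (scale_vec s c x) = norm c * norm x" for c :: 'k and x :: "'b ^ 'n"
      by (simp add: norm_vec_def scale_vec_def s.norm_scale L2_set_right_distrib)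
  qed (auto simp: scale_vec_def Finite_Cartesian_Product.vec_eq_iff s.scale_right_distrib s.scale_of_real s.scale_left_distrib)
qed

section \<open>Towers of directional derivatives\<close>

text \<open>\<open>D x vs\<close> is the iterated derivative at \<open>x\<close>, the head of
  \<open>vs\<close> being the direction taken last. Multilinearity is a consequence of the clauses,
  see \<open>btower_add\<close> and \<open>btower_scale\<close>, so building a tower amounts to
  differentiating along lines and bounding each order on the unit ball.\<close>

definition btower ::
  "('k::real_normed_field \<Rightarrow> 'e::real_normed_vector \<Rightarrow> 'e) \<Rightarrow> ('k \<Rightarrow> 'f::real_normed_vector \<Rightarrow> 'f)
    \<Rightarrow> 'e set \<Rightarrow> 'e set \<Rightarrow> ('e \<Rightarrow> 'e list \<Rightarrow> 'f) \<Rightarrow> bool" where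
  "btower sE sF V W D \<longleftrightarrow> openin (top_of_set V) W \<and>
     (\<forall>x\<in>W. \<forall>h\<in>V. \<forall>vs. set vs \<subseteq> V \<longrightarrow>
        ((\<lambda>t. D (x + sE t h) vs) has_derivative (\<lambda>t. sF t (D x (h # vs)))) (at 0)) \<and>
     (\<forall>m. \<exists>C. \<forall>x\<in>W. \<forall>vs. length vs = m \<and> set vs \<subseteq> V \<and> (\<forall>v\<in>set vs. norm v \<le> 1)
        \<longrightarrow> norm (D x vs) \<le> C)"

text \<open>
  Smoothness with all derivatives bounded on \<open>W\<close>. Only directional derivatives over \<open>'k\<close> are
  asked for: boundedness of the next order turns them into Frechet derivatives.
\<close>

definition bsmooth ::
  "('k::real_normed_field \<Rightarrow> 'e::real_normed_vector \<Rightarrow> 'e) \<Rightarrow> ('k \<Rightarrow> 'f::real_normed_vector \<Rightarrow> 'f)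
    \<Rightarrow> 'e set \<Rightarrow> 'e set \<Rightarrow> ('e \<Rightarrow> 'f) \<Rightarrow> bool" where
  "bsmooth sE sF V W f \<longleftrightarrow> (\<exists>D. btower sE sF V W D \<and> (\<forall>x\<in>W. D x [] = f x))"

lemma btower_subset:
  "btower sE sF V W D \<Longrightarrow> W' \<subseteq> W \<Longrightarrow> openin (top_of_set V) W' \<Longrightarrow> btower sE sF V W' D"
  unfolding btower_def by (meson subsetD)

lemma bsmooth_subset:
  "bsmooth sE sF V W f \<Longrightarrow> W' \<subseteq> W \<Longrightarrow> openin (top_of_set V) W' \<Longrightarrow> bsmooth sE sF V W' f"
  unfolding bsmooth_def by (meson subsetD btower_subset)

locale tower_spaces = E: banach_over sE + F: banach_over sF
  for sE :: "'k::{real_normed_field,euclidean_space} \<Rightarrow> 'e::banach \<Rightarrow> 'e"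
    and sF :: "'k \<Rightarrow> 'f::banach \<Rightarrow> 'f" +
  fixes V :: "'e set"
  assumes subspace_V: "E.subspace V"
begin

lemma V_add: "x \<in> V \<Longrightarrow> y \<in> V \<Longrightarrow> x + y \<in> V"
  and V_scale: "x \<in> V \<Longrightarrow> sE c x \<in> V"
  and V_0: "0 \<in> V"
  and V_diff: "x \<in> V \<Longrightarrow> y \<in> V \<Longrightarrow> x - y \<in> V"
  using subspace_V by (auto simp: E.subspace_def E.subspace_diff)

lemma V_scaleR: "x \<in> V \<Longrightarrow> r *\<^sub>R x \<in> V"
  using V_scale[of x "of_real r"] by (simp add: E.scale_of_real)

lemma V_convex: "convex V"
  by (auto simp: convex_def intro!: V_add V_scaleR)

lemma has_derivative_unique_scale:
  assumes "(f has_derivative (\<lambda>t. sF t a)) (at 0)" "(f has_derivative (\<lambda>t. sF t b)) (at 0)"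
  shows "a = b"
proof -
  have "(\<lambda>t. sF t a) = (\<lambda>t. sF t b)" by (rule has_derivative_unique[OF assms])
  from fun_cong[OF this, of 1] show ?thesis by simp
qed

lemma eventually_line:
  assumes "openin (top_of_set V) W" "x \<in> W" "h \<in> V"
  shows "eventually (\<lambda>t. x + sE t h \<in> W) (at 0)"
proof -
  obtain U where U: "open U" "W = V \<inter> U" using assms(1) by (auto simp: openin_open)
  have "((\<lambda>t. x + sE t h) \<longlongrightarrow> x + sE 0 h) (at 0)"
    by (intro tendsto_intros E.tendsto_scale)
  then have "((\<lambda>t. x + sE t h) \<longlongrightarrow> x) (at 0)" by simp
  with U assms have "eventually (\<lambda>t. x + sE t h \<in> U) (at 0)" by (auto simp: tendsto_def)
  then show ?thesis
    by eventually_elim (use U assms in \<open>auto intro: V_add V_scale\<close>)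
qed

lemma openin_ball_subset:
  assumes "openin (top_of_set V) W" "x \<in> W"
  obtains d where "d > 0" "ball x d \<inter> V \<subseteq> W"
  using assms by (auto simp: openin_contains_ball)

lemma btower_openin: "btower sE sF V W D \<Longrightarrow> openin (top_of_set V) W"
  by (auto simp: btower_def)

lemma btower_sub: "btower sE sF V W D \<Longrightarrow> x \<in> W \<Longrightarrow> x \<in> V"
  by (auto dest!: btower_openin openin_imp_subset)

lemma btower_deriv:
  "btower sE sF V W D \<Longrightarrow> x \<in> W \<Longrightarrow> h \<in> V \<Longrightarrow> set vs \<subseteq> V \<Longrightarrow>
    ((\<lambda>t. D (x + sE t h) vs) has_derivative (\<lambda>t. sF t (D x (h # vs)))) (at 0)"
  by (auto simp: btower_def)

text \<open>The tool for inductions over towers: an identity between entries of one order is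
  differentiated along a line, and uniqueness of derivatives carries it to the next order. Agreement
  is asked for only while the line stays in \<open>W\<close>, which it does near \<open>0\<close>
  because \<open>W\<close> is relatively open.\<close>

lemma btower_deriv_unique:
  assumes D: "btower sE sF V W D" and "x \<in> W" "h \<in> V" "set vs \<subseteq> V"
    and g: "(g has_derivative (\<lambda>t. sF t b)) (at 0)"
    and eq: "\<And>t. x + sE t h \<in> W \<Longrightarrow> g t = D (x + sE t h) vs"
  shows "D x (h # vs) = b"
proof (rule has_derivative_unique_scale)
  show "((\<lambda>t. D (x + sE t h) vs) has_derivative (\<lambda>t. sF t (D x (h # vs)))) (at 0)"
    by (rule btower_deriv) fact+
  show "((\<lambda>t. D (x + sE t h) vs) has_derivative (\<lambda>t. sF t b)) (at 0)"
    using g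
  proof (rule has_derivative_transform_eventually)
    show "\<forall>\<^sub>F t in at 0. g t = D (x + sE t h) vs"
      using eventually_line[OF btower_openin[OF D] assms(2,3)]
      by eventually_elim (rule eq)
    show "g 0 = D (x + sE 0 h) vs" using eq[of 0] assms by simp
  qed simp
qed

lemma btower_unique:
  assumes "btower sE sF V W D" "btower sE sF V W' D'"
    and "\<And>x. x \<in> W \<inter> W' \<Longrightarrow> D x [] = D' x []"
  shows "x \<in> W \<inter> W' \<Longrightarrow> set vs \<subseteq> V \<Longrightarrow> D x vs = D' x vs"
proof (induction vs arbitrary: x)
  case Nil then show ?case using assms by simp
next
  case (Cons h vs)
  have op: "openin (top_of_set V) (W \<inter> W')" using assms btower_openin by blast
  have D: "btower sE sF V (W \<inter> W') D" by (rule btower_subset[OF assms(1) _ op]) simp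
  show ?case
    by (rule btower_deriv_unique[OF D, where g="\<lambda>t. D' (x + sE t h) vs"])
      (use Cons assms in \<open>auto intro: btower_deriv\<close>)
qed

text \<open>All slots are rescaled at once, so that the induction hypothesis covers the tail while
  the head follows from the chain rule for \<open>t \<mapsto> t * c\<close>.\<close>

lemma btower_scale_all:
  assumes D: "btower sE sF V W D"
  shows "length cs = length us \<Longrightarrow> x \<in> W \<Longrightarrow> set us \<subseteq> V \<Longrightarrow>
    D x (map2 sE cs us) = sF (prod_list cs) (D x us)"
proof (induction us arbitrary: cs x)
  case Nil then show ?case by simp
next
  case (Cons h us)
  then obtain c cs' where cs: "cs = c # cs'" "length cs' = length us" by (cases cs) auto
  have sub: "set (map2 sE cs' us) \<subseteq> V" using Cons.prems cs by (auto intro!: V_scale dest: set_zip_rightD)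
  have "D x (sE c h # map2 sE cs' us) = sF (c * prod_list cs') (D x (h # us))"
  proof (rule btower_deriv_unique[OF D])
    have "((\<lambda>t. sF (prod_list cs') (D (x + sE (t * c) h) us)) has_derivative
        (\<lambda>t. sF (prod_list cs') (sF (t * c) (D x (h # us))))) (at 0)"
    proof (rule bounded_linear.has_derivative[OF F.bounded_linear_scale_right])
      have "((\<lambda>t. D (x + sE t h) us) has_derivative (\<lambda>t. sF t (D x (h # us)))) (at (0 * c))"
        using Cons.prems by (auto intro: btower_deriv[OF D])
      have "((\<lambda>t. t * c) has_derivative (\<lambda>t. t * c)) (at (0::'k))"
        by (auto intro!: derivative_eq_intros)
      from has_derivative_compose[OF this \<open>(_ has_derivative _) (at (0 * c))\<close>]
      show "((\<lambda>t. D (x + sE (t * c) h) us) has_derivative (\<lambda>t. sF (t * c) (D x (h # us)))) (at 0)" .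
    qed
    then show "((\<lambda>t. sF (prod_list cs') (D (x + sE (t * c) h) us)) has_derivative
        (\<lambda>t. sF t (sF (c * prod_list cs') (D x (h # us))))) (at 0)"
      by (simp add: mult_ac)
    show "sF (prod_list cs') (D (x + sE (t * c) h) us) = D (x + sE t (sE c h)) (map2 sE cs' us)"
      if "x + sE t (sE c h) \<in> W" for t
      using Cons that cs by simp
  qed (use Cons.prems sub in \<open>auto intro: V_scale\<close>)
  then show ?case using cs by simp
qed

lemma btower_bound:
  assumes D: "btower sE sF V W D"
  obtains C where "C \<ge> 0" "\<And>x vs. x \<in> W \<Longrightarrow> length vs = m \<Longrightarrow> set vs \<subseteq> V \<Longrightarrow>
    norm (D x vs) \<le> C * prod_list (map norm vs)"
proof -
  obtain C where C: "\<And>x vs. x \<in> W \<Longrightarrow> length vs = m \<Longrightarrow> set vs \<subseteq> V \<Longrightarrow> (\<forall>v\<in>set vs. norm v \<le> 1)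
        \<Longrightarrow> norm (D x vs) \<le> C"
    using D unfolding btower_def by meson
  show ?thesis
  proof
    fix x vs assume x: "x \<in> W" and vs: "length vs = m" "set vs \<subseteq> V"
    define us where "us = map (\<lambda>v. (inverse (norm v)) *\<^sub>R v) vs"
    have us: "set us \<subseteq> V" "length us = m" "\<forall>v\<in>set us. norm v \<le> 1"
      using vs by (auto simp: us_def intro!: V_scaleR) (simp add: divide_simps split: if_splits)
    define cs where "cs = map (\<lambda>v. of_real (norm v) :: 'k) vs"
    \<comment> \<open>For a zero entry both the factor and the normalized vector are
      \<open>0\<close>, so zero entries are covered.\<close>
    have "map2 sE cs us = vs"
      by (rule nth_equalityI) (auto simp: us_def cs_def E.scale_of_real divide_inverse[symmetric])
    then have "D x vs = sF (prod_list cs) (D x us)"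
      using btower_scale_all[OF D, of cs us x] x us vs by (simp add: cs_def)
    then have "norm (D x vs) = norm (prod_list cs) * norm (D x us)" by (simp add: F.norm_scale)
    also have "norm (prod_list cs) = prod_list (map norm vs)"
      unfolding cs_def by (induction vs) (auto simp: norm_mult)
    also have "\<dots> * norm (D x us) \<le> prod_list (map norm vs) * max C 0"
      using C[OF x us(2,1,3)] by (intro mult_left_mono prod_list_nonneg) auto
    finally show "norm (D x vs) \<le> max C 0 * prod_list (map norm vs)" by (simp add: mult.commute)
  qed simp
qed

section \<open>Mean value and Taylor estimates, additivity\<close>

lemma btower_real_derivative:
  assumes D: "btower sE sF V W D" and "x + s *\<^sub>R H \<in> W" "H \<in> V" "set vs \<subseteq> V"
  shows "((\<lambda>s. D (x + s *\<^sub>R H) vs) has_vector_derivative D (x + s *\<^sub>R H) (H # vs)) (at s)"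
proof -
  have 1: "((\<lambda>t. D (x + s *\<^sub>R H + sE t H) vs) has_derivative
      (\<lambda>t. sF t (D (x + s *\<^sub>R H) (H # vs)))) (at ((\<lambda>s'. of_real (s' - s)) s))"
    using btower_deriv[OF assms] by simp
  have "((\<lambda>s'. of_real (s' - s) :: 'k) has_derivative (\<lambda>h. of_real h)) (at s)"
    by (auto intro!: derivative_eq_intros bounded_linear.has_derivative[OF bounded_linear_of_real])
  from has_derivative_compose[OF this 1]
  show ?thesis
    by (simp add: has_vector_derivative_def F.scale_of_real E.scale_of_real algebra_simps)
qed

lemma btower_lipschitz:
  assumes D: "btower sE sF V W D" and W: "convex W"
  obtains C where "C \<ge> 0" "\<And>x H vs. x \<in> W \<Longrightarrow> x + H \<in> W \<Longrightarrow> length vs = m \<Longrightarrow> set vs \<subseteq> V \<Longrightarrow>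
    norm (D (x + H) vs - D x vs) \<le> C * norm H * prod_list (map norm vs)"
proof -
  obtain C where C: "C \<ge> 0" "\<And>x vs. x \<in> W \<Longrightarrow> length vs = Suc m \<Longrightarrow> set vs \<subseteq> V \<Longrightarrow>
    norm (D x vs) \<le> C * prod_list (map norm vs)"
    using btower_bound[OF D, of "Suc m"] by blast
  have "norm (D (x + H) vs - D x vs) \<le> C * norm H * prod_list (map norm vs)"
    if x: "x \<in> W" "x + H \<in> W" and vs: "length vs = m" "set vs \<subseteq> V" for x H vs
  proof -
    have HV: "H \<in> V" using V_diff[of "x + H" x] btower_sub[OF D] x by simp
    have seg: "x + s *\<^sub>R H \<in> W" if "s \<in> {0..1}" for s
      using convexD_alt[OF W x(1) x(2), of s] that by (simp add: algebra_simps)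
    have "norm ((\<lambda>s. D (x + s *\<^sub>R H) vs) 1 - (\<lambda>s. D (x + s *\<^sub>R H) vs) 0)
        \<le> (C * norm H * prod_list (map norm vs)) * norm (1 - 0 :: real)"
    proof (rule differentiable_bound[of "{0..1}"])
      fix s :: real assume s: "s \<in> {0..1}"
      show "((\<lambda>s. D (x + s *\<^sub>R H) vs) has_derivative (\<lambda>h. h *\<^sub>R D (x + s *\<^sub>R H) (H # vs))) (at s within {0..1})"
        using btower_real_derivative[OF D seg[OF s] HV vs(2)]
        by (auto simp: has_vector_derivative_def intro: has_derivative_at_withinI)
      show "onorm (\<lambda>h. h *\<^sub>R D (x + s *\<^sub>R H) (H # vs)) \<le> C * norm H * prod_list (map norm vs)"
      proof (rule onorm_le)
        fix h :: real
        have "norm (h *\<^sub>R D (x + s *\<^sub>R H) (H # vs)) \<le> \<bar>h\<bar> * (C * (norm H * prod_list (map norm vs)))"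
          using C(2)[OF seg[OF s], of "H # vs"] vs HV by (auto intro!: mult_left_mono)
        then show "norm (h *\<^sub>R D (x + s *\<^sub>R H) (H # vs)) \<le> C * norm H * prod_list (map norm vs) * norm h"
          by (simp add: mult_ac)
      qed
    qed auto
    then show ?thesis by simp
  qed
  with C(1) that show ?thesis by blast
qed

text \<open>Along the segment the derivative differs from its value at \<open>x\<close> by at most a
  multiple of \<open>norm H\<close>, by the Lipschitz bound one order up. The mean value estimate
  contributes the second factor \<open>norm H\<close>.\<close>

lemma btower_taylor:
  assumes D: "btower sE sF V W D" and W: "convex W"
  obtains C where "C \<ge> 0" "\<And>x H vs. x \<in> W \<Longrightarrow> x + H \<in> W \<Longrightarrow> length vs = m \<Longrightarrow> set vs \<subseteq> V \<Longrightarrow>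
    norm (D (x + H) vs - D x vs - D x (H # vs)) \<le> C * (norm H)\<^sup>2 * prod_list (map norm vs)"
proof -
  obtain C where C: "C \<ge> 0" "\<And>x H vs. x \<in> W \<Longrightarrow> x + H \<in> W \<Longrightarrow> length vs = Suc m \<Longrightarrow> set vs \<subseteq> V \<Longrightarrow>
    norm (D (x + H) vs - D x vs) \<le> C * norm H * prod_list (map norm vs)"
    using btower_lipschitz[OF D W, of "Suc m"] by blast
  have "norm (D (x + H) vs - D x vs - D x (H # vs)) \<le> C * (norm H)\<^sup>2 * prod_list (map norm vs)"
    if x: "x \<in> W" "x + H \<in> W" and vs: "length vs = m" "set vs \<subseteq> V" for x H vs
  proof -
    have HV: "H \<in> V" using V_diff[of "x + H" x] btower_sub[OF D] x by simp
    have seg: "x + s *\<^sub>R H \<in> W" if "s \<in> {0..1}" for s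
      using convexD_alt[OF W x(1) x(2), of s] that by (simp add: algebra_simps)
    have "norm ((\<lambda>s. D (x + s *\<^sub>R H) vs) 1 - (\<lambda>s. D (x + s *\<^sub>R H) vs) 0
         - (1 - 0) *\<^sub>R D (x + 0 *\<^sub>R H) (H # vs))
        \<le> norm (1 - 0 :: real) * (C * (norm H)\<^sup>2 * prod_list (map norm vs))"
    proof (rule vector_differentiable_bound_linearization[of "{0..1}"])
      fix s :: real assume s: "s \<in> {0..1}"
      show "((\<lambda>s. D (x + s *\<^sub>R H) vs) has_vector_derivative D (x + s *\<^sub>R H) (H # vs)) (at s within {0..1})"
        using btower_real_derivative[OF D seg[OF s] HV vs(2)]
        by (auto intro: has_vector_derivative_at_within)
      have "norm (D (x + s *\<^sub>R H) (H # vs) - D x (H # vs)) \<le> C * norm (s *\<^sub>R H) * prod_list (map norm (H # vs))"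
        using C(2)[OF x(1) seg[OF s], of "H # vs"] vs HV by simp
      also have "\<dots> = \<bar>s\<bar> * (C * (norm H)\<^sup>2 * prod_list (map norm vs))" by (simp add: power2_eq_square)
      also have "\<dots> \<le> 1 * (C * (norm H)\<^sup>2 * prod_list (map norm vs))"
        using s C(1) by (intro mult_right_mono mult_nonneg_nonneg prod_list_nonneg) auto
      finally show "norm (D (x + s *\<^sub>R H) (H # vs) - D (x + 0 *\<^sub>R H) (H # vs)) \<le> C * (norm H)\<^sup>2 * prod_list (map norm vs)"
        by simp
    qed (auto simp: closed_segment_eq_real_ivl)
    then show ?thesis by simp
  qed
  with C(1) that show ?thesis by blast
qed

lemma btower_local_convex:
  assumes D: "btower sE sF V W D" and x: "x \<in> W"
  obtains d where "d > 0" "ball x d \<inter> V \<subseteq> W" "btower sE sF V (ball x d \<inter> V) D" "convex (ball x d \<inter> V)"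
proof -
  obtain d where d: "d > 0" "ball x d \<inter> V \<subseteq> W"
    using openin_ball_subset[OF btower_openin[OF D] x] by blast
  have "openin (top_of_set V) (ball x d \<inter> V)" by (metis Int_commute open_ball openin_open_Int)
  with d D show ?thesis
    by (intro that[of d]) (auto intro: btower_subset convex_Int V_convex)
qed

text \<open>Directional derivatives need not be additive in general; here the bounds on the next two
  orders force it. The point \<open>x + t *\<^sub>R (h1 + h2)\<close> is reached directly or via
  \<open>x + t *\<^sub>R h1\<close>. The two linearizations differ by \<open>O(t\<^sup>2)\<close>,
  so nothing is left after dividing by \<open>t\<close> and letting \<open>t\<close> tend to
  \<open>0\<close>.\<close>

lemma btower_add_first:
  assumes D0: "btower sE sF V W0 D" and x0: "x \<in> W0" and h: "h1 \<in> V" "h2 \<in> V" and vs: "set vs \<subseteq> V"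
  shows "D x ((h1 + h2) # vs) = D x (h1 # vs) + D x (h2 # vs)"
proof -
  obtain d where d: "d > 0" and D: "btower sE sF V (ball x d \<inter> V) D" and cv: "convex (ball x d \<inter> V)"
    using btower_local_convex[OF D0 x0] by blast
  let ?W = "ball x d \<inter> V"
  have xV: "x \<in> V" by (rule btower_sub[OF D0 x0])
  obtain C where C: "C \<ge> 0" "\<And>x H us. x \<in> ?W \<Longrightarrow> x + H \<in> ?W \<Longrightarrow> length us = length vs \<Longrightarrow> set us \<subseteq> V \<Longrightarrow>
    norm (D (x + H) us - D x us - D x (H # us)) \<le> C * (norm H)\<^sup>2 * prod_list (map norm us)"
    using btower_taylor[OF D cv] by blast
  obtain C' where C': "C' \<ge> 0" "\<And>x H us. x \<in> ?W \<Longrightarrow> x + H \<in> ?W \<Longrightarrow> length us = Suc (length vs) \<Longrightarrow> set us \<subseteq> V \<Longrightarrow>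
    norm (D (x + H) us - D x us) \<le> C' * norm H * prod_list (map norm us)"
    using btower_lipschitz[OF D cv, where m="Suc (length vs)"] by blast
  define P where "P = prod_list (map norm vs)"
  define K where "K = C * (norm (h1 + h2))\<^sup>2 * P + C * (norm h1)\<^sup>2 * P + C * (norm h2)\<^sup>2 * P
     + C' * norm h1 * norm h2 * P"
  define u where "u = D x ((h1 + h2) # vs) - D x (h1 # vs) - D x (h2 # vs)"
  have hom: "D y ((t *\<^sub>R h) # vs) = t *\<^sub>R D y (h # vs)" if "y \<in> ?W" "h \<in> V" for y t h
  proof -
    have eq: "map2 sE (replicate (length vs) 1) vs = vs" by (rule nth_equalityI) auto
    have "prod_list (replicate n 1) = (1::'k)" for n by (induction n) auto
    then show ?thesis
      using btower_scale_all[OF D, of "of_real t # replicate (length vs) 1" "h # vs" y] that vs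
      by (simp add: eq E.scale_of_real F.scale_of_real)
  qed
  have key: "norm u \<le> K * t" if t: "t > 0" "t * (norm h1 + norm h2 + 1) < d" for t
  proof -
    have n1: "norm (t *\<^sub>R h1) < d" and n12: "norm (t *\<^sub>R h1 + t *\<^sub>R h2) < d"
    proof -
      have "norm (t *\<^sub>R h1 + t *\<^sub>R h2) \<le> t * norm h1 + t * norm h2"
        using t norm_triangle_ineq[of "t *\<^sub>R h1" "t *\<^sub>R h2"] by simp
      moreover have "t * (norm h1 + norm h2 + 1) = t * norm h1 + t * norm h2 + t"
        by (simp add: algebra_simps)
      moreover have "t * norm h2 \<ge> 0" "norm (t *\<^sub>R h1) = t * norm h1" using t by auto
      ultimately show "norm (t *\<^sub>R h1) < d" "norm (t *\<^sub>R h1 + t *\<^sub>R h2) < d" using t by linarith+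
    qed
    have x1: "x + t *\<^sub>R h1 \<in> ?W" and x12: "x + t *\<^sub>R h1 + t *\<^sub>R h2 \<in> ?W" and x: "x \<in> ?W"
      using n1 n12 h xV d by (auto simp: dist_norm norm_minus_commute algebra_simps intro!: V_add V_scaleR)
    have a: "norm (D (x + t *\<^sub>R (h1 + h2)) vs - D x vs - t *\<^sub>R D x ((h1 + h2) # vs)) \<le> C * (norm (t *\<^sub>R (h1 + h2)))\<^sup>2 * P"
      using C(2)[of x "t *\<^sub>R (h1 + h2)" vs] x x12 vs h hom[OF x, of "h1 + h2" t] V_add[OF h]
      by (simp add: P_def algebra_simps)
    have b: "norm (D (x + t *\<^sub>R h1) vs - D x vs - t *\<^sub>R D x (h1 # vs)) \<le> C * (norm (t *\<^sub>R h1))\<^sup>2 * P"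
      using C(2)[of x "t *\<^sub>R h1" vs] x x1 vs h hom[OF x h(1)] by (simp add: P_def)
    have c: "norm (D (x + t *\<^sub>R h1 + t *\<^sub>R h2) vs - D (x + t *\<^sub>R h1) vs - t *\<^sub>R D (x + t *\<^sub>R h1) (h2 # vs)) \<le> C * (norm (t *\<^sub>R h2))\<^sup>2 * P"
      using C(2)[of "x + t *\<^sub>R h1" "t *\<^sub>R h2" vs] x12 x1 vs h hom[OF x1 h(2)] by (simp add: P_def)
    have e: "norm (D (x + t *\<^sub>R h1) (h2 # vs) - D x (h2 # vs)) \<le> C' * norm (t *\<^sub>R h1) * (norm h2 * P)"
      using C'(2)[of x "t *\<^sub>R h1" "h2 # vs"] x x1 vs h by (simp add: P_def)
    have e': "norm (t *\<^sub>R (D (x + t *\<^sub>R h1) (h2 # vs) - D x (h2 # vs))) \<le> t * (C' * norm (t *\<^sub>R h1) * (norm h2 * P))"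
      using e t by (simp del: norm_scaleR add: norm_scaleR[of t "D (x + t *\<^sub>R h1) (h2 # vs) - D x (h2 # vs)"])
    have "t *\<^sub>R u = - (D (x + t *\<^sub>R (h1 + h2)) vs - D x vs - t *\<^sub>R D x ((h1 + h2) # vs))
        + (D (x + t *\<^sub>R h1) vs - D x vs - t *\<^sub>R D x (h1 # vs))
        + (D (x + t *\<^sub>R h1 + t *\<^sub>R h2) vs - D (x + t *\<^sub>R h1) vs - t *\<^sub>R D (x + t *\<^sub>R h1) (h2 # vs))
        + t *\<^sub>R (D (x + t *\<^sub>R h1) (h2 # vs) - D x (h2 # vs))"
      by (simp add: u_def algebra_simps)
    then have "norm (t *\<^sub>R u) \<le> C * (norm (t *\<^sub>R (h1 + h2)))\<^sup>2 * P + C * (norm (t *\<^sub>R h1))\<^sup>2 * P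
        + C * (norm (t *\<^sub>R h2))\<^sup>2 * P + t * (C' * norm (t *\<^sub>R h1) * (norm h2 * P))"
      using a b c e' by (smt (verit) norm_triangle_ineq norm_minus_cancel)
    also have "\<dots> = t * (K * t)"
    proof -
      have "C * (t * a)\<^sup>2 * P + C * (t * b)\<^sup>2 * P + C * (t * c)\<^sup>2 * P + t * (C' * (t * b) * (c * P))
        = t * ((C * a\<^sup>2 * P + C * b\<^sup>2 * P + C * c\<^sup>2 * P + C' * b * c * P) * t)" for a b c
        by (simp add: power_mult_distrib power2_eq_square algebra_simps)
      from this[of "norm (h1 + h2)" "norm h1" "norm h2"] t show ?thesis
        by (simp only: K_def norm_scaleR abs_of_pos)
    qed
    finally have "t * norm u \<le> t * (K * t)" using t by simp
    then show ?thesis using t by simp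
  qed
  have "norm u \<le> 0"
  proof (rule tendsto_lowerbound)
    have "((\<lambda>t. K * t) \<longlongrightarrow> K * 0) (at_right 0)" by (intro tendsto_intros)
    then show "((\<lambda>t. K * t) \<longlongrightarrow> 0) (at_right 0)" by simp
    define b where "b = d / (norm h1 + norm h2 + 1)"
    have pos: "norm h1 + norm h2 + 1 > 0" by (simp add: add_nonneg_pos)
    have "b > 0" using d pos by (simp add: b_def)
    then show "\<forall>\<^sub>F t in at_right 0. norm u \<le> K * t"
      unfolding eventually_at_right_field
      by (intro exI[of _ b]) (use pos in \<open>auto intro!: key simp: b_def pos_less_divide_eq\<close>)
  qed simp
  then show ?thesis by (simp add: u_def algebra_simps)
qed

text \<open>The head slot is \<open>btower_add_first\<close>; a later slot inherits additivity by
  differentiating the identity of the lower order.\<close>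

lemma btower_add:
  assumes D: "btower sE sF V W D"
  shows "x \<in> W \<Longrightarrow> set vs \<subseteq> V \<Longrightarrow> i < length vs \<Longrightarrow> a \<in> V \<Longrightarrow> b \<in> V \<Longrightarrow>
    D x (vs[i := a + b]) = D x (vs[i := a]) + D x (vs[i := b])"
proof (induction vs arbitrary: x i)
  case Nil then show ?case by simp
next
  case (Cons h vs)
  show ?case
  proof (cases i)
    case 0
    then show ?thesis using Cons.prems btower_add_first[OF D] by simp
  next
    case (Suc j)
    have sub: "set (vs[j := c]) \<subseteq> V" if "c \<in> V" for c
      using Cons.prems that set_update_subset_insert[of vs j c] by auto
    have "D x (h # vs[j := a + b]) = D x (h # vs[j := a]) + D x (h # vs[j := b])"
    proof (rule btower_deriv_unique[OF D])
      show "((\<lambda>t. D (x + sE t h) (vs[j := a]) + D (x + sE t h) (vs[j := b])) has_derivative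
        (\<lambda>t. sF t (D x (h # vs[j := a]) + D x (h # vs[j := b])))) (at 0)"
        unfolding F.scale_right_distrib
        by (intro has_derivative_add btower_deriv[OF D]) (use Cons.prems sub in simp_all)
      show "D (x + sE t h) (vs[j := a]) + D (x + sE t h) (vs[j := b]) = D (x + sE t h) (vs[j := a + b])"
        if "x + sE t h \<in> W" for t
        using Cons.IH[OF that, of j] Cons.prems Suc by simp
    qed (use Cons.prems sub[OF V_add] in simp_all)
    then show ?thesis using Suc by simp
  qed
qed

lemma btower_scale:
  assumes D: "btower sE sF V W D"
    and x: "x \<in> W" "set vs \<subseteq> V" "i < length vs" "a \<in> V"
  shows "D x (vs[i := sE c a]) = sF c (D x (vs[i := a]))"
proof -
  have sub: "set (vs[i := a]) \<subseteq> V"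
    using x set_update_subset_insert[of vs i a] by auto
  have "D x (map2 sE ((replicate (length vs) 1)[i := c]) (vs[i := a])) =
      sF (prod_list ((replicate (length vs) 1)[i := c])) (D x (vs[i := a]))"
    using x sub by (intro btower_scale_all[OF D]) auto
  also have "map2 sE ((replicate (length vs) 1)[i := c]) (vs[i := a]) = vs[i := sE c a]"
    using x by (intro nth_equalityI) (auto simp: nth_list_update)
  also have "prod_list ((replicate n 1)[i := c]) = c" if "i < n" for n i
    using that
  proof (induction n arbitrary: i)
    case (Suc n)
    have "prod_list (replicate n 1) = (1::'k)" by (induction n) auto
    then show ?case using Suc by (cases i) auto
  qed simp
  finally show ?thesis using x by simp
qed

lemma btower_multilinear:
  assumes D: "btower sE sF V W D" and "x \<in> W"
  shows "bounded_multilinear_on sE sF V m (D x)"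
proof -
  obtain C where "\<And>x vs. x \<in> W \<Longrightarrow> length vs = m \<Longrightarrow> set vs \<subseteq> V \<Longrightarrow>
    norm (D x vs) \<le> C * prod_list (map norm vs)"
    using btower_bound[OF D, of m] by blast
  then show ?thesis
    unfolding bounded_multilinear_on_def
    using btower_add[OF D] btower_scale[OF D] assms(2) by blast
qed

text \<open>Bounded derivatives are available only locally, so each point has its own tower. By
  \<open>btower_unique\<close> the towers agree on overlaps, hence the tower of \<open>x\<close>
  evaluated at \<open>x\<close> itself gives one consistent family.\<close>

lemma bsmooth_imp_smooth_on_subspace:
  assumes "W \<subseteq> V" and loc: "\<And>x. x \<in> W \<Longrightarrow> \<exists>U. x \<in> U \<and> U \<subseteq> W \<and> bsmooth sE sF V U f"
  shows "smooth_on_subspace sE sF V W f"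
proof -
  have "\<forall>x\<in>W. \<exists>U D. x \<in> U \<and> U \<subseteq> W \<and> btower sE sF V U D \<and> (\<forall>y\<in>U. D y [] = f y)"
    using loc unfolding bsmooth_def by meson
  then obtain U DD where UD: "\<And>x. x \<in> W \<Longrightarrow> x \<in> U x" "\<And>x. x \<in> W \<Longrightarrow> U x \<subseteq> W"
    "\<And>x. x \<in> W \<Longrightarrow> btower sE sF V (U x) (DD x)" "\<And>x y. x \<in> W \<Longrightarrow> y \<in> U x \<Longrightarrow> DD x y [] = f y"
    by metis
  have opn: "openin (top_of_set V) W"
  proof (subst openin_subopen, intro ballI)
    fix x assume "x \<in> W"
    with btower_openin[OF UD(3)] UD(1,2)
    show "\<exists>T. openin (top_of_set V) T \<and> x \<in> T \<and> T \<subseteq> W"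
      by (intro exI[of _ "U x"]) simp
  qed
  have eq: "DD y y vs = DD x y vs" if "x \<in> W" "y \<in> U x" "set vs \<subseteq> V" for x y vs
  proof (rule btower_unique[of "U y" "DD y" "U x" "DD x"])
    have "y \<in> W" using that UD(2) by blast
    then show "btower sE sF V (U y) (DD y)" "btower sE sF V (U x) (DD x)"
      "y \<in> U y \<inter> U x" using UD that by auto
    show "DD y z [] = DD x z []" if "z \<in> U y \<inter> U x" for z
      using UD(4) that \<open>y \<in> W\<close> \<open>x \<in> W\<close> by simp
  qed fact
  define D where "D m x vs = DD x x vs" for m :: nat and x vs
  show ?thesis
    unfolding smooth_on_subspace_def
  proof (intro conjI exI[of _ D] ballI allI impI opn)
    show "D 0 x [] = f x" if "x \<in> W" for x using that UD by (simp add: D_def)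
    show "bounded_multilinear_on sE sF V m (D m x)" if "x \<in> W" for x m
      using btower_multilinear[OF UD(3)[OF that] UD(1)[OF that]]
      by (simp add: D_def[abs_def])
    fix m x and e :: real assume x: "x \<in> W" and e: "e > 0"
    note T = UD(3)[OF x]
    obtain d where d: "d > 0" "ball x d \<inter> V \<subseteq> U x" "btower sE sF V (ball x d \<inter> V) (DD x)"
      and cv: "convex (ball x d \<inter> V)"
      using btower_local_convex[OF T UD(1)[OF x]] by blast
    obtain C where C: "C \<ge> 0" "\<And>y H us. y \<in> ball x d \<inter> V \<Longrightarrow> y + H \<in> ball x d \<inter> V \<Longrightarrow> length us = m \<Longrightarrow> set us \<subseteq> V \<Longrightarrow>
      norm (DD x (y + H) us - DD x y us - DD x y (H # us)) \<le> C * (norm H)\<^sup>2 * prod_list (map norm us)"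
      using btower_taylor[OF d(3) cv] by blast
    \<comment> \<open>For \<open>norm h\<close> below this bound the quadratic error is at most
      \<open>e * norm h\<close>; the summand \<open>1\<close> keeps the quotient meaningful when
      \<open>C = 0\<close>.\<close>
    define d' where "d' = min d (e / (C + 1))"
    have d': "d' > 0" using d e C by (simp add: d'_def)
    have xV: "x \<in> V" using x assms(1) by blast
    show "\<exists>d>0. \<forall>h\<in>V. norm h < d \<and> x + h \<in> W \<longrightarrow>
           (\<forall>vs. length vs = m \<and> set vs \<subseteq> V \<longrightarrow>
              norm (D m (x + h) vs - D m x vs - D (Suc m) x (h # vs))
                \<le> e * norm h * prod_list (map norm vs))"
    proof (intro exI[of _ d'] conjI d' ballI impI allI)
      fix h vs assume h: "h \<in> V" "norm h < d' \<and> x + h \<in> W" and vs: "length vs = m \<and> set vs \<subseteq> V"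
      have xh: "x + h \<in> ball x d \<inter> V" using h xV by (auto simp: d'_def dist_norm V_add)
      have "norm (D m (x + h) vs - D m x vs - D (Suc m) x (h # vs)) =
         norm (DD x (x + h) vs - DD x x vs - DD x x (h # vs))"
        using eq[OF x, of "x + h" vs] xh d(2) vs by (auto simp: D_def)
      also have "\<dots> \<le> C * (norm h)\<^sup>2 * prod_list (map norm vs)"
        using C(2)[of x h vs] xh vs xV d by simp
      also have "\<dots> = (C * norm h) * norm h * prod_list (map norm vs)" by (simp add: power2_eq_square)
      also have "\<dots> \<le> e * norm h * prod_list (map norm vs)"
      proof (intro mult_right_mono prod_list_nonneg)
        have "C * norm h \<le> (C + 1) * (e / (C + 1))"
          using h C(1) e by (intro mult_mono) (auto simp: d'_def)
        then show "C * norm h \<le> e" using C(1) by simp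
      qed auto
      finally show "norm (D m (x + h) vs - D m x vs - D (Suc m) x (h # vs)) \<le> e * norm h * prod_list (map norm vs)" .
    qed
  qed
qed

end

lemma has_derivative_sum_list:
  "(\<And>s. s \<in> set xs \<Longrightarrow> (f s has_derivative f' s) F) \<Longrightarrow>
    ((\<lambda>t. \<Sum>s\<leftarrow>xs. f s t) has_derivative (\<lambda>t. \<Sum>s\<leftarrow>xs. f' s t)) F"
  by (induction xs) (auto intro!: has_derivative_add)

lemma (in banach_over) scale_sum_list: "scale c (\<Sum>s\<leftarrow>xs. f s) = (\<Sum>s\<leftarrow>xs. scale c (f s))"
  by (induction xs) (auto simp: scale_right_distrib)

text \<open>Turns derivatives in a scalar variable into limits of quotients, to which norm estimates
  and squeezing apply directly.\<close>

lemma (in banach_over) has_derivative_scale_iff: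
  "(f has_derivative (\<lambda>t. scale t a)) (at 0) \<longleftrightarrow> ((\<lambda>t. scale (inverse t) (f t - f 0)) \<longlongrightarrow> a) (at 0)"
proof -
  have "norm (f t - f 0 - scale (t - 0) a) / norm (t - 0) = norm (scale (inverse t) (f t - f 0) - a)"
    if "t \<noteq> 0" for t
  proof -
    have "scale (inverse t) (f t - f 0) - a = scale (inverse t) (f t - f 0 - scale t a)"
      using that by (simp add: scale_right_diff_distrib)
    then show ?thesis using that by (simp add: norm_scale norm_inverse divide_inverse mult.commute)
  qed
  then have "((\<lambda>t. norm (f t - f 0 - scale (t - 0) a) / norm (t - 0)) \<longlongrightarrow> 0) (at 0) \<longleftrightarrow>
      ((\<lambda>t. norm (scale (inverse t) (f t - f 0) - a)) \<longlongrightarrow> 0) (at 0)"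
    by (intro filterlim_cong) (auto simp: eventually_at_filter)
  also have "\<dots> \<longleftrightarrow> ((\<lambda>t. scale (inverse t) (f t - f 0)) \<longlongrightarrow> a) (at 0)"
    by (simp add: tendsto_norm_zero_iff LIM_zero_iff)
  finally show ?thesis
    by (simp add: has_derivative_iff_norm bounded_linear_scale_left)
qed

lemma (in banach_over) has_derivative_scale_tendsto:
  assumes "(f has_derivative (\<lambda>t. scale t a)) (at 0)"
  shows "(f \<longlongrightarrow> f 0) (at 0)"
  using has_derivative_continuous[OF assms] by (simp add: continuous_within)

subsection \<open>Derivatives of multilinear expressions\<close>

lemma prod_list_tendsto:
  fixes f :: "'i \<Rightarrow> 'a \<Rightarrow> real"
  shows "(\<And>i. i \<in> set is \<Longrightarrow> (f i \<longlongrightarrow> l i) F) \<Longrightarrow>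
    ((\<lambda>x. \<Prod>i\<leftarrow>is. f i x) \<longlongrightarrow> (\<Prod>i\<leftarrow>is. l i)) F"
  by (induction "is") (auto intro!: tendsto_mult)

locale two_spaces = Z: banach_over sZ + F: banach_over sF
  for sZ :: "'k::{real_normed_field,euclidean_space} \<Rightarrow> 'z::banach \<Rightarrow> 'z"
    and sF :: "'k \<Rightarrow> 'f::banach \<Rightarrow> 'f"
begin

text \<open>A product rule: \<open>Op'\<close> comes from the moving point, the sum from the moving
  arguments. Linearity is asked for only on \<open>VZ\<close> and at points of \<open>A\<close>, so
  that operators multilinear merely on a subspace are covered.\<close>

lemma multilinear_has_derivative:
  fixes Op :: "'z list \<Rightarrow> 'x \<Rightarrow> 'f"
  assumes VZ: "Z.subspace VZ"
    and add: "\<And>vs i a b x. length vs = n \<Longrightarrow> set vs \<subseteq> VZ \<Longrightarrow> i < n \<Longrightarrow> a \<in> VZ \<Longrightarrow> b \<in> VZ \<Longrightarrow> x \<in> A \<Longrightarrow>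
      Op (vs[i := a + b]) x = Op (vs[i := a]) x + Op (vs[i := b]) x"
    and scl: "\<And>vs i a c x. length vs = n \<Longrightarrow> set vs \<subseteq> VZ \<Longrightarrow> i < n \<Longrightarrow> a \<in> VZ \<Longrightarrow> x \<in> A \<Longrightarrow>
      Op (vs[i := sZ c a]) x = sF c (Op (vs[i := a]) x)"
    and bound: "\<And>vs x. length vs = n \<Longrightarrow> set vs \<subseteq> VZ \<Longrightarrow> x \<in> A \<Longrightarrow>
      norm (Op vs x) \<le> C * prod_list (map norm vs)"
    and der: "\<And>vs. length vs = n \<Longrightarrow> set vs \<subseteq> VZ \<Longrightarrow>
      ((\<lambda>t. Op vs (x t)) has_derivative (\<lambda>t. sF t (Op' vs))) (at 0)"
    and xA: "eventually (\<lambda>t. x t \<in> A) (at 0)" "x 0 \<in> A"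
    and us: "\<And>t. length (us t) = n" "length du = n" "set (us 0) \<subseteq> VZ" "set du \<subseteq> VZ"
      "eventually (\<lambda>t. set (us t) \<subseteq> VZ) (at 0)"
    and uder: "\<And>i. i < n \<Longrightarrow> ((\<lambda>t. us t ! i) has_derivative (\<lambda>t. sZ t (du ! i))) (at 0)"
  shows "((\<lambda>t. Op (us t) (x t)) has_derivative
     (\<lambda>t. sF t (Op' (us 0) + (\<Sum>i\<leftarrow>[0..<n]. Op ((us 0)[i := du ! i]) (x 0))))) (at 0)"
proof -
  have VZd: "a \<in> VZ \<Longrightarrow> b \<in> VZ \<Longrightarrow> a - b \<in> VZ" and VZs: "a \<in> VZ \<Longrightarrow> sZ c a \<in> VZ" for a b c
    using VZ by (auto simp: Z.subspace_diff Z.subspace_def)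
  have upd: "set (vs[i := a]) \<subseteq> VZ" if "set vs \<subseteq> VZ" "a \<in> VZ" for vs i a
    using that set_update_subset_insert[of vs i a] by auto
  have diff: "Op (vs[i := a - b]) y = Op (vs[i := a]) y - Op (vs[i := b]) y"
    if "length vs = n" "set vs \<subseteq> VZ" "i < n" "a \<in> VZ" "b \<in> VZ" "y \<in> A" for vs i a b y
    using add[OF that(1-3) VZd[OF that(4,5)] that(5,6)] by simp
  \<comment> \<open>Induction on the number \<open>j\<close> of slots that already carry moving
    arguments; the others are frozen at \<open>vs\<close>.\<close>
  have "((\<lambda>t. Op (take j (us t) @ drop j vs) (x t)) has_derivative
     (\<lambda>t. sF t (Op' (take j (us 0) @ drop j vs) +
        (\<Sum>i\<leftarrow>[0..<j]. Op ((take j (us 0) @ drop j vs)[i := du ! i]) (x 0))))) (at 0)"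
    if "j \<le> n" "length vs = n" "set vs \<subseteq> VZ" for j vs
    using that
  proof (induction j arbitrary: vs)
    case 0 then show ?case using der by simp
  next
    case (Suc j)
    define L where "L t = take j (us t) @ drop j vs" for t
    have j: "j < n" using Suc.prems by simp
    have dj: "du ! j \<in> VZ" and uj: "us 0 ! j \<in> VZ" using us j by (auto dest: nth_mem)
    have len: "length (L t) = n" for t using us Suc.prems by (simp add: L_def)
    have Lset: "set (L t) \<subseteq> VZ" if "set (us t) \<subseteq> VZ" for t
      using that Suc.prems by (auto simp: L_def dest: in_set_takeD in_set_dropD)
    have Lupd: "(L t)[j := c] = take j (us t) @ drop j (vs[j := c])" for t c
      using us j Suc.prems by (intro nth_equalityI) (auto simp: L_def nth_append nth_list_update)
    have Suc_upd: "take (Suc j) (us t) @ drop (Suc j) vs = (L t)[j := us t ! j]" for t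
      using us j Suc.prems
      by (intro nth_equalityI) (auto simp: L_def nth_append nth_list_update min_def)
    have IH: "((\<lambda>t. Op ((L t)[j := c]) (x t)) has_derivative
     (\<lambda>t. sF t (Op' ((L 0)[j := c]) +
        (\<Sum>i\<leftarrow>[0..<j]. Op ((L 0)[j := c, i := du ! i]) (x 0))))) (at 0)" if "c \<in> VZ" for c
      unfolding Lupd using Suc.prems that upd by (intro Suc.IH) auto
    define q where "q t = sZ (inverse t) (us t ! j - us 0 ! j)" for t
    have q: "(q \<longlongrightarrow> du ! j) (at 0)"
      using uder[OF j] unfolding q_def Z.has_derivative_scale_iff .
    have ev: "eventually (\<lambda>t. x t \<in> A \<and> set (us t) \<subseteq> VZ \<and> t \<noteq> 0) (at 0)"
      using xA(1) us(5) by (intro eventually_conj) (auto simp: eventually_at_filter)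
    \<comment> \<open>The increment in slot \<open>j\<close> is \<open>0\<close> at
      \<open>t = 0\<close>, so only the limit of its difference quotient contributes.\<close>
    have "((\<lambda>t. Op ((L t)[j := us t ! j - us 0 ! j]) (x t)) has_derivative
        (\<lambda>t. sF t (Op ((L 0)[j := du ! j]) (x 0)))) (at 0)"
      unfolding F.has_derivative_scale_iff
    proof -
      have z: "Op ((L 0)[j := us 0 ! j - us 0 ! j]) (x 0) = 0"
        using diff[OF len Lset j uj uj xA(2)] us by simp
      \<comment> \<open>\<open>q t - du ! j\<close> tends to \<open>0\<close> while the other slots
        converge, so the multilinear bound makes the term vanish in the limit.\<close>
      have zero: "((\<lambda>t. Op ((L t)[j := q t - du ! j]) (x t)) \<longlongrightarrow> 0) (at 0)"
      proof (rule Lim_null_comparison)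
        let ?B = "\<lambda>t. C * (\<Prod>i\<leftarrow>[0..<n]. norm ((L t)[j := q t - du ! j] ! i))"
        have utends: "((\<lambda>t. us t ! i) \<longlongrightarrow> us 0 ! i) (at 0)" if "i < n" for i
          by (rule Z.has_derivative_scale_tendsto[OF uder[OF that]])
        have "((\<lambda>t. (L t)[j := q t - du ! j] ! i) \<longlongrightarrow> (L 0)[j := 0] ! i) (at 0)" if "i < n" for i
        proof (cases "i = j")
          case True
          then show ?thesis using j q len by (auto intro: LIM_zero)
        next
          case False
          then show ?thesis using utends[OF that] us that Suc.prems
            by (cases "i < j") (auto simp: L_def nth_append)
        qed
        then have "(?B \<longlongrightarrow> C * (\<Prod>i\<leftarrow>[0..<n]. norm ((L 0)[j := 0] ! i))) (at 0)"
          by (intro tendsto_intros prod_list_tendsto) auto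
        moreover have "(\<Prod>i\<leftarrow>[0..<n]. norm ((L 0)[j := 0] ! i)) = 0"
          using j len by (auto simp: prod_list_zero_iff intro!: image_eqI[of _ _ j])
        ultimately show "(?B \<longlongrightarrow> 0) (at 0)" by simp
        show "\<forall>\<^sub>F t in at 0. norm (Op ((L t)[j := q t - du ! j]) (x t)) \<le> ?B t"
          using ev
        proof eventually_elim
          case (elim t)
          have "us t ! j \<in> VZ" using elim us j by (auto dest: nth_mem)
          then have "q t - du ! j \<in> VZ" unfolding q_def using uj dj by (intro VZd VZs) auto
          then have "norm (Op ((L t)[j := q t - du ! j]) (x t)) \<le> C * prod_list (map norm ((L t)[j := q t - du ! j]))"
            using elim Lset len by (intro bound upd) auto
          also have "map norm ((L t)[j := q t - du ! j]) = map (\<lambda>i. norm ((L t)[j := q t - du ! j] ! i)) [0..<n]"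
            using len by (intro nth_equalityI) auto
          finally show ?case .
        qed
      qed
      have "((\<lambda>t. Op ((L t)[j := q t - du ! j]) (x t) + Op ((L t)[j := du ! j]) (x t)) \<longlongrightarrow>
          0 + Op ((L 0)[j := du ! j]) (x 0)) (at 0)"
        by (intro tendsto_add zero F.has_derivative_scale_tendsto[OF IH[OF dj]])
      moreover have "\<forall>\<^sub>F t in at 0. Op ((L t)[j := q t - du ! j]) (x t) + Op ((L t)[j := du ! j]) (x t)
         = sF (inverse t) (Op ((L t)[j := us t ! j - us 0 ! j]) (x t) - Op ((L 0)[j := us 0 ! j - us 0 ! j]) (x 0))"
        using ev
      proof eventually_elim
        case (elim t)
        have "us t ! j \<in> VZ" using elim us j by (auto dest: nth_mem)
        then have d: "us t ! j - us 0 ! j \<in> VZ" using uj by (intro VZd) auto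
        then have "q t \<in> VZ" unfolding q_def by (rule VZs)
        then have "Op ((L t)[j := q t - du ! j]) (x t) + Op ((L t)[j := du ! j]) (x t) = Op ((L t)[j := q t]) (x t)"
          using diff[OF len Lset j _ dj] elim by simp
        also have "\<dots> = sF (inverse t) (Op ((L t)[j := us t ! j - us 0 ! j]) (x t))"
          unfolding q_def using elim len Lset j d by (intro scl) auto
        finally show ?case using z by simp
      qed
      ultimately show "((\<lambda>t. sF (inverse t) (Op ((L t)[j := us t ! j - us 0 ! j]) (x t) - Op ((L 0)[j := us 0 ! j - us 0 ! j]) (x 0)))
         \<longlongrightarrow> Op ((L 0)[j := du ! j]) (x 0)) (at 0)"
        by (auto intro: Lim_transform_eventually)
    qed
    from has_derivative_add[OF IH[OF uj] this]
    have 1: "((\<lambda>t. Op ((L t)[j := us 0 ! j]) (x t) + Op ((L t)[j := us t ! j - us 0 ! j]) (x t)) has_derivative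
     (\<lambda>t. sF t (Op' ((L 0)[j := us 0 ! j]) +
        (\<Sum>i\<leftarrow>[0..<Suc j]. Op ((L 0)[j := us 0 ! j, i := du ! i]) (x 0))))) (at 0)"
      by (simp add: F.scale_right_distrib add_ac)
    have *: "Op ((L t)[j := us 0 ! j]) (x t) + Op ((L t)[j := us t ! j - us 0 ! j]) (x t)
       = Op ((L t)[j := us t ! j]) (x t)" if "x t \<in> A" "set (us t) \<subseteq> VZ" for t
    proof -
      have "us t ! j \<in> VZ" using that us j by (auto dest: nth_mem)
      then show ?thesis using diff[OF len Lset j _ uj that(1)] that by simp
    qed
    show ?case
      unfolding Suc_upd using 1
    proof (rule has_derivative_transform_eventually)
      show "\<forall>\<^sub>F t in at 0. Op ((L t)[j := us 0 ! j]) (x t) + Op ((L t)[j := us t ! j - us 0 ! j]) (x t)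
       = Op ((L t)[j := us t ! j]) (x t)"
        using ev by eventually_elim (auto intro!: *)
      show "Op ((L 0)[j := us 0 ! j]) (x 0) + Op ((L 0)[j := us 0 ! j - us 0 ! j]) (x 0)
       = Op ((L 0)[j := us 0 ! j]) (x 0)"
        by (rule *) (use xA us in auto)
    qed simp
  qed
  from this[of n "us 0"] show ?thesis using us by simp
qed

text \<open>A quadratic estimate at the single point \<open>x 0\<close> suffices: the remainder
  divided by \<open>t\<close> is bounded by a multiple of \<open>norm H * norm (q t)\<close>, whose
  first factor tends to \<open>0\<close> while the second one stays bounded.\<close>

lemma taylor_has_derivative:
  fixes f :: "'z \<Rightarrow> 'f"
  assumes VZ: "Z.subspace VZ"
    and taylor: "\<And>H. H \<in> VZ \<Longrightarrow> x 0 + H \<in> A \<Longrightarrow> norm (f (x 0 + H) - f (x 0) - f' H) \<le> K * (norm H)\<^sup>2"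
    and add: "\<And>a b. a \<in> VZ \<Longrightarrow> b \<in> VZ \<Longrightarrow> f' (a + b) = f' a + f' b"
    and scl: "\<And>a c. a \<in> VZ \<Longrightarrow> f' (sZ c a) = sF c (f' a)"
    and bound: "\<And>a. a \<in> VZ \<Longrightarrow> norm (f' a) \<le> C * norm a"
    and x: "(x has_derivative (\<lambda>t. sZ t dx)) (at 0)" "x 0 \<in> VZ" "dx \<in> VZ"
      "eventually (\<lambda>t. x t \<in> A \<inter> VZ) (at 0)"
  shows "((\<lambda>t. f (x t)) has_derivative (\<lambda>t. sF t (f' dx))) (at 0)"
proof -
  have VZd: "a \<in> VZ \<Longrightarrow> b \<in> VZ \<Longrightarrow> a - b \<in> VZ" and VZs: "a \<in> VZ \<Longrightarrow> sZ c a \<in> VZ" for a b c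
    using VZ by (auto simp: Z.subspace_diff Z.subspace_def)
  define q where "q t = sZ (inverse t) (x t - x 0)" for t
  have q: "(q \<longlongrightarrow> dx) (at 0)" using x(1) unfolding q_def Z.has_derivative_scale_iff .
  have xt: "(x \<longlongrightarrow> x 0) (at 0)" by (rule Z.has_derivative_scale_tendsto[OF x(1)])
  let ?B = "\<lambda>t. K * (norm (x t - x 0) * norm (q t)) + C * norm (q t - dx)"
  have "(?B \<longlongrightarrow> K * (0 * norm dx) + C * 0) (at 0)"
    using q xt by (intro tendsto_intros tendsto_norm_zero) (auto intro: LIM_zero)
  then have B: "(?B \<longlongrightarrow> 0) (at 0)" by simp
  have "\<forall>\<^sub>F t in at 0. norm (sF (inverse t) (f (x t) - f (x 0)) - f' dx) \<le> ?B t"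
    using x(4) eventually_neq_at_within[of 0 0 UNIV]
  proof eventually_elim
    case (elim t)
    define H where "H = x t - x 0"
    have H: "H \<in> VZ" "x 0 + H = x t" "x 0 + H \<in> A" using elim x VZd by (auto simp: H_def)
    have qH: "q t = sZ (inverse t) H" "q t \<in> VZ" using H VZs by (auto simp: q_def H_def)
    have "sF (inverse t) (f (x t) - f (x 0)) - f' dx =
       sF (inverse t) (f (x 0 + H) - f (x 0) - f' H) + (f' (q t) - f' dx)"
      using H qH by (simp add: F.scale_right_diff_distrib scl)
    also have "f' (q t) - f' dx = f' (q t - dx)"
      using add[of "q t - dx" dx] VZd[OF qH(2) x(3)] x(3) by simp
    also have "norm (sF (inverse t) (f (x 0 + H) - f (x 0) - f' H) + f' (q t - dx))
       \<le> norm (inverse t) * (K * (norm H)\<^sup>2) + C * norm (q t - dx)"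
      by (intro norm_triangle_le add_mono bound VZd qH x)
        (auto simp: F.norm_scale intro!: mult_left_mono taylor H)
    also have "norm (inverse t) * (K * (norm H)\<^sup>2) = K * (norm H * norm (q t))"
      by (simp add: qH Z.norm_scale power2_eq_square mult_ac)
    finally show ?case by (simp add: H_def)
  qed
  from Lim_null_comparison[OF this B]
  show ?thesis unfolding F.has_derivative_scale_iff by (simp add: LIM_zero_iff)
qed

end

subsection \<open>Towers from systems of terms\<close>

context tower_spaces
begin

lemma bsmooth_transform: "bsmooth sE sF V W f \<Longrightarrow> (\<And>x. x \<in> W \<Longrightarrow> f x = g x) \<Longrightarrow> bsmooth sE sF V W g"
  unfolding bsmooth_def by (metis (no_types, lifting))

text \<open>
  A term stands for an expression in the direction vectors \<open>us\<close>, in the order in which the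
  derivatives are taken, and \<open>der n\<close> differentiates it in a new direction numbered \<open>n\<close>.
\<close>

lemma bsmooth_terms:
  fixes val :: "'t \<Rightarrow> 'e \<Rightarrow> 'e list \<Rightarrow> 'f" and der :: "nat \<Rightarrow> 't \<Rightarrow> 't list"
    and good :: "nat \<Rightarrow> 't \<Rightarrow> bool"
  assumes op: "openin (top_of_set V) W"
    and good: "\<And>n s s'. good n s \<Longrightarrow> s' \<in> set (der n s) \<Longrightarrow> good (Suc n) s'"
    and deriv: "\<And>n s x us h. good n s \<Longrightarrow> x \<in> W \<Longrightarrow> length us = n \<Longrightarrow> set us \<subseteq> V \<Longrightarrow> h \<in> V \<Longrightarrow>
      ((\<lambda>t. val s (x + sE t h) us) has_derivative
        (\<lambda>t. sF t (\<Sum>s'\<leftarrow>der n s. val s' x (us @ [h])))) (at 0)"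
    and bound: "\<And>n s. good n s \<Longrightarrow> \<exists>C. \<forall>x\<in>W. \<forall>us. length us = n \<and> set us \<subseteq> V \<and>
      (\<forall>v\<in>set us. norm v \<le> 1) \<longrightarrow> norm (val s x us) \<le> C"
    and s0: "good 0 s0"
  shows "bsmooth sE sF V W (\<lambda>x. val s0 x [])"
proof -
  define terms where "terms = rec_nat [s0] (\<lambda>n ts. concat (map (der n) ts))"
  have terms: "terms 0 = [s0]" "terms (Suc n) = concat (map (der n) (terms n))" for n
    by (simp_all add: terms_def)
  have goodn: "good n s" if "s \<in> set (terms n)" for n s
    using that by (induction n arbitrary: s) (auto simp: terms s0 intro: good)
  have sum_concat: "(\<Sum>s\<leftarrow>concat xss. f s) = (\<Sum>xs\<leftarrow>xss. \<Sum>s\<leftarrow>xs. f s)" for xss and f :: "'t \<Rightarrow> 'f"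
    by (induction xss) auto
  \<comment> \<open>Terms number the directions by age, whereas towers put the newest direction
    first; hence the reversal.\<close>
  define D where "D x vs = (\<Sum>s\<leftarrow>terms (length vs). val s x (rev vs))" for x vs
  have "btower sE sF V W D"
    unfolding btower_def
  proof (intro conjI op ballI allI impI)
    fix x h vs assume x: "x \<in> W" "h \<in> V" "set vs \<subseteq> V"
    have "((\<lambda>t. \<Sum>s\<leftarrow>terms (length vs). val s (x + sE t h) (rev vs)) has_derivative
      (\<lambda>t. \<Sum>s\<leftarrow>terms (length vs). sF t (\<Sum>s'\<leftarrow>der (length vs) s. val s' x (rev vs @ [h])))) (at 0)"
      using x goodn by (intro has_derivative_sum_list deriv) auto
    then show "((\<lambda>t. D (x + sE t h) vs) has_derivative (\<lambda>t. sF t (D x (h # vs)))) (at 0)"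
      by (simp add: D_def terms sum_concat F.scale_sum_list o_def)
  next
    fix m
    have "\<exists>C. \<forall>x\<in>W. \<forall>us. length us = m \<and> set us \<subseteq> V \<and>
      (\<forall>v\<in>set us. norm v \<le> 1) \<longrightarrow> norm (\<Sum>s\<leftarrow>ts. val s x us) \<le> C" if "set ts \<subseteq> set (terms m)" for ts
      using that
    proof (induction ts)
      case Nil then show ?case by auto
    next
      case (Cons s ts)
      obtain C where C: "\<forall>x\<in>W. \<forall>us. length us = m \<and> set us \<subseteq> V \<and>
        (\<forall>v\<in>set us. norm v \<le> 1) \<longrightarrow> norm (\<Sum>s\<leftarrow>ts. val s x us) \<le> C" using Cons by auto
      obtain C' where C': "\<forall>x\<in>W. \<forall>us. length us = m \<and> set us \<subseteq> V \<and>
        (\<forall>v\<in>set us. norm v \<le> 1) \<longrightarrow> norm (val s x us) \<le> C'"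
        using bound[OF goodn[of s m]] Cons.prems by auto
      show ?case
        using C C' by (intro exI[of _ "C' + C"]) (auto intro!: norm_triangle_mono)
    qed
    from this[of "terms m"] obtain C where C: "\<forall>x\<in>W. \<forall>us. length us = m \<and> set us \<subseteq> V \<and>
      (\<forall>v\<in>set us. norm v \<le> 1) \<longrightarrow> norm (\<Sum>s\<leftarrow>terms m. val s x us) \<le> C" by auto
    show "\<exists>C. \<forall>x\<in>W. \<forall>vs. length vs = m \<and> set vs \<subseteq> V \<and> (\<forall>v\<in>set vs. norm v \<le> 1) \<longrightarrow> norm (D x vs) \<le> C"
      by (rule exI[of _ C]) (use C in \<open>auto simp: D_def\<close>)
  qed
  then show ?thesis unfolding bsmooth_def
    by (intro exI[of _ D]) (auto simp: D_def terms)
qed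

text \<open>\<open>b\<close> selects directions by their index in \<open>us\<close>. Terms use such
  lists to remember which directions have hit a factor, and the indices remain valid when further
  directions are appended.\<close>

lemma btower_bound_indices:
  assumes "btower sE sF V W D" "set b \<subseteq> {..<n}"
  obtains C where "C \<ge> 0" "\<And>x us. x \<in> W \<Longrightarrow> length us = n \<Longrightarrow> set us \<subseteq> V \<Longrightarrow> (\<forall>v\<in>set us. norm v \<le> 1) \<Longrightarrow>
    norm (D x (map ((!) us) b)) \<le> C"
proof -
  obtain C where C: "\<And>x us. x \<in> W \<Longrightarrow> length us = length b \<Longrightarrow> set us \<subseteq> V \<Longrightarrow> (\<forall>v\<in>set us. norm v \<le> 1) \<Longrightarrow>
    norm (D x us) \<le> C"
    using assms(1) unfolding btower_def by (metis (no_types, lifting))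
  show ?thesis
  proof (rule that[of "max C 0"])
    fix x us assume x: "x \<in> W" and us: "length us = n" "set us \<subseteq> V" "\<forall>v\<in>set us. norm v \<le> 1"
    have "set (map ((!) us) b) \<subseteq> set us" using us assms(2) by (auto intro!: nth_mem)
    then have "norm (D x (map ((!) us) b)) \<le> C"
      using us by (intro C x) auto
    then show "norm (D x (map ((!) us) b)) \<le> max C 0" by simp
  qed simp
qed

lemma btower_deriv_indices:
  assumes "btower sE sF V W D" "set b \<subseteq> {..<n}" "x \<in> W" "length us = n" "set us \<subseteq> V" "h \<in> V"
  shows "((\<lambda>t. D (x + sE t h) (map ((!) us) b)) has_derivative
     (\<lambda>t. sF t (D x (map ((!) (us @ [h])) (n # b))))) (at 0)"
proof -
  have "set (map ((!) us) b) \<subseteq> V" using assms by (auto intro!: subsetD[OF assms(5) nth_mem])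
  from btower_deriv[OF assms(1,3,6) this]
  have "((\<lambda>t. D (x + sE t h) (map ((!) us) b)) has_derivative
     (\<lambda>t. sF t (D x (h # map ((!) us) b)))) (at 0)" .
  moreover have "h # map ((!) us) b = map ((!) (us @ [h])) (n # b)"
    using assms by (auto simp: nth_append)
  ultimately show ?thesis by simp
qed

section \<open>Closure properties of bounded smoothness\<close>

lemma bsmooth_affine:
  assumes "openin (top_of_set V) W" "bounded W" "bounded_klinear sE sF l"
  shows "bsmooth sE sF V W (\<lambda>x. c + l x)"
proof -
  have bl: "bounded_linear l" and ks: "\<And>c x. l (sE c x) = sF c (l x)"
    using assms(3) by (auto simp: bounded_klinear_def)
  interpret l: bounded_linear l by (rule bl)
  define D where "D x vs = (case vs of [] \<Rightarrow> c + l x | [h] \<Rightarrow> l h | _ \<Rightarrow> 0)" for x vs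
  obtain K where K: "\<And>x. norm (l x) \<le> norm x * K" "K > 0" using l.pos_bounded by blast
  obtain B where B: "\<And>x. x \<in> W \<Longrightarrow> norm x \<le> B" using assms(2) by (auto simp: bounded_iff)
  have "btower sE sF V W D"
    unfolding btower_def
  proof (intro conjI ballI allI impI assms(1))
    fix x h vs assume "x \<in> W" "h \<in> V" "set vs \<subseteq> V"
    show "((\<lambda>t. D (x + sE t h) vs) has_derivative (\<lambda>t. sF t (D x (h # vs)))) (at 0)"
    proof (cases vs)
      case Nil
      have "((\<lambda>t. c + (l x + sF t (l h))) has_derivative (\<lambda>t. sF t (l h))) (at 0)"
        by (auto intro!: derivative_eq_intros bounded_linear.has_derivative[OF F.bounded_linear_scale_left])
      then show ?thesis using Nil by (simp add: D_def l.add ks)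
    next
      case (Cons a vs')
      then have "D (x + sE t h) vs = D x vs" "D x (h # vs) = 0" for t
        by (auto simp: D_def split: list.splits)
      then show ?thesis by simp
    qed
  next
    fix m
    show "\<exists>C. \<forall>x\<in>W. \<forall>vs. length vs = m \<and> set vs \<subseteq> V \<and> (\<forall>v\<in>set vs. norm v \<le> 1) \<longrightarrow> norm (D x vs) \<le> C"
    proof (intro exI[of _ "norm c + max B 1 * K"] ballI allI impI)
      fix x vs assume x: "x \<in> W" and vs: "length vs = m \<and> set vs \<subseteq> V \<and> (\<forall>v\<in>set vs. norm v \<le> 1)"
      have *: "norm (l y) \<le> max B 1 * K" if "norm y \<le> max B 1" for y
        using order_trans[OF K(1)[of y] mult_right_mono[OF that]] K(2) by simp
      have "norm (c + l x) \<le> norm c + max B 1 * K"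
        using B[OF x] by (intro norm_triangle_mono *) auto
      moreover have "0 \<le> norm c + max B 1 * K" using K(2) by simp
      moreover have "norm (l h) \<le> norm c + max B 1 * K" if "norm h \<le> 1" for h
        using *[of h] that norm_ge_zero[of c] by linarith
      ultimately show "norm (D x vs) \<le> norm c + max B 1 * K"
        using vs by (auto simp: D_def split: list.splits)
    qed
  qed
  then show ?thesis unfolding bsmooth_def by (intro exI[of _ D]) (simp add: D_def)
qed

lemma bsmooth_const: "openin (top_of_set V) W \<Longrightarrow> bsmooth sE sF V W (\<lambda>x. c)"
proof -
  assume op: "openin (top_of_set V) W"
  define D where "D x vs = (case vs of [] \<Rightarrow> c | _ \<Rightarrow> 0)" for x :: 'e and vs :: "'e list"
  have "btower sE sF V W D" unfolding btower_def
  proof (intro conjI op allI exI[of _ "norm c"] ballI impI)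
    show "((\<lambda>t. D (x + sE t h) vs) has_derivative (\<lambda>t. sF t (D x (h # vs)))) (at 0)" for x h vs
      by (auto simp: D_def)
    show "norm (D x vs) \<le> norm c" for x vs by (auto simp: D_def split: list.splits)
  qed
  then show ?thesis unfolding bsmooth_def by (intro exI[of _ D]) (simp add: D_def)
qed

lemma bsmooth_add:
  assumes "bsmooth sE sF V W f" "bsmooth sE sF V W g"
  shows "bsmooth sE sF V W (\<lambda>x. f x + g x)"
proof -
  obtain D1 D2 where D: "btower sE sF V W D1" "\<forall>x\<in>W. D1 x [] = f x" "btower sE sF V W D2" "\<forall>x\<in>W. D2 x [] = g x"
    using assms unfolding bsmooth_def by blast
  have "btower sE sF V W (\<lambda>x vs. D1 x vs + D2 x vs)"
    unfolding btower_def
  proof (intro conjI ballI allI impI btower_openin[OF D(1)])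
    fix x h vs assume x: "x \<in> W" "h \<in> V" "set vs \<subseteq> V"
    show "((\<lambda>t. D1 (x + sE t h) vs + D2 (x + sE t h) vs) has_derivative (\<lambda>t. sF t (D1 x (h # vs) + D2 x (h # vs)))) (at 0)"
      unfolding F.scale_right_distrib
      by (intro has_derivative_add btower_deriv[OF D(1)] btower_deriv[OF D(3)] x)
  next
    fix m
    obtain C1 where C1: "\<forall>x\<in>W. \<forall>vs. length vs = m \<and> set vs \<subseteq> V \<and> (\<forall>v\<in>set vs. norm v \<le> 1) \<longrightarrow> norm (D1 x vs) \<le> C1"
      using D(1) unfolding btower_def by meson
    obtain C2 where C2: "\<forall>x\<in>W. \<forall>vs. length vs = m \<and> set vs \<subseteq> V \<and> (\<forall>v\<in>set vs. norm v \<le> 1) \<longrightarrow> norm (D2 x vs) \<le> C2"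
      using D(3) unfolding btower_def by meson
    show "\<exists>C. \<forall>x\<in>W. \<forall>vs. length vs = m \<and> set vs \<subseteq> V \<and> (\<forall>v\<in>set vs. norm v \<le> 1) \<longrightarrow> norm (D1 x vs + D2 x vs) \<le> C"
      using C1 C2 by (intro exI[of _ "C1 + C2"]) (auto intro!: norm_triangle_mono)
  qed
  then show ?thesis using D unfolding bsmooth_def by (intro exI conjI) auto
qed

lemma bsmooth_sum:
  assumes "finite I" "openin (top_of_set V) W" "\<And>i. i \<in> I \<Longrightarrow> bsmooth sE sF V W (f i)"
  shows "bsmooth sE sF V W (\<lambda>x. \<Sum>i\<in>I. f i x)"
  using assms by (induction I rule: finite_induct) (auto intro: bsmooth_const bsmooth_add)

lemma bsmooth_linear:
  assumes H: "banach_over sH" and "bsmooth sE sF V W f" "bounded_klinear sF sH l"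
  shows "bsmooth sE sH V W (\<lambda>x. l (f x))"
proof -
  interpret H: banach_over sH by fact
  obtain D where D: "btower sE sF V W D" "\<forall>x\<in>W. D x [] = f x"
    using assms unfolding bsmooth_def by blast
  have bl: "bounded_linear l" and ks: "\<And>c x. l (sF c x) = sH c (l x)"
    using assms(3) by (auto simp: bounded_klinear_def)
  interpret l: bounded_linear l by (rule bl)
  obtain K where K: "\<And>x. norm (l x) \<le> norm x * K" "K > 0" using l.pos_bounded by blast
  have "btower sE sH V W (\<lambda>x vs. l (D x vs))"
    unfolding btower_def
  proof (intro conjI ballI allI impI btower_openin[OF D(1)])
    fix x h vs assume x: "x \<in> W" "h \<in> V" "set vs \<subseteq> V"
    show "((\<lambda>t. l (D (x + sE t h) vs)) has_derivative (\<lambda>t. sH t (l (D x (h # vs))))) (at 0)"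
      unfolding ks[symmetric]
      by (intro bounded_linear.has_derivative[OF bl] btower_deriv[OF D(1)] x)
  next
    fix m
    obtain C where C: "\<forall>x\<in>W. \<forall>vs. length vs = m \<and> set vs \<subseteq> V \<and> (\<forall>v\<in>set vs. norm v \<le> 1) \<longrightarrow> norm (D x vs) \<le> C"
      using D(1) unfolding btower_def by meson
    show "\<exists>C. \<forall>x\<in>W. \<forall>vs. length vs = m \<and> set vs \<subseteq> V \<and> (\<forall>v\<in>set vs. norm v \<le> 1) \<longrightarrow> norm (l (D x vs)) \<le> C"
      using C K by (intro exI[of _ "C * K"] ballI allI impI order_trans[OF K(1)] mult_right_mono) auto
  qed
  then show ?thesis using D unfolding bsmooth_def by (intro exI conjI) auto
qed

text \<open>Leibniz rule: a term is a pair of index lists recording which directions have hit either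
  factor, and a new direction joins one of the two.\<close>

lemma bsmooth_scale:
  assumes p: "bsmooth sE (*) V W p" and f: "bsmooth sE sF V W f"
  shows "bsmooth sE sF V W (\<lambda>x. sF (p x) (f x))"
proof -
  interpret K: tower_spaces sE "(*)" V
    by (intro tower_spaces.intro tower_spaces_axioms.intro E.banach_over_axioms banach_over_times subspace_V)
  obtain D1 D2 where D: "btower sE (*) V W D1" "\<forall>x\<in>W. D1 x [] = p x" "btower sE sF V W D2" "\<forall>x\<in>W. D2 x [] = f x"
    using assms unfolding bsmooth_def by blast
  define val where "val s x us = sF (D1 x (map ((!) us) (fst s))) (D2 x (map ((!) us) (snd s)))"
    for s :: "nat list \<times> nat list" and x us
  have "bsmooth sE sF V W (\<lambda>x. val ([], []) x [])"
  proof (rule bsmooth_terms[where good="\<lambda>n s. set (fst s) \<subseteq> {..<n} \<and> set (snd s) \<subseteq> {..<n}"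
        and der="\<lambda>n s. [(n # fst s, snd s), (fst s, n # snd s)]"])
    show "openin (top_of_set V) W" by (rule btower_openin[OF D(3)])
  next
    fix n :: nat and s x us h assume s: "set (fst s) \<subseteq> {..<n} \<and> set (snd s) \<subseteq> {..<n}" "x \<in> W" "length us = n" "set us \<subseteq> V" "h \<in> V"
    have eq: "map ((!) (us @ [h])) b = map ((!) us) b" if "set b \<subseteq> {..<n}" for b
      using that s by (auto simp: nth_append)
    have d1: "((\<lambda>t. D1 (x + sE t h) (map ((!) us) (fst s))) has_derivative
       (\<lambda>t. t * D1 x (map ((!) (us @ [h])) (n # fst s)))) (at 0)"
      by (rule K.btower_deriv_indices[OF D(1)]) (use s in auto)
    have d2: "((\<lambda>t. D2 (x + sE t h) (map ((!) us) (snd s))) has_derivative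
       (\<lambda>t. sF t (D2 x (map ((!) (us @ [h])) (n # snd s))))) (at 0)"
      by (rule btower_deriv_indices[OF D(3)]) (use s in auto)
    show "((\<lambda>t. val s (x + sE t h) us) has_derivative
        (\<lambda>t. sF t (\<Sum>s'\<leftarrow>[(n # fst s, snd s), (fst s, n # snd s)]. val s' x (us @ [h])))) (at 0)"
      unfolding val_def
      by (rule has_derivative_eq_rhs[OF F.scale_has_derivative[OF d1 d2]])
        (use s in \<open>simp add: fun_eq_iff F.scale_right_distrib mult.commute add.commute eq\<close>)
  next
    fix n :: nat and s assume s: "set (fst s) \<subseteq> {..<n} \<and> set (snd s) \<subseteq> {..<n}"
    obtain C1 where C1: "C1 \<ge> 0" "\<And>x us. x \<in> W \<Longrightarrow> length us = n \<Longrightarrow> set us \<subseteq> V \<Longrightarrow> (\<forall>v\<in>set us. norm v \<le> 1) \<Longrightarrow>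
       norm (D1 x (map ((!) us) (fst s))) \<le> C1"
      using K.btower_bound_indices[OF D(1), of "fst s" n] s by metis
    obtain C2 where C2: "C2 \<ge> 0" "\<And>x us. x \<in> W \<Longrightarrow> length us = n \<Longrightarrow> set us \<subseteq> V \<Longrightarrow> (\<forall>v\<in>set us. norm v \<le> 1) \<Longrightarrow>
       norm (D2 x (map ((!) us) (snd s))) \<le> C2"
      using btower_bound_indices[OF D(3), of "snd s" n] s by metis
    show "\<exists>C. \<forall>x\<in>W. \<forall>us. length us = n \<and> set us \<subseteq> V \<and>
      (\<forall>v\<in>set us. norm v \<le> 1) \<longrightarrow> norm (val s x us) \<le> C"
      by (intro exI[of _ "C1 * C2"]) (auto simp: val_def F.norm_scale intro!: mult_mono C1 C2)
  qed auto
  then show ?thesis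
    by (rule bsmooth_transform) (simp add: val_def D)
qed

lemma bsmooth_scale_power:
  assumes p: "bsmooth sE (*) V W p" and f: "bsmooth sE sF V W f"
  shows "bsmooth sE sF V W (\<lambda>x. sF (p x ^ j) (f x))"
proof (induction j)
  case 0 then show ?case using f by simp
next
  case (Suc j)
  from bsmooth_scale[OF p this] show ?case by simp
qed

end

section \<open>Power series of symmetric multilinear maps\<close>

text \<open>The class is stable under the index shift and under \<open>diffs\<close>, the two
  operations performed on the series \<open>ser\<close> below by splitting off an argument and by
  differentiation.\<close>

definition admissible_weight :: "(nat \<Rightarrow> real) \<Rightarrow> bool" where
  "admissible_weight w \<longleftrightarrow> (\<forall>m. w m \<ge> 0) \<and> (\<forall>s. \<bar>s\<bar> < 1 \<longrightarrow> summable (\<lambda>m. w m * s ^ m))"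

lemma admissible_weight_const: "admissible_weight (\<lambda>m. 1)"
  by (auto simp: admissible_weight_def summable_geometric)

lemma admissible_weight_Suc:
  assumes "admissible_weight w"
  shows "admissible_weight (\<lambda>m. w (Suc m))"
  unfolding admissible_weight_def
proof (intro conjI allI impI)
  fix s :: real assume s: "\<bar>s\<bar> < 1"
  show "summable (\<lambda>m. w (Suc m) * s ^ m)"
  proof (cases "s = 0")
    case True then show ?thesis by (auto intro: summable_finite[of "{0}"])
  next
    case False
    have "summable (\<lambda>m. w (Suc m) * s ^ Suc m)"
      using assms s summable_Suc_iff[of "\<lambda>m. w m * s ^ m"] by (simp add: admissible_weight_def)
    then have "summable (\<lambda>m. inverse s * (w (Suc m) * s ^ Suc m))" by (rule summable_mult)
    then show ?thesis using False by (simp add: field_simps)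
  qed
qed (use assms in \<open>auto simp: admissible_weight_def\<close>)

lemma admissible_weight_diffs:
  assumes "admissible_weight w"
  shows "admissible_weight (diffs w)"
  unfolding admissible_weight_def
proof (intro conjI allI impI)
  fix s :: real assume "\<bar>s\<bar> < 1"
  then show "summable (\<lambda>m. diffs w m * s ^ m)"
    using assms by (intro termdiff_converges[of s 1]) (auto simp: admissible_weight_def)
qed (use assms in \<open>auto simp: admissible_weight_def diffs_def\<close>)

lemma admissible_weight_mult_nat:
  assumes "admissible_weight w"
  shows "admissible_weight (\<lambda>m. real m * w m)"
  unfolding admissible_weight_def
proof (intro conjI allI impI)
  fix s :: real assume "\<bar>s\<bar> < 1"
  then have "summable (\<lambda>m. s * (diffs w m * s ^ m))"
    using admissible_weight_diffs[OF assms] by (intro summable_mult) (auto simp: admissible_weight_def)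
  then have "summable (\<lambda>m. real (Suc m) * w (Suc m) * s ^ Suc m)"
    by (simp add: diffs_def mult_ac)
  then show "summable (\<lambda>m. real m * w m * s ^ m)"
    by (subst summable_Suc_iff[symmetric])
qed (use assms in \<open>auto simp: admissible_weight_def\<close>)

locale power_series = two_spaces sB sC
  for sB :: "'k::{real_normed_field,euclidean_space} \<Rightarrow> 'b::banach \<Rightarrow> 'b"
    and sC :: "'k \<Rightarrow> 'c::banach \<Rightarrow> 'c" +
  fixes al :: "'b list \<Rightarrow> 'c" and r M :: real
  assumes r_pos: "r > 0" and M_nonneg: "M \<ge> 0"
    and al_add: "i < length vs \<Longrightarrow> al (vs[i := x + y]) = al (vs[i := x]) + al (vs[i := y])"
    and al_scale: "i < length vs \<Longrightarrow> al (vs[i := sB c x]) = sC c (al (vs[i := x]))"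
    and al_sym: "mset vs = mset ws \<Longrightarrow> al vs = al ws"
    and al_bound: "norm (al vs) \<le> M / r ^ length vs * prod_list (map norm vs)"
begin

text \<open>\<open>G\<close> is the case of weight \<open>1\<close> without fixed arguments.
  Differentiation in direction \<open>h\<close> changes the weight to \<open>diffs w\<close> and
  adds \<open>h\<close> to the fixed arguments, so derivatives of every order stay in this
  family.\<close>

definition ser :: "(nat \<Rightarrow> real) \<Rightarrow> 'b list \<Rightarrow> 'b \<Rightarrow> 'c" where
  "ser w vs x = (\<Sum>m. w m *\<^sub>R al (vs @ replicate m x))"

definition coef_bound :: "'b list \<Rightarrow> real" where
  "coef_bound vs = M / r ^ length vs * prod_list (map norm vs)"

lemma coef_bound_Cons: "coef_bound (x # vs) = norm x / r * coef_bound vs"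
  by (simp add: coef_bound_def)

lemma coef_bound_nonneg: "coef_bound vs \<ge> 0"
  unfolding coef_bound_def using r_pos M_nonneg
  by (intro mult_nonneg_nonneg divide_nonneg_nonneg prod_list_nonneg) auto

lemma al_Cons_add: "al ((x + y) # vs) = al (x # vs) + al (y # vs)"
  using al_add[of 0 "x # vs" x y] by simp

lemma al_bound_replicate:
  assumes "norm x \<le> \<kappa>"
  shows "norm (al (vs @ replicate m x)) \<le> coef_bound vs * (\<kappa> / r) ^ m"
proof -
  have "prod_list (map norm (vs @ replicate m x)) = prod_list (map norm vs) * norm x ^ m"
    by (induction m) (simp_all add: replicate_append_same[symmetric])
  then have "norm (al (vs @ replicate m x)) \<le> coef_bound vs * (norm x / r) ^ m"
    using al_bound[of "vs @ replicate m x"]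
    by (simp add: coef_bound_def power_add power_divide)
  also have "\<dots> \<le> coef_bound vs * (\<kappa> / r) ^ m"
    using assms r_pos coef_bound_nonneg by (intro mult_left_mono power_mono divide_right_mono) auto
  finally show ?thesis .
qed

lemma al_replicate_Suc: "al (us @ replicate (Suc m) x) = al ((x # us) @ replicate m x)"
  by (rule al_sym) simp

context
  fixes \<kappa> :: real
  assumes \<kappa>: "0 < \<kappa>" "\<kappa> < r"
begin

lemma summable_weight:
  assumes "admissible_weight w"
  shows "summable (\<lambda>m. w m * (\<kappa> / r) ^ m)"
  using assms \<kappa> by (simp add: admissible_weight_def)

lemma summable_ser:
  assumes w: "admissible_weight w" and x: "norm x \<le> \<kappa>"
  shows "summable (\<lambda>m. w m *\<^sub>R al (vs @ replicate m x))"
proof (rule summable_comparison_test')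
  show "summable (\<lambda>m. coef_bound vs * (w m * (\<kappa> / r) ^ m))"
    by (intro summable_mult summable_weight w)
  show "norm (w m *\<^sub>R al (vs @ replicate m x)) \<le> coef_bound vs * (w m * (\<kappa> / r) ^ m)" if "m \<ge> 0" for m
    using mult_left_mono[OF al_bound_replicate[OF x, of vs m], of "w m"] w
    by (simp add: admissible_weight_def mult_ac)
qed

lemma ser_bound:
  assumes w: "admissible_weight w" and x: "norm x \<le> \<kappa>"
  shows "norm (ser w vs x) \<le> (\<Sum>m. w m * (\<kappa> / r) ^ m) * coef_bound vs"
proof -
  have "norm (ser w vs x) \<le> (\<Sum>m. w m * (\<kappa> / r) ^ m * coef_bound vs)"
    unfolding ser_def
  proof (rule norm_suminf_le)
    show "norm (w m *\<^sub>R al (vs @ replicate m x)) \<le> w m * (\<kappa> / r) ^ m * coef_bound vs" for m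
      using mult_left_mono[OF al_bound_replicate[OF x, of vs m], of "w m"] w
      by (simp add: admissible_weight_def mult_ac)
    show "summable (\<lambda>m. w m * (\<kappa> / r) ^ m * coef_bound vs)"
      by (intro summable_mult2 summable_weight w)
  qed
  also have "\<dots> = (\<Sum>m. w m * (\<kappa> / r) ^ m) * coef_bound vs"
    by (intro suminf_mult2[symmetric] summable_weight w)
  finally show ?thesis .
qed

lemma al_replicate_add:
  "i < length vs \<Longrightarrow> al (vs[i := a + b] @ ys) = al (vs[i := a] @ ys) + al (vs[i := b] @ ys)"
  using al_add[of i "vs @ ys" a b] by (simp add: list_update_append)

lemma ser_add:
  assumes "admissible_weight w" "norm x \<le> \<kappa>" "i < length vs"
  shows "ser w (vs[i := a + b]) x = ser w (vs[i := a]) x + ser w (vs[i := b]) x"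
  unfolding ser_def using assms
  by (subst suminf_add) (auto intro!: summable_ser simp: al_replicate_add scaleR_add_right)

lemma ser_scale:
  assumes "admissible_weight w" "norm x \<le> \<kappa>" "i < length vs"
  shows "ser w (vs[i := sB c a]) x = sC c (ser w (vs[i := a]) x)"
  unfolding ser_def bounded_linear.suminf[OF F.bounded_linear_scale_right summable_ser[OF assms(1,2)]]
  using assms by (auto simp: list_update_append1[symmetric] al_scale F.scale_scaleR)

lemma ser_split:
  assumes "admissible_weight w" "norm x \<le> \<kappa>"
  shows "ser w vs x = w 0 *\<^sub>R al vs + ser (\<lambda>m. w (Suc m)) (x # vs) x"
  using suminf_split_head[OF summable_ser[OF assms, of vs]]
  by (simp add: ser_def al_replicate_Suc del: replicate_Suc)

text \<open>The arguments \<open>x + h\<close> are replaced by \<open>x\<close> one at a time. Both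
  sides carry an extra factor \<kappa>, because the natural bound contains
  \<open>\<kappa> ^ (m - 1)\<close>, whose truncated exponent would spoil the induction.\<close>

lemma al_diff_bound:
  assumes "norm x \<le> \<kappa>" "norm (x + h) \<le> \<kappa>"
  shows "norm (al (us @ replicate m (x + h)) - al (us @ replicate m x)) * \<kappa>
     \<le> real m * (norm h * (\<kappa> / r) ^ m * coef_bound us)"
proof (induction m arbitrary: us)
  case (Suc m)
  have eq: "al (us @ replicate (Suc m) (x + h)) - al (us @ replicate (Suc m) x) =
     al ((h # us) @ replicate m (x + h)) + (al ((x # us) @ replicate m (x + h)) - al ((x # us) @ replicate m x))"
    by (simp add: al_replicate_Suc al_Cons_add del: replicate_Suc)
  have A: "norm (al ((h # us) @ replicate m (x + h))) * \<kappa> \<le> coef_bound (h # us) * (\<kappa> / r) ^ m * \<kappa>"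
    using al_bound_replicate[OF assms(2), of "h # us" m] \<kappa> by (intro mult_right_mono) auto
  have B: "norm (al ((x # us) @ replicate m (x + h)) - al ((x # us) @ replicate m x)) * \<kappa>
     \<le> real m * (norm h * (\<kappa> / r) ^ m * coef_bound (x # us))"
    by (rule Suc.IH)
  also have "\<dots> \<le> real m * (norm h * (\<kappa> / r) ^ m * (\<kappa> / r * coef_bound us))"
    unfolding coef_bound_Cons using assms \<kappa> r_pos coef_bound_nonneg
    by (intro mult_left_mono mult_right_mono divide_right_mono) auto
  finally have B': "norm (al ((x # us) @ replicate m (x + h)) - al ((x # us) @ replicate m x)) * \<kappa>
     \<le> real m * (norm h * (\<kappa> / r) ^ Suc m * coef_bound us)" by (simp add: mult_ac)
  have "norm (al (us @ replicate (Suc m) (x + h)) - al (us @ replicate (Suc m) x)) * \<kappa>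
    \<le> norm (al ((h # us) @ replicate m (x + h))) * \<kappa> + norm (al ((x # us) @ replicate m (x + h)) - al ((x # us) @ replicate m x)) * \<kappa>"
    unfolding eq distrib_right[symmetric] using \<kappa> by (intro mult_right_mono norm_triangle_ineq) auto
  also have "\<dots> \<le> coef_bound (h # us) * (\<kappa> / r) ^ m * \<kappa> + real m * (norm h * (\<kappa> / r) ^ Suc m * coef_bound us)"
    by (rule add_mono[OF A B'])
  also have "\<dots> = real (Suc m) * (norm h * (\<kappa> / r) ^ Suc m * coef_bound us)"
    using r_pos by (simp add: coef_bound_Cons field_simps)
  finally show ?case .
qed simp

text \<open>Splitting off one argument \<open>x + h\<close> leaves a Taylor remainder with
  \<open>x\<close> fixed and a plain difference with \<open>h\<close> fixed, which is
  \<open>al_diff_bound\<close>. The constants add up by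
  \<open>(real m)\<^sup>2 + real m \<le> (real (Suc m))\<^sup>2\<close>. At \<open>m = 0\<close> the
  factor \<open>real m\<close> removes the term with the truncated exponent.\<close>

lemma al_taylor_bound:
  assumes "norm x \<le> \<kappa>" "norm (x + h) \<le> \<kappa>"
  shows "norm (al (us @ replicate m (x + h)) - al (us @ replicate m x) - real m *\<^sub>R al (h # us @ replicate (m - 1) x)) * \<kappa>\<^sup>2
     \<le> (real m)\<^sup>2 * ((norm h)\<^sup>2 * (\<kappa> / r) ^ m * coef_bound us)"
proof (induction m arbitrary: us)
  case (Suc m)
  define P where "P us = al (us @ replicate m (x + h)) - al (us @ replicate m x) - real m *\<^sub>R al (h # us @ replicate (m - 1) x)" for us
  define Q where "Q us = al (us @ replicate m (x + h)) - al (us @ replicate m x)" for us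
  have "real m *\<^sub>R al (h # x # us @ replicate (m - 1) x) = real m *\<^sub>R al (h # us @ replicate m x)"
  proof (cases m)
    case (Suc l)
    have "al (h # x # us @ replicate l x) = al (h # us @ replicate (Suc l) x)"
      by (rule al_sym) simp
    then show ?thesis using Suc by simp
  qed simp
  then have eq: "al (us @ replicate (Suc m) (x + h)) - al (us @ replicate (Suc m) x) - real (Suc m) *\<^sub>R al (h # us @ replicate m x)
     = P (x # us) + Q (h # us)"
    by (simp add: P_def Q_def al_replicate_Suc al_Cons_add scaleR_left_distrib del: replicate_Suc) metis
  have cb: "coef_bound (x # us) \<le> \<kappa> / r * coef_bound us"
    unfolding coef_bound_Cons using assms r_pos coef_bound_nonneg
    by (intro mult_right_mono divide_right_mono) auto
  have A: "norm (P (x # us)) * \<kappa>\<^sup>2 \<le> (real m)\<^sup>2 * ((norm h)\<^sup>2 * (\<kappa> / r) ^ m * coef_bound (x # us))"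
    unfolding P_def by (rule Suc.IH)
  also have "\<dots> \<le> (real m)\<^sup>2 * ((norm h)\<^sup>2 * (\<kappa> / r) ^ m * (\<kappa> / r * coef_bound us))"
    using \<kappa> r_pos by (intro mult_left_mono cb) auto
  finally have A: "norm (P (x # us)) * \<kappa>\<^sup>2 \<le> (real m)\<^sup>2 * ((norm h)\<^sup>2 * (\<kappa> / r) ^ Suc m * coef_bound us)"
    by (simp add: mult_ac)
  have "norm (Q (h # us)) * \<kappa> * \<kappa> \<le> real m * (norm h * (\<kappa> / r) ^ m * coef_bound (h # us)) * \<kappa>"
    unfolding Q_def using \<kappa> by (intro mult_right_mono al_diff_bound assms) auto
  also have "\<dots> = real m * ((norm h)\<^sup>2 * (\<kappa> / r) ^ Suc m * coef_bound us)"
    by (simp add: coef_bound_Cons power2_eq_square field_simps)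
  finally have B: "norm (Q (h # us)) * \<kappa>\<^sup>2 \<le> real m * ((norm h)\<^sup>2 * (\<kappa> / r) ^ Suc m * coef_bound us)"
    by (simp add: power2_eq_square mult_ac)
  have "norm (P (x # us) + Q (h # us)) * \<kappa>\<^sup>2 \<le> norm (P (x # us)) * \<kappa>\<^sup>2 + norm (Q (h # us)) * \<kappa>\<^sup>2"
    unfolding distrib_right[symmetric] by (intro mult_right_mono norm_triangle_ineq) auto
  also have "\<dots> \<le> ((real m)\<^sup>2 + real m) * ((norm h)\<^sup>2 * (\<kappa> / r) ^ Suc m * coef_bound us)"
    using A B by (simp only: distrib_right)
  also have "\<dots> \<le> (real (Suc m))\<^sup>2 * ((norm h)\<^sup>2 * (\<kappa> / r) ^ Suc m * coef_bound us)"
    using \<kappa> r_pos coef_bound_nonneg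
    by (intro mult_right_mono mult_nonneg_nonneg) (auto simp: power2_eq_square algebra_simps)
  finally show ?case using eq by simp
qed simp

text \<open>The termwise bound has a factor \<open>(real m)\<^sup>2\<close>, which
  \<open>admissible_weight_mult_nat\<close> absorbs into the weight.\<close>

lemma ser_taylor:
  assumes w: "admissible_weight w"
  obtains K where "\<And>vs x h. norm x \<le> \<kappa> \<Longrightarrow> norm (x + h) \<le> \<kappa> \<Longrightarrow>
    norm (ser w vs (x + h) - ser w vs x - ser (diffs w) (h # vs) x) \<le> K * coef_bound vs * (norm h)\<^sup>2"
proof
  fix vs :: "'b list" and x h :: 'b assume x: "norm x \<le> \<kappa>" "norm (x + h) \<le> \<kappa>"
  let ?W = "\<lambda>m. real m * (real m * w m)"
  have W: "admissible_weight ?W" by (intro admissible_weight_mult_nat w)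
  define d where "d m = al (vs @ replicate m (x + h)) - al (vs @ replicate m x) - real m *\<^sub>R al (h # vs @ replicate (m - 1) x)" for m
  have "(\<lambda>m. (real (Suc m) * w (Suc m)) *\<^sub>R al (h # vs @ replicate m x)) sums ser (diffs w) (h # vs) x"
    using summable_sums[OF summable_ser[OF admissible_weight_diffs[OF w] x(1), of "h # vs"]]
    by (simp add: diffs_def ser_def)
  \<comment> \<open>Shifts the series with weight \<open>diffs w\<close> back by one index; the term
    added at \<open>m = 0\<close> has the factor \<open>0\<close>.\<close>
  from sums_Suc[of "\<lambda>m. (real m * w m) *\<^sub>R al (h # vs @ replicate (m - 1) x)", simplified, OF this[simplified]]
  have 1: "(\<lambda>m. (real m * w m) *\<^sub>R al (h # vs @ replicate (m - 1) x)) sums ser (diffs w) (h # vs) x" by simp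
  have "(\<lambda>m. w m *\<^sub>R al (vs @ replicate m (x + h)) - w m *\<^sub>R al (vs @ replicate m x) -
      (real m * w m) *\<^sub>R al (h # vs @ replicate (m - 1) x))
     sums (ser w vs (x + h) - ser w vs x - ser (diffs w) (h # vs) x)"
    unfolding ser_def[of w] by (intro sums_diff summable_sums[OF summable_ser[OF w]] x 1)
  moreover have "w m *\<^sub>R al (vs @ replicate m (x + h)) - w m *\<^sub>R al (vs @ replicate m x) -
      (real m * w m) *\<^sub>R al (h # vs @ replicate (m - 1) x) = w m *\<^sub>R d m" for m
    by (simp add: d_def scaleR_diff_right mult.commute)
  ultimately have "(\<lambda>m. w m *\<^sub>R d m) sums (ser w vs (x + h) - ser w vs x - ser (diffs w) (h # vs) x)"
    by simp
  then have eq: "ser w vs (x + h) - ser w vs x - ser (diffs w) (h # vs) x = (\<Sum>m. w m *\<^sub>R d m)"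
    by (simp add: sums_iff)
  let ?c = "inverse (\<kappa>\<^sup>2) * (norm h)\<^sup>2 * coef_bound vs"
  have "norm (\<Sum>m. w m *\<^sub>R d m) \<le> (\<Sum>m. ?W m * (\<kappa> / r) ^ m * ?c)"
  proof (rule norm_suminf_le)
    fix m
    have "norm (d m) \<le> inverse (\<kappa>\<^sup>2) * ((real m)\<^sup>2 * ((norm h)\<^sup>2 * (\<kappa> / r) ^ m * coef_bound vs))"
      using al_taylor_bound[OF x, of vs m] \<kappa> by (simp add: d_def field_simps)
    from mult_left_mono[OF this, of "w m"] w
    show "norm (w m *\<^sub>R d m) \<le> ?W m * (\<kappa> / r) ^ m * ?c"
      by (simp add: admissible_weight_def power2_eq_square mult_ac)
  qed (intro summable_mult2 summable_weight W)
  also have "\<dots> = (\<Sum>m. ?W m * (\<kappa> / r) ^ m) * ?c"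
    by (intro suminf_mult2[symmetric] summable_weight W)
  finally show "norm (ser w vs (x + h) - ser w vs x - ser (diffs w) (h # vs) x)
     \<le> ((\<Sum>m. ?W m * (\<kappa> / r) ^ m) * inverse (\<kappa>\<^sup>2)) * coef_bound vs * (norm h)\<^sup>2"
    unfolding eq by (simp add: mult_ac)
qed

lemma ser_has_derivative:
  assumes w: "admissible_weight w"
    and x: "(x has_derivative (\<lambda>t. sB t dx)) (at 0)" "norm (x 0) \<le> \<kappa>"
      "eventually (\<lambda>t. norm (x t) \<le> \<kappa>) (at 0)"
  shows "((\<lambda>t. ser w vs (x t)) has_derivative (\<lambda>t. sC t (ser (diffs w) (dx # vs) (x 0)))) (at 0)"
proof -
  obtain K where K: "\<And>vs x h. norm x \<le> \<kappa> \<Longrightarrow> norm (x + h) \<le> \<kappa> \<Longrightarrow>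
    norm (ser w vs (x + h) - ser w vs x - ser (diffs w) (h # vs) x) \<le> K * coef_bound vs * (norm h)\<^sup>2"
    using ser_taylor[OF w] by blast
  note dw = admissible_weight_diffs[OF w]
  show ?thesis
  proof (rule taylor_has_derivative[where f = "ser w vs" and VZ=UNIV and A="cball 0 \<kappa>"
        and f' = "\<lambda>H. ser (diffs w) (H # vs) (x 0)"])
    show "norm (ser w vs (x 0 + H) - ser w vs (x 0) - ser (diffs w) (H # vs) (x 0)) \<le> K * coef_bound vs * (norm H)\<^sup>2"
      if "x 0 + H \<in> cball 0 \<kappa>" for H using K x that by simp
    show "ser (diffs w) ((a + b) # vs) (x 0) = ser (diffs w) (a # vs) (x 0) + ser (diffs w) (b # vs) (x 0)" for a b
      using ser_add[OF dw x(2), of 0 "a # vs" a b] by simp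
    show "ser (diffs w) ((sB c a) # vs) (x 0) = sC c (ser (diffs w) (a # vs) (x 0))" for a c
      using ser_scale[OF dw x(2), of 0 "a # vs" c a] by simp
    show "norm (ser (diffs w) (a # vs) (x 0)) \<le> ((\<Sum>m. diffs w m * (\<kappa> / r) ^ m) * coef_bound vs / r) * norm a" for a
      using ser_bound[OF dw x(2), of "a # vs"] by (simp add: coef_bound_Cons mult_ac)
  qed (use x in auto)
qed

lemma ser_multi_has_derivative:
  assumes w: "admissible_weight w"
    and x: "(x has_derivative (\<lambda>t. sB t dx)) (at 0)" "norm (x 0) \<le> \<kappa>"
      "eventually (\<lambda>t. norm (x t) \<le> \<kappa>) (at 0)"
    and us: "\<And>t. length (us t) = n" "length du = n"
    and uder: "\<And>i. i < n \<Longrightarrow> ((\<lambda>t. us t ! i) has_derivative (\<lambda>t. sB t (du ! i))) (at 0)"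
  shows "((\<lambda>t. ser w (us t) (x t)) has_derivative
     (\<lambda>t. sC t (ser (diffs w) (dx # us 0) (x 0) + (\<Sum>i\<leftarrow>[0..<n]. ser w ((us 0)[i := du ! i]) (x 0))))) (at 0)"
proof (rule multilinear_has_derivative[where Op = "ser w" and VZ=UNIV and A="cball 0 \<kappa>"
      and Op' = "\<lambda>vs. ser (diffs w) (dx # vs) (x 0)"])
  show "norm (ser w vs y) \<le> ((\<Sum>m. w m * (\<kappa> / r) ^ m) * (M / r ^ n)) * prod_list (map norm vs)"
    if "length vs = n" "y \<in> cball 0 \<kappa>" for vs y
    using ser_bound[OF w, of y vs] that by (simp add: coef_bound_def mult_ac)
qed (use assms in \<open>auto intro!: ser_add ser_scale ser_has_derivative\<close>)

text \<open>A term consists of a weight and of tower entries filling the fixed arguments. A new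
  direction hits either the base point, which turns the weight into its \<open>diffs\<close> and
  adds an argument, or one of the arguments already present.\<close>

lemma bsmooth_ser:
  fixes sE :: "'k \<Rightarrow> 'e::banach \<Rightarrow> 'e"
  assumes V: "tower_spaces sE sB V" and w0: "admissible_weight w0"
    and f: "bsmooth sE sB V W f" "\<And>x. x \<in> W \<Longrightarrow> norm (f x) \<le> \<kappa>"
    and fs: "\<And>f'. f' \<in> set fs \<Longrightarrow> bsmooth sE sB V W f'"
  shows "bsmooth sE sC V W (\<lambda>x. ser w0 (map (\<lambda>f'. f' x) fs) (f x))"
proof -
  interpret B: tower_spaces sE sB V by (rule V)
  interpret C: tower_spaces sE sC V
    by (intro tower_spaces.intro tower_spaces_axioms.intro B.E.banach_over_axioms
        F.banach_over_axioms B.subspace_V)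
  obtain Df where Df: "btower sE sB V W Df" "\<And>x. x \<in> W \<Longrightarrow> Df x [] = f x"
    using f(1) unfolding bsmooth_def by blast
  have "\<forall>f'. \<exists>D. f' \<in> set fs \<longrightarrow> btower sE sB V W D \<and> (\<forall>x\<in>W. D x [] = f' x)"
    using fs unfolding bsmooth_def by blast
  then obtain DD where DD: "\<And>f'. f' \<in> set fs \<Longrightarrow> btower sE sB V W (DD f')"
    "\<And>f' x. f' \<in> set fs \<Longrightarrow> x \<in> W \<Longrightarrow> DD f' x [] = f' x" by metis
  define sval where "sval x us p = fst p x (map ((!) us) (snd p))"
    for x us and p :: "('e \<Rightarrow> 'e list \<Rightarrow> 'b) \<times> nat list"
  define val where "val s x us = ser (fst s) (map (sval x us) (snd s)) (Df x [])"
    for s :: "(nat \<Rightarrow> real) \<times> (('e \<Rightarrow> 'e list \<Rightarrow> 'b) \<times> nat list) list" and x us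
  define der where "der n s = (diffs (fst s), (Df, [n]) # snd s) #
      map (\<lambda>i. (fst s, (snd s)[i := (fst (snd s ! i), n # snd (snd s ! i))])) [0..<length (snd s)]"
    for n :: nat and s :: "(nat \<Rightarrow> real) \<times> (('e \<Rightarrow> 'e list \<Rightarrow> 'b) \<times> nat list) list"
  define good where "good n s \<longleftrightarrow> admissible_weight (fst s) \<and>
      (\<forall>p\<in>set (snd s). btower sE sB V W (fst p) \<and> set (snd p) \<subseteq> {..<n})"
    for n and s :: "(nat \<Rightarrow> real) \<times> (('e \<Rightarrow> 'e list \<Rightarrow> 'b) \<times> nat list) list"
  have "bsmooth sE sC V W (\<lambda>x. val (w0, map (\<lambda>f'. (DD f', [])) fs) x [])"
  proof (rule C.bsmooth_terms[where good=good and der=der])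
    show "openin (top_of_set V) W" by (rule B.btower_openin[OF Df(1)])
    show "good 0 (w0, map (\<lambda>f'. (DD f', [])) fs)" using w0 DD by (auto simp: good_def)
  next
    fix n s s' assume s: "good n s" "s' \<in> set (der n s)"
    have *: "set (snd p) \<subseteq> {..<Suc n}" if "p \<in> set (snd s)" for p
      using s(1) that by (force simp: good_def less_Suc_eq)
    from s(2) consider "s' = (diffs (fst s), (Df, [n]) # snd s)"
      | i where "i < length (snd s)" "s' = (fst s, (snd s)[i := (fst (snd s ! i), n # snd (snd s ! i))])"
      by (auto simp: der_def)
    then show "good (Suc n) s'"
    proof cases
      case 1
      then show ?thesis using s(1) Df * by (auto simp: good_def intro: admissible_weight_diffs)
    next
      case 2
      have "p \<in> set (snd s) \<or> p = (fst (snd s ! i), n # snd (snd s ! i))" if "p \<in> set (snd s')" for p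
        using that 2 set_update_subset_insert[of "snd s" i] by auto
      moreover have "snd s ! i \<in> set (snd s)" using 2 by simp
      ultimately show ?thesis using s(1) * 2 unfolding good_def by fastforce
    qed
  next
    fix n s x us h assume s: "good n s" "x \<in> W" "length us = n" "set us \<subseteq> V" "h \<in> V"
    have w: "admissible_weight (fst s)" using s by (simp add: good_def)
    let ?us = "\<lambda>t. map (sval (x + sE t h) us) (snd s)"
    let ?du = "map (\<lambda>p. fst p x (map ((!) (us @ [h])) (n # snd p))) (snd s)"
    have ev: "eventually (\<lambda>t. x + sE t h \<in> W) (at 0)"
      by (rule B.eventually_line[OF B.btower_openin[OF Df(1)]]) (use s in auto)
    have deriv: "((\<lambda>t. ser (fst s) (?us t) (Df (x + sE t h) [])) has_derivative
       (\<lambda>t. sC t (ser (diffs (fst s)) (Df x [h] # ?us 0) (Df (x + sE 0 h) []) +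
         (\<Sum>i\<leftarrow>[0..<length (snd s)]. ser (fst s) ((?us 0)[i := ?du ! i]) (Df (x + sE 0 h) []))))) (at 0)"
    proof (rule ser_multi_has_derivative[OF w])
      show "((\<lambda>t. Df (x + sE t h) []) has_derivative (\<lambda>t. sB t (Df x [h]))) (at 0)"
        by (rule B.btower_deriv[OF Df(1)]) (use s in auto)
      show "norm (Df (x + sE 0 h) []) \<le> \<kappa>" using Df f s by simp
      show "\<forall>\<^sub>F t in at 0. norm (Df (x + sE t h) []) \<le> \<kappa>"
        using ev by eventually_elim (simp add: Df f)
      show "((\<lambda>t. ?us t ! i) has_derivative (\<lambda>t. sB t (?du ! i))) (at 0)" if "i < length (snd s)" for i
      proof -
        have "snd s ! i \<in> set (snd s)" using that by simp
        then show ?thesis using that s unfolding good_def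
          by (auto simp: sval_def simp del: list.map intro!: B.btower_deriv_indices)
      qed
    qed simp_all
    have eq: "sval x (us @ [h]) p = sval x us p" if "p \<in> set (snd s)" for p
    proof -
      have "map ((!) (us @ [h])) (snd p) = map ((!) us) (snd p)"
        using that s by (auto simp: good_def nth_append)
      then show ?thesis by (simp only: sval_def)
    qed
    have upd: "map (sval x (us @ [h])) ((snd s)[i := (fst (snd s ! i), n # snd (snd s ! i))])
       = (map (sval x us) (snd s))[i := ?du ! i]" if "i < length (snd s)" for i
      using that eq by (intro nth_equalityI) (auto simp: nth_list_update sval_def)
    have "(\<Sum>i\<leftarrow>[0..<length (snd s)]. ser (fst s)
        (map (sval x (us @ [h])) ((snd s)[i := (fst (snd s ! i), n # snd (snd s ! i))])) (Df x [])) =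
      (\<Sum>i\<leftarrow>[0..<length (snd s)]. ser (fst s) ((map (sval x us) (snd s))[i := ?du ! i]) (Df x []))"
      by (intro arg_cong[of _ _ sum_list] map_cong refl) (simp only: upd set_upt atLeastLessThan_iff)
    moreover have "map (sval x (us @ [h])) (snd s) = map (sval x us) (snd s)"
      using eq by simp
    moreover have "sval x (us @ [h]) (Df, [n]) = Df x [h]" using s by (simp add: sval_def nth_append)
    moreover note deriv
    ultimately show "((\<lambda>t. val s (x + sE t h) us) has_derivative
        (\<lambda>t. sC t (\<Sum>s'\<leftarrow>der n s. val s' x (us @ [h])))) (at 0)"
      by (simp add: val_def der_def o_def cong: map_cong)
  next
    fix n s assume s: "good n s"
    have w: "admissible_weight (fst s)" using s by (simp add: good_def)
    have "\<exists>C. \<forall>x\<in>W. \<forall>us. length us = n \<and> set us \<subseteq> V \<and> (\<forall>v\<in>set us. norm v \<le> 1) \<longrightarrow>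
      prod_list (map (\<lambda>p. norm (sval x us p)) ps) \<le> C" if "set ps \<subseteq> set (snd s)" for ps
      using that
    proof (induction ps)
      case Nil then show ?case by auto
    next
      case (Cons p ps)
      obtain C where C: "\<forall>x\<in>W. \<forall>us. length us = n \<and> set us \<subseteq> V \<and> (\<forall>v\<in>set us. norm v \<le> 1) \<longrightarrow>
        prod_list (map (\<lambda>p. norm (sval x us p)) ps) \<le> C" using Cons by auto
      obtain C' where C': "C' \<ge> 0" "\<And>x us. x \<in> W \<Longrightarrow> length us = n \<Longrightarrow> set us \<subseteq> V \<Longrightarrow> (\<forall>v\<in>set us. norm v \<le> 1) \<Longrightarrow>
        norm (sval x us p) \<le> C'"
        using B.btower_bound_indices[of W "fst p" "snd p" n] s Cons.prems
        unfolding good_def sval_def by (metis list.set_intros(1) subsetD)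
      show ?case
        using C C' by (intro exI[of _ "C' * C"]) (auto intro!: mult_mono prod_list_nonneg)
    qed
    from this[of "snd s"] obtain C where C: "\<And>x us. x \<in> W \<Longrightarrow> length us = n \<Longrightarrow> set us \<subseteq> V \<Longrightarrow> \<forall>v\<in>set us. norm v \<le> 1 \<Longrightarrow>
        prod_list (map (\<lambda>p. norm (sval x us p)) (snd s)) \<le> C" by auto
    let ?S = "\<Sum>m. fst s m * (\<kappa> / r) ^ m"
    have S: "?S \<ge> 0" using w \<kappa> r_pos by (intro suminf_nonneg summable_weight) (auto simp: admissible_weight_def)
    show "\<exists>C. \<forall>x\<in>W. \<forall>us. length us = n \<and> set us \<subseteq> V \<and> (\<forall>v\<in>set us. norm v \<le> 1) \<longrightarrow> norm (val s x us) \<le> C"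
    proof (intro exI[of _ "?S * (M / r ^ length (snd s) * C)"] ballI allI impI)
      fix x us assume x: "x \<in> W" and us: "length us = n \<and> set us \<subseteq> V \<and> (\<forall>v\<in>set us. norm v \<le> 1)"
      have "norm (val s x us) \<le> ?S * coef_bound (map (sval x us) (snd s))"
        unfolding val_def using f(2)[OF x] Df(2)[OF x] by (intro ser_bound w) simp
      also have "\<dots> \<le> ?S * (M / r ^ length (snd s) * C)"
        unfolding coef_bound_def using C[OF x, of us] us S r_pos M_nonneg
        by (intro mult_left_mono) (auto simp: o_def intro!: mult_left_mono divide_right_mono)
      finally show "norm (val s x us) \<le> ?S * (M / r ^ length (snd s) * C)" .
    qed
  qed
  then show ?thesis
    by (rule C.bsmooth_transform) (auto simp: val_def sval_def Df DD o_def cong: map_cong)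
qed

end

end

section \<open>Taylor expansion along polynomial curves\<close>

lemma diffs_shift: "diffs w (Suc m) = diffs (\<lambda>m. w (Suc m)) m + w (Suc (Suc m))" for w :: "nat \<Rightarrow> real"
  by (simp add: diffs_def algebra_simps)

context power_series
begin

definition pcurve :: "nat \<Rightarrow> 'k \<Rightarrow> (nat \<Rightarrow> 'b) \<Rightarrow> 'b" where
  "pcurve n e z = (\<Sum>i=1..n. sB (e ^ i) (z i))"

text \<open>
  \<open>gam w q vs z\<close> is the coefficient of \<open>\<epsilon>\<^sup>q\<close> in \<open>ser w vs (\<Sum>i. \<epsilon>\<^sup>i z\<^sub>i)\<close>, and \<open>rmd n \<epsilon> z w q vs\<close> is the
  remainder after \<open>q\<close> coefficients, divided by \<open>\<epsilon>\<^sup>q\<close>. Both arise by splitting off one argument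
  \<open>\<Sum>i. \<epsilon>\<^sup>i z\<^sub>i\<close> of the series at a time; the truncated subtractions in \<open>rmd\<close> cover the summands
  \<open>\<epsilon>\<^sup>i z\<^sub>i\<close> with \<open>i > q\<close>, too.
\<close>

fun gam :: "(nat \<Rightarrow> real) \<Rightarrow> nat \<Rightarrow> 'b list \<Rightarrow> (nat \<Rightarrow> 'b) \<Rightarrow> 'c" where
  "gam w 0 vs z = w 0 *\<^sub>R al vs"
| "gam w (Suc q) vs z = (\<Sum>i=1..Suc q. gam (\<lambda>m. w (Suc m)) (Suc q - i) (z i # vs) z)"

fun rmd :: "nat \<Rightarrow> 'k \<Rightarrow> (nat \<Rightarrow> 'b) \<Rightarrow> (nat \<Rightarrow> real) \<Rightarrow> nat \<Rightarrow> 'b list \<Rightarrow> 'c" where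
  "rmd n e z w 0 vs = ser w vs (pcurve n e z)"
| "rmd n e z w (Suc q) vs =
     (\<Sum>i=1..n. sC (e ^ (i - Suc q)) (if i = 0 then 0 else rmd n e z (\<lambda>m. w (Suc m)) (Suc q - i) (z i # vs)))"

declare gam.simps(2) [simp del] rmd.simps(2) [simp del]

lemma gam_pos: "q > 0 \<Longrightarrow> gam w q vs z = (\<Sum>i=1..q. gam (\<lambda>m. w (Suc m)) (q - i) (z i # vs) z)"
  by (cases q) (simp_all add: gam.simps(2))

lemma rmd_pos: "q > 0 \<Longrightarrow> rmd n e z w q vs =
    (\<Sum>i=1..n. sC (e ^ (i - q)) (rmd n e z (\<lambda>m. w (Suc m)) (q - i) (z i # vs)))"
  by (cases q) (auto simp: rmd.simps(2) intro!: sum.cong)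

lemma gam_cong: "(\<And>i. 1 \<le> i \<Longrightarrow> i \<le> q \<Longrightarrow> z i = z' i) \<Longrightarrow> gam w q vs z = gam w q vs z'"
proof (induction q arbitrary: w vs rule: less_induct)
  case (less q)
  show ?case
  proof (cases "q = 0")
    case False
    then have "q > 0" by simp
    moreover have "gam (\<lambda>m. w (Suc m)) (q - i) (z i # vs) z = gam (\<lambda>m. w (Suc m)) (q - i) (z' i # vs) z'"
      if "i \<in> {1..q}" for i
      using that less.prems less.IH[of "q - i" "\<lambda>m. w (Suc m)" "z i # vs"] by simp
    ultimately show ?thesis by (simp add: gam_pos)
  qed simp
qed

lemma gam_mset: "mset vs = mset us \<Longrightarrow> gam w q vs z = gam w q us z"
proof (induction q arbitrary: w vs us rule: less_induct)
  case (less q)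
  show ?case
  proof (cases "q = 0")
    case True then show ?thesis using al_sym[OF less.prems] by simp
  next
    case False
    then have "q > 0" by simp
    moreover have "gam (\<lambda>m. w (Suc m)) (q - i) (z i # vs) z = gam (\<lambda>m. w (Suc m)) (q - i) (z i # us) z"
      if "i \<in> {1..q}" for i
      using that less.prems by (intro less.IH) auto
    ultimately show ?thesis by (simp add: gam_pos)
  qed
qed

lemma gam_add_weight: "gam (\<lambda>m. w m + w' m) q vs z = gam w q vs z + gam w' q vs z"
proof (induction q arbitrary: w w' vs rule: less_induct)
  case (less q)
  show ?case
    by (cases "q = 0") (auto simp: gam_pos scaleR_left_distrib less.IH sum.distrib[symmetric] intro!: sum.cong)
qed

lemma gam_Cons_add: "gam w q ((a + b) # vs) z = gam w q (a # vs) z + gam w q (b # vs) z"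
proof (induction q arbitrary: w vs rule: less_induct)
  case (less q)
  show ?case
  proof (cases "q = 0")
    case True then show ?thesis by (simp add: al_Cons_add scaleR_add_right)
  next
    case False
    have swap: "gam w' p (z i # c # vs) z = gam w' p (c # z i # vs) z" for w' p c i
      by (rule gam_mset) simp
    show ?thesis
      using False by (simp add: gam_pos swap less.IH sum.distrib)
  qed
qed

lemma gam_Cons_scale: "gam w q (sB c a # vs) z = sC c (gam w q (a # vs) z)"
proof (induction q arbitrary: w vs rule: less_induct)
  case (less q)
  show ?case
  proof (cases "q = 0")
    case True then show ?thesis using al_scale[of 0 "a # vs" c a] by (simp add: F.scale_scaleR)
  next
    case False
    have swap: "gam w' p (z i # c # vs) z = gam w' p (c # z i # vs) z" for w' p c i
      by (rule gam_mset) simp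
    show ?thesis
      using False by (simp add: gam_pos swap less.IH F.scale_sum_right)
  qed
qed

lemma gam_bound:
  "\<exists>C\<ge>0. \<forall>vs. length vs = m \<longrightarrow> norm (gam w q vs z) \<le> C * prod_list (map norm vs)"
proof (induction q arbitrary: w m rule: less_induct)
  case (less q)
  show ?case
  proof (cases "q = 0")
    case True
    have "norm (w 0 *\<^sub>R al vs) \<le> \<bar>w 0\<bar> * (M / r ^ length vs) * prod_list (map norm vs)" for vs
      using mult_left_mono[OF al_bound[of vs], of "\<bar>w 0\<bar>"] by (simp add: mult_ac)
    then show ?thesis using True r_pos M_nonneg
      by (intro exI[of _ "\<bar>w 0\<bar> * (M / r ^ m)"]) auto
  next
    case False
    have "\<exists>C\<ge>0. \<forall>vs. length vs = Suc m \<longrightarrow> norm (gam (\<lambda>m. w (Suc m)) (q - i) vs z) \<le> C * prod_list (map norm vs)"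
      if "i \<in> {1..q}" for i
      using that by (intro less.IH) auto
    then obtain C where C: "\<And>i. i \<in> {1..q} \<Longrightarrow> C i \<ge> 0"
      "\<And>i vs. i \<in> {1..q} \<Longrightarrow> length vs = Suc m \<Longrightarrow> norm (gam (\<lambda>m. w (Suc m)) (q - i) vs z) \<le> C i * prod_list (map norm vs)"
      by metis
    show ?thesis
    proof (intro exI[of _ "\<Sum>i=1..q. C i * norm (z i)"] conjI allI impI)
      show "0 \<le> (\<Sum>i=1..q. C i * norm (z i))" by (intro sum_nonneg mult_nonneg_nonneg C) auto
      fix vs :: "'b list" assume "length vs = m"
      then have "norm (gam w q vs z) \<le> (\<Sum>i=1..q. C i * prod_list (map norm (z i # vs)))"
        using False unfolding gam_pos[OF False[unfolded neq0_conv]]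
        by (intro sum_norm_le C) auto
      also have "\<dots> = (\<Sum>i=1..q. C i * norm (z i)) * prod_list (map norm vs)"
        by (simp add: sum_distrib_left mult_ac)
      finally show "norm (gam w q vs z) \<le> (\<Sum>i=1..q. C i * norm (z i)) * prod_list (map norm vs)" .
    qed
  qed
qed

lemma bounded_klinear_gam: "bounded_klinear sB sC (\<lambda>v. gam w q [v] z)"
proof -
  obtain C where C: "\<And>vs. length vs = 1 \<Longrightarrow> norm (gam w q vs z) \<le> C * prod_list (map norm vs)"
    using gam_bound[of 1 w q z] by blast
  have "bounded_linear (\<lambda>v. gam w q [v] z)"
  proof (rule bounded_linear_intro)
    show "gam w q [x + y] z = gam w q [x] z + gam w q [y] z" for x y by (rule gam_Cons_add)
    show "gam w q [c *\<^sub>R x] z = c *\<^sub>R gam w q [x] z" for c x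
      using gam_Cons_scale[of w q "of_real c" x "[]" z] by (simp add: F.scale_of_real Z.scale_of_real)
    show "norm (gam w q [x] z) \<le> norm x * C" for x using C[of "[x]"] by (simp add: mult.commute)
  qed
  then show ?thesis by (simp add: bounded_klinear_def gam_Cons_scale)
qed

text \<open>\<open>diffs w\<close> counts the possible positions of the distinguished argument
  \<open>d\<close>: either \<open>d\<close> is the next argument to be split off, or an ordinary
  coefficient is and \<open>d\<close> remains to be placed.\<close>

lemma gam_diffs_Cons:
  "gam (diffs w) p (d # vs) z = gam (\<lambda>m. w (Suc m)) p (d # vs) z +
     (\<Sum>i=1..p. gam (diffs (\<lambda>m. w (Suc m))) (p - i) (d # z i # vs) z)"
proof (cases "p = 0")
  case True then show ?thesis by (simp add: diffs_def)
next
  case False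
  have swap: "gam w' p (x # d # vs) z = gam w' p (d # x # vs) z" for w' p x
    by (rule gam_mset) simp
  show ?thesis
    using False by (simp add: gam_pos diffs_shift gam_add_weight sum.distrib swap)
qed

text \<open>The change is exactly linear, not merely to first order: a product of two changes would
  have order beyond \<open>2 * k + 1\<close>. The linear part consists of coefficients of the
  derivative of the series.\<close>

lemma gam_shift:
  assumes "\<And>i. 1 \<le> i \<Longrightarrow> i \<le> k \<Longrightarrow> z' i = z i" and "q \<le> 2 * k + 1"
  shows "gam w q vs z' = gam w q vs z + (\<Sum>l=k+1..q. gam (diffs w) (q - l) ((z' l - z l) # vs) z)"
  using assms(2)
proof (induction q arbitrary: w vs rule: less_induct)
  case (less q)
  show ?case
  proof (cases "q = 0")
    case False
    let ?w = "\<lambda>m. w (Suc m)"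
    define d where "d l = z' l - z l" for l
    define f where "f i l = gam (diffs ?w) (q - i - l) (d l # z i # vs) z" for i l
    have step: "gam ?w (q - i) (z' i # vs) z' = gam ?w (q - i) (z i # vs) z
        + (if i > k then gam ?w (q - i) (d i # vs) z else 0) + (\<Sum>l=k+1..q-i. f i l)" if i: "i \<in> {1..q}" for i
    proof (cases "i \<le> k")
      case True
      then show ?thesis using i assms(1)[of i] less.IH[of "q - i" ?w "z i # vs"] less.prems
        by (simp add: f_def d_def)
    next
      case False
      \<comment> \<open>Here \<open>q - i \<le> k\<close>, so the inner coefficient sees none of the
        changed entries.\<close>
      then have "gam ?w (q - i) (z' i # vs) z' = gam ?w (q - i) (z' i # vs) z"
        using less.prems assms(1) by (intro gam_cong) auto
      also have "\<dots> = gam ?w (q - i) (z i # vs) z + gam ?w (q - i) (d i # vs) z"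
        using gam_Cons_add[of ?w "q - i" "z i" "d i" vs z] by (simp add: d_def)
      finally show ?thesis using False less.prems i by simp
    qed
    have "gam w q vs z' = (\<Sum>i=1..q. gam ?w (q - i) (z i # vs) z
        + (if i > k then gam ?w (q - i) (d i # vs) z else 0) + (\<Sum>l=k+1..q-i. f i l))"
      using False step by (simp add: gam_pos)
    also have "\<dots> = gam w q vs z + (\<Sum>i=1..q. if i > k then gam ?w (q - i) (d i # vs) z else 0)
        + (\<Sum>i=1..q. \<Sum>l=k+1..q-i. f i l)"
      using False by (simp add: gam_pos sum.distrib)
    also have "(\<Sum>i=1..q. if i > k then gam ?w (q - i) (d i # vs) z else 0) = (\<Sum>l=k+1..q. gam ?w (q - l) (d l # vs) z)"
      by (rule sum.mono_neutral_cong_right) auto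
    also have "(\<Sum>i=1..q. \<Sum>l=k+1..q-i. f i l) = (\<Sum>(i,l)\<in>(SIGMA i:{1..q}. {k+1..q-i}). f i l)"
      by (rule sum.Sigma) auto
    also have "\<dots> = (\<Sum>(l,i)\<in>(SIGMA l:{k+1..q}. {1..q-l}). f i l)"
      by (rule sum.reindex_bij_witness[of _ prod.swap prod.swap]) auto
    also have "\<dots> = (\<Sum>l=k+1..q. \<Sum>i=1..q-l. f i l)"
      by (rule sum.Sigma[symmetric]) auto
    also have "(\<Sum>l=k+1..q. \<Sum>i=1..q-l. f i l) = (\<Sum>l=k+1..q. \<Sum>i=1..q-l. gam (diffs ?w) (q - l - i) (d l # z i # vs) z)"
      by (intro sum.cong refl) (simp add: f_def add.commute)
    finally have "gam w q vs z' = gam w q vs z + ((\<Sum>l=k+1..q. gam ?w (q - l) (d l # vs) z) +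
        (\<Sum>l=k+1..q. \<Sum>i=1..q-l. gam (diffs ?w) (q - l - i) (d l # z i # vs) z))"
      by (simp only: add.assoc)
    then show ?thesis
      unfolding sum.distrib[symmetric] gam_diffs_Cons[of w, symmetric] d_def .
  qed simp
qed

context
  fixes \<kappa> :: real
  assumes \<kappa>: "0 < \<kappa>" "\<kappa> < r"
begin

lemma ser_pcurve_Cons:
  assumes w: "admissible_weight w" and c: "norm x \<le> \<kappa>"
  shows "ser w (pcurve n e z # vs) x = (\<Sum>i=1..n. sC (e ^ i) (ser w (z i # vs) x))"
proof -
  have add: "ser w ((a + b) # vs) x = ser w (a # vs) x + ser w (b # vs) x" for a b
    using ser_add[OF \<kappa> w c, of 0 "a # vs" a b] by simp
  have scl: "ser w (sB t a # vs) x = sC t (ser w (a # vs) x)" for a t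
    using ser_scale[OF \<kappa> w c, of 0 "a # vs" t a] by simp
  have zero: "ser w (0 # vs) x = 0" using scl[of 0 0] by simp
  have "ser w ((\<Sum>i\<in>I. sB (e ^ i) (z i)) # vs) x = (\<Sum>i\<in>I. sC (e ^ i) (ser w (z i # vs) x))" if "finite I" for I
    using that by (induction I) (auto simp: add scl zero)
  then show ?thesis by (simp add: pcurve_def)
qed

text \<open>\<open>ser_split\<close> splits off one argument, the sum over the curve is expanded,
  and the summand with index \<open>i < q\<close> is expanded further up to \<open>q - i\<close>
  coefficients. Summands with \<open>i \<ge> q\<close> enter the remainder as a whole.\<close>

lemma ser_expansion:
  assumes c: "norm (pcurve n e z) \<le> \<kappa>" and z: "\<And>i. i > n \<Longrightarrow> z i = 0"
  shows "admissible_weight w \<Longrightarrow> ser w vs (pcurve n e z) =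
     (\<Sum>j<q. sC (e ^ j) (gam w j vs z)) + sC (e ^ q) (rmd n e z w q vs)"
proof (induction q arbitrary: w vs rule: less_induct)
  case (less q)
  show ?case
  proof (cases "q = 0")
    case False
    let ?w = "\<lambda>m. w (Suc m)" and ?c = "pcurve n e z"
    have w': "admissible_weight ?w" by (rule admissible_weight_Suc) fact
    define f where "f i j = sC (e ^ j) (gam ?w (j - i) (z i # vs) z)" for i j
    have step: "sC (e ^ i) (ser ?w (z i # vs) ?c) = (\<Sum>j\<in>{i..<q}. f i j)
        + sC (e ^ q) (sC (e ^ (i - q)) (rmd n e z ?w (q - i) (z i # vs)))" if i: "i \<in> {1..n}" for i
    proof (cases "i < q")
      case True
      have "sC (e ^ i) (ser ?w (z i # vs) ?c) = (\<Sum>j<q-i. sC (e ^ (i + j)) (gam ?w j (z i # vs) z))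
          + sC (e ^ (i + (q - i))) (rmd n e z ?w (q - i) (z i # vs))"
        using i False less.IH[OF _ w', of "q - i" "z i # vs"]
        by (simp add: F.scale_right_distrib F.scale_sum_right power_add)
      also have "(\<Sum>j<q-i. sC (e ^ (i + j)) (gam ?w j (z i # vs) z)) = (\<Sum>j\<in>{i..<q}. f i j)"
        by (rule sum.reindex_bij_witness[of _ "\<lambda>j. j - i" "\<lambda>j. i + j"]) (auto simp: f_def)
      finally show ?thesis using True by simp
    next
      case False
      then show ?thesis by (simp add: power_add[symmetric])
    qed
    have "ser w vs ?c = w 0 *\<^sub>R al vs + (\<Sum>i=1..n. sC (e ^ i) (ser ?w (z i # vs) ?c))"
      using ser_split[OF \<kappa> less.prems c] ser_pcurve_Cons[OF w' c] by simp
    also have "(\<Sum>i=1..n. sC (e ^ i) (ser ?w (z i # vs) ?c)) = (\<Sum>i=1..n. \<Sum>j\<in>{i..<q}. f i j) + sC (e ^ q) (rmd n e z w q vs)"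
      using False step by (simp add: rmd_pos F.scale_sum_right sum.distrib)
    also have "(\<Sum>i=1..n. \<Sum>j\<in>{i..<q}. f i j) = (\<Sum>(i,j)\<in>(SIGMA i:{1..n}. {i..<q}). f i j)"
      by (rule sum.Sigma) auto
    also have "\<dots> = (\<Sum>(j,i)\<in>(SIGMA j:{1..<q}. {1..j} \<inter> {..n}). f i j)"
      by (rule sum.reindex_bij_witness[of _ prod.swap prod.swap]) auto
    also have "\<dots> = (\<Sum>j=1..<q. \<Sum>i\<in>{1..j} \<inter> {..n}. f i j)"
      by (rule sum.Sigma[symmetric]) auto
    also have "\<dots> = (\<Sum>j=1..<q. sC (e ^ j) (gam w j vs z))"
    proof (intro sum.cong refl)
      fix j assume j: "j \<in> {1..<q}"
      have zero: "gam ?w p (0 # vs) z = 0" for p using gam_Cons_scale[of ?w p 0 0 vs z] by simp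
      \<comment> \<open>\<open>gam\<close> sums over all indices up to \<open>j\<close>; those
        beyond \<open>n\<close> contribute nothing because \<open>z\<close> vanishes there.\<close>
      have "(\<Sum>i\<in>{1..j} \<inter> {..n}. f i j) = (\<Sum>i=1..j. f i j)"
        by (rule sum.mono_neutral_left) (auto simp: f_def z zero)
      then show "(\<Sum>i\<in>{1..j} \<inter> {..n}. f i j) = sC (e ^ j) (gam w j vs z)"
        using j by (simp add: gam_pos f_def F.scale_sum_right)
    qed
    also have "w 0 *\<^sub>R al vs + ((\<Sum>j=1..<q. sC (e ^ j) (gam w j vs z)) + sC (e ^ q) (rmd n e z w q vs))
       = (\<Sum>j<q. sC (e ^ j) (gam w j vs z)) + sC (e ^ q) (rmd n e z w q vs)"
      using False by (simp add: sum.atLeast_Suc_lessThan[of 0 q, simplified] lessThan_atLeast0 add.assoc)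
    finally show ?thesis .
  qed simp
qed

text \<open>The constant is uniform over all curves with bounded coefficients and values in the
  given ball, which later makes the determinant estimate uniform in the parameters.\<close>

lemma rmd_bound:
  "admissible_weight w \<Longrightarrow> \<exists>C\<ge>0. \<forall>e z vs. length vs = m \<and> norm e \<le> 1 \<and> (\<forall>i. norm (z i) \<le> c) \<and> norm (pcurve n e z) \<le> \<kappa> \<longrightarrow>
     norm (rmd n e z w q vs) \<le> C * prod_list (map norm vs)"
proof (induction q arbitrary: w m rule: less_induct)
  case (less q)
  show ?case
  proof (cases "q = 0")
    case True
    let ?S = "\<Sum>m. w m * (\<kappa> / r) ^ m"
    have "?S \<ge> 0" using less.prems \<kappa> r_pos
      by (intro suminf_nonneg summable_weight[OF \<kappa>]) (auto simp: admissible_weight_def)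
    then show ?thesis using True r_pos M_nonneg ser_bound[OF \<kappa> less.prems]
      by (intro exI[of _ "?S * (M / r ^ m)"]) (auto simp: coef_bound_def mult_ac)
  next
    case False
    have w': "admissible_weight (\<lambda>m. w (Suc m))" by (rule admissible_weight_Suc) fact
    have "\<exists>C\<ge>0. \<forall>e z vs. length vs = Suc m \<and> norm e \<le> 1 \<and> (\<forall>i. norm (z i) \<le> c) \<and> norm (pcurve n e z) \<le> \<kappa> \<longrightarrow>
     norm (rmd n e z (\<lambda>m. w (Suc m)) (q - i) vs) \<le> C * prod_list (map norm vs)" if "i \<in> {1..n}" for i
      using that False by (intro less.IH w') auto
    then obtain C where C: "\<And>i. i \<in> {1..n} \<Longrightarrow> C i \<ge> 0"
      "\<And>i e z vs. i \<in> {1..n} \<Longrightarrow> length vs = Suc m \<Longrightarrow> norm e \<le> 1 \<Longrightarrow> (\<forall>i. norm (z i) \<le> c) \<Longrightarrow> norm (pcurve n e z) \<le> \<kappa> \<Longrightarrow>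
        norm (rmd n e z (\<lambda>m. w (Suc m)) (q - i) vs) \<le> C i * prod_list (map norm vs)"
      by metis
    show ?thesis
    proof (intro exI[of _ "\<Sum>i=1..n. C i * \<bar>c\<bar>"] conjI allI impI)
      show "0 \<le> (\<Sum>i=1..n. C i * \<bar>c\<bar>)" by (intro sum_nonneg mult_nonneg_nonneg C) auto
      fix e :: 'k and z :: "nat \<Rightarrow> 'b" and vs :: "'b list"
      assume *: "length vs = m \<and> norm e \<le> 1 \<and> (\<forall>i. norm (z i) \<le> c) \<and> norm (pcurve n e z) \<le> \<kappa>"
      have "norm (rmd n e z w q vs) \<le> (\<Sum>i=1..n. C i * \<bar>c\<bar> * prod_list (map norm vs))"
        unfolding rmd_pos[OF False[unfolded neq0_conv]]
      proof (rule sum_norm_le)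
        fix i assume i: "i \<in> {1..n}"
        have "norm (sC (e ^ (i - q)) (rmd n e z (\<lambda>m. w (Suc m)) (q - i) (z i # vs)))
           \<le> 1 * (C i * prod_list (map norm (z i # vs)))"
          unfolding F.norm_scale norm_power using * i
          by (intro mult_mono power_le_one C(2)) auto
        also have "\<dots> \<le> C i * (\<bar>c\<bar> * prod_list (map norm vs))"
        proof -
          have "norm (z i) \<le> \<bar>c\<bar>" using * by (metis abs_ge_self order_trans)
          then show ?thesis using C(1)[OF i]
            by (auto intro!: mult_left_mono mult_right_mono prod_list_nonneg)
        qed
        finally show "norm (sC (e ^ (i - q)) (rmd n e z (\<lambda>m. w (Suc m)) (q - i) (z i # vs)))
           \<le> C i * \<bar>c\<bar> * prod_list (map norm vs)" by (simp add: mult_ac)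
      qed
      then show "norm (rmd n e z w q vs) \<le> (\<Sum>i=1..n. C i * \<bar>c\<bar>) * prod_list (map norm vs)"
        by (simp add: sum_distrib_right)
    qed
  qed
qed

text \<open>The recursion ends in \<open>ser\<close>, so smoothness reduces to
  \<open>bsmooth_ser\<close>. The fixed arguments are functions of \<open>x\<close>, because the
  coefficients \<open>z i\<close> accumulate among them.\<close>

lemma bsmooth_rmd:
  fixes sE :: "'k \<Rightarrow> 'e::banach \<Rightarrow> 'e"
  assumes V: "tower_spaces sE sB V"
    and e: "bsmooth sE (*) V W e" and z: "\<And>i. bsmooth sE sB V W (z i)"
    and c: "\<And>x. x \<in> W \<Longrightarrow> norm (pcurve n (e x) (\<lambda>i. z i x)) \<le> \<kappa>"
  shows "admissible_weight w \<Longrightarrow> (\<And>f. f \<in> set fs \<Longrightarrow> bsmooth sE sB V W f) \<Longrightarrow>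
    bsmooth sE sC V W (\<lambda>x. rmd n (e x) (\<lambda>i. z i x) w q (map (\<lambda>f. f x) fs))"
proof (induction q arbitrary: w fs rule: less_induct)
  case (less q)
  interpret B: tower_spaces sE sB V by (rule V)
  interpret C: tower_spaces sE sC V
    by (intro tower_spaces.intro tower_spaces_axioms.intro B.E.banach_over_axioms
        F.banach_over_axioms B.subspace_V)
  have op: "openin (top_of_set V) W" using z[of 0] unfolding bsmooth_def by (auto dest: B.btower_openin)
  show ?case
  proof (cases "q = 0")
    case True
    have "bsmooth sE sB V W (\<lambda>x. pcurve n (e x) (\<lambda>i. z i x))"
      unfolding pcurve_def by (intro B.bsmooth_sum op B.bsmooth_scale_power e z) auto
    then show ?thesis using True less.prems c by (auto intro!: bsmooth_ser[OF \<kappa> V])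
  next
    case False
    have w': "admissible_weight (\<lambda>m. w (Suc m))" by (rule admissible_weight_Suc) fact
    have "bsmooth sE sC V W (\<lambda>x. \<Sum>i=1..n. sC (e x ^ (i - q)) (rmd n (e x) (\<lambda>i. z i x) (\<lambda>m. w (Suc m)) (q - i) (map (\<lambda>f. f x) (z i # fs))))"
      by (intro C.bsmooth_sum op C.bsmooth_scale_power e less.IH w') (use False less.prems z in auto)
    then show ?thesis using False by (simp add: rmd_pos)
  qed
qed

end

end

section \<open>Iterated derivatives and the system of undetermined coefficients\<close>

context banach_over
begin

lemma kderiv_eqI:
  assumes "(f has_derivative (\<lambda>h. scale h D)) (at x)"
  shows "kderiv scale f x = D"
  unfolding kderiv_def
proof (rule the_equality)
  show "(f has_derivative (\<lambda>h. scale h D)) (at x)" by (rule assms)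
  fix D' assume "(f has_derivative (\<lambda>h. scale h D')) (at x)"
  from has_derivative_unique[OF this assms] have "scale 1 D' = scale 1 D" by metis
  then show "D' = D" by simp
qed

lemma tower_spaces_line: "tower_spaces (*) scale UNIV"
proof -
  interpret K: banach_over "(*) :: 'k \<Rightarrow> 'k \<Rightarrow> 'k" by (rule banach_over_times)
  show ?thesis
    by (intro tower_spaces.intro tower_spaces_axioms.intro K.banach_over_axioms banach_over_axioms)
      (rule vector_space_over_itself.subspace_UNIV)
qed

lemma btower_line_derivative:
  assumes "btower (*) scale UNIV W D" "x \<in> W"
  shows "((\<lambda>y. D y vs) has_derivative (\<lambda>t. scale t (D x (1 # vs)))) (at x)"
proof -
  have "((\<lambda>t. D (x + t * 1) vs) has_derivative (\<lambda>t. scale t (D x (1 # vs)))) (at ((\<lambda>y. y - x) x))"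
    using tower_spaces.btower_deriv[OF tower_spaces_line assms, of 1 vs] by simp
  moreover have "((\<lambda>y. y - x) has_derivative (\<lambda>t. t)) (at x)"
    by (auto intro!: derivative_eq_intros)
  ultimately show ?thesis
    using has_derivative_compose[of "\<lambda>y. y - x" "\<lambda>t. t" x UNIV "\<lambda>t. D (x + t * 1) vs"] by simp
qed

text \<open>Only two Leibniz terms survive, since the factor \<open>x\<close> is linear. At
  \<open>i = 0\<close> the truncated \<open>i - 1\<close> is harmless because of the factor
  \<open>real i\<close>.\<close>

lemma kderiv_iterate_mult:
  assumes D: "btower (*) scale UNIV W D" and f: "\<And>x. x \<in> W \<Longrightarrow> f x = c + scale x (D x [])"
  shows "x \<in> W \<Longrightarrow> (kderiv scale ^^ i) f x =
    (if i = 0 then c else 0) + (scale x (D x (replicate i 1)) + real i *\<^sub>R D x (replicate (i - 1) 1))"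
proof (induction i arbitrary: x)
  case 0 then show ?case using f by simp
next
  case (Suc i)
  have "open W" using D by (auto simp: btower_def)
  let ?g = "\<lambda>x. (if i = 0 then c else 0) + (scale x (D x (replicate i 1)) + real i *\<^sub>R D x (replicate (i - 1) 1))"
  let ?d = "scale x (D x (1 # replicate i 1)) + real (Suc i) *\<^sub>R D x (replicate i 1)"
  have "(?g has_derivative (\<lambda>t. scale t ?d)) (at x)"
  proof (rule has_derivative_eq_rhs)
    show "(?g has_derivative (\<lambda>t. 0 + ((scale x (scale t (D x (1 # replicate i 1))) + scale t (D x (replicate i 1)))
        + real i *\<^sub>R scale t (D x (1 # replicate (i - 1) 1))))) (at x)"
      by (intro has_derivative_add has_derivative_const scale_has_derivative has_derivative_ident
          has_derivative_scaleR_right btower_line_derivative[OF D Suc.prems])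
    have "real i *\<^sub>R D x (1 # replicate (i - Suc 0) 1) = real i *\<^sub>R D x (replicate i 1)" by (cases i) auto
    then show "(\<lambda>t. 0 + ((scale x (scale t (D x (1 # replicate i 1))) + scale t (D x (replicate i 1)))
        + real i *\<^sub>R scale t (D x (1 # replicate (i - 1) 1)))) = (\<lambda>t. scale t ?d)"
      by (simp add: fun_eq_iff scale_right_distrib scale_scaleR[symmetric] mult.commute scaleR_left_distrib)
  qed
  then have "((kderiv scale ^^ i) f has_derivative (\<lambda>t. scale t ?d)) (at x)"
    by (rule has_derivative_transform_within_open[OF _ \<open>open W\<close> Suc.prems]) (simp add: Suc.IH)
  then show ?case by (simp add: kderiv_eqI)
qed

text \<open>Factors \<open>x\<close> are peeled off one at a time: for
  \<open>f x = c 0 + x h x\<close> the derivative of order \<open>j\<close> at \<open>0\<close> is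
  \<open>j\<close> times that of order \<open>j - 1\<close> of \<open>h\<close>, which builds up the
  factorial.\<close>

lemma kderiv_expansion:
  assumes "open W" "0 \<in> W" "bounded W" "bsmooth (*) scale UNIV W g"
    and "\<And>x. x \<in> W \<Longrightarrow> f x = (\<Sum>j<q. scale (x ^ j) (c j)) + scale (x ^ q) (g x)"
  shows "j < q \<Longrightarrow> (kderiv scale ^^ j) f 0 = fact j *\<^sub>R c j"
  using assms(5)
proof (induction q arbitrary: f c j)
  case (Suc q)
  interpret L: tower_spaces "(*)" scale UNIV by (rule tower_spaces_line)
  interpret K: tower_spaces "(*)" "(*) :: 'k \<Rightarrow> 'k \<Rightarrow> 'k" UNIV
    by (rule banach_over.tower_spaces_line[OF banach_over_times])
  have op: "openin (top_of_set UNIV) W" using assms(1) by simp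
  have id: "bsmooth (*) (*) UNIV W (\<lambda>x::'k. x)"
    using K.bsmooth_affine[OF op assms(3), of "\<lambda>x. x" 0] by (simp add: bounded_klinear_def)
  define h where "h x = (\<Sum>j<q. scale (x ^ j) (c (Suc j))) + scale (x ^ q) (g x)" for x
  have "bsmooth (*) scale UNIV W h"
    unfolding h_def
    by (intro L.bsmooth_add L.bsmooth_sum op L.bsmooth_scale_power id L.bsmooth_const assms(4)) auto
  then obtain D where D: "btower (*) scale UNIV W D" "\<And>x. x \<in> W \<Longrightarrow> D x [] = h x"
    unfolding bsmooth_def by blast
  have f: "f x = c 0 + scale x (h x)" if "x \<in> W" for x
    using Suc.prems(2)[OF that]
    by (simp add: h_def sum.lessThan_Suc_shift scale_right_distrib scale_sum_right add.assoc del: sum.lessThan_Suc)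
  show ?case
  proof (cases j)
    case 0 then show ?thesis using f[OF assms(2)] by simp
  next
    case (Suc i)
    have it: "(kderiv scale ^^ i) h 0 = D 0 (replicate i 1)" 
    proof -
      have "(kderiv scale ^^ i) h x = D x (replicate i 1)" if "x \<in> W" for x
        using that
      proof (induction i arbitrary: x)
        case 0 then show ?case using D by simp
      next
        case (Suc i)
        have "((kderiv scale ^^ i) h has_derivative (\<lambda>t. scale t (D x (1 # replicate i 1)))) (at x)"
          by (rule has_derivative_transform_within_open[OF btower_line_derivative[OF D(1) Suc.prems] assms(1) Suc.prems])
            (simp add: Suc.IH)
        then show ?case by (simp add: kderiv_eqI)
      qed
      then show ?thesis using assms(2) by simp
    qed
    have "(kderiv scale ^^ j) f 0 = real j *\<^sub>R D 0 (replicate (j - 1) 1)"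
      using kderiv_iterate_mult[OF D(1), of f "c 0" 0 j] f D(2) assms(2) Suc by simp
    also have "D 0 (replicate (j - 1) 1) = fact i *\<^sub>R c (Suc i)"
      using Suc.IH[where f=h and c="\<lambda>j. c (Suc j)" and j=i, OF _ h_def] Suc.prems(1) Suc it by simp
    finally show ?thesis using Suc by simp
  qed
qed simp

end

text \<open>Absorbs the factorials of \<open>curve\<close>, which leaves the coefficients of a plain
  power series in \<epsilon>. The padding by \<open>0\<close> makes them a function on all indices,
  as \<open>gam\<close> expects.\<close>

definition entry :: "('k::real_normed_field \<Rightarrow> 'b::real_normed_vector \<Rightarrow> 'b) \<Rightarrow> 'b list \<Rightarrow> nat \<Rightarrow> 'b" where
  "entry sB zs j = (if 1 \<le> j \<and> j \<le> length zs then sB (1 / fact j) (zs ! (j - 1)) else 0)"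

locale analytic_map = power_series sB sC al r M
  for sB :: "'k::{real_normed_field,euclidean_space} \<Rightarrow> 'b::banach \<Rightarrow> 'b"
    and sC :: "'k \<Rightarrow> 'c::banach \<Rightarrow> 'c" and al r M +
  fixes G :: "'b \<Rightarrow> 'c"
  assumes G_ser: "norm x < r \<Longrightarrow> G x = ser (\<lambda>m. 1) [] x"
begin

text \<open>The weights of the derivative: \<open>ser G1 [h] x\<close> is the derivative of
  \<open>G\<close> at \<open>x\<close> in direction \<open>h\<close>, see
  \<open>G_has_derivative\<close>.\<close>

definition G1 :: "nat \<Rightarrow> real" where "G1 = diffs (\<lambda>m. 1)"

lemma admissible_weight_G1: "admissible_weight G1"
  unfolding G1_def by (intro admissible_weight_diffs admissible_weight_const)

lemma G_has_derivative:
  assumes "norm x < r"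
  shows "(G has_derivative (\<lambda>h. ser G1 [h] x)) (at x)"
proof -
  \<comment> \<open>The midpoint lies strictly between \<open>norm x\<close> and \<open>r\<close>,
    so a whole ball around \<open>x\<close> falls under the Taylor estimate.\<close>
  define \<kappa> where "\<kappa> = (norm x + r) / 2"
  have \<kappa>: "0 < \<kappa>" "\<kappa> < r" "norm x < \<kappa>" using assms r_pos norm_ge_zero[of x] by (auto simp: \<kappa>_def simp del: norm_ge_zero)
  obtain K where K: "\<And>vs x h. norm x \<le> \<kappa> \<Longrightarrow> norm (x + h) \<le> \<kappa> \<Longrightarrow>
    norm (ser (\<lambda>m. 1) vs (x + h) - ser (\<lambda>m. 1) vs x - ser G1 (h # vs) x) \<le> K * coef_bound vs * (norm h)\<^sup>2"
    using ser_taylor[OF \<kappa>(1,2) admissible_weight_const] unfolding G1_def by blast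
  note w = admissible_weight_G1
  have bl: "bounded_linear (\<lambda>h. ser G1 [h] x)"
  proof (rule bounded_linear_intro)
    show "ser G1 [a + b] x = ser G1 [a] x + ser G1 [b] x" for a b
      using ser_add[OF \<kappa>(1,2) w, of x 0 "[a]" a b] \<kappa> by simp
    show "ser G1 [c *\<^sub>R a] x = c *\<^sub>R ser G1 [a] x" for a c
      using ser_scale[OF \<kappa>(1,2) w, of x 0 "[a]" "of_real c" a] \<kappa> by (simp add: F.scale_of_real Z.scale_of_real)
    show "norm (ser G1 [a] x) \<le> norm a * ((\<Sum>m. G1 m * (\<kappa> / r) ^ m) * (M / r))" for a
      using ser_bound[OF \<kappa>(1,2) w, of x "[a]"] \<kappa> by (simp add: coef_bound_def mult_ac)
  qed
  define C where "C = K * coef_bound []"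
  show ?thesis
  proof (rule has_derivativeI_sandwich[OF _ bl, where e="\<kappa> - norm x" and H="\<lambda>y. \<bar>C\<bar> * norm (y - x)"])
    show "0 < \<kappa> - norm x" using \<kappa> by simp
    fix y assume y: "y \<noteq> x" "dist y x < \<kappa> - norm x"
    have ny: "norm y < \<kappa>" using y norm_triangle_sub[of y x] by (simp add: dist_norm)
    have "norm (G y - G x - ser G1 [y - x] x) \<le> C * (norm (y - x))\<^sup>2"
      using K[of x "y - x" "[]"] ny \<kappa> by (simp add: G_ser C_def)
    also have "\<dots> \<le> \<bar>C\<bar> * (norm (y - x))\<^sup>2" by (intro mult_right_mono) auto
    also have "\<dots> = \<bar>C\<bar> * norm (y - x) * norm (y - x)" by (simp add: power2_eq_square)
    finally show "norm (G y - G x - ser G1 [y - x] x) / norm (y - x) \<le> \<bar>C\<bar> * norm (y - x)"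
      using y by (simp add: divide_le_eq)
  next
    have "((\<lambda>y. \<bar>C\<bar> * norm (y - x)) \<longlongrightarrow> \<bar>C\<bar> * norm (x - x)) (at x)" by (intro tendsto_intros)
    then show "((\<lambda>y. \<bar>C\<bar> * norm (y - x)) \<longlongrightarrow> 0) (at x)" by simp
  qed
qed

lemma frechet_derivative_G:
  "norm x < r \<Longrightarrow> frechet_derivative G (at x) = (\<lambda>h. ser G1 [h] x)"
  using frechet_derivative_at[OF G_has_derivative] by metis

lemma pcurve_tendsto: "((\<lambda>e. pcurve n e z) \<longlongrightarrow> 0) (at 0)"
proof -
  have "((\<lambda>e. \<Sum>i=1..n. sB (e ^ i) (z i)) \<longlongrightarrow> (\<Sum>i=1..n. sB (0 ^ i) (z i))) (at 0)"
    by (intro tendsto_sum Z.tendsto_scale tendsto_intros)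
  also have "(\<Sum>i=1..n. sB (0 ^ i) (z i)) = 0" by (intro sum.neutral) (auto simp: power_0_left)
  finally show ?thesis by (simp add: pcurve_def)
qed

lemma pcurve_small:
  assumes "\<kappa> > 0"
  obtains d where "d > 0" "\<And>e. norm e < d \<Longrightarrow> norm (pcurve n e z) \<le> \<kappa>"
proof -
  have "\<forall>\<^sub>F e in at 0. norm (pcurve n e z) < \<kappa>"
    using tendsto_norm[OF pcurve_tendsto[of n z]] assms by (intro order_tendstoD(2)) auto
  then obtain d where d: "d > 0" "\<And>e. e \<noteq> 0 \<Longrightarrow> dist e 0 < d \<Longrightarrow> norm (pcurve n e z) < \<kappa>"
    by (auto simp: eventually_at)
  have "pcurve n 0 z = 0" unfolding pcurve_def by (intro sum.neutral) (auto simp: power_0_left)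
  then show ?thesis using d assms by (intro that[of d]) (auto intro: less_imp_le simp: dist_norm, metis less_imp_le norm_zero)
qed

text \<open>Serves both \<open>T\<close>, with the weight of \<open>G\<close>, and the operators
  \<open>A\<^sub>i\<close>, with the weight \<open>G1\<close> and one fixed argument. The remainder
  of \<open>ser_expansion\<close> is smooth in \<epsilon>, so \<open>kderiv_expansion\<close> reads
  off the coefficients.\<close>

lemma kderiv_ser_pcurve:
  assumes w: "admissible_weight w" and z: "\<And>i. i > n \<Longrightarrow> z i = 0"
    and f: "\<And>e. norm (pcurve n e z) < r \<Longrightarrow> f e = ser w vs (pcurve n e z)"
  shows "(kderiv sC ^^ j) f 0 = fact j *\<^sub>R gam w j vs z"
proof -
  have \<kappa>: "0 < r / 2" "r / 2 < r" using r_pos by auto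
  obtain d where d: "d > 0" "\<And>e. norm e < d \<Longrightarrow> norm (pcurve n e z) \<le> r / 2"
    using pcurve_small[OF \<kappa>(1)] by blast
  let ?W = "ball 0 d :: 'k set"
  interpret L: tower_spaces "(*)" sC UNIV by (rule F.tower_spaces_line)
  interpret LB: tower_spaces "(*)" sB UNIV by (rule Z.tower_spaces_line)
  interpret K: tower_spaces "(*)" "(*) :: 'k \<Rightarrow> 'k \<Rightarrow> 'k" UNIV
    by (rule banach_over.tower_spaces_line[OF banach_over_times])
  have op: "openin (top_of_set UNIV) ?W" by simp
  have id: "bsmooth (*) (*) UNIV ?W (\<lambda>x::'k. x)"
    using K.bsmooth_affine[OF op bounded_ball, of "\<lambda>x. x" 0] by (simp add: bounded_klinear_def)
  have "bsmooth (*) sC UNIV ?W (\<lambda>e. rmd n e (\<lambda>i. (\<lambda>_. z i) e) w (Suc j) (map (\<lambda>f. f e) (map (\<lambda>v _. v) vs)))"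
    by (rule bsmooth_rmd[OF \<kappa> Z.tower_spaces_line id _ _ w]) (use d op in \<open>auto intro: LB.bsmooth_const\<close>)
  then have "bsmooth (*) sC UNIV ?W (\<lambda>e. rmd n e z w (Suc j) vs)" by (simp add: o_def)
  from F.kderiv_expansion[OF _ _ bounded_ball this, where f=f and c="\<lambda>j. gam w j vs z" and j=j and q="Suc j"]
  show ?thesis
    using d \<kappa> f ser_expansion[OF \<kappa> _ z w, where vs=vs and q="Suc j"]
    by (force simp del: sum.lessThan_Suc)
qed

lemma curve_eq_pcurve: "curve sB zs e = pcurve (length zs) e (entry sB zs)"
  unfolding curve_def pcurve_def by (intro sum.cong refl) (auto simp: entry_def)

lemma entry_zero: "i > length zs \<Longrightarrow> entry sB zs i = 0"
  by (simp add: entry_def)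

lemma T_eq_gam: "T sB sC G zs = fact (length zs) *\<^sub>R gam (\<lambda>m. 1) (length zs) [] (entry sB zs)"
  unfolding T_def
  by (rule kderiv_ser_pcurve[where n = "length zs"])
    (auto simp: admissible_weight_const entry_zero curve_eq_pcurve G_ser)

text \<open>Truncating the tuple after \<open>i\<close> entries does not change the coefficient of
  order \<open>i\<close>, so all equations of the system refer to one and the same curve.\<close>

lemma X_iff_gam:
  "zs \<in> X sB sC G n \<longleftrightarrow> length zs = n \<and> (\<forall>i\<in>{1..n}. gam (\<lambda>m. 1) i [] (entry sB zs) = 0)"
proof -
  have "T sB sC G (take i zs) = 0 \<longleftrightarrow> gam (\<lambda>m. 1) i [] (entry sB zs) = 0" if "i \<in> {1..length zs}" for i
  proof -
    have "gam (\<lambda>m. 1) i [] (entry sB (take i zs)) = gam (\<lambda>m. 1) i [] (entry sB zs)"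
      using that by (intro gam_cong) (auto simp: entry_def)
    then show ?thesis using that by (simp add: T_eq_gam min_absorb2)
  qed
  then show ?thesis by (auto simp: X_def)
qed

lemma expansion_coeff_eq_gam:
  "expansion_coeff sB sC G zbar i v = gam G1 i [v] (entry sB zbar)"
proof -
  have "(kderiv sC ^^ i) (\<lambda>e. frechet_derivative G (at (curve sB zbar e)) v) 0 = fact i *\<^sub>R gam G1 i [v] (entry sB zbar)"
    by (rule kderiv_ser_pcurve[where n = "length zbar"])
      (auto simp: admissible_weight_G1 entry_zero curve_eq_pcurve frechet_derivative_G)
  moreover have "sC (1 / fact i) (fact i *\<^sub>R x) = x" for x
    using F.scale_of_real[of "fact i" x, symmetric] by simp
  ultimately show ?thesis by (simp add: expansion_coeff_def)
qed

end

section \<open>The implicit function theorem for towers\<close>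

text \<open>
  Expressions for the derivatives of the solution of \<open>y = \<Phi> (p, y)\<close>: \<open>Point\<close> is \<open>(p, y p)\<close>,
  \<open>Dir i\<close> is the \<open>i\<close>-th direction, \<open>Deriv\<close> applies a derivative of \<open>\<Phi>\<close> at \<open>(p, y p)\<close>, and \<open>Solve\<close>
  applies the inverse of \<open>u \<mapsto> u - \<Phi>\<^sub>y (p, y p) u\<close>.
\<close>

datatype iexp = Point | Dir nat | Deriv "iexp list" | Solve iexp

primrec iexp_wf :: "nat \<Rightarrow> iexp \<Rightarrow> bool" where
  "iexp_wf n Point = True"
| "iexp_wf n (Dir i) = (i < n)"
| "iexp_wf n (Deriv es) = list_all id (map (iexp_wf n) es)"
| "iexp_wf n (Solve e) = iexp_wf n e"

text \<open>Implicit differentiation: moving \<open>p\<close> in direction \<open>h\<close> moves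
  \<open>y p\<close> in the direction \<open>u\<close> with
  \<open>u - \<Phi>\<^sub>y u = \<Phi>\<^sub>p h\<close>. The derivative of \<open>Point\<close> is
  the sum of the two entries.\<close>

definition point_deriv :: "nat \<Rightarrow> iexp list" where
  "point_deriv n = [Dir n, Solve (Deriv [Dir n])]"

text \<open>Lists stand for sums. The rule for \<open>Solve\<close> is that of an inverse operator,
  \<open>(L v)' = L (A' (L v)) + L v'\<close>, where \<open>A'\<close> is a second derivative of
  \<Phi> in the direction of the moving point.\<close>

primrec iexp_deriv :: "nat \<Rightarrow> iexp \<Rightarrow> iexp list" where
  "iexp_deriv n Point = point_deriv n"
| "iexp_deriv n (Dir i) = []"
| "iexp_deriv n (Deriv es) = map (\<lambda>d. Deriv (d # es)) (point_deriv n) @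
     concat (map2 (\<lambda>i ds. map (\<lambda>d. Deriv (es[i := d])) ds) [0..<length es] (map (iexp_deriv n) es))"
| "iexp_deriv n (Solve e) = map (\<lambda>d. Solve (Deriv [d, Solve e])) (point_deriv n) @
     map Solve (iexp_deriv n e)"

lemma iexp_wf_Suc: "iexp_wf n e \<Longrightarrow> iexp_wf (Suc n) e"
  by (induction e) (auto simp: list_all_iff)

lemma iexp_wf_point_deriv: "e \<in> set (point_deriv n) \<Longrightarrow> iexp_wf (Suc n) e"
  by (auto simp: point_deriv_def)

lemma iexp_wf_deriv: "iexp_wf n e \<Longrightarrow> d \<in> set (iexp_deriv n e) \<Longrightarrow> iexp_wf (Suc n) d"
proof (induction e arbitrary: d)
  case Point then show ?case by (simp add: iexp_wf_point_deriv)
next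
  case (Deriv es)
  have es: "iexp_wf (Suc n) e" if "e \<in> set es" for e
    using that Deriv.prems by (auto simp: list_all_iff intro: iexp_wf_Suc)
  from Deriv.prems(2) consider (a) d' where "d' \<in> set (point_deriv n)" "d = Deriv (d' # es)"
    | (b) i d' where "i < length es" "d' \<in> set (iexp_deriv n (es ! i))" "d = Deriv (es[i := d'])"
    by (auto simp: set_zip)
  then show ?case
  proof cases
    case a then show ?thesis using es by (auto simp: list_all_iff iexp_wf_point_deriv)
  next
    case b
    have esi: "es ! i \<in> set es" using b by simp
    have "iexp_wf n (es ! i)" using Deriv.prems(1) esi by (auto simp: list_all_iff)
    then have "iexp_wf (Suc n) d'" by (rule Deriv.IH[OF esi _ b(2)])
    then show ?thesis using es b(3) set_update_subset_insert[of es i d'] by (auto simp: list_all_iff)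
  qed
next
  case (Solve e)
  then show ?case by (auto simp: iexp_wf_Suc iexp_wf_point_deriv)
qed auto

lemma subspace_Times_UNIV:
  assumes "tower_spaces sE sC V"
  shows "tower_spaces (scale_pair sE sC) sC (V \<times> UNIV)"
proof -
  interpret tower_spaces sE sC V by fact
  interpret P: banach_over "scale_pair sE sC"
    by (rule banach_over_pair) (fact E.banach_over_axioms F.banach_over_axioms)+
  show ?thesis
    by (intro tower_spaces.intro tower_spaces_axioms.intro P.banach_over_axioms F.banach_over_axioms)
      (auto simp: P.subspace_def scale_pair_def zero_prod_def V_0 V_add V_scale)
qed

text \<open>The fixed point \<open>y\<close> is given, and its smoothness is at stake. The
  contraction factor one half passes to the partial derivative in the second variable, so that
  \<open>u \<mapsto> u - Aop p u\<close> is invertible with a bound independent of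
  \<open>p\<close>.\<close>

locale implicit_function = tower_spaces sE sC V
  for sE :: "'k::{real_normed_field,euclidean_space} \<Rightarrow> 'e::banach \<Rightarrow> 'e"
    and sC :: "'k \<Rightarrow> 'c::banach \<Rightarrow> 'c" and V +
  fixes Phi :: "'e \<times> 'c \<Rightarrow> 'c" and DPhi :: "'e \<times> 'c \<Rightarrow> ('e \<times> 'c) list \<Rightarrow> 'c"
    and Om :: "('e \<times> 'c) set" and W :: "'e set" and y :: "'e \<Rightarrow> 'c"
  assumes DPhi: "btower (scale_pair sE sC) sC (V \<times> UNIV) Om DPhi"
    and Phi: "\<And>x. x \<in> Om \<Longrightarrow> DPhi x [] = Phi x"
    and convex_Om: "convex Om"
    and openin_W: "openin (top_of_set V) W" and bounded_W: "bounded W"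
    and y_in: "\<And>p. p \<in> W \<Longrightarrow> (p, y p) \<in> Om"
    and y_fixed: "\<And>p. p \<in> W \<Longrightarrow> y p = Phi (p, y p)"
    and contraction: "\<And>p u v. (p, u) \<in> Om \<Longrightarrow> (p, v) \<in> Om \<Longrightarrow> norm (Phi (p, u) - Phi (p, v)) \<le> norm (u - v) / 2"
begin

abbreviation sZ where "sZ \<equiv> scale_pair sE sC"

sublocale Z: tower_spaces sZ sC "V \<times> UNIV"
  by (rule subspace_Times_UNIV) (rule tower_spaces_axioms)

sublocale ZC: two_spaces sZ sC
  by (intro two_spaces.intro Z.E.banach_over_axioms F.banach_over_axioms)

definition Aop :: "'e \<Rightarrow> 'c \<Rightarrow> 'c" where "Aop p u = DPhi (p, y p) [(0, u)]"

lemma DPhi_Cons_add: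
  "x \<in> Om \<Longrightarrow> set zs \<subseteq> V \<times> UNIV \<Longrightarrow> a \<in> V \<times> UNIV \<Longrightarrow> b \<in> V \<times> UNIV \<Longrightarrow>
    DPhi x ((a + b) # zs) = DPhi x (a # zs) + DPhi x (b # zs)"
  using Z.btower_add[OF DPhi, of x "a # zs" 0 a b] by simp

lemma DPhi_Cons_scale:
  "x \<in> Om \<Longrightarrow> set zs \<subseteq> V \<times> UNIV \<Longrightarrow> a \<in> V \<times> UNIV \<Longrightarrow>
    DPhi x (sZ c a # zs) = sC c (DPhi x (a # zs))"
  using Z.btower_scale[OF DPhi, of x "a # zs" 0 a c] by simp

lemma Aop_add: "p \<in> W \<Longrightarrow> Aop p (u + v) = Aop p u + Aop p v"
  using DPhi_Cons_add[OF y_in, of p "[]" "(0, u)" "(0, v)"] by (simp add: Aop_def V_0)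

lemma Aop_scale: "p \<in> W \<Longrightarrow> Aop p (sC c u) = sC c (Aop p u)"
  using DPhi_Cons_scale[OF y_in, of p "[]" "(0, u)" c] by (simp add: Aop_def V_0 scale_pair_def)

lemma Aop_diff: "p \<in> W \<Longrightarrow> Aop p (u - v) = Aop p u - Aop p v"
  using Aop_add[of p "u - v" v] by simp

text \<open>The limit of the difference quotients inherits the Lipschitz constant of \<Phi> in its
  second variable.\<close>

lemma Aop_bound:
  assumes p: "p \<in> W"
  shows "norm (Aop p u) \<le> norm u / 2"
proof (rule tendsto_upperbound)
  have mem: "(0, u) \<in> V \<times> UNIV" by (simp add: V_0)
  have "((\<lambda>t. DPhi ((p, y p) + sZ t (0, u)) []) has_derivative (\<lambda>t. sC t (Aop p u))) (at 0)"
    using Z.btower_deriv[OF DPhi y_in[OF p] mem, of "[]"] by (simp add: Aop_def)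
  then show "((\<lambda>t. norm (sC (inverse t) (DPhi ((p, y p) + sZ t (0, u)) [] - DPhi ((p, y p) + sZ 0 (0, u)) [])))
      \<longlongrightarrow> norm (Aop p u)) (at 0)"
    unfolding F.has_derivative_scale_iff by (rule tendsto_norm)
  have ev: "\<forall>\<^sub>F t in at 0. (p, y p) + sZ t (0, u) \<in> Om"
    by (rule Z.eventually_line[OF Z.btower_openin[OF DPhi] y_in[OF p] mem])
  show "\<forall>\<^sub>F t in at 0. norm (sC (inverse t) (DPhi ((p, y p) + sZ t (0, u)) [] - DPhi ((p, y p) + sZ 0 (0, u)) [])) \<le> norm u / 2"
    using ev eventually_neq_at_within[of 0 0 UNIV]
  proof eventually_elim
    case (elim t)
    have "norm (Phi (p, y p + sC t u) - Phi (p, y p)) \<le> norm (sC t u) / 2"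
      using contraction[of p "y p + sC t u" "y p"] elim y_in[OF p] by (simp add: scale_pair_def)
    then have "norm (Phi (p, y p + sC t u) - Phi (p, y p)) / norm t \<le> norm u / 2"
      using elim by (simp add: F.norm_scale divide_le_eq mult.commute)
    moreover have "norm (sC (inverse t) (Phi (p, y p + sC t u) - Phi (p, y p))) =
        norm (Phi (p, y p + sC t u) - Phi (p, y p)) / norm t"
      by (simp add: F.norm_scale norm_inverse divide_inverse mult.commute)
    ultimately show ?case using elim y_in[OF p] by (simp add: Phi scale_pair_def)
  qed
qed simp

text \<open>The inverse of \<open>u \<mapsto> u - Aop p u\<close>, written as the fixed point of a
  contraction so that existence and uniqueness come from Banach's theorem.\<close>

definition Lop :: "'e \<Rightarrow> 'c \<Rightarrow> 'c" where "Lop p v = (THE u. v + Aop p u = u)"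

lemma Lop_ex1: "p \<in> W \<Longrightarrow> \<exists>!u. v + Aop p u = u"
proof (rule banach_fix_type[of "1/2"], goal_cases)
  case 3
  have "norm (Aop p (a - b)) \<le> 1 / 2 * norm (a - b)" for a b
    using Aop_bound[OF 3, of "a - b"] by simp
  then show ?case by (simp add: dist_norm Aop_diff[OF 3])
qed simp_all

lemma Lop_eq: "p \<in> W \<Longrightarrow> v + Aop p (Lop p v) = Lop p v"
  unfolding Lop_def by (rule theI'[OF Lop_ex1])

lemma Lop_unique: "p \<in> W \<Longrightarrow> v + Aop p u = u \<Longrightarrow> Lop p v = u"
  using Lop_ex1[of p v] Lop_eq[of p v] by blast

lemma Lop_add: "p \<in> W \<Longrightarrow> Lop p (u + v) = Lop p u + Lop p v"
proof (rule Lop_unique)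
  assume p: "p \<in> W"
  have "u + v + Aop p (Lop p u + Lop p v) = (u + Aop p (Lop p u)) + (v + Aop p (Lop p v))"
    by (simp only: Aop_add[OF p] add_ac)
  then show "u + v + Aop p (Lop p u + Lop p v) = Lop p u + Lop p v"
    by (simp only: Lop_eq[OF p])
qed

lemma Lop_zero: "p \<in> W \<Longrightarrow> Lop p 0 = 0"
  using Aop_scale[of p 0 0] by (intro Lop_unique) auto

lemma Lop_sum_list: "p \<in> W \<Longrightarrow> Lop p (\<Sum>d\<leftarrow>ds. f d) = (\<Sum>d\<leftarrow>ds. Lop p (f d))"
  by (induction ds) (auto simp: Lop_add Lop_zero)

lemma solve_estimate:
  assumes "p \<in> W" shows "norm u \<le> 2 * norm (u - Aop p u)"
  using Aop_bound[OF assms, of u] norm_triangle_ineq2[of u "Aop p u"] by linarith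

lemma Lop_bound: "p \<in> W \<Longrightarrow> norm (Lop p v) \<le> 2 * norm v"
  using solve_estimate[of p "Lop p v"] Lop_eq[of p v] by (metis add_diff_cancel)

text \<open>For the difference \<open>w\<close> between the increment of \<open>y\<close> and its
  candidate linearization, \<open>w - Aop p w\<close> is a Taylor remainder of \<Phi>, hence
  quadratic in the increment of the point. A Lipschitz bound on \<open>y\<close> makes it quadratic
  in \<open>t\<close>, and \<open>solve_estimate\<close> transfers the bound to
  \<open>w\<close>.\<close>

lemma y_has_derivative:
  assumes p: "p \<in> W" and h: "h \<in> V"
  shows "((\<lambda>t. y (p + sE t h)) has_derivative (\<lambda>t. sC t (Lop p (DPhi (p, y p) [(h, 0)])))) (at 0)"
proof -
  define Y where "Y t = y (p + sE t h)" for t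
  define u where "u = Lop p (DPhi (p, y p) [(h, 0)])"
  note X = y_in[OF p]
  obtain C1 where C1': "C1 \<ge> 0" "\<And>x H us. x \<in> Om \<Longrightarrow> x + H \<in> Om \<Longrightarrow> length us = 0 \<Longrightarrow> set us \<subseteq> V \<times> UNIV \<Longrightarrow>
      norm (DPhi (x + H) us - DPhi x us) \<le> C1 * norm H * prod_list (map norm us)"
    using Z.btower_lipschitz[OF DPhi convex_Om, of 0] by blast
  have C1: "C1 \<ge> 0" "\<And>x H. x \<in> Om \<Longrightarrow> x + H \<in> Om \<Longrightarrow> norm (DPhi (x + H) [] - DPhi x []) \<le> C1 * norm H"
    using C1'(1) C1'(2)[of _ _ "[]"] by simp_all
  obtain C where C': "C \<ge> 0" "\<And>x H us. x \<in> Om \<Longrightarrow> x + H \<in> Om \<Longrightarrow> length us = 0 \<Longrightarrow> set us \<subseteq> V \<times> UNIV \<Longrightarrow>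
      norm (DPhi (x + H) us - DPhi x us - DPhi x (H # us)) \<le> C * (norm H)\<^sup>2 * prod_list (map norm us)"
    using Z.btower_taylor[OF DPhi convex_Om, of 0] by blast
  have C: "C \<ge> 0" "\<And>x H. x \<in> Om \<Longrightarrow> x + H \<in> Om \<Longrightarrow> norm (DPhi (x + H) [] - DPhi x [] - DPhi x [H]) \<le> C * (norm H)\<^sup>2"
    using C'(1) C'(2)[of _ _ "[]"] by simp_all
  define K where "K = (1 + 2 * C1) * norm h"
  have K: "K \<ge> 0" using C1 by (simp add: K_def)
  have mem: "(h, 0) \<in> V \<times> UNIV" using h by simp
  have ev1: "\<forall>\<^sub>F t in at 0. p + sE t h \<in> W" by (rule eventually_line[OF openin_W p h])
  have ev2: "\<forall>\<^sub>F t in at 0. (p, y p) + sZ t (h, 0) \<in> Om"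
    by (rule Z.eventually_line[OF Z.btower_openin[OF DPhi] X mem])
  have Y0: "Y 0 = y p" by (simp add: Y_def)
  have "\<forall>\<^sub>F t in at 0. norm (sC (inverse t) (Y t - Y 0) - u) \<le> 2 * C * K\<^sup>2 * norm t"
    using ev1 ev2 eventually_neq_at_within[of 0 0 UNIV]
  proof eventually_elim
    case (elim t)
    have Xt: "(p + sE t h, Y t) \<in> Om" using y_in[OF elim(1)] by (simp add: Y_def)
    have Xm: "(p + sE t h, y p) \<in> Om" using elim(2) by (simp add: scale_pair_def)
    have "norm (Phi (p + sE t h, y p) - Phi (p, y p)) \<le> C1 * norm (sE t h, 0 :: 'c)"
      using C1(2)[OF X, of "(sE t h, 0)"] X Xm by (simp add: Phi)
    moreover have "norm (Phi (p + sE t h, Y t) - Phi (p + sE t h, y p)) \<le> norm (Y t - Y 0) / 2"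
      using contraction[OF Xt Xm] by (simp add: Y0)
    moreover have "Y t - Y 0 = (Phi (p + sE t h, Y t) - Phi (p + sE t h, y p)) + (Phi (p + sE t h, y p) - Phi (p, y p))"
      using y_fixed[OF p] y_fixed[OF elim(1)] by (simp add: Y_def)
    \<comment> \<open>The contraction contributes half of the increment itself, which is absorbed on
      the left; hence the factor \<open>2\<close>.\<close>
    ultimately have Ylip: "norm (Y t - Y 0) \<le> 2 * C1 * (norm t * norm h)"
      using norm_triangle_ineq[of "Phi (p + sE t h, Y t) - Phi (p + sE t h, y p)" "Phi (p + sE t h, y p) - Phi (p, y p)"]
      by (simp add: norm_Pair E.norm_scale)
    define H where "H = (sE t h, Y t - Y 0)"
    have "norm H \<le> norm (sE t h) + norm (Y t - Y 0)"
      unfolding H_def norm_Pair by (rule sqrt_sum_squares_le_sum) auto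
    also have "\<dots> \<le> K * norm t" using Ylip by (simp add: E.norm_scale K_def algebra_simps)
    finally have nH: "norm H \<le> K * norm t" .
    have H': "H = sZ t (h, 0) + (0, Y t - Y 0)" by (simp add: H_def scale_pair_def)
    have "DPhi (p, y p) [H] = DPhi (p, y p) [sZ t (h, 0)] + Aop p (Y t - Y 0)"
      unfolding H' Aop_def by (rule DPhi_Cons_add[OF X]) (use h in \<open>auto simp: scale_pair_def V_scale V_0\<close>)
    also have "DPhi (p, y p) [sZ t (h, 0)] = sC t (DPhi (p, y p) [(h, 0)])"
      by (rule DPhi_Cons_scale[OF X]) (use h in auto)
    also have "DPhi (p, y p) [(h, 0)] = u - Aop p u"
      using Lop_eq[OF p, of "DPhi (p, y p) [(h, 0)]"] by (simp add: u_def algebra_simps)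
    finally have DH: "DPhi (p, y p) [H] = sC t (u - Aop p u) + Aop p (Y t - Y 0)" .
    define w where "w = Y t - Y 0 - sC t u"
    have "w - Aop p w = (Y t - Y 0) - DPhi (p, y p) [H]"
      using p by (simp add: w_def DH Aop_diff Aop_scale F.scale_right_diff_distrib)
    also have "Y t - Y 0 = DPhi ((p, y p) + H) [] - DPhi (p, y p) []"
      using y_fixed[OF p] y_fixed[OF elim(1)] X Xt by (simp add: Phi H_def Y_def)
    finally have "norm (w - Aop p w) \<le> C * (norm H)\<^sup>2"
      using C(2)[OF X, of H] Xt by (simp add: H_def Y0)
    also have "\<dots> \<le> C * (K * norm t)\<^sup>2" using nH C by (intro mult_left_mono power_mono) auto
    finally have w: "norm w \<le> 2 * (C * (K * norm t)\<^sup>2)" using solve_estimate[OF p, of w] by linarith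
    have "sC (inverse t) (Y t - Y 0) - u = sC (inverse t) w"
      using elim by (simp add: w_def F.scale_right_diff_distrib)
    then have "norm (sC (inverse t) (Y t - Y 0) - u) = norm w / norm t"
      by (simp add: F.norm_scale norm_inverse divide_inverse mult.commute)
    also have "\<dots> \<le> 2 * (C * (K * norm t)\<^sup>2) / norm t" using w by (intro divide_right_mono) auto
    also have "\<dots> = 2 * C * K\<^sup>2 * norm t" using elim by (simp add: power2_eq_square)
    finally show ?case .
  qed
  moreover have "((\<lambda>t::'k. 2 * C * K\<^sup>2 * norm t) \<longlongrightarrow> 0) (at 0)"
    using tendsto_mult_right_zero[OF tendsto_norm_zero[OF tendsto_ident_at[of "0::'k"]], of "2 * C * K\<^sup>2"] by simp
  ultimately have "((\<lambda>t. sC (inverse t) (Y t - Y 0) - u) \<longlongrightarrow> 0) (at 0)"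
    by (rule Lim_null_comparison)
  then show ?thesis
    unfolding F.has_derivative_scale_iff Y_def u_def by (simp add: LIM_zero_iff)
qed

definition Xdot :: "'e \<Rightarrow> 'e \<Rightarrow> 'e \<times> 'c" where
  "Xdot p h = (h, Lop p (DPhi (p, y p) [(h, 0)]))"

lemma point_has_derivative:
  assumes p: "p \<in> W" and h: "h \<in> V"
  shows "((\<lambda>t. (p + sE t h, y (p + sE t h))) has_derivative (\<lambda>t. sZ t (Xdot p h))) (at 0)"
proof -
  have "((\<lambda>t. p + sE t h) has_derivative (\<lambda>t. sE t h)) (at 0)"
    using has_derivative_add[OF has_derivative_const[of p]
        bounded_linear.has_derivative[OF E.bounded_linear_scale_left[of h] has_derivative_ident]] by simp
  from has_derivative_Pair[OF this y_has_derivative[OF assms]]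
  show ?thesis by (simp add: scale_pair_def Xdot_def)
qed

lemma DPhi_point_has_derivative:
  assumes p: "p \<in> W" and h: "h \<in> V" and zs: "set zs \<subseteq> V \<times> UNIV"
  shows "((\<lambda>t. DPhi (p + sE t h, y (p + sE t h)) zs) has_derivative
     (\<lambda>t. sC t (DPhi (p, y p) (Xdot p h # zs)))) (at 0)"
proof -
  note X = y_in[OF p]
  obtain K where K: "K \<ge> 0" "\<And>x H us. x \<in> Om \<Longrightarrow> x + H \<in> Om \<Longrightarrow> length us = length zs \<Longrightarrow> set us \<subseteq> V \<times> UNIV \<Longrightarrow>
    norm (DPhi (x + H) us - DPhi x us - DPhi x (H # us)) \<le> K * (norm H)\<^sup>2 * prod_list (map norm us)"
    using Z.btower_taylor[OF DPhi convex_Om] by blast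
  obtain C where C: "C \<ge> 0" "\<And>x us. x \<in> Om \<Longrightarrow> length us = Suc (length zs) \<Longrightarrow> set us \<subseteq> V \<times> UNIV \<Longrightarrow>
    norm (DPhi x us) \<le> C * prod_list (map norm us)"
    using Z.btower_bound[OF DPhi, of "Suc (length zs)"] by blast
  show ?thesis
  proof (rule ZC.taylor_has_derivative[OF Z.subspace_V,
        where f="\<lambda>x. DPhi x zs" and x="\<lambda>t. (p + sE t h, y (p + sE t h))" and A=Om
        and f'="\<lambda>H. DPhi (p, y p) (H # zs)" and dx="Xdot p h"])
    show "norm (DPhi ((p + sE 0 h, y (p + sE 0 h)) + H) zs - DPhi (p + sE 0 h, y (p + sE 0 h)) zs - DPhi (p, y p) (H # zs))
       \<le> K * prod_list (map norm zs) * (norm H)\<^sup>2"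
      if "(p + sE 0 h, y (p + sE 0 h)) + H \<in> Om" for H
      using K(2)[OF X, of H zs] that zs by (simp add: mult_ac)
    show "norm (DPhi (p, y p) (a # zs)) \<le> C * prod_list (map norm zs) * norm a" if "a \<in> V \<times> UNIV" for a
      using C(2)[OF X, of "a # zs"] that zs by (simp add: mult_ac)
    have "\<forall>\<^sub>F t in at 0. p + sE t h \<in> W" by (rule eventually_line[OF openin_W p h])
    then show "\<forall>\<^sub>F t in at 0. (p + sE t h, y (p + sE t h)) \<in> Om \<inter> V \<times> UNIV"
      by eventually_elim (use y_in Z.btower_sub[OF DPhi] in blast)
    show "DPhi (p, y p) ((a + b) # zs) = DPhi (p, y p) (a # zs) + DPhi (p, y p) (b # zs)"
      if "a \<in> V \<times> UNIV" "b \<in> V \<times> UNIV" for a b by (rule DPhi_Cons_add[OF X zs that])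
    show "DPhi (p, y p) (sZ c a # zs) = sC c (DPhi (p, y p) (a # zs))" if "a \<in> V \<times> UNIV" for a c
      by (rule DPhi_Cons_scale[OF X zs that])
    show "((\<lambda>t. (p + sE t h, y (p + sE t h))) has_derivative (\<lambda>t. sZ t (Xdot p h))) (at 0)"
      by (rule point_has_derivative[OF p h])
    show "(p + sE 0 h, y (p + sE 0 h)) \<in> V \<times> UNIV" using Z.btower_sub[OF DPhi X] by simp
    show "Xdot p h \<in> V \<times> UNIV" using h by (simp add: Xdot_def)
  qed
qed

text \<open>All values lie in the product space, so that every term may serve as a direction of
  \<Phi>: parameter directions are padded by \<open>0\<close> on the right, values of
  \<open>Deriv\<close> and \<open>Solve\<close> on the left.\<close>

primrec ival :: "iexp \<Rightarrow> 'e \<Rightarrow> 'e list \<Rightarrow> 'e \<times> 'c" where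
  "ival Point p us = (p, y p)"
| "ival (Dir i) p us = (us ! i, 0)"
| "ival (Deriv es) p us = (0, DPhi (p, y p) (map (\<lambda>f. f p us) (map ival es)))"
| "ival (Solve e) p us = (0, Lop p (snd (ival e p us)))"

lemma ival_Deriv: "ival (Deriv es) p us = (0, DPhi (p, y p) (map (\<lambda>e. ival e p us) es))"
  by (simp add: o_def)

declare ival.simps(3) [simp del]

lemma ival_mem:
  assumes "p \<in> W" "set us \<subseteq> V" "iexp_wf (length us) e"
  shows "ival e p us \<in> V \<times> UNIV"
  using assms openin_imp_subset[OF openin_W]
  by (cases e) (auto simp: V_0 ival_Deriv dest: nth_mem)

lemma ival_append: "iexp_wf (length us) e \<Longrightarrow> ival e p (us @ vs) = ival e p us"
proof (induction e)
  case (Deriv es)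
  then have "map (\<lambda>e. ival e p (us @ vs)) es = map (\<lambda>e. ival e p us) es"
    by (auto simp: list_all_iff)
  then show ?case by (simp only: ival_Deriv)
qed (auto simp: nth_append)

lemma sum_list_point_deriv:
  "p \<in> W \<Longrightarrow> length us = n \<Longrightarrow> (\<Sum>d\<leftarrow>point_deriv n. ival d p (us @ [h])) = Xdot p h"
  by (simp add: point_deriv_def ival_Deriv Xdot_def nth_append)

lemma fst_sum_list: "fst (\<Sum>d\<leftarrow>ds. f d) = (\<Sum>d\<leftarrow>ds. fst (f d))" for f :: "'t \<Rightarrow> 'p::comm_monoid_add \<times> 'q::comm_monoid_add"
  by (induction ds) auto

lemma snd_sum_list: "snd (\<Sum>d\<leftarrow>ds. f d) = (\<Sum>d\<leftarrow>ds. snd (f d))" for f :: "'t \<Rightarrow> 'p::comm_monoid_add \<times> 'q::comm_monoid_add"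
  by (induction ds) auto

lemma sum_list_mem: "(\<And>d. d \<in> set ds \<Longrightarrow> f d \<in> V \<times> UNIV) \<Longrightarrow> (\<Sum>d\<leftarrow>ds. f d) \<in> V \<times> UNIV" for f :: "'t \<Rightarrow> 'e \<times> 'c"
  by (induction ds) (auto intro: Z.V_add Z.V_0 simp del: mem_Times_iff)

lemma DPhi_update_sum_list:
  fixes f :: "'t \<Rightarrow> 'e \<times> 'c"
  assumes X: "x \<in> Om" "set zs \<subseteq> V \<times> UNIV" "i < length zs"
  shows "(\<And>d. d \<in> set ds \<Longrightarrow> f d \<in> V \<times> UNIV) \<Longrightarrow>
    DPhi x (zs[i := (\<Sum>d\<leftarrow>ds. f d)]) = (\<Sum>d\<leftarrow>ds. DPhi x (zs[i := f d]))"
proof (induction ds)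
  case Nil
  then show ?case using Z.btower_scale[OF DPhi X, of 0 0] Z.V_0 by simp
next
  case (Cons d ds)
  then show ?case
    using Z.btower_add[OF DPhi X, of "f d" "\<Sum>d\<leftarrow>ds. f d"] sum_list_mem[of ds f] by simp
qed

lemma has_derivative_Pair_0:
  assumes "(f has_derivative (\<lambda>t. sC t a)) (at 0)"
  shows "((\<lambda>t. (0, f t)) has_derivative (\<lambda>t. sZ t (0, a))) (at 0)"
  using has_derivative_Pair[OF has_derivative_const[of 0] assms] by (simp add: scale_pair_def)

text \<open>Subtracting the equations at \<open>t\<close> and at \<open>0\<close> shows that the
  increment of the solution solves the equation at \<open>t\<close> with right-hand side
  \<open>k t\<close>. Its quotient, compared with \<open>w\<close>, leaves a residual tending to
  \<open>0\<close>, and \<open>solve_estimate\<close> is uniform in the point.\<close>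

lemma solve_has_derivative:
  assumes p: "p \<in> W" and h: "h \<in> V"
    and v: "(v has_derivative (\<lambda>t. sC t v')) (at 0)"
  shows "((\<lambda>t. Lop (p + sE t h) (v t)) has_derivative
    (\<lambda>t. sC t (Lop p (DPhi (p, y p) [Xdot p h, (0, Lop p (v 0))]) + Lop p v'))) (at 0)"
proof -
  define u where "u t = Lop (p + sE t h) (v t)" for t
  define k' where "k' = DPhi (p, y p) [Xdot p h, (0, u 0)] + v'"
  define w where "w = Lop p k'"
  have u0: "u 0 = Lop p (v 0)" by (simp add: u_def)
  define k where "k t = v t - v 0 + (Aop (p + sE t h) (u 0) - Aop p (u 0))" for t
  have Ader: "((\<lambda>t. Aop (p + sE t h) c) has_derivative (\<lambda>t. sC t (DPhi (p, y p) [Xdot p h, (0, c)]))) (at 0)" for c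
    unfolding Aop_def by (rule DPhi_point_has_derivative[OF p h]) (simp add: V_0)
  have k0: "k 0 = 0" by (simp add: k_def)
  have kt: "(k has_derivative (\<lambda>t. sC t k')) (at 0)"
    unfolding k_def
    by (rule has_derivative_eq_rhs)
      (rule has_derivative_add[OF has_derivative_diff[OF v has_derivative_const]
            has_derivative_diff[OF Ader has_derivative_const]],
       simp add: k'_def F.scale_right_distrib add.commute)
  have "((\<lambda>t. sC (inverse t) (u t - u 0) - w) \<longlongrightarrow> 0) (at 0)"
  proof (rule Lim_null_comparison)
    let ?B = "\<lambda>t. 2 * norm ((sC (inverse t) (k t - k 0) - k') + (Aop (p + sE t h) w - Aop (p + sE 0 h) w))"
    have "(?B \<longlongrightarrow> 2 * norm ((k' - k') + (Aop (p + sE 0 h) w - Aop (p + sE 0 h) w))) (at 0)"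
      using kt F.has_derivative_scale_tendsto[OF Ader[of w]]
      unfolding F.has_derivative_scale_iff by (intro tendsto_intros)
    then show "(?B \<longlongrightarrow> 0) (at 0)" by simp
    show "\<forall>\<^sub>F t in at 0. norm (sC (inverse t) (u t - u 0) - w) \<le> ?B t"
      using eventually_line[OF openin_W p h] eventually_neq_at_within[of 0 0 UNIV]
    proof eventually_elim
      case (elim t)
      let ?q = "p + sE t h"
      have "u t - Aop ?q (u t) = v t" and "u 0 - Aop p (u 0) = v 0"
        using Lop_eq[OF elim(1), of "v t"] Lop_eq[OF p, of "v 0"] by (simp_all add: u_def algebra_simps)
      then have e1: "(u t - u 0) - Aop ?q (u t - u 0) = k t"
        unfolding Aop_diff[OF elim(1)] k_def by (simp add: algebra_simps)
      have e2: "w - Aop p w = k'" using Lop_eq[OF p, of k'] by (simp add: w_def algebra_simps)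
      define g where "g = sC (inverse t) (u t - u 0) - w"
      have "g - Aop ?q g = sC (inverse t) ((u t - u 0) - Aop ?q (u t - u 0)) - (w - Aop ?q w)"
        by (simp add: g_def Aop_diff[OF elim(1)] Aop_scale[OF elim(1)] F.scale_right_diff_distrib)
      also have "\<dots> = (sC (inverse t) (k t - k 0) - k') + (Aop ?q w - Aop (p + sE 0 h) w)"
        unfolding e1 e2[symmetric] k0 by simp
      finally show ?case using solve_estimate[OF elim(1), of g] by (simp add: g_def)
    qed
  qed
  then have "(u has_derivative (\<lambda>t. sC t w)) (at 0)"
    unfolding F.has_derivative_scale_iff by (simp add: LIM_zero_iff)
  then show ?thesis using p by (simp add: u_def[abs_def] w_def k'_def Lop_add)
qed

text \<open>\<open>Deriv\<close> follows from the product rule for multilinear operators and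
  \<open>Solve\<close> from \<open>solve_has_derivative\<close>. Terms have no addition, so a sum
  that appears inside an argument has to be pulled out by multilinearity.\<close>

lemma ival_has_derivative:
  assumes p: "p \<in> W" and h: "h \<in> V" and us: "set us \<subseteq> V" "length us = n"
  shows "iexp_wf n e \<Longrightarrow> ((\<lambda>t. ival e (p + sE t h) us) has_derivative
    (\<lambda>t. sZ t (\<Sum>d\<leftarrow>iexp_deriv n e. ival d p (us @ [h])))) (at 0)"
proof (induction e)
  case Point
  then show ?case using point_has_derivative[OF p h] us p by (simp add: sum_list_point_deriv)
next
  case (Dir i)
  then show ?case by simp
next
  case (Solve e)
  have "((\<lambda>t. snd (ival e (p + sE t h) us)) has_derivative
    (\<lambda>t. snd (sZ t (\<Sum>d\<leftarrow>iexp_deriv n e. ival d p (us @ [h]))))) (at 0)"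
    using Solve by (intro has_derivative_snd) auto
  then have "((\<lambda>t. snd (ival e (p + sE t h) us)) has_derivative
    (\<lambda>t. sC t (\<Sum>d\<leftarrow>iexp_deriv n e. snd (ival d p (us @ [h]))))) (at 0)"
    by (simp add: snd_sum_list)
  from has_derivative_Pair_0[OF solve_has_derivative[OF p h this]]
  have 1: "((\<lambda>t. ival (Solve e) (p + sE t h) us) has_derivative
    (\<lambda>t. sZ t (0, Lop p (DPhi (p, y p) [Xdot p h, ival (Solve e) p us]) +
       (\<Sum>d\<leftarrow>iexp_deriv n e. Lop p (snd (ival d p (us @ [h]))))))) (at 0)"
    by (simp add: Lop_sum_list[OF p])
  have wf: "iexp_wf (length us) (Solve e)" using Solve us by simp
  have mem: "ival (Solve e) p us \<in> V \<times> UNIV" by (rule ival_mem[OF p us(1) wf])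
  have mem': "ival d p (us @ [h]) \<in> V \<times> UNIV" if "d \<in> set (point_deriv n)" for d
    using iexp_wf_point_deriv[OF that] us h by (intro ival_mem p) auto
  have "DPhi (p, y p) [Xdot p h, ival (Solve e) p us] =
     (\<Sum>d\<leftarrow>point_deriv n. DPhi (p, y p) [ival d p (us @ [h]), ival (Solve e) p us])"
    using DPhi_update_sum_list[OF y_in[OF p], of "[0, ival (Solve e) p us]" 0 "point_deriv n" "\<lambda>d. ival d p (us @ [h])"]
      mem mem' sum_list_point_deriv[OF p us(2), of h] Z.V_0
    by (simp add: zero_prod_def)
  then have "Lop p (DPhi (p, y p) [Xdot p h, ival (Solve e) p us]) =
     (\<Sum>d\<leftarrow>point_deriv n. Lop p (DPhi (p, y p) [ival d p (us @ [h]), ival (Solve e) p us]))"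
    by (simp add: Lop_sum_list[OF p])
  moreover have "ival (Solve e) p (us @ [h]) = ival (Solve e) p us" by (rule ival_append[OF wf])
  ultimately have "(0, Lop p (DPhi (p, y p) [Xdot p h, ival (Solve e) p us]) +
       (\<Sum>d\<leftarrow>iexp_deriv n e. Lop p (snd (ival d p (us @ [h]))))) = 
      (\<Sum>d\<leftarrow>iexp_deriv n (Solve e). ival d p (us @ [h]))"
    by (intro prod_eqI) (simp_all add: fst_sum_list snd_sum_list ival_Deriv o_def)
  with 1 show ?case by simp
next
  case (Deriv es)
  let ?X = "\<lambda>t. (p + sE t h, y (p + sE t h))"
  let ?us = "\<lambda>t. map (\<lambda>e. ival e (p + sE t h) us) es"
  let ?du = "map (\<lambda>e. \<Sum>d\<leftarrow>iexp_deriv n e. ival d p (us @ [h])) es"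
  have wfe: "iexp_wf n e" if "e \<in> set es" for e using that Deriv.prems by (auto simp: list_all_iff)
  have ev: "\<forall>\<^sub>F t in at 0. p + sE t h \<in> W" by (rule eventually_line[OF openin_W p h])
  have mem: "set (map (\<lambda>e. ival e q us) es) \<subseteq> V \<times> UNIV" if "q \<in> W" for q
    unfolding set_map using ival_mem[OF that us(1)] wfe us(2) by blast
  have dmem: "(\<Sum>d\<leftarrow>iexp_deriv n e. ival d p (us @ [h])) \<in> V \<times> UNIV" if "e \<in> set es" for e
    using iexp_wf_deriv[OF wfe[OF that]] us h by (intro sum_list_mem ival_mem p) auto
  obtain C where C: "C \<ge> 0" "\<And>x us. x \<in> Om \<Longrightarrow> length us = length es \<Longrightarrow> set us \<subseteq> V \<times> UNIV \<Longrightarrow>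
    norm (DPhi x us) \<le> C * prod_list (map norm us)"
    using Z.btower_bound[OF DPhi, of "length es"] by blast
  have "((\<lambda>t. DPhi (?X t) (?us t)) has_derivative
     (\<lambda>t. sC t (DPhi (p, y p) (Xdot p h # ?us 0) +
        (\<Sum>i\<leftarrow>[0..<length es]. DPhi (?X 0) ((?us 0)[i := ?du ! i]))))) (at 0)"
  proof (rule ZC.multilinear_has_derivative[OF Z.subspace_V, where A=Om and C=C
        and Op="\<lambda>zs x. DPhi x zs" and Op'="\<lambda>zs. DPhi (p, y p) (Xdot p h # zs)"])
    show "\<forall>\<^sub>F t in at 0. ?X t \<in> Om" using ev by eventually_elim (rule y_in)
    show "?X 0 \<in> Om" using y_in[OF p] by simp
    show "\<forall>\<^sub>F t in at 0. set (?us t) \<subseteq> V \<times> UNIV" using ev by eventually_elim (rule mem)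
    show "set (?us 0) \<subseteq> V \<times> UNIV" using mem[OF p] by simp
    show "set ?du \<subseteq> V \<times> UNIV" unfolding set_map using dmem by blast
    show "((\<lambda>t. ?us t ! i) has_derivative (\<lambda>t. sZ t (?du ! i))) (at 0)" if "i < length es" for i
      using Deriv.IH[of "es ! i"] wfe[of "es ! i"] that by simp
    show "norm (DPhi x vs) \<le> C * prod_list (map norm vs)"
      if "length vs = length es" "set vs \<subseteq> V \<times> UNIV" "x \<in> Om" for vs x using C(2) that by blast
    show "((\<lambda>t. DPhi (?X t) vs) has_derivative (\<lambda>t. sC t (DPhi (p, y p) (Xdot p h # vs)))) (at 0)"
      if "set vs \<subseteq> V \<times> UNIV" for vs by (rule DPhi_point_has_derivative[OF p h that])
  qed (auto intro: Z.btower_add[OF DPhi] Z.btower_scale[OF DPhi])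
  from has_derivative_Pair_0[OF this]
  have 1: "((\<lambda>t. ival (Deriv es) (p + sE t h) us) has_derivative
    (\<lambda>t. sZ t (0, DPhi (p, y p) (Xdot p h # ?us 0) +
        (\<Sum>i\<leftarrow>[0..<length es]. DPhi (?X 0) ((?us 0)[i := ?du ! i]))))) (at 0)"
    by (simp only: ival_Deriv)
  have vals: "map (\<lambda>e. ival e p (us @ [h])) es = map (\<lambda>e. ival e p us) es"
    using wfe us by (auto simp: ival_append)
  have mem': "ival d p (us @ [h]) \<in> V \<times> UNIV" if "d \<in> set (point_deriv n)" for d
    using iexp_wf_point_deriv[OF that] us h by (intro ival_mem p) auto
  have a: "DPhi (p, y p) (Xdot p h # map (\<lambda>e. ival e p us) es) = (\<Sum>d\<leftarrow>point_deriv n. snd (ival (Deriv (d # es)) p (us @ [h])))"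
    using DPhi_update_sum_list[OF y_in[OF p], of "0 # ?us 0" 0 "point_deriv n" "\<lambda>d. ival d p (us @ [h])"]
      mem[OF p] mem' sum_list_point_deriv[OF p us(2), of h] Z.V_0
    by (simp add: ival_Deriv vals zero_prod_def)
  have b: "DPhi (?X 0) ((?us 0)[i := ?du ! i]) =
      (\<Sum>d\<leftarrow>iexp_deriv n (es ! i). snd (ival (Deriv (es[i := d])) p (us @ [h])))" if i: "i < length es" for i
  proof -
    have esi: "es ! i \<in> set es" using i by simp
    have "DPhi (p, y p) ((?us 0)[i := \<Sum>d\<leftarrow>iexp_deriv n (es ! i). ival d p (us @ [h])]) =
      (\<Sum>d\<leftarrow>iexp_deriv n (es ! i). DPhi (p, y p) ((?us 0)[i := ival d p (us @ [h])]))"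
      using mem[OF p] i iexp_wf_deriv[OF wfe[OF esi]] us h
      by (intro DPhi_update_sum_list[OF y_in[OF p]] ival_mem p) auto
    then show ?thesis using i by (simp add: ival_Deriv map_update vals)
  qed
  have "(\<Sum>i\<leftarrow>[0..<length es]. DPhi (?X 0) ((?us 0)[i := ?du ! i])) =
     (\<Sum>i\<leftarrow>[0..<length es]. \<Sum>d\<leftarrow>iexp_deriv n (es ! i). snd (ival (Deriv (es[i := d])) p (us @ [h])))"
    by (intro arg_cong[of _ _ sum_list] map_cong refl b) auto
  moreover have "(\<Sum>d\<leftarrow>concat (map2 (\<lambda>i ds. map (\<lambda>d. Deriv (es[i := d])) ds) [0..<length es] (map (iexp_deriv n) es)). snd (ival d p (us @ [h])))
     = (\<Sum>i\<leftarrow>[0..<length es]. \<Sum>d\<leftarrow>iexp_deriv n (es ! i). snd (ival (Deriv (es[i := d])) p (us @ [h])))"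
  proof -
    have sum_concat: "(\<Sum>s\<leftarrow>concat xss. f s) = (\<Sum>xs\<leftarrow>xss. \<Sum>s\<leftarrow>xs. f s)" for xss and f :: "iexp \<Rightarrow> 'c"
      by (induction xss) auto
    have "map2 (\<lambda>i ds. map (\<lambda>d. Deriv (es[i := d])) ds) [0..<length es] (map (iexp_deriv n) es)
      = map (\<lambda>i. map (\<lambda>d. Deriv (es[i := d])) (iexp_deriv n (es ! i))) [0..<length es]"
      by (intro nth_equalityI) auto
    then show ?thesis by (simp add: sum_concat o_def)
  qed
  ultimately have "(0, DPhi (p, y p) (Xdot p h # ?us 0) +
        (\<Sum>i\<leftarrow>[0..<length es]. DPhi (?X 0) ((?us 0)[i := ?du ! i]))) =
      (\<Sum>d\<leftarrow>iexp_deriv n (Deriv es). ival d p (us @ [h]))"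
  proof (intro prod_eqI, goal_cases)
    case 1
    have "fst (ival d p (us @ [h])) = 0" if "d \<in> set (iexp_deriv n (Deriv es))" for d
      using that by (auto simp: ival_Deriv)
    then have *: "map (\<lambda>d. fst (ival d p (us @ [h]))) (iexp_deriv n (Deriv es)) = map (\<lambda>d. 0) (iexp_deriv n (Deriv es))"
      by (intro map_cong) auto
    show ?case by (simp only: fst_sum_list fst_conv * sum_list_0)
  next
    case 2
    then show ?case by (simp add: snd_sum_list a o_def)
  qed
  with 1 show ?case by (simp only:)
qed

lemma ival_bound:
  "iexp_wf n e \<Longrightarrow> \<exists>C\<ge>0. \<forall>p\<in>W. \<forall>us. length us = n \<and> set us \<subseteq> V \<and> (\<forall>v\<in>set us. norm v \<le> 1) \<longrightarrow> norm (ival e p us) \<le> C"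
proof (induction e)
  case Point
  obtain B where B: "\<And>p. p \<in> W \<Longrightarrow> norm p \<le> B" using bounded_W by (auto simp: bounded_iff)
  obtain C where C0: "C \<ge> 0" "\<And>x us. x \<in> Om \<Longrightarrow> length us = 0 \<Longrightarrow> set us \<subseteq> V \<times> UNIV \<Longrightarrow>
    norm (DPhi x us) \<le> C * prod_list (map norm us)"
    using Z.btower_bound[OF DPhi, of 0] by blast
  have C: "C \<ge> 0" "\<And>x. x \<in> Om \<Longrightarrow> norm (DPhi x []) \<le> C"
    using C0(1) C0(2)[of _ "[]"] by simp_all
  have "norm (p, y p) \<le> \<bar>B\<bar> + C" if "p \<in> W" for p
  proof -
    have "norm (p, y p) \<le> norm p + norm (y p)" unfolding norm_Pair by (rule sqrt_sum_squares_le_sum) auto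
    also have "norm (y p) = norm (DPhi (p, y p) [])" using Phi[OF y_in[OF that]] y_fixed[OF that] by simp
    finally show ?thesis using B[OF that] C(2)[OF y_in[OF that]] by linarith
  qed
  then show ?case using C(1) by (intro exI[of _ "\<bar>B\<bar> + C"]) auto
next
  case (Dir i)
  then show ?case by (intro exI[of _ 1]) (auto simp: norm_Pair)
next
  case (Solve e)
  then obtain C where C: "C \<ge> 0" "\<And>p us. p \<in> W \<Longrightarrow> length us = n \<Longrightarrow> set us \<subseteq> V \<Longrightarrow> (\<forall>v\<in>set us. norm v \<le> 1) \<Longrightarrow> norm (ival e p us) \<le> C"
    by auto
  show ?case
  proof (intro exI[of _ "2 * C"] conjI ballI allI impI)
    fix p us assume p: "p \<in> W" and us: "length us = n \<and> set us \<subseteq> V \<and> (\<forall>v\<in>set us. norm v \<le> 1)"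
    have "norm (Lop p (snd (ival e p us))) \<le> 2 * norm (snd (ival e p us))" by (rule Lop_bound[OF p])
    also have "\<dots> \<le> 2 * norm (ival e p us)"
      using norm_snd_le[of "snd (ival e p us)" "fst (ival e p us)"] by simp
    finally show "norm (ival (Solve e) p us) \<le> 2 * C"
      using C(2)[OF p, of us] us by (simp add: norm_Pair)
  qed (use C in simp)
next
  case (Deriv es)
  have wfe: "iexp_wf n e" if "e \<in> set es" for e using that Deriv.prems by (auto simp: list_all_iff)
  have "\<exists>C\<ge>0. \<forall>p\<in>W. \<forall>us. length us = n \<and> set us \<subseteq> V \<and> (\<forall>v\<in>set us. norm v \<le> 1) \<longrightarrow>
     prod_list (map (\<lambda>e. norm (ival e p us)) ds) \<le> C" if "set ds \<subseteq> set es" for ds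
    using that
  proof (induction ds)
    case Nil then show ?case by (intro exI[of _ 1]) auto
  next
    case (Cons d ds)
    then obtain C where C: "C \<ge> 0" "\<forall>p\<in>W. \<forall>us. length us = n \<and> set us \<subseteq> V \<and> (\<forall>v\<in>set us. norm v \<le> 1) \<longrightarrow>
      prod_list (map (\<lambda>e. norm (ival e p us)) ds) \<le> C" by auto
    obtain C' where C': "C' \<ge> 0" "\<forall>p\<in>W. \<forall>us. length us = n \<and> set us \<subseteq> V \<and> (\<forall>v\<in>set us. norm v \<le> 1) \<longrightarrow>
      norm (ival d p us) \<le> C'" using Deriv.IH[of d] wfe[of d] Cons.prems by auto
    show ?case using C C' by (intro exI[of _ "C' * C"]) (auto intro!: mult_mono prod_list_nonneg)
  qed
  from this[of es] obtain C where C: "C \<ge> 0" "\<And>p us. p \<in> W \<Longrightarrow> length us = n \<Longrightarrow> set us \<subseteq> V \<Longrightarrow> (\<forall>v\<in>set us. norm v \<le> 1) \<Longrightarrow>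
     prod_list (map (\<lambda>e. norm (ival e p us)) es) \<le> C" by auto
  obtain K where K: "K \<ge> 0" "\<And>x us. x \<in> Om \<Longrightarrow> length us = length es \<Longrightarrow> set us \<subseteq> V \<times> UNIV \<Longrightarrow>
    norm (DPhi x us) \<le> K * prod_list (map norm us)"
    using Z.btower_bound[OF DPhi, of "length es"] by blast
  show ?case
  proof (intro exI[of _ "K * C"] conjI ballI allI impI)
    fix p us assume p: "p \<in> W" and us: "length us = n \<and> set us \<subseteq> V \<and> (\<forall>v\<in>set us. norm v \<le> 1)"
    have "set (map (\<lambda>e. ival e p us) es) \<subseteq> V \<times> UNIV"
      unfolding set_map using ival_mem[OF p, of us] us wfe by blast
    then have "norm (ival (Deriv es) p us) \<le> K * prod_list (map norm (map (\<lambda>e. ival e p us) es))"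
      using K(2)[OF y_in[OF p], of "map (\<lambda>e. ival e p us) es"] by (simp add: ival_Deriv norm_Pair)
    also have "\<dots> \<le> K * C" using C(2)[OF p, of us] us K(1) by (intro mult_left_mono) (auto simp: o_def)
    finally show "norm (ival (Deriv es) p us) \<le> K * C" .
  qed (use C K in simp)
qed

theorem bsmooth_implicit: "bsmooth sE sC V W y"
proof -
  interpret EZ: tower_spaces sE sZ V
    by (intro tower_spaces.intro tower_spaces_axioms.intro E.banach_over_axioms
        Z.E.banach_over_axioms subspace_V)
  have "bsmooth sE sZ V W (\<lambda>p. ival Point p [])"
  proof (rule EZ.bsmooth_terms[where good=iexp_wf and der=iexp_deriv])
    show "((\<lambda>t. ival s (x + sE t h) us) has_derivative (\<lambda>t. sZ t (\<Sum>s'\<leftarrow>iexp_deriv n s. ival s' x (us @ [h])))) (at 0)"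
      if "iexp_wf n s" "x \<in> W" "length us = n" "set us \<subseteq> V" "h \<in> V" for n s x us h
      using ival_has_derivative that by blast
    show "\<exists>C. \<forall>x\<in>W. \<forall>us. length us = n \<and> set us \<subseteq> V \<and> (\<forall>v\<in>set us. norm v \<le> 1) \<longrightarrow> norm (ival s x us) \<le> C"
      if "iexp_wf n s" for n s using ival_bound[OF that] by blast
  qed (auto intro: iexp_wf_deriv openin_W)
  then have "bsmooth sE sC V W (\<lambda>p. snd (ival Point p []))"
    by (rule EZ.bsmooth_linear[OF F.banach_over_axioms]) (simp add: bounded_klinear_def bounded_linear_snd)
  then show ?thesis by simp
qed

end

section \<open>Bounded inverses and projections\<close>

text \<open>The open mapping theorem on closed subspaces, for a map that is linear only there.\<close>

theorem bounded_below_closed_range: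
  fixes T :: "'x::banach \<Rightarrow> 'y::banach"
  assumes V: "subspace V" "closed V" and Y: "closed (T ` V)"
    and add: "\<And>x y. x \<in> V \<Longrightarrow> y \<in> V \<Longrightarrow> T (x + y) = T x + T y"
    and scl: "\<And>c x. x \<in> V \<Longrightarrow> T (c *\<^sub>R x) = c *\<^sub>R T x"
    and cont: "continuous_on V T" and inj: "inj_on T V"
  obtains K where "K \<ge> 0" "\<And>v. v \<in> V \<Longrightarrow> norm v \<le> K * norm (T v)"
proof -
  let ?Y = "T ` V"
  have Vd: "x - y \<in> V" if "x \<in> V" "y \<in> V" for x y using V that by (simp add: subspace_diff)
  have Vs: "c *\<^sub>R x \<in> V" if "x \<in> V" for c x using V that by (simp add: subspace_scale)
  have Va: "x + y \<in> V" if "x \<in> V" "y \<in> V" for x y using V that by (simp add: subspace_add)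
  have V0: "0 \<in> V" using V by (simp add: subspace_0)
  have diff: "T (x - y) = T x - T y" if "x \<in> V" "y \<in> V" for x y
    using add[OF Vd[OF that] that(2)] by simp
  have T0: "T 0 = 0" using diff[OF V0 V0] by simp
  \<comment> \<open>The range is complete because it is closed, so Baire's theorem gives one of
    these closed sets an interior point relative to the range.\<close>
  define A where "A n = closure (T ` (V \<inter> cball 0 (real n)))" for n
  have AY: "A n \<subseteq> ?Y" for n unfolding A_def using Y by (intro closure_minimal) auto
  have UA: "(\<Union>n. A n) = ?Y"
  proof
    show "?Y \<subseteq> (\<Union>n. A n)"
    proof
      fix y assume "y \<in> ?Y"
      then obtain v where v: "v \<in> V" "y = T v" by blast
      obtain n where "norm v \<le> real n" using real_arch_simple by blast
      with v have "y \<in> A n" unfolding A_def by (intro subsetD[OF closure_subset]) auto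
      then show "y \<in> (\<Union>n. A n)" by blast
    qed
  qed (use AY in blast)
  have cm: "completely_metrizable_space (top_of_set ?Y)"
    using completely_metrizable_space_closedin[OF completely_metrizable_space_euclidean, of ?Y] Y by simp
  have "\<exists>n. top_of_set ?Y interior_of A n \<noteq> {}"
  proof (rule ccontr)
    assume none: "\<nexists>n. top_of_set ?Y interior_of A n \<noteq> {}"
    have "top_of_set ?Y interior_of \<Union>(range A) = {}"
    proof (rule Baire_category_alt)
      show "closedin (top_of_set ?Y) S \<and> top_of_set ?Y interior_of S = {}" if S: "S \<in> range A" for S
      proof -
        obtain n where "S = A n" using S by blast
        moreover have "closedin (top_of_set ?Y) (A n)" using AY by (auto simp: A_def closedin_closed)
        ultimately show ?thesis using none by blast
      qed
    qed (use cm in auto)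
    then have "top_of_set ?Y interior_of ?Y = {}" using UA by simp
    moreover have "top_of_set ?Y interior_of ?Y = ?Y"
      using interior_of_topspace[of "top_of_set ?Y"] by simp
    ultimately show False using V0 by blast
  qed
  then obtain n y0 where "y0 \<in> top_of_set ?Y interior_of A n" by blast
  then obtain U where U: "openin (top_of_set ?Y) U" "y0 \<in> U" "U \<subseteq> A n"
    by (auto simp: interior_of_def)
  then have "\<exists>\<rho>>0. ball y0 \<rho> \<inter> ?Y \<subseteq> U" and y0: "y0 \<in> ?Y"
    unfolding openin_contains_ball by auto
  with U(3) obtain \<rho> where rho: "\<rho> > 0" "ball y0 \<rho> \<inter> ?Y \<subseteq> A n" by auto
  \<comment> \<open>Subtracting approximants of \<open>y0\<close> from those of
    \<open>y0 + y\<close> moves the ball of density to the origin; this doubles the norm bound to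
    \<open>2 * real n\<close>.\<close>
  have approx: "\<exists>x\<in>V. norm x \<le> 2 * real n \<and> norm (T x - y) < d"
    if y: "y \<in> ?Y" "norm y < \<rho>" and d: "d > 0" for y d
  proof -
    have "y0 + y \<in> ?Y" using y y0 by (auto simp: add[symmetric] intro!: imageI Va)
    then have "y0 + y \<in> ball y0 \<rho> \<inter> ?Y" "y0 \<in> ball y0 \<rho> \<inter> ?Y" using rho y y0 by (simp_all add: dist_norm)
    then have "y0 + y \<in> A n" "y0 \<in> A n" using rho(2) by blast+
    then obtain z1 z2 where "z1 \<in> T ` (V \<inter> cball 0 (real n))" "dist z1 (y0 + y) < d / 2"
      "z2 \<in> T ` (V \<inter> cball 0 (real n))" "dist z2 y0 < d / 2"
      unfolding A_def closure_approachable using half_gt_zero[OF d] by blast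
    then obtain x1 x2 where x: "x1 \<in> V" "norm x1 \<le> n" "dist (T x1) (y0 + y) < d / 2"
      "x2 \<in> V" "norm x2 \<le> n" "dist (T x2) y0 < d / 2"
      by auto
    have e: "T (x1 - x2) - y = (T x1 - (y0 + y)) - (T x2 - y0)" using x by (simp add: diff)
    have "norm (T (x1 - x2) - y) < d"
      using x(3,6) norm_triangle_ineq4[of "T x1 - (y0 + y)" "T x2 - y0"] unfolding e dist_norm by linarith
    moreover have "norm (x1 - x2) \<le> 2 * real n" using x norm_triangle_ineq4[of x1 x2] by simp
    ultimately show ?thesis using Vd x by blast
  qed
  \<comment> \<open>A nonzero vector is rescaled to norm \<open>\<rho> / 2\<close> and approximated
    within \<open>\<rho> / 4\<close>; scaling back halves the error and produces this
    constant.\<close>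
  define C where "C = 4 * real n / \<rho>"
  have C0: "C \<ge> 0" using rho by (simp add: C_def)
  have half: "\<exists>x\<in>V. norm x \<le> C * norm y \<and> norm (y - T x) \<le> norm y / 2" if y: "y \<in> ?Y" for y
  proof (cases "y = 0")
    case True then show ?thesis using V0 T0 by (intro bexI[of _ 0]) auto
  next
    case False
    define c where "c = \<rho> / (2 * norm y)"
    have c: "c > 0" using False rho by (simp add: c_def)
    obtain v where v: "v \<in> V" "y = T v" using y by blast
    have "c *\<^sub>R y \<in> ?Y" using v by (auto simp: scl[symmetric] intro!: imageI Vs)
    moreover have "norm (c *\<^sub>R y) < \<rho>" using False rho c by (simp add: c_def)
    ultimately obtain x where x: "x \<in> V" "norm x \<le> 2 * real n" "norm (T x - c *\<^sub>R y) < \<rho> / 4"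
      using approx[of "c *\<^sub>R y" "\<rho> / 4"] rho by auto
    define x' where "x' = inverse c *\<^sub>R x"
    have "y - T x' = - (inverse c *\<^sub>R (T x - c *\<^sub>R y))"
      using c x by (simp add: x'_def scl scaleR_diff_right)
    then have "norm (y - T x') = norm (T x - c *\<^sub>R y) / c" using c by (simp add: divide_inverse mult.commute)
    also have "\<dots> \<le> (\<rho> / 4) / c" using x c by (intro divide_right_mono) auto
    also have "\<dots> = norm y / 2" using False rho by (simp add: c_def)
    finally have "norm (y - T x') \<le> norm y / 2" .
    moreover have "norm x' \<le> C * norm y"
    proof -
      have "norm x' = norm x / c" using c by (simp add: x'_def divide_inverse mult.commute)
      also have "\<dots> \<le> 2 * real n / c" using x c by (intro divide_right_mono) auto
      also have "\<dots> = C * norm y" using False rho by (simp add: c_def C_def)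
      finally show ?thesis .
    qed
    moreover have "x' \<in> V" unfolding x'_def by (rule Vs[OF x(1)])
    ultimately show ?thesis by blast
  qed
  then obtain \<phi> where phi: "\<And>y. y \<in> ?Y \<Longrightarrow> \<phi> y \<in> V" "\<And>y. y \<in> ?Y \<Longrightarrow> norm (\<phi> y) \<le> C * norm y"
    "\<And>y. y \<in> ?Y \<Longrightarrow> norm (y - T (\<phi> y)) \<le> norm y / 2" by metis
  have "norm v \<le> (2 * C) * norm (T v)" if v: "v \<in> V" for v
  proof -
    \<comment> \<open>The residuals halve in each step, so the corrections sum to a preimage of
      \<open>T v\<close> of norm at most \<open>2 * C * norm (T v)\<close>. Injectivity identifies
      it with \<open>v\<close>.\<close>
    define ys where "ys = rec_nat (T v) (\<lambda>_ y. y - T (\<phi> y))"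
    have ys: "ys 0 = T v" "ys (Suc i) = ys i - T (\<phi> (ys i))" for i by (simp_all add: ys_def)
    have ysY: "ys i \<in> ?Y" for i
    proof (induction i)
      case 0 then show ?case using v by (simp add: ys)
    next
      case (Suc i)
      then obtain u where "u \<in> V" "ys i = T u" by blast
      then show ?case using phi(1)[OF Suc] by (auto simp: ys diff[symmetric] intro!: imageI Vd)
    qed
    have nys: "norm (ys i) \<le> norm (T v) * (1/2) ^ i" for i
    proof (induction i)
      case (Suc i)
      then show ?case using phi(3)[OF ysY[of i]] by (simp add: ys)
    qed (simp add: ys)
    define x where "x i = \<phi> (ys i)" for i
    have xV: "x i \<in> V" for i unfolding x_def by (rule phi(1)[OF ysY])
    have nx: "norm (x i) \<le> C * norm (T v) * (1/2) ^ i" for i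
      unfolding x_def using order_trans[OF phi(2)[OF ysY] mult_left_mono[OF nys C0]] by (simp add: mult_ac)
    have gs: "summable (\<lambda>i. C * norm (T v) * (1/2::real) ^ i)" by (intro summable_mult summable_geometric) auto
    have sx: "summable x" by (rule summable_comparison_test'[OF gs]) (use nx in auto)
    define s where "s = suminf x"
    have psV: "(\<Sum>i<m. x i) \<in> V" for m using xV V by (intro subspace_sum) auto
    have lim: "(\<lambda>m. \<Sum>i<m. x i) \<longlonglongrightarrow> s" unfolding s_def by (rule summable_LIMSEQ[OF sx])
    have sV: "s \<in> V" by (rule closed_sequentially[OF V(2) _ lim]) (use psV in auto)
    have Tps: "T (\<Sum>i<m. x i) = T v - ys m" for m
    proof (induction m)
      case 0 then show ?case using T0 by (simp add: ys)
    next
      case (Suc m)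
      then show ?case using add[OF psV xV, of m m] by (simp add: ys x_def)
    qed
    have "(\<lambda>m. T (\<Sum>i<m. x i)) \<longlonglongrightarrow> T s"
      by (rule continuous_on_tendsto_compose[OF cont lim sV]) (use psV in auto)
    moreover have "(\<lambda>m. T v - ys m) \<longlonglongrightarrow> T v - 0"
    proof (intro tendsto_intros Lim_null_comparison[of ys])
      show "\<forall>\<^sub>F m in sequentially. norm (ys m) \<le> norm (T v) * (1/2) ^ m" using nys by auto
      show "(\<lambda>m. norm (T v) * (1/2) ^ m) \<longlonglongrightarrow> 0"
        by (intro tendsto_mult_right_zero LIMSEQ_power_zero) auto
    qed
    ultimately have "T s = T v" unfolding Tps using LIMSEQ_unique by fastforce
    then have "s = v" using inj sV v by (auto dest: inj_onD)
    have "norm s \<le> (\<Sum>i. C * norm (T v) * (1/2) ^ i)"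
      unfolding s_def by (rule norm_suminf_le[OF nx gs])
    also have "\<dots> = (2 * C) * norm (T v)" using suminf_mult[of "\<lambda>i. (1/2::real) ^ i" "C * norm (T v)"]
      by (simp add: suminf_geometric summable_geometric)
    finally show ?thesis using \<open>s = v\<close> by simp
  qed
  with C0 show ?thesis by (intro that[of "2 * C"]) auto
qed

lemma (in banach_over) real_subspace: "subspace V \<Longrightarrow> Real_Vector_Spaces.subspace V"
  unfolding subspace_def Real_Vector_Spaces.subspace_def
  by (metis scale_of_real)

section \<open>Projections onto closed summands\<close>

context banach_over
begin

lemma direct_sum_unique:
  assumes "direct_sum V W U" "subspace V" "subspace W" "v \<in> V" "w \<in> W" "v' \<in> V" "w' \<in> W" "v + w = v' + w'"
  shows "v = v'" "w = w'"
proof -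
  have "v - v' = w' - w" using assms(8) by (simp add: algebra_simps)
  moreover have "v - v' \<in> V" "w' - w \<in> W" using assms by (auto intro: subspace_diff)
  ultimately have "v - v' \<in> V \<inter> W" by auto
  then have "v - v' = 0" using assms(1) unfolding direct_sum_def by blast
  then show "v = v'" "w = w'" using assms(8) by auto
qed

lemma proj_along_eq:
  assumes "direct_sum V W U" "subspace V" "subspace W" "v \<in> V" "w \<in> W"
  shows "proj_along V W (v + w) = v"
  unfolding proj_along_def
proof (rule the_equality)
  fix r assume "r \<in> V \<and> v + w - r \<in> W"
  then show "r = v" using direct_sum_unique(1)[OF assms(1-3), of r "v + w - r" v w] assms by simp
qed (use assms in simp)

lemma proj_along_props:
  assumes "direct_sum V W U" "subspace V" "subspace W" "u \<in> U"
  shows "proj_along V W u \<in> V" "u - proj_along V W u \<in> W"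
proof -
  obtain v w where "u = v + w" "v \<in> V" "w \<in> W" using assms(1,4) unfolding direct_sum_def by blast
  then show "proj_along V W u \<in> V" "u - proj_along V W u \<in> W"
    using proj_along_eq[OF assms(1-3)] by auto
qed

lemma proj_along_linear:
  assumes "direct_sum V W U" "subspace V" "subspace W" "u \<in> U" "u' \<in> U"
  shows "proj_along V W (u + u') = proj_along V W u + proj_along V W u'"
    and "proj_along V W (scale c u) = scale c (proj_along V W u)"
proof -
  note P = proj_along_props[OF assms(1-3)]
  have "u + u' = (proj_along V W u + proj_along V W u') + ((u - proj_along V W u) + (u' - proj_along V W u'))"
    by simp
  then show "proj_along V W (u + u') = proj_along V W u + proj_along V W u'"
    using P assms by (metis proj_along_eq subspace_add)
  have "scale c u = scale c (proj_along V W u) + scale c (u - proj_along V W u)"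
    by (simp add: scale_right_diff_distrib)
  then show "proj_along V W (scale c u) = scale c (proj_along V W u)"
    using P assms by (metis proj_along_eq subspace_scale)
qed

text \<open>The addition map from \<open>V \<times> W\<close> to \<open>U\<close> is a continuous
  linear bijection between complete spaces, so its inverse is bounded.\<close>

lemma proj_along_bounded:
  assumes ds: "direct_sum V W U" and V: "subspace V" "closed V" and W: "subspace W" "closed W" and U: "closed U"
  obtains K where "\<And>u. u \<in> U \<Longrightarrow> norm (proj_along V W u) \<le> K * norm u"
proof -
  have img: "(\<lambda>p. fst p + snd p) ` (V \<times> W) = U"
    using ds by (force simp: direct_sum_def image_iff)
  obtain K where K: "K \<ge> 0" "\<And>p. p \<in> V \<times> W \<Longrightarrow> norm p \<le> K * norm (fst p + snd p)"
  proof (rule bounded_below_closed_range[of "V \<times> W" "\<lambda>p. fst p + snd p"])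
    show "Real_Vector_Spaces.subspace (V \<times> W)" using real_subspace V W by (simp add: subspace_Times)
    show "closed (V \<times> W)" using V W by (simp add: closed_Times)
    show "closed ((\<lambda>p. fst p + snd p) ` (V \<times> W))" using img U by simp
    show "inj_on (\<lambda>p. fst p + snd p) (V \<times> W)"
      using direct_sum_unique[OF ds V(1) W(1)] by (auto simp: inj_on_def)
  qed (auto simp: algebra_simps intro!: continuous_intros)
  have "norm (proj_along V W u) \<le> K * norm u" if "u \<in> U" for u
  proof -
    note P = proj_along_props[OF ds V(1) W(1) that]
    have "norm (proj_along V W u) \<le> norm (proj_along V W u, u - proj_along V W u)"
      by (rule norm_fst_le)
    also have "\<dots> \<le> K * norm u" using K(2)[of "(proj_along V W u, u - proj_along V W u)"] P by simp
    finally show ?thesis .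
  qed
  then show ?thesis by (rule that)
qed

end

subsection \<open>Bounded linear operators over the scalar field\<close>

lemma bounded_klinearD:
  assumes "bounded_klinear s t f"
  shows "bounded_linear f" "f (x + y) = f x + f y" "f (s c x) = t c (f x)" "f 0 = 0" "f (x - y) = f x - f y" "f (- x) = - f x"
    "f (r *\<^sub>R x) = r *\<^sub>R f x"
proof -
  show bl: "bounded_linear f" and "f (s c x) = t c (f x)" using assms by (auto simp: bounded_klinear_def)
  interpret bounded_linear f by (rule bl)
  show "f (x + y) = f x + f y" "f 0 = 0" "f (x - y) = f x - f y" "f (- x) = - f x" "f (r *\<^sub>R x) = r *\<^sub>R f x"
    by (simp_all add: add zero diff neg scaleR)
qed

lemma bounded_klinear_sum_distrib:
  "bounded_klinear s t f \<Longrightarrow> f (\<Sum>i\<in>I. g i) = (\<Sum>i\<in>I. f (g i))"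
  using bounded_klinearD(1) bounded_linear.linear linear_sum by blast

lemma bounded_klinear_compose:
  "bounded_klinear s t f \<Longrightarrow> bounded_klinear r s g \<Longrightarrow> bounded_klinear r t (\<lambda>x. f (g x))"
  by (simp add: bounded_klinear_def bounded_linear_compose)

lemma bounded_klinear_ident: "bounded_klinear s s (\<lambda>x. x)"
  by (simp add: bounded_klinear_def)

lemma (in banach_over) bounded_klinear_zero: "bounded_klinear s scale (\<lambda>x. 0)"
  by (simp add: bounded_klinear_def)

lemma (in banach_over) bounded_klinear_scale: "bounded_klinear scale scale (scale c)"
  by (simp add: bounded_klinear_def bounded_linear_scale_right mult.commute)

lemma (in banach_over) bounded_klinear_add:
  "bounded_klinear s scale f \<Longrightarrow> bounded_klinear s scale g \<Longrightarrow> bounded_klinear s scale (\<lambda>x. f x + g x)"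
  by (simp add: bounded_klinear_def bounded_linear_add scale_right_distrib)

lemma (in banach_over) bounded_klinear_diff:
  "bounded_klinear s scale f \<Longrightarrow> bounded_klinear s scale g \<Longrightarrow> bounded_klinear s scale (\<lambda>x. f x - g x)"
  by (simp add: bounded_klinear_def bounded_linear_sub scale_right_diff_distrib)

lemma (in banach_over) bounded_klinear_minus:
  "bounded_klinear s scale f \<Longrightarrow> bounded_klinear s scale (\<lambda>x. - f x)"
  by (simp add: bounded_klinear_def bounded_linear_minus)

lemma (in banach_over) bounded_klinear_sum:
  "(\<And>i. i \<in> I \<Longrightarrow> bounded_klinear s scale (f i)) \<Longrightarrow> bounded_klinear s scale (\<lambda>x. \<Sum>i\<in>I. f i x)"
  by (simp add: bounded_klinear_def bounded_linear_sum scale_sum_right)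

section \<open>Operators associated with the decompositions\<close>

text \<open>The linear algebra of the decomposition, for arbitrary bounded operators
  \<open>A j\<close>; surjectivity of the sum operator enters as \<open>Rc_top\<close>.\<close>

locale kernel_chain = B: banach_over sB + C: banach_over sC
  for sB :: "'k::{real_normed_field,euclidean_space} \<Rightarrow> 'b::banach \<Rightarrow> 'b"
    and sC :: "'k \<Rightarrow> 'c::banach \<Rightarrow> 'c" +
  fixes A S :: "nat \<Rightarrow> 'b \<Rightarrow> 'c" and N Nc :: "nat \<Rightarrow> 'b set" and R Rc :: "nat \<Rightarrow> 'c set" and k :: nat
  assumes A_lin: "bounded_klinear sB sC (A j)"
    and dec: "decomposition sB sC A k S N Nc R Rc"
    and Rc_top: "Rc (k+1) = {0}"
begin

lemma N_0: "N 0 = UNIV" and Rc_0: "Rc 0 = UNIV" and S_1: "S (Suc 0) = A 0"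
  using dec by (auto simp: decomposition_def)

lemma dec_at:
  assumes "i \<le> k"
  shows "N (Suc i) = {v \<in> N i. S (Suc i) v = 0}" "R (Suc i) = S (Suc i) ` N i"
    "closed_subspace sB (Nc (Suc i))" "closed_subspace sB (N (Suc i))"
    "closed_subspace sC (R (Suc i))" "closed_subspace sC (Rc (Suc i))"
    "direct_sum (Nc (Suc i)) (N (Suc i)) (N i)" "direct_sum (R (Suc i)) (Rc (Suc i)) (Rc i)"
    "continuous_on (Nc (Suc i)) (S (Suc i))" "bij_betw (S (Suc i)) (Nc (Suc i)) (R (Suc i))"
proof -
  have "Suc i \<in> {1..k+1}" using assms by simp
  with dec show "N (Suc i) = {v \<in> N i. S (Suc i) v = 0}" "R (Suc i) = S (Suc i) ` N i"
    "closed_subspace sB (Nc (Suc i))" "closed_subspace sB (N (Suc i))"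
    "closed_subspace sC (R (Suc i))" "closed_subspace sC (Rc (Suc i))"
    "direct_sum (Nc (Suc i)) (N (Suc i)) (N i)" "direct_sum (R (Suc i)) (Rc (Suc i)) (Rc i)"
    "continuous_on (Nc (Suc i)) (S (Suc i))" "bij_betw (S (Suc i)) (Nc (Suc i)) (R (Suc i))"
    unfolding decomposition_def by (metis diff_Suc_1)+
qed

lemma N_subspace: "i \<le> k + 1 \<Longrightarrow> B.subspace (N i)" "i \<le> k + 1 \<Longrightarrow> closed (N i)"
proof -
  assume "i \<le> k + 1"
  then show "B.subspace (N i)" "closed (N i)"
    using dec_at(4)[of "i - 1"] by (cases i; auto simp: N_0 closed_subspace_def)+
qed

lemma Rc_subspace: "i \<le> k + 1 \<Longrightarrow> C.subspace (Rc i)" "i \<le> k + 1 \<Longrightarrow> closed (Rc i)"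
proof -
  assume "i \<le> k + 1"
  then show "C.subspace (Rc i)" "closed (Rc i)"
    using dec_at(6)[of "i - 1"] by (cases i; auto simp: Rc_0 closed_subspace_def)+
qed

lemma R_subspace: "i \<le> k \<Longrightarrow> C.subspace (R (Suc i))" "i \<le> k \<Longrightarrow> closed (R (Suc i))"
  and Nc_subspace: "i \<le> k \<Longrightarrow> B.subspace (Nc (Suc i))" "i \<le> k \<Longrightarrow> closed (Nc (Suc i))"
  using dec_at(3,5) by (auto simp: closed_subspace_def)

lemma Nc_subset: assumes "i \<le> k" shows "Nc (Suc i) \<subseteq> N i"
proof
  fix x assume "x \<in> Nc (Suc i)"
  moreover have "0 \<in> N (Suc i)" using N_subspace(1)[of "Suc i"] assms by (simp add: B.subspace_0)
  ultimately have "x + 0 \<in> {v + w |v w. v \<in> Nc (Suc i) \<and> w \<in> N (Suc i)}" by blast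
  then show "x \<in> N i" using dec_at(7)[OF assms] unfolding direct_sum_def by simp
qed

lemma N_Suc_subset: "i \<le> k \<Longrightarrow> N (Suc i) \<subseteq> N i"
  using dec_at(1) by auto

lemma R_subset: assumes "i \<le> k" shows "R (Suc i) \<subseteq> Rc i"
proof
  fix x assume "x \<in> R (Suc i)"
  moreover have "0 \<in> Rc (Suc i)" using Rc_subspace(1)[of "Suc i"] assms by (simp add: C.subspace_0)
  ultimately have "x + 0 \<in> {v + w |v w. v \<in> R (Suc i) \<and> w \<in> Rc (Suc i)}" by blast
  then show "x \<in> Rc i" using dec_at(8)[OF assms] unfolding direct_sum_def by simp
qed

lemma Rc_Suc_subset: assumes "i \<le> k" shows "Rc (Suc i) \<subseteq> Rc i"
proof
  fix x assume "x \<in> Rc (Suc i)"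
  moreover have "0 \<in> R (Suc i)" using R_subspace(1)[OF assms] by (simp add: C.subspace_0)
  ultimately have "0 + x \<in> {v + w |v w. v \<in> R (Suc i) \<and> w \<in> Rc (Suc i)}" by blast
  then show "x \<in> Rc i" using dec_at(8)[OF assms] unfolding direct_sum_def by simp
qed

subsection \<open>Components with respect to \<open>R\<^sub>1, R\<^sub>2, \<dots>\<close>\<close>

text \<open>\<open>rcomp l y\<close> is the component of \<open>y\<close> in \<open>R\<^sub>l\<close>, and \<open>rest l y\<close> what remains in \<open>R\<^sub>l\<^sup>c\<close>.\<close>

primrec rest :: "nat \<Rightarrow> 'c \<Rightarrow> 'c" where
  "rest 0 y = y"
| "rest (Suc l) y = rest l y - proj_along (R (Suc l)) (Rc (Suc l)) (rest l y)"

definition rcomp :: "nat \<Rightarrow> 'c \<Rightarrow> 'c" where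
  "rcomp l y = proj_along (R l) (Rc l) (rest (l - 1) y)"

lemma rest_Suc: "rest (Suc l) y = rest l y - rcomp (Suc l) y"
  by (simp add: rcomp_def)

lemma proj_klinear:
  assumes i: "i \<le> k" and f: "bounded_klinear sC sC f" "\<And>y. f y \<in> Rc i"
  shows "bounded_klinear sC sC (\<lambda>y. proj_along (R (Suc i)) (Rc (Suc i)) (f y))"
proof -
  note ds = dec_at(8)[OF i] and RS = R_subspace[OF i] and RcS = Rc_subspace[of "Suc i"]
  have RcS': "C.subspace (Rc (Suc i))" "closed (Rc (Suc i))" using RcS i by auto
  note lin = C.proj_along_linear[OF ds RS(1) RcS'(1)]
  obtain K where K: "\<And>u. u \<in> Rc i \<Longrightarrow> norm (proj_along (R (Suc i)) (Rc (Suc i)) u) \<le> K * norm u"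
    using C.proj_along_bounded[OF ds RS RcS'] Rc_subspace(2)[of i] i by auto
  obtain K' where K': "\<And>y. norm (f y) \<le> norm y * K'"
    using bounded_linear.bounded[OF bounded_klinearD(1)[OF f(1)]] by blast
  have "bounded_linear (\<lambda>y. proj_along (R (Suc i)) (Rc (Suc i)) (f y))"
  proof (rule bounded_linear_intro)
    fix x y c
    show "proj_along (R (Suc i)) (Rc (Suc i)) (f (x + y)) =
       proj_along (R (Suc i)) (Rc (Suc i)) (f x) + proj_along (R (Suc i)) (Rc (Suc i)) (f y)"
      using lin(1) f by (simp add: bounded_klinearD(2)[OF f(1)])
    show "proj_along (R (Suc i)) (Rc (Suc i)) (f (c *\<^sub>R x)) = c *\<^sub>R proj_along (R (Suc i)) (Rc (Suc i)) (f x)"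
      using lin(2)[of "f x" "f x" "of_real c"] f by (simp add: bounded_klinearD(7)[OF f(1)] C.scale_of_real)
    have "norm (proj_along (R (Suc i)) (Rc (Suc i)) (f x)) \<le> \<bar>K\<bar> * norm (f x)"
      using K[OF f(2)[of x]] by (meson abs_ge_self mult_right_mono norm_ge_zero order_trans)
    also have "\<dots> \<le> \<bar>K\<bar> * (norm x * K')" by (intro mult_left_mono K') auto
    finally show "norm (proj_along (R (Suc i)) (Rc (Suc i)) (f x)) \<le> norm x * (\<bar>K\<bar> * K')" by (simp add: mult_ac)
  qed
  then show ?thesis using lin(2)[OF f(2) f(2)]
    by (simp add: bounded_klinear_def bounded_klinearD(3)[OF f(1)])
qed

lemma rest_mem_klinear:
  "l \<le> k + 1 \<Longrightarrow> (\<forall>y. rest l y \<in> Rc l) \<and> bounded_klinear sC sC (rest l)"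
proof (induction l)
  case 0
  then show ?case using bounded_klinear_ident[of sC] by (simp add: Rc_0 id_def[symmetric] rest.simps(1)[abs_def])
next
  case (Suc l)
  then have l: "l \<le> k" and IH: "\<And>y. rest l y \<in> Rc l" "bounded_klinear sC sC (rest l)" by auto
  have "rest (Suc l) y \<in> Rc (Suc l)" for y
    using C.proj_along_props(2)[OF dec_at(8)[OF l] R_subspace(1)[OF l] Rc_subspace(1)[of "Suc l"] IH(1)[of y]] l by simp
  moreover have "bounded_klinear sC sC (\<lambda>y. rest l y - proj_along (R (Suc l)) (Rc (Suc l)) (rest l y))"
    by (intro C.bounded_klinear_diff IH(2) proj_klinear l IH(1))
  ultimately show ?case by (simp add: rest.simps(2)[abs_def])
qed

lemmas rest_mem = rest_mem_klinear[THEN conjunct1, THEN spec]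
  and rest_klinear = rest_mem_klinear[THEN conjunct2]

lemma rcomp_mem: "l \<le> k \<Longrightarrow> rcomp (Suc l) y \<in> R (Suc l)"
  unfolding rcomp_def
  using C.proj_along_props(1)[OF dec_at(8) R_subspace(1) Rc_subspace(1) rest_mem] by simp

lemma rcomp_klinear: "l \<le> k \<Longrightarrow> bounded_klinear sC sC (rcomp (Suc l))"
  using proj_klinear[OF _ rest_klinear rest_mem, of l] by (simp add: rcomp_def[abs_def])

lemma rest_of_Rc: "i \<le> k + 1 \<Longrightarrow> y \<in> Rc i \<Longrightarrow> rest i y = y"
proof (induction i)
  case (Suc i)
  then have i: "i \<le> k" and y: "y \<in> Rc i" using Rc_Suc_subset[of i] by auto
  have "proj_along (R (Suc i)) (Rc (Suc i)) (0 + y) = 0"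
    using Suc.prems i by (intro C.proj_along_eq[OF dec_at(8)[OF i]] R_subspace Rc_subspace C.subspace_0) auto
  then show ?case using Suc.IH i y by simp
qed simp

lemma rcomp_of_R:
  assumes i: "i \<le> k" and y: "rest i y \<in> R (Suc i)"
  shows "rcomp (Suc i) y = rest i y" "rest (Suc i) y = 0"
proof -
  have "proj_along (R (Suc i)) (Rc (Suc i)) (rest i y + 0) = rest i y"
    using i y by (intro C.proj_along_eq[OF dec_at(8)[OF i]] R_subspace Rc_subspace C.subspace_0) auto
  then show "rcomp (Suc i) y = rest i y" "rest (Suc i) y = 0" by (simp_all add: rcomp_def)
qed

declare rest.simps(2) [simp del]

lemma rest_zero_mono:
  assumes "rest i y = 0" "i \<le> j" "j \<le> k + 1"
  shows "rest j y = 0"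
  using assms(2,3)
proof (induction j rule: dec_induct)
  case base then show ?case using assms(1) by simp
next
  case (step j)
  then have j: "j \<le> k" and z: "rest j y = 0" by auto
  have "rest j y \<in> R (Suc j)" using z R_subspace(1)[OF j] by (simp add: C.subspace_0)
  then show ?case by (rule rcomp_of_R(2)[OF j])
qed

lemma rest_sum_R:
  assumes i: "i \<le> k + 1" and r: "\<And>l. l \<in> {1..i} \<Longrightarrow> r l \<in> R l"
  shows "rest i (\<Sum>l=1..i. r l) = 0"
proof -
  have "rest i (r l) = 0" if l: "l \<in> {1..i}" for l
  proof -
    obtain p where p: "l = Suc p" "p \<le> k" using l i by (cases l) auto
    have "r l \<in> Rc p" using r[OF l] R_subset[OF p(2)] p(1) by auto
    then have "rest p (r l) = r l" using p by (intro rest_of_Rc) auto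
    then have "rest l (r l) = 0" using rcomp_of_R(2)[OF p(2), of "r l"] r[OF l] p(1) by simp
    then show ?thesis by (rule rest_zero_mono) (use l i in auto)
  qed
  then show ?thesis
    unfolding bounded_klinear_sum_distrib[OF rest_klinear[OF i]] by (intro sum.neutral) auto
qed

lemma sum_rcomp: "y - rest i y = (\<Sum>l=1..i. rcomp l y)"
proof (induction i)
  case (Suc i)
  have "y - rest (Suc i) y = (y - rest i y) + rcomp (Suc i) y" by (simp add: rest_Suc)
  then show ?case using Suc by simp
qed simp

text \<open>Connects the projection used to define \<open>S\<close>, along the whole sum of the
  first \<open>i\<close> ranges, with the stepwise removal of components, which is easier to bound
  and to iterate.\<close>

lemma proj_along_eq_rest:
  assumes i: "i \<le> k + 1"
  shows "proj_along (Rc i) (subspace_sum {1..i} R) y = rest i y"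
  unfolding proj_along_def
proof (rule the_equality)
  have "rcomp l y \<in> R l" if "l \<in> {1..i}" for l using rcomp_mem[of "l - 1" y] that i by (cases l) auto
  then show "rest i y \<in> Rc i \<and> y - rest i y \<in> subspace_sum {1..i} R"
    using rest_mem[OF i] unfolding sum_rcomp subspace_sum_def by blast
  fix r assume r: "r \<in> Rc i \<and> y - r \<in> subspace_sum {1..i} R"
  then obtain v where v: "y - r = (\<Sum>l=1..i. v l)" "\<And>l. l \<in> {1..i} \<Longrightarrow> v l \<in> R l"
    unfolding subspace_sum_def by blast
  have "rest i y - rest i r = 0"
    using rest_sum_R[OF i, of v] v bounded_klinearD(5)[OF rest_klinear[OF i], of y r] by simp
  then show "r = rest i y" using rest_of_Rc[OF i, of r] r by simp
qed

subsection \<open>Solution operators\<close>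

text \<open>The normalizing factor of \<open>S (Suc i)\<close>; it has to be undone whenever
  \<open>S\<close> is inverted.\<close>

definition kap :: "nat \<Rightarrow> 'k" where "kap i = fact (2 * i) / fact i"

lemma kap_nonzero: "kap i \<noteq> 0" by (simp add: kap_def)

text \<open>The factor is chosen such that the defect \<open>rh (l - 1)\<close> of the preimage has
  exactly the component \<open>rcomp l y\<close> in \<open>R l\<close>, by
  \<open>S_eq\<close>.\<close>

definition lift :: "nat \<Rightarrow> 'c \<Rightarrow> 'b" where
  "lift l y = inv_into (Nc l) (S l) (sC (kap (l - 1)) (rcomp l y))"

text \<open>
  For \<open>v \<in> N\<^sub>i\<close> the vectors \<open>E i j v\<close>, \<open>j < i\<close>, are an admissible choice of \<open>v\<^sub>0 = v, v\<^sub>1, \<dots>, v\<^bsub>i-1\<^esub>\<close> in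
  the definition of \<open>S\<^bsub>i+1\<^esub>\<close>, so \<open>row i i v\<close> agrees with a multiple of \<open>S\<^bsub>i+1\<^esub> v\<close> up to an element
  of \<open>R\<^sub>1 \<oplus> \<dots> \<oplus> R\<^sub>i\<close>. The operators \<open>J i l\<close> solve \<open>\<Sum>l\<le>i. row (l-1) (l-1) (J i l y) = y\<close> on
  \<open>R\<^sub>1 \<oplus> \<dots> \<oplus> R\<^sub>i\<close> by back substitution; they are used to correct \<open>E i\<close> to \<open>E (i+1)\<close>.
\<close>

function (domintros) E :: "nat \<Rightarrow> nat \<Rightarrow> 'b \<Rightarrow> 'b" and J :: "nat \<Rightarrow> nat \<Rightarrow> 'c \<Rightarrow> 'b" where
  "E 0 = (\<lambda>j v. if j = 0 then v else 0)"
| "E (Suc i) = (\<lambda>j v. if i < j then 0 else E i j v -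
     (\<Sum>l=1..i. if i + 1 - l \<le> j then E (l - 1) (j - (i + 1 - l)) (J i l (\<Sum>m=0..i. A m (E i (i - m) v))) else 0))"
| "J 0 = (\<lambda>l y. 0)"
| "J (Suc i) = (\<lambda>l y. if l = Suc i then lift (Suc i) y
     else J i l (y - (\<Sum>m=0..i. A m (E i (i - m) (lift (Suc i) y)))))"
  by pat_completeness auto
termination by (relation "Wellfounded.measure (\<lambda>x. case x of Inl i \<Rightarrow> i | Inr i \<Rightarrow> i)") auto

text \<open>The coefficient of \<open>\<epsilon>\<^sup>s\<close> in the formal product of
  \<open>\<Sum>j. \<epsilon>\<^sup>j A j\<close> and
  \<open>\<Sum>j. \<epsilon>\<^sup>j E i j v\<close>.\<close>

definition row :: "nat \<Rightarrow> nat \<Rightarrow> 'b \<Rightarrow> 'c" where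
  "row i s v = (\<Sum>j=0..s. A j (E i (s - j) v))"

abbreviation rh :: "nat \<Rightarrow> 'b \<Rightarrow> 'c" where "rh i \<equiv> row i i"

text \<open>The correction of level \<open>l\<close> starts in \<open>N (l - 1)\<close>, so its rows
  before number \<open>l - 1\<close> vanish. The shift by \<open>i + 1 - l\<close> moves row
  \<open>l - 1\<close> to row \<open>i\<close>, the one that has to be corrected.\<close>

lemma E_Suc: "E (Suc i) j v = (if i < j then 0 else E i j v -
     (\<Sum>l=1..i. if i + 1 - l \<le> j then E (l - 1) (j - (i + 1 - l)) (J i l (rh i v)) else 0))"
  by (simp only: E.simps(2) row_def)

lemma J_Suc: "J (Suc i) l y = (if l = Suc i then lift (Suc i) y else J i l (y - rh i (lift (Suc i) y)))"
  by (simp add: row_def)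

declare E.simps(2) [simp del] J.simps(2) [simp del]

definition NC :: "'b set" where "NC = subspace_sum {1..k+1} Nc"

lemma NC_subspace: "B.subspace NC"
  unfolding NC_def subspace_sum_def
proof (rule B.subspaceI)
  have Ns: "B.subspace (Nc i)" if "i \<in> {1..k+1}" for i using Nc_subspace(1)[of "i - 1"] that by (cases i) auto
  show "0 \<in> {\<Sum>i = 1..k + 1. v i |v. \<forall>i\<in>{1..k + 1}. v i \<in> Nc i}"
    using Ns by (intro CollectI exI[of _ "\<lambda>_. 0"]) (auto simp: B.subspace_0)
  fix x y c assume "x \<in> {\<Sum>i = 1..k + 1. v i |v. \<forall>i\<in>{1..k + 1}. v i \<in> Nc i}"
  then obtain v where v: "x = (\<Sum>i = 1..k + 1. v i)" "\<forall>i\<in>{1..k + 1}. v i \<in> Nc i" by blast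
  show "sB c x \<in> {\<Sum>i = 1..k + 1. v i |v. \<forall>i\<in>{1..k + 1}. v i \<in> Nc i}"
    using v Ns by (intro CollectI exI[of _ "\<lambda>i. sB c (v i)"]) (auto simp: B.scale_sum_right B.subspace_scale simp del: sum.cl_ivl_Suc)
  assume "y \<in> {\<Sum>i = 1..k + 1. v i |v. \<forall>i\<in>{1..k + 1}. v i \<in> Nc i}"
  then obtain w where w: "y = (\<Sum>i = 1..k + 1. w i)" "\<forall>i\<in>{1..k + 1}. w i \<in> Nc i" by blast
  show "x + y \<in> {\<Sum>i = 1..k + 1. v i |v. \<forall>i\<in>{1..k + 1}. v i \<in> Nc i}"
    using v w Ns by (intro CollectI exI[of _ "\<lambda>i. v i + w i"]) (auto simp: sum.distrib B.subspace_add simp del: sum.cl_ivl_Suc)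
qed

lemma Nc_NC: assumes "l \<in> {1..k+1}" "m \<in> Nc l" shows "m \<in> NC"
proof -
  have Ns: "0 \<in> Nc i" if "i \<in> {1..k+1}" for i using Nc_subspace(1)[of "i - 1"] that by (cases i) (auto simp: B.subspace_0)
  have "m = (\<Sum>i=1..k+1. if i = l then m else 0)" using assms by simp
  then show ?thesis unfolding NC_def subspace_sum_def using assms Ns
    by (intro CollectI exI[of _ "\<lambda>i. if i = l then m else 0"]) auto
qed

lemma E_0_index: "E i 0 v = v"
  by (induction i) (auto simp: E_Suc intro!: sum.neutral)

lemma E_zero: "j \<ge> max i 1 \<Longrightarrow> E i j v = 0"
  by (cases i) (auto simp: E_Suc)

text \<open>Multiplying a curve by \<open>\<epsilon>\<^sup>d\<close> multiplies its image by
  \<open>\<epsilon>\<^sup>d\<close>, stated for coefficients with truncated subtraction.\<close>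

lemma shift_row:
  assumes "\<And>j. bounded_klinear sB sB (E i j)"
  shows "(\<Sum>j=0..s. A j (if d \<le> s - j then E i (s - j - d) m else 0)) = (if d \<le> s then row i (s - d) m else 0)"
proof (cases "d \<le> s")
  case True
  have "(\<Sum>j=0..s. A j (if d \<le> s - j then E i (s - j - d) m else 0)) = (\<Sum>j=0..s-d. A j (E i (s - d - j) m))"
  proof (rule sum.mono_neutral_cong_right)
    show "\<forall>j\<in>{0..s} - {0..s - d}. A j (if d \<le> s - j then E i (s - j - d) m else 0) = 0"
      using True by (auto simp: bounded_klinearD(4)[OF A_lin])
    show "A j (if d \<le> s - j then E i (s - j - d) m else 0) = A j (E i (s - d - j) m)" if "j \<in> {0..s-d}" for j
    proof -
      have "d \<le> s - j" "s - j - d = s - d - j" using that True by auto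
      then show ?thesis by simp
    qed
  qed auto
  then show ?thesis using True by (simp add: row_def)
next
  case False
  then show ?thesis by (auto simp: bounded_klinearD(4)[OF A_lin] intro!: sum.neutral)
qed

lemma row_klinear:
  assumes "\<And>j. bounded_klinear sB sB (E i j)"
  shows "bounded_klinear sB sC (row i s)"
  unfolding row_def[abs_def] by (intro C.bounded_klinear_sum bounded_klinear_compose[OF A_lin] assms)

text \<open>The clauses are proved in one induction: \<open>S_eq\<close> and the boundedness of
  \<open>lift (Suc i)\<close> rest on the rows solved by \<open>E i\<close>, and the next level is
  built from both. The clause on \<open>NC\<close> is there for the determinant, where the perturbed
  vectors must stay in \<open>NC\<close>.\<close>

definition chain_inv :: "nat \<Rightarrow> bool" where
  "chain_inv i \<longleftrightarrow> (\<forall>j. bounded_klinear sB sB (E i j)) \<and> (\<forall>j\<ge>1. \<forall>v. E i j v \<in> NC) \<and>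
     (\<forall>v\<in>N i. \<forall>s<i. row i s v = 0) \<and>
     (\<forall>l. bounded_klinear sC sB (J i l)) \<and> (\<forall>l\<in>{1..i}. \<forall>y. J i l y \<in> Nc l) \<and>
     (\<forall>y. rest i y = 0 \<longrightarrow> (\<Sum>l=1..i. rh (l - 1) (J i l y)) = y)"

text \<open>The last clause of \<open>decomposition\<close> is applied to the choice
  \<open>v\<^sub>j = E i j v\<close>; level \<open>0\<close> is separate because \<open>S 1\<close>
  is prescribed directly.\<close>

lemma S_eq:
  assumes inv: "chain_inv i" and i: "i \<le> k" and v: "v \<in> N i"
  shows "S (Suc i) v = sC (kap i) (rest i (rh i v))"
proof (cases "i = 0")
  case True
  then show ?thesis by (simp add: S_1 row_def kap_def)
next
  case False
  have r: "(\<Sum>j=0..s. A j (E i (s - j) v)) = 0" if "s < i" for s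
    using inv that v by (simp add: chain_inv_def row_def)
  have "\<forall>i\<in>{1..k}. \<forall>v. v 0 \<in> N i \<and> (\<forall>s<i. (\<Sum>j=0..s. A j (v (s - j))) = 0) \<longrightarrow>
        S (Suc i) (v 0) =
          sC (fact (2 * i) / fact i)
            (proj_along (Rc i) (subspace_sum {1..i} R) (\<Sum>j=1..i. A j (v (i - j))))"
    using dec by (simp add: decomposition_def)
  from bspec[OF this, of i, THEN spec, of "\<lambda>j. E i j v"]
  have "S (Suc i) v = sC (kap i) (rest i (\<Sum>j=1..i. A j (E i (i - j) v)))"
    using False i v r by (simp add: E_0_index proj_along_eq_rest[unfolded One_nat_def] kap_def)
  \<comment> \<open>The summand \<open>j = 0\<close> of \<open>rh i v\<close> involves
    \<open>E i i v\<close>, which is \<open>0\<close> for \<open>i > 0\<close>.\<close>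
  also have "(\<Sum>j=1..i. A j (E i (i - j) v)) = rh i v"
    using False by (simp add: row_def sum.atLeast_Suc_atMost[of 0] E_zero bounded_klinearD(4)[OF A_lin])
  finally show ?thesis .
qed

text \<open>\<open>S (Suc i)\<close> is a total function whose linearity is known only on
  \<open>N i\<close>, by way of \<open>S_eq\<close>. The bound on its inverse comes from
  \<open>bounded_below_closed_range\<close>.\<close>

lemma lift_props:
  assumes inv: "chain_inv i" and i: "i \<le> k"
  shows "lift (Suc i) y \<in> Nc (Suc i)" "S (Suc i) (lift (Suc i) y) = sC (kap i) (rcomp (Suc i) y)"
    "bounded_klinear sC sB (lift (Suc i))"
    "m \<in> Nc (Suc i) \<Longrightarrow> S (Suc i) m = sC (kap i) (rcomp (Suc i) y) \<Longrightarrow> lift (Suc i) y = m"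
proof -
  note bij = dec_at(10)[OF i]
  have rhl: "bounded_klinear sB sC (rh i)" using inv by (intro row_klinear) (simp add: chain_inv_def)
  have restl: "bounded_klinear sC sC (rest i)" using i by (intro rest_klinear) auto
  have Sl: "bounded_klinear sB sC (\<lambda>v. sC (kap i) (rest i (rh i v)))"
    by (intro bounded_klinear_compose[OF C.bounded_klinear_scale] bounded_klinear_compose[OF restl] rhl)
  note NcS = Nc_subspace[OF i]
  have Seq: "S (Suc i) v = sC (kap i) (rest i (rh i v))" if "v \<in> Nc (Suc i)" for v
    using S_eq[OF inv i] Nc_subset[OF i] that by blast
  have Sadd: "S (Suc i) (u + v) = S (Suc i) u + S (Suc i) v" if "u \<in> Nc (Suc i)" "v \<in> Nc (Suc i)" for u v
    using bounded_klinearD(2)[OF Sl, of u v] that NcS by (simp add: Seq B.subspace_add)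
  have Sscl: "S (Suc i) (sB c u) = sC c (S (Suc i) u)" if "u \<in> Nc (Suc i)" for u c
    using bounded_klinearD(3)[OF Sl, of c u] that NcS by (simp add: Seq B.subspace_scale)
  have Q: "sC (kap i) (rcomp (Suc i) y) \<in> S (Suc i) ` Nc (Suc i)" for y
    using bij rcomp_mem[OF i, of y] R_subspace(1)[OF i] by (auto simp: bij_betw_def C.subspace_scale)
  have mem: "lift (Suc i) y \<in> Nc (Suc i)" for y
    unfolding lift_def using inv_into_into[OF Q[of y]] by simp
  have Slift: "S (Suc i) (lift (Suc i) y) = sC (kap i) (rcomp (Suc i) y)" for y
    unfolding lift_def using f_inv_into_f[OF Q[of y]] by simp
  have uniq: "lift (Suc i) y = m" if "m \<in> Nc (Suc i)" "S (Suc i) m = sC (kap i) (rcomp (Suc i) y)" for y m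
    using inj_onD[OF bij_betw_imp_inj_on[OF bij], of "lift (Suc i) y" m] Slift[of y] mem[of y] that by simp
  note compl = rcomp_klinear[OF i]
  obtain K where K: "K \<ge> 0" "\<And>v. v \<in> Nc (Suc i) \<Longrightarrow> norm v \<le> K * norm (S (Suc i) v)"
  proof (rule bounded_below_closed_range[of "Nc (Suc i)" "S (Suc i)"])
    show "closed (S (Suc i) ` Nc (Suc i))" using bij R_subspace(2)[OF i] by (simp add: bij_betw_def)
    show "S (Suc i) (c *\<^sub>R x) = c *\<^sub>R S (Suc i) x" if "x \<in> Nc (Suc i)" for c x
      using Sscl[OF that, of "of_real c"] by (simp add: B.scale_of_real C.scale_of_real)
  qed (use bij dec_at(9)[OF i] NcS B.real_subspace Sadd in \<open>auto simp: bij_betw_def\<close>)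
  obtain K' where K': "\<And>y. norm (rcomp (Suc i) y) \<le> norm y * K'"
    using bounded_linear.bounded[OF bounded_klinearD(1)[OF compl]] by blast
  have "bounded_klinear sC sB (lift (Suc i))"
    unfolding bounded_klinear_def
  proof (intro conjI allI)
    show scl: "lift (Suc i) (sC c x) = sB c (lift (Suc i) x)" for c x
      using mem[of x] NcS by (intro uniq)
        (simp_all add: B.subspace_scale Sscl Slift bounded_klinearD(3)[OF compl] mult.commute)
    show "bounded_linear (lift (Suc i))"
    proof (rule bounded_linear_intro)
      show "lift (Suc i) (x + y) = lift (Suc i) x + lift (Suc i) y" for x y
        using mem NcS by (intro uniq)
          (simp_all add: B.subspace_add Sadd Slift bounded_klinearD(2)[OF compl] C.scale_right_distrib)
      show "lift (Suc i) (c *\<^sub>R x) = c *\<^sub>R lift (Suc i) x" for c x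
        using scl[of "of_real c" x] by (simp add: B.scale_of_real C.scale_of_real)
      show "norm (lift (Suc i) x) \<le> norm x * (K * (norm (kap i) * K'))" for x
      proof -
        have "norm (lift (Suc i) x) \<le> K * (norm (kap i) * norm (rcomp (Suc i) x))"
          using K(2)[OF mem[of x]] by (simp add: Slift C.norm_scale)
        also have "\<dots> \<le> K * (norm (kap i) * (norm x * K'))"
          using K(1) K' by (intro mult_left_mono) auto
        finally show ?thesis by (simp add: mult_ac)
      qed
    qed
  qed
  then show "bounded_klinear sC sB (lift (Suc i))" .
  show "lift (Suc i) y \<in> Nc (Suc i)" "S (Suc i) (lift (Suc i) y) = sC (kap i) (rcomp (Suc i) y)"
    "m \<in> Nc (Suc i) \<Longrightarrow> S (Suc i) m = sC (kap i) (rcomp (Suc i) y) \<Longrightarrow> lift (Suc i) y = m"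
    by (rule mem Slift uniq; assumption?)+
qed

lemma chain_inv: "i \<le> k + 1 \<Longrightarrow> chain_inv i"
proof (induction i rule: less_induct)
  case (less i')
  show ?case
  proof (cases i')
    case 0
    have "bounded_klinear sB sB (E 0 j)" for j
      by (cases "j = 0") (simp_all add: bounded_klinear_ident B.bounded_klinear_zero)
    moreover have "E 0 j v \<in> NC" if "j \<ge> 1" for j v using that NC_subspace by (simp add: B.subspace_0)
    ultimately show ?thesis using 0 by (simp add: chain_inv_def B.bounded_klinear_zero)
  next
    case (Suc i)
    with less.prems have i: "i \<le> k" by simp
    have inv: "chain_inv p" if "p \<le> i" for p using less.IH[of p] Suc that i by simp
    note invi = inv[OF order.refl]
    have El: "bounded_klinear sB sB (E p j)" if "p \<le> i" for p j using inv[OF that] by (simp add: chain_inv_def)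
    have ENC: "E p j v \<in> NC" if "p \<le> i" "j \<ge> 1" for p j v using inv[OF that(1)] that by (simp add: chain_inv_def)
    have Jl: "bounded_klinear sC sB (J i l)" for l using invi by (simp add: chain_inv_def)
    have JNc: "J i l y \<in> Nc l" if "l \<in> {1..i}" for l y using invi that by (simp add: chain_inv_def)
    have rows: "row p s v = 0" if "p \<le> i" "v \<in> N p" "s < p" for p s v using inv[OF that(1)] that by (simp add: chain_inv_def)
    have Jsum: "(\<Sum>l=1..i. rh (l - 1) (J i l y)) = y" if "rest i y = 0" for y
      using invi that by (simp add: chain_inv_def)
    have rhl: "bounded_klinear sB sC (rh i)" by (intro row_klinear El) simp
    note L = lift_props[OF invi i]
    have restl: "bounded_klinear sC sC (rest i)" using i by (intro rest_klinear) auto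
    have rest_rh: "rest i (rh i v) = sC (inverse (kap i)) (S (Suc i) v)" if "v \<in> N i" for v
      using S_eq[OF invi i that] kap_nonzero[of i] by simp
    have 1: "bounded_klinear sB sB (E (Suc i) j)" for j
    proof (cases "i < j")
      case True
      then show ?thesis by (simp add: E_Suc[abs_def] B.bounded_klinear_zero)
    next
      case False
      have "bounded_klinear sB sB (\<lambda>v. E i j v -
        (\<Sum>l=1..i. if i + 1 - l \<le> j then E (l - 1) (j - (i + 1 - l)) (J i l (rh i v)) else 0))"
      proof (intro B.bounded_klinear_diff B.bounded_klinear_sum El order.refl)
        fix l assume "l \<in> {1..i}"
        then have "bounded_klinear sB sB (E (l - 1) (j - (i + 1 - l)))" by (intro El) auto
        from bounded_klinear_compose[OF this bounded_klinear_compose[OF Jl rhl]]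
        show "bounded_klinear sB sB (\<lambda>v. if i + 1 - l \<le> j then E (l - 1) (j - (i + 1 - l)) (J i l (rh i v)) else 0)"
          by (cases "i + 1 - l \<le> j") (simp_all add: B.bounded_klinear_zero)
      qed
      then show ?thesis using False by (simp add: E_Suc[abs_def])
    qed
    have 2: "E (Suc i) j v \<in> NC" if j: "j \<ge> 1" for j v
    proof (cases "i < j")
      case True then show ?thesis using NC_subspace by (simp add: E_Suc B.subspace_0)
    next
      case False
      have "(if i + 1 - l \<le> j then E (l - 1) (j - (i + 1 - l)) (J i l (rh i v)) else 0) \<in> NC" if l: "l \<in> {1..i}" for l
      proof (cases "j - (i + 1 - l) = 0")
        case True
        have "J i l (rh i v) \<in> NC" using JNc[OF l] l i by (intro Nc_NC[of l]) auto
        then show ?thesis using True NC_subspace by (simp add: E_0_index B.subspace_0)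
      next
        case False
        then show ?thesis using ENC[of "l - 1" "j - (i + 1 - l)"] l NC_subspace by (auto simp: B.subspace_0)
      qed
      then have "(\<Sum>l=1..i. if i + 1 - l \<le> j then E (l - 1) (j - (i + 1 - l)) (J i l (rh i v)) else 0) \<in> NC"
        by (intro B.subspace_sum[OF NC_subspace]) auto
      then show ?thesis using False ENC[of i j v] j NC_subspace by (simp add: E_Suc B.subspace_diff)
    qed
    have 3: "row (Suc i) s v = 0" if v: "v \<in> N (Suc i)" and s: "s < Suc i" for v s
    proof -
      have vN: "v \<in> N i" "S (Suc i) v = 0" using v dec_at(1)[OF i] by auto
      have z: "rest i (rh i v) = 0" using rest_rh[OF vN(1)] vN(2) by simp
      define m where "m l = J i l (rh i v)" for l
      have mN: "m l \<in> N (l - 1)" if "l \<in> {1..i}" for l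
        using JNc[OF that] Nc_subset[of "l - 1"] that i unfolding m_def by (cases l) auto
      have "row (Suc i) s v = (\<Sum>j=0..s. A j (E i (s - j) v -
        (\<Sum>l=1..i. if i + 1 - l \<le> s - j then E (l - 1) (s - j - (i + 1 - l)) (m l) else 0)))"
        unfolding row_def[of "Suc i" s v] m_def using s by (intro sum.cong refl) (auto simp: E_Suc)
      also have "\<dots> = row i s v - (\<Sum>j=0..s. \<Sum>l=1..i. A j (if i + 1 - l \<le> s - j then E (l - 1) (s - j - (i + 1 - l)) (m l) else 0))"
        by (simp only: row_def bounded_klinearD(5)[OF A_lin] sum_subtractf bounded_klinear_sum_distrib[OF A_lin])
      also have "(\<Sum>j=0..s. \<Sum>l=1..i. A j (if i + 1 - l \<le> s - j then E (l - 1) (s - j - (i + 1 - l)) (m l) else 0)) =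
         (\<Sum>l=1..i. if i + 1 - l \<le> s then row (l - 1) (s - (i + 1 - l)) (m l) else 0)"
        by (subst sum.swap) (intro sum.cong refl shift_row El, auto)
      finally have eq: "row (Suc i) s v = row i s v - (\<Sum>l=1..i. if i + 1 - l \<le> s then row (l - 1) (s - (i + 1 - l)) (m l) else 0)" .
      show ?thesis
      proof (cases "s = i")
        case True
        have "(\<Sum>l=1..i. if i + 1 - l \<le> s then row (l - 1) (s - (i + 1 - l)) (m l) else 0) = (\<Sum>l=1..i. rh (l - 1) (m l))"
          using True by (intro sum.cong refl) (auto simp: Suc_diff_le)
        then show ?thesis using eq Jsum[OF z] True by (simp add: m_def)
      next
        case False
        \<comment> \<open>Before row \<open>i\<close> the shifted corrections only meet rows below
          \<open>l - 1\<close>, which vanish on \<open>N (l - 1)\<close>.\<close>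
        have "(\<Sum>l=1..i. if i + 1 - l \<le> s then row (l - 1) (s - (i + 1 - l)) (m l) else 0) = 0"
        proof (intro sum.neutral ballI)
          fix l assume l: "l \<in> {1..i}"
          show "(if i + 1 - l \<le> s then row (l - 1) (s - (i + 1 - l)) (m l) else 0) = 0"
          proof (cases "i + 1 - l \<le> s")
            case True
            then have "row (l - 1) (s - (i + 1 - l)) (m l) = 0"
              using l s False mN[OF l] by (intro rows) auto
            then show ?thesis by simp
          qed simp
        qed
        then show ?thesis using eq rows[OF order.refl vN(1), of s] s False by simp
      qed
    qed
    have 4: "bounded_klinear sC sB (J (Suc i) l)" for l
    proof (cases "l = Suc i")
      case True then show ?thesis using L(3) by (simp add: J_Suc[abs_def])
    next
      case False
      have "bounded_klinear sC sC (\<lambda>y. y - rh i (lift (Suc i) y))"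
        by (intro C.bounded_klinear_diff bounded_klinear_ident bounded_klinear_compose[OF rhl L(3)])
      from bounded_klinear_compose[OF Jl this] show ?thesis using False by (simp add: J_Suc[abs_def])
    qed
    have 5: "J (Suc i) l y \<in> Nc l" if "l \<in> {1..Suc i}" for l y
      using that JNc L(1) by (cases "l = Suc i") (auto simp: J_Suc)
    have 6: "(\<Sum>l=1..Suc i. rh (l - 1) (J (Suc i) l y)) = y" if y: "rest (Suc i) y = 0" for y
    proof -
      \<comment> \<open>Back substitution: \<open>m\<close> accounts for the component in
        \<open>R (Suc i)\<close>. What is left is annihilated by \<open>rest i\<close> and falls
        under the induction hypothesis.\<close>
      define m where "m = lift (Suc i) y"
      have mN: "m \<in> N i" using L(1)[of y] Nc_subset[OF i] by (auto simp: m_def)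
      have "rest i (rh i m) = rcomp (Suc i) y"
        using rest_rh[OF mN] L(2)[of y] kap_nonzero[of i] by (simp add: m_def)
      then have "rest i (y - rh i m) = 0"
        using y by (simp add: bounded_klinearD(5)[OF restl] rest_Suc)
      from Jsum[OF this] have "(\<Sum>l=1..i. rh (l - 1) (J i l (y - rh i m))) = y - rh i m" .
      moreover have "(\<Sum>l=1..i. rh (l - 1) (J (Suc i) l y)) = (\<Sum>l=1..i. rh (l - 1) (J i l (y - rh i m)))"
        by (intro sum.cong refl) (auto simp: J_Suc m_def)
      ultimately have "(\<Sum>l=1..i. rh (l - 1) (J (Suc i) l y)) = y - rh i m" by simp
      then show ?thesis by (simp add: J_Suc m_def)
    qed
    show ?thesis using 1 2 3 4 5 6 unfolding Suc chain_inv_def by simp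
  qed
qed

lemma E_klinear: "i \<le> k + 1 \<Longrightarrow> bounded_klinear sB sB (E i j)"
  and E_NC: "i \<le> k + 1 \<Longrightarrow> j \<ge> 1 \<Longrightarrow> E i j v \<in> NC"
  and row_zero: "i \<le> k + 1 \<Longrightarrow> v \<in> N i \<Longrightarrow> s < i \<Longrightarrow> row i s v = 0"
  and J_klinear: "i \<le> k + 1 \<Longrightarrow> bounded_klinear sC sB (J i l)"
  and J_mem: "i \<le> k + 1 \<Longrightarrow> l \<in> {1..i} \<Longrightarrow> J i l y \<in> Nc l"
  and J_sum: "i \<le> k + 1 \<Longrightarrow> rest i y = 0 \<Longrightarrow> (\<Sum>l=1..i. rh (l - 1) (J i l y)) = y"
  using chain_inv unfolding chain_inv_def by blast+

lemma rh_klinear: "i \<le> k + 1 \<Longrightarrow> bounded_klinear sB sC (row i s)"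
  by (intro row_klinear E_klinear)

lemma rest_rh:
  assumes "i \<le> k" "v \<in> N i"
  shows "rest i (rh i v) = sC (inverse (kap i)) (S (Suc i) v)"
  using S_eq[OF chain_inv, of i v] assms kap_nonzero[of i] by simp

section \<open>Solving the last row and parametrizing its kernel\<close>

definition Jt :: "nat \<Rightarrow> 'c \<Rightarrow> 'b" where "Jt = J (k + 1)"

lemma Jt_sum: "(\<Sum>l=1..k+1. rh (l - 1) (Jt l y)) = y"
  unfolding Jt_def using rest_mem[of "k + 1" y] Rc_top by (intro J_sum) auto

lemma Jt_klinear: "bounded_klinear sC sB (Jt l)"
  unfolding Jt_def by (rule J_klinear) simp

lemma Jt_mem: "l \<in> {1..k+1} \<Longrightarrow> Jt l y \<in> Nc l"
  unfolding Jt_def by (rule J_mem) auto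

text \<open>\<open>rest i\<close> annihilates all summands but the last one, which is read off by
  injectivity of \<open>S (Suc i)\<close> on the complement; the others follow by induction. This
  uniqueness later makes the defects of a basis independent.\<close>

lemma J_inverse:
  "i \<le> k + 1 \<Longrightarrow> (\<And>l. l \<in> {1..i} \<Longrightarrow> m l \<in> Nc l) \<Longrightarrow> l \<in> {1..i} \<Longrightarrow>
    J i l (\<Sum>p=1..i. rh (p - 1) (m p)) = m l"
proof (induction i arbitrary: l)
  case (Suc i)
  then have i: "i \<le> k" by simp
  let ?y = "\<Sum>p=1..Suc i. rh (p - 1) (m p)"
  note restl = rest_klinear[of i]
  have mN: "m (Suc p) \<in> N p" if "p \<le> i" for p using Nc_subset[of p] Suc.prems(2)[of "Suc p"] that i by auto
  have mR: "sC (inverse (kap p)) (S (Suc p) (m (Suc p))) \<in> R (Suc p)" if "p \<le> i" for p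
  proof -
    have "S (Suc p) (m (Suc p)) \<in> R (Suc p)" using dec_at(2)[of p] mN[OF that] that i by auto
    then show ?thesis using R_subspace(1)[of p] that i by (simp add: C.subspace_scale)
  qed
  have "rest i (rh (p - 1) (m p)) = 0" if p: "p \<in> {1..i}" for p
  proof -
    obtain q where q: "p = Suc q" "q \<le> k" "Suc q \<le> i" using p i by (cases p) auto
    have "rest q (rh q (m p)) \<in> R (Suc q)"
      using rest_rh[OF q(2), of "m p"] mN[of q] mR[of q] q by simp
    then have "rest p (rh q (m p)) = 0" using rcomp_of_R(2)[OF q(2)] q by simp
    then have "rest p (rh (p - 1) (m p)) = 0" using q by simp
    then show ?thesis by (rule rest_zero_mono) (use p i in auto)
  qed
  then have "(\<Sum>p=1..i. rest i (rh (p - 1) (m p))) = 0" by (intro sum.neutral) auto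
  then have ry: "rest i ?y = sC (inverse (kap i)) (S (Suc i) (m (Suc i)))"
    using i rest_rh[OF i mN[OF order.refl]] restl
    by (simp add: bounded_klinearD(2) bounded_klinear_sum_distrib)
  then have "rcomp (Suc i) ?y = rest i ?y" using mR[of i] by (intro rcomp_of_R(1)[OF i]) auto
  then have lift: "lift (Suc i) ?y = m (Suc i)"
    using ry kap_nonzero[of i] Suc.prems(2)[of "Suc i"] i
    by (intro lift_props(4)[OF chain_inv]) auto
  show ?case
  proof (cases "l = Suc i")
    case True then show ?thesis using lift by (simp add: J_Suc)
  next
    case False
    have "J (Suc i) l ?y = J i l (?y - rh i (m (Suc i)))" using False lift by (simp only: J_Suc if_False)
    also have "?y - rh i (m (Suc i)) = (\<Sum>p=1..i. rh (p - 1) (m p))" by simp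
    also have "J i l \<dots> = m l" using Suc.prems False by (intro Suc.IH) auto
    finally show ?thesis .
  qed
qed simp

text \<open>For \<open>v \<in> N l'\<close> the defect \<open>rh (l' - 1) v\<close> lies in the sum
  of the earlier ranges, so vectors of the earlier complements can compensate it, see
  \<open>sum_corr\<close>.\<close>

definition corr :: "nat \<Rightarrow> nat \<Rightarrow> 'b \<Rightarrow> 'b" where
  "corr l l' v = - J (l' - 1) l (rh (l' - 1) v)"

lemma corr_klinear: "l' \<le> k + 1 \<Longrightarrow> bounded_klinear sB sB (corr l l')"
  unfolding corr_def[abs_def]
  by (intro B.bounded_klinear_minus bounded_klinear_compose[OF J_klinear rh_klinear]) auto

lemma corr_mem: "l' \<le> k + 1 \<Longrightarrow> 1 \<le> l \<Longrightarrow> l < l' \<Longrightarrow> corr l l' v \<in> Nc l"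
  unfolding corr_def using J_mem[of "l' - 1" l] Nc_subspace(1)[of "l - 1"] by (cases l) (auto simp: B.subspace_neg)

lemma sum_corr:
  assumes l': "1 \<le> l'" "l' \<le> k + 1" and v: "v \<in> N l'"
  shows "(\<Sum>l=1..l'-1. rh (l - 1) (corr l l' v)) = - rh (l' - 1) v"
proof -
  obtain i where i: "l' = Suc i" "i \<le> k" using l' by (cases l') auto
  have "v \<in> N i" "S (Suc i) v = 0" using v dec_at(1)[OF i(2)] i by auto
  then have "rest i (rh i v) = 0" using rest_rh[OF i(2)] by simp
  from J_sum[OF _ this] have "(\<Sum>l=1..i. rh (l - 1) (J i l (rh i v))) = rh i v" using i by simp
  moreover have "rh (l - 1) (corr l l' v) = - rh (l - 1) (J i l (rh i v))" if "l \<in> {1..i}" for l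
  proof -
    have "l - 1 \<le> k + 1" using that i by auto
    from bounded_klinearD(6)[OF rh_klinear[OF this]] show ?thesis using i by (simp add: corr_def)
  qed
  ultimately show ?thesis using i by (simp add: sum_negf)
qed

text \<open>Adds the compensating vectors to \<open>n\<close>, so that the defects cancel in the
  last row. Only larger indices act on smaller ones, which makes \<open>Lhat\<close>
  unitriangular.\<close>

definition Lh :: "(nat \<Rightarrow> 'b) \<Rightarrow> nat \<Rightarrow> 'b" where
  "Lh n l = n l + (\<Sum>l'=l+1..k+1. corr l l' (n l'))"

lemma Lh_mem:
  assumes n: "\<And>l. l \<in> {1..k+1} \<Longrightarrow> n l \<in> N l" and l: "l \<in> {1..k+1}"
  shows "Lh n l \<in> N (l - 1)"
proof -
  obtain i where i: "l = Suc i" "i \<le> k" using l by (cases l) auto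
  have Ni: "B.subspace (N i)" using N_subspace(1)[of i] i by simp
  have "corr l l' (n l') \<in> N i" if "l' \<in> {l+1..k+1}" for l'
    using corr_mem[of l' l "n l'"] that l Nc_subset[OF i(2)] i by auto
  moreover have "n l \<in> N i" using n[OF l] N_Suc_subset[OF i(2)] i by auto
  ultimately show ?thesis using Ni i unfolding Lh_def by (auto intro!: B.subspace_add B.subspace_sum)
qed

lemma sum_Lh:
  assumes n: "\<And>l. l \<in> {1..k+1} \<Longrightarrow> n l \<in> N l"
  shows "(\<Sum>l=1..k+1. rh (l - 1) (Lh n l)) = 0"
proof -
  have "(\<Sum>l=1..k+1. rh (l - 1) (Lh n l)) =
      (\<Sum>l=1..k+1. rh (l - 1) (n l) + (\<Sum>l'=l+1..k+1. rh (l - 1) (corr l l' (n l'))))"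
  proof (intro sum.cong refl)
    fix l assume "l \<in> {1..k+1}"
    then have "bounded_klinear sB sC (rh (l - 1))" by (intro rh_klinear) auto
    then show "rh (l - 1) (Lh n l) = rh (l - 1) (n l) + (\<Sum>l'=l+1..k+1. rh (l - 1) (corr l l' (n l')))"
      by (simp only: Lh_def bounded_klinearD(2) bounded_klinear_sum_distrib)
  qed
  also have "\<dots> = (\<Sum>l=1..k+1. rh (l - 1) (n l)) + (\<Sum>l=1..k+1. \<Sum>l'=l+1..k+1. rh (l - 1) (corr l l' (n l')))"
    by (rule sum.distrib)
  also have "(\<Sum>l=1..k+1. \<Sum>l'=l+1..k+1. rh (l - 1) (corr l l' (n l'))) =
      (\<Sum>(l,l')\<in>(SIGMA l:{1..k+1}. {l+1..k+1}). rh (l - 1) (corr l l' (n l')))"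
    by (rule sum.Sigma) auto
  also have "\<dots> = (\<Sum>(l',l)\<in>(SIGMA l':{1..k+1}. {1..l'-1}). rh (l - 1) (corr l l' (n l')))"
    by (rule sum.reindex_bij_witness[of _ prod.swap prod.swap]) auto
  also have "\<dots> = (\<Sum>l'=1..k+1. \<Sum>l=1..l'-1. rh (l - 1) (corr l l' (n l')))"
    by (rule sum.Sigma[symmetric]) auto
  also have "\<dots> = (\<Sum>l'=1..k+1. - rh (l' - 1) (n l'))"
    using n by (intro sum.cong refl sum_corr) auto
  finally show ?thesis by (simp only: sum_negf add.right_inverse)
qed

text \<open>The homogeneous linear system for \<open>v\<^sub>0, \<dots>, v\<^sub>k\<close>, solved up to its last row.\<close>

definition csol :: "(nat \<Rightarrow> 'b) \<Rightarrow> nat \<Rightarrow> 'b" where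
  "csol w s = (\<Sum>l=1..k+1. if k + 1 - l \<le> s then E (l - 1) (s - (k + 1 - l)) (w l) else 0)"

text \<open>The shift by \<open>k + 1 - l\<close> places the defects of all \<open>w l\<close> in
  the same row \<open>k\<close>; the rows before it vanish by \<open>row_zero\<close>.\<close>

lemma csol_rows:
  assumes w: "\<And>l. l \<in> {1..k+1} \<Longrightarrow> w l \<in> N (l - 1)" and s: "s \<le> k"
  shows "(\<Sum>j=0..s. A j (csol w (s - j))) = (if s = k then (\<Sum>l=1..k+1. rh (l - 1) (w l)) else 0)"
proof -
  have "(\<Sum>j=0..s. A j (csol w (s - j))) =
      (\<Sum>j=0..s. \<Sum>l=1..k+1. A j (if k + 1 - l \<le> s - j then E (l - 1) (s - j - (k + 1 - l)) (w l) else 0))"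
    by (simp only: csol_def bounded_klinear_sum_distrib[OF A_lin])
  also have "\<dots> = (\<Sum>l=1..k+1. if k + 1 - l \<le> s then row (l - 1) (s - (k + 1 - l)) (w l) else 0)"
    by (subst sum.swap) (intro sum.cong refl shift_row E_klinear, auto)
  also have "\<dots> = (\<Sum>l=1..k+1. if s = k then rh (l - 1) (w l) else 0)"
  proof (intro sum.cong refl)
    fix l assume l: "l \<in> {1..k+1}"
    show "(if k + 1 - l \<le> s then row (l - 1) (s - (k + 1 - l)) (w l) else 0) = (if s = k then rh (l - 1) (w l) else 0)"
    proof (cases "s = k")
      case True
      then have "s - (k + 1 - l) = l - 1" "k + 1 - l \<le> s" using l by auto
      then show ?thesis using True by simp
    next
      case False
      have "row (l - 1) (s - (k + 1 - l)) (w l) = 0" if "k + 1 - l \<le> s"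
        using that l s False w[OF l] by (intro row_zero) auto
      then show ?thesis using False by simp
    qed
  qed
  finally show ?thesis by (cases "s = k") simp_all
qed

end

text \<open>Surjectivity writes a vector \<open>y\<close> of the last complement as a sum of
  \<open>r i \<in> R (Suc i)\<close>. Since \<open>y\<close> and all summands after
  \<open>r i\<close> lie in \<open>Rc (Suc i)\<close>, directness of the sum makes
  \<open>r 0\<close>, \<open>r 1\<close> and so on vanish in turn.\<close>

lemma complement_zero_of_surjective:
  assumes C: "banach_over sC" and dec: "decomposition sB sC A k S N Nc R Rc"
    and surj: "{(\<Sum>i=1..k+1. S i (n (i - 1))) | n. \<forall>i\<in>{0..k}. n i \<in> N i} = UNIV"
  shows "Rc (k+1) = {0}"
proof -
  interpret C: banach_over sC by (rule C)
  have at: "R (Suc i) = S (Suc i) ` N i" "C.subspace (R (Suc i))" "C.subspace (Rc (Suc i))"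
    "direct_sum (R (Suc i)) (Rc (Suc i)) (Rc i)" if "i \<le> k" for i
  proof -
    have "Suc i \<in> {1..k+1}" using that by simp
    with dec show "R (Suc i) = S (Suc i) ` N i" "C.subspace (R (Suc i))" "C.subspace (Rc (Suc i))"
      "direct_sum (R (Suc i)) (Rc (Suc i)) (Rc i)"
      unfolding decomposition_def closed_subspace_def by (metis diff_Suc_1)+
  qed
  have sub: "R (Suc i) \<subseteq> Rc i" "Rc (Suc i) \<subseteq> Rc i" if i: "i \<le> k" for i
  proof -
    have z: "0 \<in> R (Suc i)" "0 \<in> Rc (Suc i)" using at(2,3)[OF i] by (simp_all add: C.subspace_0)
    have eq: "Rc i = {v + w | v w. v \<in> R (Suc i) \<and> w \<in> Rc (Suc i)}" using at(4)[OF i] unfolding direct_sum_def by blast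
    show "R (Suc i) \<subseteq> Rc i"
    proof
      fix x assume "x \<in> R (Suc i)"
      then have "x + 0 \<in> Rc i" unfolding eq using z by blast
      then show "x \<in> Rc i" by simp
    qed
    show "Rc (Suc i) \<subseteq> Rc i"
    proof
      fix x assume "x \<in> Rc (Suc i)"
      then have "0 + x \<in> Rc i" unfolding eq using z by blast
      then show "x \<in> Rc i" by simp
    qed
  qed
  have anti: "Rc j \<subseteq> Rc i" if "i \<le> j" "j \<le> k + 1" for i j
    using that
  proof (induction j rule: dec_induct)
    case (step j) then show ?case using sub(2)[of j] by simp
  qed simp
  have "y = 0" if y: "y \<in> Rc (k + 1)" for y
  proof -
    have "y \<in> {(\<Sum>i=1..k+1. S i (n (i - 1))) | n. \<forall>i\<in>{0..k}. n i \<in> N i}" unfolding surj by simp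
    then obtain n where n: "y = (\<Sum>i=1..k+1. S i (n (i - 1)))" "\<forall>i\<in>{0..k}. n i \<in> N i" by blast
    define r where "r i = S (Suc i) (n i)" for i
    have yr: "y = (\<Sum>i=0..k. r i)"
      using n(1) sum.shift_bounds_cl_Suc_ivl[of "\<lambda>i. S i (n (i - 1))" 0 k] by (simp add: r_def)
    have rR: "r i \<in> R (Suc i)" if "i \<le> k" for i using n(2) at(1)[OF that] that by (auto simp: r_def)
    have "r i = 0" if "i \<le> k" for i
      using that
    proof (induction i rule: less_induct)
      case (less i)
      have Rs: "C.subspace (Rc (Suc i))" using at(3) less.prems by blast
      have "y = (\<Sum>p=i..k. r p)"
        unfolding yr using less by (intro sum.mono_neutral_right) auto
      also have "\<dots> = r i + (\<Sum>p=Suc i..k. r p)" using less.prems by (rule sum.atLeast_Suc_atMost)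
      finally have eq: "r i = y - (\<Sum>p=Suc i..k. r p)" by simp
      have "r p \<in> Rc (Suc i)" if "p \<in> {Suc i..k}" for p
        using rR[of p] sub(1)[of p] anti[of "Suc i" p] that by auto
      then have "(\<Sum>p=Suc i..k. r p) \<in> Rc (Suc i)" by (rule C.subspace_sum[OF Rs])
      moreover have "y \<in> Rc (Suc i)" using y anti[of "Suc i" "k + 1"] less.prems by auto
      ultimately have "r i \<in> Rc (Suc i)" unfolding eq by (intro C.subspace_diff[OF Rs])
      then show ?case using at(4)[OF less.prems] rR[OF less.prems] unfolding direct_sum_def by blast
    qed
    then show ?thesis unfolding yr by (intro sum.neutral) auto
  qed
  moreover have "0 \<in> Rc (k + 1)" using at(3)[of k] by (simp add: C.subspace_0)
  ultimately show ?thesis by blast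
qed

subsection \<open>Triangular operator matrices\<close>

context banach_over
begin

lemma GL_compose: "f \<in> GL scale \<Longrightarrow> g \<in> GL scale \<Longrightarrow> f \<circ> g \<in> GL scale"
  unfolding GL_def
proof (clarify, intro CollectI conjI)
  fix f' g' assume f: "bounded_klinear scale scale f" "bounded_klinear scale scale f'" "f \<circ> f' = id" "f' \<circ> f = id"
    and g: "bounded_klinear scale scale g" "bounded_klinear scale scale g'" "g \<circ> g' = id" "g' \<circ> g = id"
  show "bounded_klinear scale scale (f \<circ> g)" using bounded_klinear_compose[OF f(1) g(1)] by (simp add: o_def)
  show "\<exists>h. bounded_klinear scale scale h \<and> f \<circ> g \<circ> h = id \<and> h \<circ> (f \<circ> g) = id"
  proof (intro exI conjI)
    show "bounded_klinear scale scale (g' \<circ> f')" using bounded_klinear_compose[OF g(2) f(2)] by (simp add: o_def)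
    show "f \<circ> g \<circ> (g' \<circ> f') = id" "g' \<circ> f' \<circ> (f \<circ> g) = id"
      using f(3,4) g(3,4) by (metis comp_assoc comp_id)+
  qed
qed

text \<open>The inverse is the Neumann series, which terminates.\<close>

lemma GL_unipotent:
  assumes U: "bounded_klinear scale scale U" and nil: "\<And>x. (U ^^ m) x = 0"
  shows "(\<lambda>x. x + U x) \<in> GL scale"
proof -
  define h where "h x = (\<Sum>j<m. (-1) ^ j *\<^sub>R (U ^^ j) x)" for x
  have Up: "bounded_klinear scale scale (U ^^ j)" for j
  proof (induction j)
    case 0 then show ?case using bounded_klinear_ident[of scale] by (simp add: id_def)
  next
    case (Suc j)
    from bounded_klinear_compose[OF U Suc] show ?case by (simp add: o_def)
  qed
  have Uj: "bounded_klinear scale scale (\<lambda>x. (-1) ^ j *\<^sub>R (U ^^ j) x)" for j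
    using bounded_klinear_compose[OF bounded_klinear_scale[of "of_real ((-1) ^ j)"] Up[of j]] by (simp only: scale_of_real)
  have hU: "h (U x) = U (h x)" for x
    by (simp add: h_def bounded_klinear_sum_distrib[OF U] bounded_klinearD(7)[OF U] funpow_swap1)
  have tel: "(\<Sum>j<p. (-1) ^ j *\<^sub>R (U ^^ j) (x + U x)) = x - (-1) ^ p *\<^sub>R (U ^^ p) x" for p x
    by (induction p) (auto simp: bounded_klinearD(2)[OF Up] funpow_swap1 algebra_simps)
  have left: "h (x + U x) = x" for x using tel[of x m] nil by (simp add: h_def)
  have "bounded_klinear scale scale h" unfolding h_def[abs_def] by (intro bounded_klinear_sum Uj)
  moreover have "h x + U (h x) = x" for x
  proof -
    have "h x + U (h x) = h (x + U x)"
      using bounded_klinearD(2)[OF \<open>bounded_klinear scale scale h\<close>, of x "U x"] hU by simp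
    then show ?thesis using left by simp
  qed
  ultimately show ?thesis unfolding GL_def using left
    by (intro CollectI conjI bounded_klinear_add bounded_klinear_ident U exI[of _ h]) (auto simp: fun_eq_iff)
qed

lemma bounded_klinear_vec_nth: "bounded_klinear (scale_vec scale) scale (\<lambda>x. x $ i)"
  by (simp add: bounded_klinear_def bounded_linear_vec_nth scale_vec_def)

lemma bounded_klinear_vec_lambda:
  fixes f :: "'n::finite \<Rightarrow> 'e::real_normed_vector \<Rightarrow> 'b"
  assumes "\<And>i. bounded_klinear s scale (f i)"
  shows "bounded_klinear s (scale_vec scale) (\<lambda>x. \<chi> i. f i x)"
proof -
  have "\<forall>i. \<exists>K. \<forall>x. norm (f i x) \<le> norm x * K"
    using bounded_linear.bounded[OF bounded_klinearD(1)[OF assms]] by blast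
  then obtain K where K: "\<And>i x. norm (f i x) \<le> norm x * K i" by metis
  have "bounded_linear (\<lambda>x. \<chi> i. f i x)"
  proof (rule bounded_linear_intro)
    show "(\<chi> i. f i (x + y)) = (\<chi> i. f i x) + (\<chi> i. f i y)" for x y
      by (simp add: Finite_Cartesian_Product.vec_eq_iff bounded_klinearD(2)[OF assms])
    show "(\<chi> i. f i (c *\<^sub>R x)) = c *\<^sub>R (\<chi> i. f i x)" for c x
      by (simp add: Finite_Cartesian_Product.vec_eq_iff bounded_klinearD(7)[OF assms])
    have "norm (\<chi> i. f i x) \<le> (\<Sum>i\<in>UNIV. norm (f i x))" for x
      unfolding norm_vec_def by (rule order_trans[OF L2_set_le_sum]) auto
    also have "(\<Sum>i\<in>UNIV. norm (f i x)) \<le> norm x * (\<Sum>i\<in>UNIV. K i)" for x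
      unfolding sum_distrib_left by (intro sum_mono K)
    finally show "norm (\<chi> i. f i x) \<le> norm x * (\<Sum>i\<in>UNIV. K i)" for x .
  qed
  then show ?thesis using assms
    by (simp add: bounded_klinear_def scale_vec_def)
qed

text \<open>The strictly triangular part draws only on components of larger index, and there are at
  most \<open>K\<close> levels, so it is nilpotent.\<close>

lemma GL_unitriangular:
  fixes U :: "'n::finite \<Rightarrow> 'n \<Rightarrow> 'b \<Rightarrow> 'b" and ix :: "'n \<Rightarrow> nat"
  assumes U: "\<And>i i'. bounded_klinear scale scale (U i i')" and ix: "\<And>i. 1 \<le> ix i" "\<And>i. ix i \<le> K"
  shows "(\<lambda>x :: 'b ^ 'n. \<chi> i. x $ i + (\<Sum>i' | ix i < ix i'. U i i' (x $ i'))) \<in> GL (scale_vec scale)"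
proof -
  interpret v: banach_over "scale_vec scale :: 'k \<Rightarrow> 'b ^ 'n \<Rightarrow> 'b ^ 'n"
    by (rule banach_over_vec) (rule banach_over_axioms)
  define T :: "'b ^ 'n \<Rightarrow> 'b ^ 'n" where "T x = (\<chi> i. \<Sum>i' | ix i < ix i'. U i i' (x $ i'))" for x
  have T: "bounded_klinear (scale_vec scale) (scale_vec scale) T"
    unfolding T_def[abs_def]
    by (intro bounded_klinear_vec_lambda bounded_klinear_sum bounded_klinear_compose[OF U] bounded_klinear_vec_nth)
  have "(T ^^ m) x $ i = 0" if "ix i + m > K" for m x i
    using that
  proof (induction m arbitrary: i)
    case 0 then show ?case using ix(2)[of i] by simp
  next
    case (Suc m)
    have "(T ^^ m) x $ i' = 0" if "ix i < ix i'" for i' using Suc.prems that by (intro Suc.IH) auto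
    moreover have "T y $ i = (\<Sum>i' | ix i < ix i'. U i i' (y $ i'))" for y by (simp add: T_def)
    ultimately show ?case by (simp add: bounded_klinearD(4)[OF U])
  qed
  then have "(T ^^ K) x = 0" for x
    using ix(1) by (auto simp: Finite_Cartesian_Product.vec_eq_iff Suc_le_lessD)
  from v.GL_unipotent[OF T this] have "(\<lambda>x. x + T x) \<in> GL (scale_vec scale)" .
  moreover have "(\<lambda>x. x + T x) = (\<lambda>x. \<chi> i. x $ i + (\<Sum>i' | ix i < ix i'. U i i' (x $ i')))"
    by (simp add: fun_eq_iff T_def Finite_Cartesian_Product.vec_eq_iff)
  ultimately show ?thesis by simp
qed

lemma GL_diagonal:
  fixes c :: "'n::finite \<Rightarrow> 'k"
  assumes "\<And>i. c i \<noteq> 0"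
  shows "(\<lambda>x :: 'b ^ 'n. \<chi> i. scale (c i) (x $ i)) \<in> GL (scale_vec scale)"
proof -
  have D: "bounded_klinear (scale_vec scale) (scale_vec scale) (\<lambda>x :: 'b ^ 'n. \<chi> i. scale (c i) (x $ i))" for c :: "'n \<Rightarrow> 'k"
    by (intro bounded_klinear_vec_lambda bounded_klinear_compose[OF bounded_klinear_scale] bounded_klinear_vec_nth)
  show ?thesis unfolding GL_def using assms
    by (intro CollectI conjI D exI[of _ "\<lambda>x. \<chi> i. scale (inverse (c i)) (x $ i)"])
      (auto simp: fun_eq_iff Finite_Cartesian_Product.vec_eq_iff)
qed

end

section \<open>Construction of the solution curves\<close>

lemma (in tower_spaces) bsmooth_bound:
  assumes "bsmooth sE sF V W f"
  obtains C where "C \<ge> 0" "\<And>x. x \<in> W \<Longrightarrow> norm (f x) \<le> C"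
proof -
  obtain D where D: "btower sE sF V W D" "\<And>x. x \<in> W \<Longrightarrow> D x [] = f x"
    using assms unfolding bsmooth_def by blast
  obtain C where C: "C \<ge> 0" "\<And>x vs. x \<in> W \<Longrightarrow> length vs = 0 \<Longrightarrow> set vs \<subseteq> V \<Longrightarrow>
    norm (D x vs) \<le> C * prod_list (map norm vs)"
    using btower_bound[OF D(1), of 0] by blast
  from C(2)[of _ "[]"] D(2) C(1) show ?thesis by (intro that[of C]) auto
qed

lemma (in tower_spaces) bsmooth_lipschitz:
  assumes "bsmooth sE sF V W f" "convex W"
  obtains C where "C \<ge> 0" "\<And>x y. x \<in> W \<Longrightarrow> y \<in> W \<Longrightarrow> norm (f y - f x) \<le> C * norm (y - x)"
proof -
  obtain D where D: "btower sE sF V W D" "\<And>x. x \<in> W \<Longrightarrow> D x [] = f x"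
    using assms unfolding bsmooth_def by blast
  obtain C where C: "C \<ge> 0" "\<And>x H vs. x \<in> W \<Longrightarrow> x + H \<in> W \<Longrightarrow> length vs = 0 \<Longrightarrow> set vs \<subseteq> V \<Longrightarrow>
    norm (D (x + H) vs - D x vs) \<le> C * norm H * prod_list (map norm vs)"
    using btower_lipschitz[OF D(1) assms(2), of 0] by blast
  have "norm (f y - f x) \<le> C * norm (y - x)" if "x \<in> W" "y \<in> W" for x y
    using C(2)[of x "y - x" "[]"] that D(2) by simp
  then show ?thesis using C(1) by (intro that[of C]) auto
qed

locale solution_setup = analytic_map sB sC al r M G + kernel_chain sB sC A S N Nc R Rc k
  for sB :: "'k::{real_normed_field,euclidean_space} \<Rightarrow> 'b::banach \<Rightarrow> 'b"
    and sC :: "'k \<Rightarrow> 'c::banach \<Rightarrow> 'c" and al r M G A S N Nc R Rc k +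
  fixes zbar :: "'b list" and ix :: "'n::finite \<Rightarrow> nat"
  assumes G_0: "G 0 = 0"
    and A_eq: "A j v = gam G1 j [v] (entry sB zbar)"
    and ix: "bij_betw ix UNIV {1..k+1}"
    and zbar: "zbar \<in> take k ` X sB sC G (2 * k)"
begin

section \<open>Coefficients that solve the system up to order 2k\<close>

abbreviation w1 :: "nat \<Rightarrow> real" where "w1 \<equiv> (\<lambda>m. 1)"

definition zext :: "'b list" where "zext = (SOME zs. zs \<in> X sB sC G (2 * k) \<and> zbar = take k zs)"

lemma zext: "zext \<in> X sB sC G (2 * k)" "zbar = take k zext"
proof -
  have "\<exists>zs. zs \<in> X sB sC G (2 * k) \<and> zbar = take k zs" using zbar by auto
  from someI_ex[OF this] show "zext \<in> X sB sC G (2 * k)" "zbar = take k zext" by (simp_all add: zext_def)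
qed

lemma length_zbar: "length zbar = k"
proof (subst zext(2))
  have "length zext = 2 * k" using zext(1) by (simp add: X_def)
  then show "length (take k zext) = k" by simp
qed

abbreviation z0 :: "nat \<Rightarrow> 'b" where "z0 \<equiv> entry sB zbar"

lemma z0_zero: "i > k \<Longrightarrow> z0 i = 0"
  by (simp add: entry_def length_zbar)

lemma z0_zext: "i \<le> k \<Longrightarrow> entry sB zext i = z0 i"
proof -
  assume i: "i \<le> k"
  have "length zext = 2 * k" using zext(1) by (simp add: X_def)
  moreover have "zbar ! (i - 1) = zext ! (i - 1)" if "1 \<le> i"
    by (subst zext(2)) (use i that in auto)
  ultimately show ?thesis using i by (auto simp: entry_def length_zbar)
qed

text \<open>Beyond order \<open>k\<close> the equations are affine in the new coefficients by
  \<open>gam_shift\<close>, and the linear part is the triangular system of the \<open>A j\<close>,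
  because these are the coefficients of the derivative along \<open>zbar\<close>.\<close>

lemma gam_rows:
  assumes z: "\<And>i. 1 \<le> i \<Longrightarrow> i \<le> k \<Longrightarrow> z i = z0 i" and s: "s \<le> k"
  shows "gam w1 (k + 1 + s) [] z = gam w1 (k + 1 + s) [] z0 + (\<Sum>j=0..s. A j (z (k + 1 + (s - j))))"
proof -
  have "gam w1 (k + 1 + s) [] z = gam w1 (k + 1 + s) [] z0 +
      (\<Sum>l=k+1..k+1+s. gam (diffs w1) (k + 1 + s - l) [z l - z0 l] z0)"
    by (rule gam_shift[of k]) (use z s in auto)
  also have "(\<Sum>l=k+1..k+1+s. gam (diffs w1) (k + 1 + s - l) [z l - z0 l] z0) =
      (\<Sum>j=0..s. A j (z (k + 1 + (s - j))))"
    by (rule sum.reindex_bij_witness[of _ "\<lambda>j. k + 1 + (s - j)" "\<lambda>l. k + 1 + s - l"])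
      (auto simp: A_eq G1_def z0_zero)
  finally show ?thesis .
qed

text \<open>A particular solution of all rows but the last, supplied by an extension of
  \<open>zbar\<close> to a point of \<open>X\<close> of length \<open>2 * k\<close>. That tuple has
  no entry for \<open>s = k\<close>, where \<open>0\<close> is put.\<close>

definition vstart :: "nat \<Rightarrow> 'b" where "vstart s = (if s < k then entry sB zext (k + 1 + s) else 0)"

text \<open>The coefficient of order \<open>2 * k + 1\<close> left over by \<open>vstart\<close>;
  \<open>vhat\<close> cancels it by means of \<open>Jt\<close>.\<close>

definition defect :: "'c" where
  "defect = gam w1 (2 * k + 1) [] z0 + (\<Sum>j=0..k. A j (vstart (k - j)))"

definition vhat :: "nat \<Rightarrow> 'b" where "vhat s = vstart s + csol (\<lambda>l. Jt l (- defect)) s"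

text \<open>\<open>Jt l y\<close> makes the last row equal to \<open>y\<close>, while the part from
  \<open>Lh n\<close> keeps every row zero.\<close>

definition wvec :: "(nat \<Rightarrow> 'b) \<Rightarrow> 'c \<Rightarrow> nat \<Rightarrow> 'b" where "wvec n y l = Jt l y + Lh n l"

text \<open>The coefficients of \<open>\<epsilon>, \<dots>, \<epsilon>\<^bsup>2k+1\<^esup>\<close>, in which \<open>y\<close> parametrizes \<open>(n\<^sub>1\<^sup>c, \<dots>, n\<^bsub>k+1\<^esub>\<^sup>c)\<close> by \<open>Jt\<close>.\<close>

definition zeta :: "(nat \<Rightarrow> 'b) \<Rightarrow> 'c \<Rightarrow> nat \<Rightarrow> 'b" where
  "zeta n y i = (if i \<le> k then z0 i else if i \<le> 2 * k + 1 then vhat (i - (k + 1)) + csol (wvec n y) (i - (k + 1)) else 0)"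

lemma csol_add: "csol (\<lambda>l. w l + w' l) s = csol w s + csol w' s"
  unfolding csol_def sum.distrib[symmetric]
  by (intro sum.cong refl) (auto simp: bounded_klinearD(2)[OF E_klinear])

lemma Jt_Nminus: "l \<in> {1..k+1} \<Longrightarrow> Jt l y \<in> N (l - 1)"
  using Jt_mem[of l y] Nc_subset[of "l - 1"] by (cases l) auto

lemma wvec_N:
  assumes n: "\<And>l. l \<in> {1..k+1} \<Longrightarrow> n l \<in> N l" and l: "l \<in> {1..k+1}"
  shows "wvec n y l \<in> N (l - 1)"
proof -
  have "Z.subspace (N (l - 1))" using l by (intro N_subspace) auto
  then show ?thesis unfolding wvec_def using Jt_Nminus[OF l] Lh_mem[OF n l] Z.subspace_add by blast
qed

lemma sum_rh_wvec:
  assumes n: "\<And>l. l \<in> {1..k+1} \<Longrightarrow> n l \<in> N l"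
  shows "(\<Sum>l=1..k+1. rh (l - 1) (wvec n y l)) = y"
proof -
  have "(\<Sum>l=1..k+1. rh (l - 1) (wvec n y l)) = (\<Sum>l=1..k+1. rh (l - 1) (Jt l y) + rh (l - 1) (Lh n l))"
  proof (intro sum.cong refl)
    fix l assume "l \<in> {1..k+1}"
    then have "bounded_klinear sB sC (rh (l - 1))" by (intro rh_klinear) auto
    then show "rh (l - 1) (wvec n y l) = rh (l - 1) (Jt l y) + rh (l - 1) (Lh n l)"
      by (simp only: wvec_def bounded_klinearD(2))
  qed
  then show ?thesis by (simp only: sum.distrib Jt_sum sum_Lh[OF n] add_0_right)
qed

text \<open>Order \<open>0\<close> is \<open>G 0 = 0\<close>. Orders from \<open>1\<close> to
  \<open>k\<close> depend on \<open>zbar\<close> alone and vanish because it extends to a point of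
  \<open>X\<close>. Beyond that, the rows of \<open>vstart\<close>, of its correction and of
  \<open>wvec\<close> are added up.\<close>

lemma gam_zeta:
  assumes n: "\<And>l. l \<in> {1..k+1} \<Longrightarrow> n l \<in> N l" and i: "i \<le> 2 * k + 1"
  shows "gam w1 i [] (zeta n y) = (if i = 2 * k + 1 then y else 0)"
proof -
  have Gam0: "gam w1 0 [] z = 0" for z
  proof -
    have "ser w1 [] 0 = gam w1 0 [] z"
    proof -
      have "(\<lambda>m. w1 m *\<^sub>R al ([] @ replicate m 0)) sums al []"
      proof -
        have "al (replicate m 0) = 0" if "m \<noteq> 0" for m
          using al_scale[of 0 "replicate m 0" 0 0] that by (cases m) auto
        then have "(\<lambda>m. al (replicate m 0)) sums (\<Sum>m\<in>{0}. al (replicate m 0))"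
          by (intro sums_finite) auto
        then show ?thesis by simp
      qed
      then show ?thesis by (simp add: ser_def sums_iff)
    qed
    then show ?thesis using G_ser[of 0] G_0 r_pos by simp
  qed
  have zx: "gam w1 i [] (entry sB zext) = 0" if "i \<in> {1..2*k}" for i
    using zext(1) that X_iff_gam by blast
  consider "i = 0" | "1 \<le> i" "i \<le> k" | "i > k" by linarith
  then show ?thesis
  proof cases
    case 1 then show ?thesis using Gam0 by simp
  next
    case 2
    have "gam w1 i [] (zeta n y) = gam w1 i [] (entry sB zext)"
      using 2 by (intro gam_cong) (auto simp: zeta_def z0_zext)
    then show ?thesis using zx[of i] 2 by simp
  next
    case gt: 3
    define s where "s = i - (k + 1)"
    have 3: "i = k + 1 + s" "s \<le> k" using gt i by (auto simp: s_def)
    let ?z = "zeta n y"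
    have sum_vstart: "gam w1 (k + 1 + s) [] z0 + (\<Sum>j=0..s. A j (vstart (s - j))) = (if s = k then defect else 0)"
    proof (cases "s = k")
      case True then show ?thesis by (simp add: defect_def mult_2)
    next
      case False
      have "gam w1 (k + 1 + s) [] z0 + (\<Sum>j=0..s. A j (entry sB zext (k + 1 + (s - j)))) = 0"
        using gam_rows[of "entry sB zext" s] zx[of "k + 1 + s"] 3 False z0_zext by simp
      moreover have "(\<Sum>j=0..s. A j (entry sB zext (k + 1 + (s - j)))) = (\<Sum>j=0..s. A j (vstart (s - j)))"
        using 3 False by (intro sum.cong refl) (auto simp: vstart_def)
      ultimately show ?thesis using False by simp
    qed
    have rowJ: "(\<Sum>j=0..s. A j (csol (\<lambda>l. Jt l (- defect)) (s - j))) = (if s = k then - defect else 0)"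
      using csol_rows[of "\<lambda>l. Jt l (- defect)" s, OF Jt_Nminus 3(2)] by (simp only: Jt_sum)
    have roww: "(\<Sum>j=0..s. A j (csol (wvec n y) (s - j))) = (if s = k then y else 0)"
      using csol_rows[of "wvec n y" s, OF wvec_N[OF n] 3(2)] by (simp only: sum_rh_wvec[OF n])
    have "gam w1 i [] ?z = gam w1 (k + 1 + s) [] z0 + (\<Sum>j=0..s. A j (?z (k + 1 + (s - j))))"
      unfolding 3(1) by (rule gam_rows) (use 3 in \<open>auto simp: zeta_def\<close>)
    also have "(\<Sum>j=0..s. A j (?z (k + 1 + (s - j)))) = (\<Sum>j=0..s. A j (vstart (s - j))) +
        (\<Sum>j=0..s. A j (csol (\<lambda>l. Jt l (- defect)) (s - j))) + (\<Sum>j=0..s. A j (csol (wvec n y) (s - j)))"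
      unfolding sum.distrib[symmetric]
    proof (intro sum.cong refl)
      fix j
      have "?z (k + 1 + t) = vstart t + csol (\<lambda>l. Jt l (- defect)) t + csol (wvec n y) t" if "t \<le> k" for t
        using that by (simp add: zeta_def vhat_def)
      from this[of "s - j"] have "?z (k + 1 + (s - j)) = vstart (s - j) + csol (\<lambda>l. Jt l (- defect)) (s - j) + csol (wvec n y) (s - j)"
        using 3 by simp
      then show "A j (?z (k + 1 + (s - j))) = A j (vstart (s - j)) + A j (csol (\<lambda>l. Jt l (- defect)) (s - j)) + A j (csol (wvec n y) (s - j))"
        by (simp only: bounded_klinearD(2)[OF A_lin])
    qed
    finally show ?thesis using sum_vstart rowJ roww 3 by (auto simp: algebra_simps)
  qed
qed

lemma zeta_zero: "i > 2 * k + 1 \<Longrightarrow> zeta n y i = 0"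
  by (simp add: zeta_def)

subsection \<open>The parameter space\<close>

definition nv :: "'b ^ 'n \<Rightarrow> nat \<Rightarrow> 'b" where "nv n l = n $ (inv_into UNIV ix l)"

lemma inv_ix: "inv_into UNIV ix (ix i) = i"
  using ix by (auto simp: bij_betw_def)

lemma ix_inv: "l \<in> {1..k+1} \<Longrightarrow> ix (inv_into UNIV ix l) = l"
  using ix by (simp add: bij_betw_def f_inv_into_f)

lemma ix_range: "1 \<le> ix i" "ix i \<le> k + 1"
proof -
  have "ix i \<in> {1..k+1}" using ix unfolding bij_betw_def by blast
  then show "1 \<le> ix i" "ix i \<le> k + 1" by auto
qed

abbreviation P :: "('b ^ 'n) set" where "P \<equiv> param_space ix N"

lemma nv_N: "n \<in> P \<Longrightarrow> l \<in> {1..k+1} \<Longrightarrow> nv n l \<in> N l"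
  using ix_inv unfolding param_space_def nv_def by (metis (mono_tags, lifting) mem_Collect_eq)

abbreviation sN :: "'k \<Rightarrow> 'b ^ 'n \<Rightarrow> 'b ^ 'n" where "sN \<equiv> scale_vec sB"
abbreviation sE :: "'k \<Rightarrow> 'k \<times> ('b ^ 'n) \<Rightarrow> 'k \<times> ('b ^ 'n)" where "sE \<equiv> scale_pair (*) sN"
abbreviation VE :: "('k \<times> ('b ^ 'n)) set" where "VE \<equiv> UNIV \<times> P"
abbreviation sZ where "sZ \<equiv> scale_pair sE sC"
abbreviation VZ :: "(('k \<times> ('b ^ 'n)) \<times> 'c) set" where "VZ \<equiv> VE \<times> UNIV"

sublocale vN: banach_over sN
  by (rule banach_over_vec) (rule Z.banach_over_axioms)

lemma banach_over_sE: "banach_over sE"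
  by (rule banach_over_pair[OF banach_over_times vN.banach_over_axioms])

sublocale vE: banach_over sE by (rule banach_over_sE)

lemma P_subspace: "vN.subspace P"
proof -
  have Ns: "Z.subspace (N (ix i))" for i using ix_range[of i] by (intro N_subspace) auto
  then show ?thesis
    by (auto simp: vN.subspace_def param_space_def scale_vec_def Z.subspace_0 Z.subspace_add Z.subspace_scale)
qed

lemma VE_subspace: "vE.subspace VE"
  using P_subspace by (auto simp: vE.subspace_def vN.subspace_def zero_prod_def scale_pair_def)

lemma tower_E: "banach_over s \<Longrightarrow> tower_spaces sE s VE"
  by (intro tower_spaces.intro tower_spaces_axioms.intro vE.banach_over_axioms VE_subspace)

lemma tower_Z: "banach_over s \<Longrightarrow> tower_spaces sZ s VZ"
proof -
  assume s: "banach_over s"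
  interpret T: tower_spaces sZ sC VZ
    by (rule subspace_Times_UNIV[OF tower_E[OF F.banach_over_axioms]])
  show ?thesis by (intro tower_spaces.intro tower_spaces_axioms.intro T.E.banach_over_axioms s T.subspace_V)
qed

lemma nv_klinear: "bounded_klinear sN sB (\<lambda>n. nv n l)"
  unfolding nv_def by (rule Z.bounded_klinear_vec_nth)

lemma Lh_klinear: "bounded_klinear sN sB (\<lambda>n. Lh (nv n) l)"
  unfolding Lh_def
  by (intro Z.bounded_klinear_add nv_klinear Z.bounded_klinear_sum bounded_klinear_compose[OF corr_klinear nv_klinear]) auto

lemma csol_klinear:
  assumes "\<And>l. bounded_klinear s sB (w l)"
  shows "bounded_klinear s sB (\<lambda>x. csol (\<lambda>l. w l x) j)"
  unfolding csol_def
proof (intro Z.bounded_klinear_sum)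
  fix l assume "l \<in> {1..k+1}"
  then have "bounded_klinear s sB (\<lambda>x. E (l - 1) (j - (k + 1 - l)) (w l x))"
    by (intro bounded_klinear_compose[OF E_klinear assms]) auto
  then show "bounded_klinear s sB (\<lambda>x. if k + 1 - l \<le> j then E (l - 1) (j - (k + 1 - l)) (w l x) else 0)"
    by (cases "k + 1 - l \<le> j") (simp_all add: Z.bounded_klinear_zero)
qed

lemma csol_Lh_klinear: "bounded_klinear sN sB (\<lambda>n. csol (Lh (nv n)) j)"
  using csol_klinear[OF Lh_klinear] by simp

lemma csol_Jt_klinear: "bounded_klinear sC sB (\<lambda>y. csol (\<lambda>l. Jt l y) j)"
  by (rule csol_klinear[OF Jt_klinear])

lemma zeta_split: "zeta (nv n) y i =
    (if i \<le> k then z0 i else if i \<le> 2 * k + 1 then vhat (i - (k + 1)) + csol (Lh (nv n)) (i - (k + 1)) + csol (\<lambda>l. Jt l y) (i - (k + 1)) else 0)"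
  by (simp add: zeta_def wvec_def[abs_def] csol_add algebra_simps)

lemma fst_klinear: "bounded_klinear (scale_pair s t) s fst"
  and snd_klinear: "bounded_klinear (scale_pair s t) t snd"
  by (simp_all add: bounded_klinear_def bounded_linear_fst bounded_linear_snd)

section \<open>The fixed point problem and its domain\<close>

definition dom :: "real \<Rightarrow> real \<Rightarrow> ('k \<times> ('b ^ 'n)) set" where
  "dom d m = (ball 0 d \<times> ball 0 m) \<inter> VE"

text \<open>The solution is sought with norm at most \<open>1\<close>; the larger radius
  \<open>2\<close> places it inside a relatively open set, as towers require.\<close>

definition Om :: "real \<Rightarrow> real \<Rightarrow> (('k \<times> ('b ^ 'n)) \<times> 'c) set" where
  "Om d m = ((ball 0 d \<times> ball 0 m) \<times> ball 0 2) \<inter> VZ"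

lemma dom_iff: "(e, n) \<in> dom d m \<longleftrightarrow> norm e < d \<and> norm n < m \<and> n \<in> P"
  by (auto simp: dom_def)

lemma Om_iff: "((e, n), y) \<in> Om d m \<longleftrightarrow> norm e < d \<and> norm n < m \<and> n \<in> P \<and> norm y < 2"
  by (auto simp: Om_def)

lemma openin_dom: "openin (top_of_set VE) (dom d m)"
  unfolding dom_def by (subst Int_commute) (intro openin_open_Int open_Times open_ball)

lemma openin_Om: "openin (top_of_set VZ) (Om d m)"
  unfolding Om_def by (subst Int_commute) (intro openin_open_Int open_Times open_ball)

lemma bounded_dom: "bounded (dom d m)"
  unfolding dom_def by (intro bounded_Int disjI1 bounded_Times bounded_ball)

lemma bounded_Om: "bounded (Om d m)"
  unfolding Om_def by (intro bounded_Int disjI1 bounded_Times bounded_ball)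

lemma convex_Om: "convex (Om d m)"
proof -
  interpret T: tower_spaces sZ sC VZ by (rule tower_Z[OF F.banach_over_axioms])
  show ?thesis unfolding Om_def by (intro convex_Int convex_Times convex_ball T.V_convex)
qed

abbreviation zc :: "('k \<times> ('b ^ 'n)) \<times> 'c \<Rightarrow> nat \<Rightarrow> 'b" where
  "zc x \<equiv> zeta (nv (snd (fst x))) (snd x)"

lemma bsmooth_zc: "bsmooth sZ sB VZ (Om d m) (\<lambda>x. zc x i)"
proof -
  interpret T: tower_spaces sZ sB VZ by (rule tower_Z[OF Z.banach_over_axioms])
  have "bounded_klinear sZ sB (\<lambda>x. csol (Lh (nv (snd (fst x)))) j + csol (\<lambda>l. Jt l (snd x)) j)" for j
    by (intro Z.bounded_klinear_add bounded_klinear_compose[OF csol_Lh_klinear]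
        bounded_klinear_compose[OF csol_Jt_klinear] bounded_klinear_compose[OF snd_klinear fst_klinear] snd_klinear)
  note aff = T.bsmooth_affine[OF openin_Om bounded_Om this]
  show ?thesis
  proof (cases "i \<le> k")
    case False
    then show ?thesis using aff[of d m "vhat (i - (k + 1))" "i - (k + 1)"]
      by (cases "i \<le> 2 * k + 1") (simp_all add: zeta_split add.assoc T.bsmooth_const openin_Om)
  qed (simp add: zeta_split T.bsmooth_const openin_Om)
qed

text \<open>Smooth at \<open>\<epsilon> = 0\<close>, too, because \<open>rmd\<close> yields the
  divided remainder without performing a division.\<close>

definition Rm :: "('k \<times> ('b ^ 'n)) \<times> 'c \<Rightarrow> 'c" where
  "Rm x = rmd (2 * k + 1) (fst (fst x)) (zc x) w1 (2 * k + 2) []"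

definition Phi :: "('k \<times> ('b ^ 'n)) \<times> 'c \<Rightarrow> 'c" where
  "Phi x = sC (- fst (fst x)) (Rm x)"

definition cv :: "('k \<times> ('b ^ 'n)) \<times> 'c \<Rightarrow> 'b" where
  "cv x = pcurve (2 * k + 1) (fst (fst x)) (zc x)"

lemma half_r: "0 < r / 2" "r / 2 < r" using r_pos by auto

text \<open>For \<open>\<epsilon> \<noteq> 0\<close> the zeros of \<open>G\<close> on these curves
  thus correspond to fixed points of \<open>Phi\<close>; at \<open>\<epsilon> = 0\<close> the curve
  is at the origin.\<close>

lemma G_cv:
  assumes "norm (cv x) \<le> r / 2" "snd (fst x) \<in> P"
  shows "G (cv x) = sC (fst (fst x) ^ (2 * k + 1)) (snd x - Phi x)"
proof -
  let ?e = "fst (fst x)"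
  have n: "\<And>l. l \<in> {1..k+1} \<Longrightarrow> nv (snd (fst x)) l \<in> N l" using nv_N[OF assms(2)] by blast
  have "norm (cv x) < r" using assms half_r by linarith
  then have "G (cv x) = ser w1 [] (pcurve (2 * k + 1) ?e (zc x))" by (simp add: G_ser cv_def)
  also have "\<dots> = (\<Sum>j<2*k+2. sC (?e ^ j) (gam w1 j [] (zc x))) + sC (?e ^ (2 * k + 2)) (Rm x)"
    unfolding Rm_def by (rule ser_expansion[OF half_r])
      (use assms zeta_zero admissible_weight_const in \<open>auto simp: cv_def\<close>)
  also have "(\<Sum>j<2*k+2. sC (?e ^ j) (gam w1 j [] (zc x))) = (\<Sum>j<2*k+2. if j = 2 * k + 1 then sC (?e ^ j) (snd x) else 0)"
  proof (intro sum.cong refl)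
    fix j assume "j \<in> {..<2*k+2}"
    then have "gam w1 j [] (zc x) = (if j = 2 * k + 1 then snd x else 0)"
      using n by (intro gam_zeta) auto
    then show "sC (?e ^ j) (gam w1 j [] (zc x)) = (if j = 2 * k + 1 then sC (?e ^ j) (snd x) else 0)" by simp
  qed
  also have "\<dots> = sC (?e ^ (2 * k + 1)) (snd x)" by simp
  finally show ?thesis by (simp add: Phi_def F.scale_right_distrib)
qed

text \<open>For bounded arguments all coefficients are bounded. Shrinking \<epsilon> first brings
  the curve into the ball of radius \<open>r / 2\<close>, where \<open>Rm\<close> is smooth;
  shrinking it again lets the factor \<epsilon> in \<open>Phi\<close> beat the bounds on
  \<open>Rm\<close>.\<close>

lemma domain_bounds:
  assumes "m \<ge> 0"
  shows "\<exists>d>0. d \<le> 1 \<and> (\<forall>x\<in>Om d m. norm (cv x) \<le> r / 2) \<and> bsmooth sZ sC VZ (Om d m) Phi \<and>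
    (\<forall>x\<in>Om d m. norm (Phi x) \<le> 1) \<and>
    (\<forall>p u v. (p, u) \<in> Om d m \<longrightarrow> (p, v) \<in> Om d m \<longrightarrow> norm (Phi (p, u) - Phi (p, v)) \<le> norm (u - v) / 2)"
proof -
  interpret TB: tower_spaces sZ sB VZ by (rule tower_Z[OF Z.banach_over_axioms])
  interpret TC: tower_spaces sZ sC VZ by (rule tower_Z[OF F.banach_over_axioms])
  interpret TK: tower_spaces sZ "(*) :: 'k \<Rightarrow> 'k \<Rightarrow> 'k" VZ by (rule tower_Z[OF banach_over_times])
  have "\<exists>c\<ge>0. \<forall>x\<in>Om 1 m. norm (zc x i) \<le> c" for i
    using TB.bsmooth_bound[OF bsmooth_zc[of 1 m i]] by metis
  then obtain c where c: "\<And>i. c i \<ge> 0" "\<And>i x. x \<in> Om 1 m \<Longrightarrow> norm (zc x i) \<le> c i" by metis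
  define c' where "c' = (\<Sum>i=1..2*k+1. c i)"
  have c': "c' \<ge> 0" unfolding c'_def by (intro sum_nonneg c)
  \<comment> \<open>The curve has no constant term, so for \<open>norm \<epsilon> \<le> 1\<close>
    its norm is at most \<open>norm \<epsilon> * c'\<close>.\<close>
  define d1 where "d1 = min 1 (r / 2 / (c' + 1))"
  have d1: "d1 > 0" "d1 \<le> 1" "d1 * c' \<le> r / 2"
  proof -
    show "d1 > 0" "d1 \<le> 1" using half_r c' by (auto simp: d1_def)
    have "d1 * c' \<le> (r / 2 / (c' + 1)) * (c' + 1)"
      using half_r c' by (intro mult_mono) (auto simp: d1_def)
    also have "\<dots> = r / 2"
    proof -
      have "a / b * b = a" if "b \<noteq> 0" for a b :: real using that by simp
      from this[of "c' + 1" "r / 2"] c' show ?thesis by linarith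
    qed
    finally show "d1 * c' \<le> r / 2" .
  qed
  have sub: "Om d m \<subseteq> Om d' m" if "d \<le> d'" for d d' using that by (auto simp: Om_def)
  have cvb: "norm (cv x) \<le> r / 2" if x: "x \<in> Om d1 m" for x
  proof -
    obtain e n y where xx: "x = ((e, n), y)" by (metis prod.exhaust)
    have e: "norm e < d1" using x by (simp add: xx Om_iff)
    have x1: "x \<in> Om 1 m" using sub[OF d1(2)] x by blast
    have "norm (cv x) \<le> (\<Sum>i=1..2*k+1. d1 * c i)"
      unfolding cv_def pcurve_def
    proof (rule sum_norm_le)
      fix i assume i: "i \<in> {1..2*k+1}"
      have "norm e ^ i \<le> norm e ^ 1" using i e d1 by (intro power_decreasing) auto
      then have "norm e ^ i \<le> d1" using e by simp
      then show "norm (sB (fst (fst x) ^ i) (zc x i)) \<le> d1 * c i"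
        unfolding Z.norm_scale norm_power using c(2)[OF x1, of i] d1 by (intro mult_mono) (auto simp: xx)
    qed
    also have "\<dots> = d1 * c'" by (simp only: c'_def sum_distrib_left)
    finally show ?thesis using d1 by linarith
  qed
  have eps: "bsmooth sZ (*) VZ (Om d1 m) (\<lambda>x. fst (fst x))"
    using TK.bsmooth_affine[OF openin_Om bounded_Om bounded_klinear_compose[OF fst_klinear fst_klinear], of d1 m 0]
    by simp
  have Rm: "bsmooth sZ sC VZ (Om d1 m) Rm"
  proof -
    have "bsmooth sZ sC VZ (Om d1 m) (\<lambda>x. rmd (2 * k + 1) (fst (fst x)) (\<lambda>i. (\<lambda>x. zc x i) x) w1 (2 * k + 2) (map (\<lambda>f. f x) []))"
      by (rule bsmooth_rmd[OF half_r TB.tower_spaces_axioms eps bsmooth_zc])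
        (use cvb admissible_weight_const in \<open>auto simp: cv_def\<close>)
    then show ?thesis by (simp add: Rm_def[abs_def])
  qed
  have Phi: "bsmooth sZ sC VZ (Om d1 m) Phi"
  proof -
    have "bsmooth sZ sC VZ (Om d1 m) (\<lambda>x. sC (-1) (sC (fst (fst x)) (Rm x)))"
      by (rule TC.bsmooth_linear[OF F.banach_over_axioms TC.bsmooth_scale[OF eps Rm] F.bounded_klinear_scale])
    then show ?thesis by (simp add: Phi_def[abs_def])
  qed
  obtain K0 where K0: "K0 \<ge> 0" "\<And>x. x \<in> Om d1 m \<Longrightarrow> norm (Rm x) \<le> K0"
    using TC.bsmooth_bound[OF Rm] by blast
  obtain K1 where K1: "K1 \<ge> 0" "\<And>x y. x \<in> Om d1 m \<Longrightarrow> y \<in> Om d1 m \<Longrightarrow> norm (Rm y - Rm x) \<le> K1 * norm (y - x)"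
    using TC.bsmooth_lipschitz[OF Rm convex_Om] by blast
  \<comment> \<open>\<open>K0\<close> and \<open>K1\<close> bound \<open>Rm\<close> and its
    Lipschitz constant; multiplied by \<open>d\<close> they are at most \<open>1\<close> and one
    half. The summand \<open>1\<close> keeps the denominator positive.\<close>
  define d where "d = min d1 (1 / (2 * (K0 + K1 + 1)))"
  have d: "d > 0" "d \<le> d1" using d1 K0 K1 by (auto simp: d_def)
  have dK: "d * K0 \<le> 1" "d * K1 \<le> 1 / 2"
  proof -
    have "d * (K0 + K1 + 1) \<le> 1 / (2 * (K0 + K1 + 1)) * (K0 + K1 + 1)"
      using K0 K1 by (intro mult_right_mono) (auto simp: d_def)
    also have "\<dots> = 1 / 2" using K0 K1 by (simp add: field_simps add_nonneg_eq_0_iff)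
    finally have "d * K0 + d * K1 + d \<le> 1 / 2" by (simp add: algebra_simps)
    moreover have "d * K0 \<ge> 0" "d * K1 \<ge> 0" using d K0 K1 by auto
    ultimately show "d * K0 \<le> 1" "d * K1 \<le> 1 / 2" using d by linarith+
  qed
  note subd = sub[OF d(2)]
  show ?thesis
  proof (intro exI[of _ d] conjI ballI allI impI)
    show "d > 0" "d \<le> 1" using d d1 by auto
    show "norm (cv x) \<le> r / 2" if "x \<in> Om d m" for x using cvb subd that by blast
    show "bsmooth sZ sC VZ (Om d m) Phi" by (rule bsmooth_subset[OF Phi subd openin_Om])
    show "norm (Phi x) \<le> 1" if x: "x \<in> Om d m" for x
    proof -
      obtain e n y where xx: "x = ((e, n), y)" by (metis prod.exhaust)
      have "norm (Rm x) \<le> K0" using K0(2) subd x by blast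
      moreover have "norm e \<le> d" using x by (simp add: xx Om_iff)
      ultimately have "norm e * norm (Rm x) \<le> d * K0"
        using d by (intro mult_mono) auto
      then show ?thesis using dK by (simp add: Phi_def F.norm_scale xx)
    qed
    show "norm (Phi (p, u) - Phi (p, v)) \<le> norm (u - v) / 2" if "(p, u) \<in> Om d m" "(p, v) \<in> Om d m" for p u v
    proof -
      obtain e n where pp: "p = (e, n)" by (cases p)
      have "norm (Rm (p, u) - Rm (p, v)) \<le> K1 * norm (u - v)"
        using K1(2)[OF subsetD[OF subd that(2)] subsetD[OF subd that(1)]] by (simp add: norm_Pair)
      then have "norm e * norm (Rm (p, u) - Rm (p, v)) \<le> d * (K1 * norm (u - v))"
        using that d by (intro mult_mono) (auto simp: pp Om_iff)
      also have "\<dots> \<le> 1 / 2 * norm (u - v)" using mult_right_mono[OF dK(2), of "norm (u - v)"] by (simp add: mult.assoc)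
      finally show ?thesis
        by (simp add: Phi_def pp F.scale_right_diff_distrib[symmetric] F.norm_scale norm_minus_commute)
    qed
  qed
qed

definition dl :: "nat \<Rightarrow> real" where
  "dl m = (SOME d. d > 0 \<and> d \<le> 1 \<and> (\<forall>x\<in>Om d (real m). norm (cv x) \<le> r / 2) \<and> bsmooth sZ sC VZ (Om d (real m)) Phi \<and>
    (\<forall>x\<in>Om d (real m). norm (Phi x) \<le> 1) \<and>
    (\<forall>p u v. (p, u) \<in> Om d (real m) \<longrightarrow> (p, v) \<in> Om d (real m) \<longrightarrow> norm (Phi (p, u) - Phi (p, v)) \<le> norm (u - v) / 2))"

lemma dl: "dl m > 0" "dl m \<le> 1" "x \<in> Om (dl m) (real m) \<Longrightarrow> norm (cv x) \<le> r / 2"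
  "bsmooth sZ sC VZ (Om (dl m) (real m)) Phi" "x \<in> Om (dl m) (real m) \<Longrightarrow> norm (Phi x) \<le> 1"
  "(p, u) \<in> Om (dl m) (real m) \<Longrightarrow> (p, v) \<in> Om (dl m) (real m) \<Longrightarrow> norm (Phi (p, u) - Phi (p, v)) \<le> norm (u - v) / 2"
  using someI_ex[OF domain_bounds[of "real m", OF of_nat_0_le_iff], folded dl_def] by blast+

definition Wm :: "nat \<Rightarrow> ('k \<times> ('b ^ 'n)) set" where "Wm m = dom (dl m) (real m)"

text \<open>The admissible \<epsilon> may shrink as the parameters grow, yet any bounded set of
  parameters, together with all sufficiently small \<epsilon>, lies in a single
  \<open>Wm m\<close>.\<close>

definition WW :: "('k \<times> ('b ^ 'n)) set" where "WW = (\<Union>m. Wm m)"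

text \<open>The bound \<open>m\<close> does not occur: the fixed point in the unit ball is unique
  whichever \<open>Wm m\<close> contains \<open>p\<close>, so the local solutions agree.\<close>

definition ysol :: "'k \<times> ('b ^ 'n) \<Rightarrow> 'c" where
  "ysol p = (THE y. norm y \<le> 1 \<and> Phi (p, y) = y)"

lemma ysol_ex1:
  assumes p: "p \<in> Wm m"
  shows "\<exists>!y. norm y \<le> 1 \<and> Phi (p, y) = y"
proof -
  obtain e n where pp: "p = (e, n)" by (cases p)
  have mem: "(p, y) \<in> Om (dl m) (real m)" if "norm y \<le> 1" for y
    using p that by (auto simp: pp Wm_def dom_iff Om_iff)
  have "\<exists>!y\<in>cball 0 1. Phi (p, y) = y"
  proof (rule Banach_fix[where c="1/2"])
    show "complete (cball (0::'c) 1)" by (simp add: complete_eq_closed)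
    have "norm (Phi (p, y)) \<le> 1" if "norm y \<le> 1" for y by (rule dl(5)[OF mem[OF that]])
    then show "(\<lambda>y. Phi (p, y)) ` cball 0 1 \<subseteq> cball 0 1" by auto
    show "dist (Phi (p, x)) (Phi (p, y)) \<le> 1 / 2 * dist x y" if "x \<in> cball 0 1" "y \<in> cball 0 1" for x y
      using dl(6)[OF mem mem, of x y] that by (simp add: dist_norm)
  qed auto
  then show ?thesis by auto
qed

lemma ysol: assumes "p \<in> Wm m" shows "norm (ysol p) \<le> 1" "Phi (p, ysol p) = ysol p"
  using theI'[OF ysol_ex1[OF assms]] by (simp_all add: ysol_def)

lemma ysol_Om: "p \<in> Wm m \<Longrightarrow> (p, ysol p) \<in> Om (dl m) (real m)"
  using ysol[of p m] by (cases p) (auto simp: Wm_def dom_iff Om_iff)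

lemma ysol_0: "(0, n) \<in> Wm m \<Longrightarrow> ysol (0, n) = 0"
  using ysol(2)[of "(0, n)" m] by (simp add: Phi_def)

lemma bsmooth_ysol: "bsmooth sE sC VE (Wm m) ysol"
proof -
  obtain D where D: "btower sZ sC VZ (Om (dl m) (real m)) D" "\<And>x. x \<in> Om (dl m) (real m) \<Longrightarrow> D x [] = Phi x"
    using dl(4)[of m] unfolding bsmooth_def by blast
  have "implicit_function sE sC VE Phi D (Om (dl m) (real m)) (Wm m) ysol"
    by (intro implicit_function.intro implicit_function_axioms.intro tower_E F.banach_over_axioms D convex_Om ysol_Om)
      (use dl(6) in \<open>auto simp: Wm_def[abs_def] openin_dom bounded_dom ysol ysol[unfolded Wm_def]\<close>)
  then show ?thesis by (rule implicit_function.bsmooth_implicit)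
qed

lemma WW_subset: "WW \<subseteq> VE"
  by (auto simp: WW_def Wm_def dom_def)

lemma WW_bounded_subset:
  assumes "bounded Q" "Q \<subseteq> P"
  obtains m where "\<And>n. n \<in> Q \<Longrightarrow> norm n < real m" "{\<epsilon>. norm \<epsilon> < dl m} \<times> Q \<subseteq> Wm m"
proof -
  obtain b where b: "\<And>n. n \<in> Q \<Longrightarrow> norm n \<le> b" using assms(1) by (auto simp: bounded_iff)
  obtain m where "b < real m" using reals_Archimedean2 by blast
  then have "norm n < real m" if "n \<in> Q" for n using b[OF that] by linarith
  then show ?thesis using assms(2) by (intro that[of m]) (auto simp: Wm_def dom_iff)
qed

lemma smooth_WW:
  assumes "banach_over s" "\<And>m. bsmooth sE s VE (Wm m) f"
  shows "smooth_on_subspace (scale_prod sN) s VE WW f"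
proof -
  interpret T: tower_spaces sE s VE by (rule tower_E[OF assms(1)])
  show ?thesis unfolding scale_prod_eq_pair
    by (rule T.bsmooth_imp_smooth_on_subspace[OF WW_subset]) (use assms(2) in \<open>auto simp: WW_def\<close>)
qed

section \<open>The solution family and its coefficients\<close>

definition zz :: "nat \<Rightarrow> 'k \<times> ('b ^ 'n) \<Rightarrow> 'b" where
  "zz j p = fact j *\<^sub>R zeta (nv (snd p)) (ysol p) j"

definition sol :: "'k \<times> ('b ^ 'n) \<Rightarrow> 'b" where "sol p = cv (p, ysol p)"

definition ncomp :: "'n \<Rightarrow> 'k \<times> ('b ^ 'n) \<Rightarrow> 'b" where "ncomp i p = Jt (ix i) (ysol p)"

lemma bsmooth_zeta: "bsmooth sE sB VE (Wm m) (\<lambda>p. zeta (nv (snd p)) (ysol p) i)"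
proof -
  interpret T: tower_spaces sE sB VE by (rule tower_E[OF Z.banach_over_axioms])
  interpret TC: tower_spaces sE sC VE by (rule tower_E[OF F.banach_over_axioms])
  have op: "openin (top_of_set VE) (Wm m)" "bounded (Wm m)" by (simp_all add: Wm_def openin_dom bounded_dom)
  have "bsmooth sE sB VE (Wm m) (\<lambda>p. (vhat j + csol (Lh (nv (snd p))) j) + csol (\<lambda>l. Jt l (ysol p)) j)" for j
    by (intro T.bsmooth_add T.bsmooth_affine op bounded_klinear_compose[OF csol_Lh_klinear snd_klinear]
        TC.bsmooth_linear[OF Z.banach_over_axioms bsmooth_ysol csol_Jt_klinear])
  note aff = this
  show ?thesis
  proof (cases "i \<le> k")
    case False
    then show ?thesis using aff[of "i - (k + 1)"]
      by (cases "i \<le> 2 * k + 1") (simp_all add: zeta_split T.bsmooth_const op)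
  qed (simp add: zeta_split T.bsmooth_const op)
qed

lemma smooth_zz: "smooth_on_subspace (scale_prod sN) sB VE WW (zz j)"
proof (rule smooth_WW[OF Z.banach_over_axioms])
  fix m
  interpret T: tower_spaces sE sB VE by (rule tower_E[OF Z.banach_over_axioms])
  have "bounded_klinear sB sB ((*\<^sub>R) (fact j))"
    using Z.bounded_klinear_scale[of "of_real (fact j)"] by (simp only: Z.scale_of_real[abs_def])
  from T.bsmooth_linear[OF Z.banach_over_axioms bsmooth_zeta this]
  show "bsmooth sE sB VE (Wm m) (zz j)" by (simp add: zz_def[abs_def])
qed

lemma smooth_sol: "smooth_on_subspace (scale_prod sN) sB VE WW sol"
proof (rule smooth_WW[OF Z.banach_over_axioms])
  fix m
  interpret T: tower_spaces sE sB VE by (rule tower_E[OF Z.banach_over_axioms])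
  interpret TK: tower_spaces sE "(*) :: 'k \<Rightarrow> 'k \<Rightarrow> 'k" VE by (rule tower_E[OF banach_over_times])
  have op: "openin (top_of_set VE) (Wm m)" "bounded (Wm m)" by (simp_all add: Wm_def openin_dom bounded_dom)
  have eps: "bsmooth sE (*) VE (Wm m) fst"
    using TK.bsmooth_affine[OF op fst_klinear, of 0] by simp
  show "bsmooth sE sB VE (Wm m) sol"
    unfolding sol_def[abs_def] cv_def pcurve_def fst_conv snd_conv
    by (intro T.bsmooth_sum T.bsmooth_scale_power eps bsmooth_zeta op) auto
qed

lemma smooth_ncomp: "smooth_on_subspace (scale_prod sN) sB VE WW (ncomp i)"
proof (rule smooth_WW[OF Z.banach_over_axioms])
  fix m
  interpret TC: tower_spaces sE sC VE by (rule tower_E[OF F.banach_over_axioms])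
  show "bsmooth sE sB VE (Wm m) (ncomp i)"
    unfolding ncomp_def[abs_def] by (rule TC.bsmooth_linear[OF Z.banach_over_axioms bsmooth_ysol Jt_klinear])
qed

lemma ncomp_mem: "ncomp i p \<in> Nc (ix i)"
  unfolding ncomp_def using ix_range[of i] by (intro Jt_mem) auto

lemma zero_in_WW: "n \<in> P \<Longrightarrow> (0, n) \<in> WW"
proof -
  assume n: "n \<in> P"
  obtain m where "norm n < real m" using reals_Archimedean2 by blast
  then have "(0, n) \<in> Wm m" using n dl(1) by (simp add: Wm_def dom_iff)
  then show ?thesis by (auto simp: WW_def)
qed

lemma ysol_zero: "n \<in> P \<Longrightarrow> ysol (0, n) = 0"
  using zero_in_WW ysol_0 by (auto simp: WW_def)

lemma ncomp_zero: "n \<in> P \<Longrightarrow> ncomp i (0, n) = 0"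
  by (simp add: ncomp_def ysol_zero bounded_klinearD(4)[OF Jt_klinear])

lemma cv_bound_Wm: "p \<in> Wm m \<Longrightarrow> norm (cv (p, ysol p)) \<le> r / 2"
  by (intro dl(3) ysol_Om)

lemma G_sol: assumes "p \<in> WW" shows "G (sol p) = 0"
proof -
  obtain m where m: "p \<in> Wm m" using assms by (auto simp: WW_def)
  have "snd p \<in> P" using WW_subset assms by auto
  then show ?thesis
    using G_cv[of "(p, ysol p)", OF cv_bound_Wm[OF m]] ysol(2)[OF m] by (simp add: sol_def)
qed

lemma fact_scale: "sB (1 / fact j) (fact j *\<^sub>R x) = x" "sB (x' / fact j) (fact j *\<^sub>R x) = sB x' x"
proof -
  have *: "fact j *\<^sub>R x = sB (fact j) x" using Z.scale_of_real[of "fact j" x] by simp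
  show "sB (1 / fact j) (fact j *\<^sub>R x) = x" "sB (x' / fact j) (fact j *\<^sub>R x) = sB x' x"
    by (simp_all add: *)
qed

lemma sol_expansion: "sol (e, n) =
    (\<Sum>j=1..k. sB (e ^ j / fact j) (zbar ! (j - 1))) + (\<Sum>j=k+1..2*k+1. sB (e ^ j / fact j) (zz j (e, n)))"
proof -
  let ?f = "\<lambda>j. sB (e ^ j) (zeta (nv n) (ysol (e, n)) j)"
  have "sol (e, n) = (\<Sum>j=1..2*k+1. ?f j)" by (simp add: sol_def cv_def pcurve_def)
  also have "{1..2*k+1} = {1..k} \<union> {k+1..2*k+1}" by auto
  also have "(\<Sum>j\<in>\<dots>. ?f j) = (\<Sum>j=1..k. ?f j) + (\<Sum>j=k+1..2*k+1. ?f j)"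
    by (rule sum.union_disjoint) auto
  also have "(\<Sum>j=1..k. ?f j) = (\<Sum>j=1..k. sB (e ^ j / fact j) (zbar ! (j - 1)))"
    by (intro sum.cong refl) (auto simp: zeta_def entry_def length_zbar)
  also have "(\<Sum>j=k+1..2*k+1. ?f j) = (\<Sum>j=k+1..2*k+1. sB (e ^ j / fact j) (zz j (e, n)))"
    by (intro sum.cong refl) (simp add: zz_def fact_scale(2))
  finally show ?thesis .
qed

lemma entry_zz:
  assumes "m \<le> 2 * k + 1" "1 \<le> i" "i \<le> m" "k \<le> m"
  shows "entry sB (zbar @ map (\<lambda>j. zz j p) [k+1..<m+1]) i = zeta (nv (snd p)) (ysol p) i"
proof (cases "i \<le> k")
  case True
  then have "i - 1 < k" using assms by simp
  then show ?thesis using True assms by (simp add: entry_def length_zbar zeta_def nth_append del: upt_Suc)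
next
  case False
  define j where "j = i - 1 - k"
  have j: "i = k + 1 + j" "j < m - k" using False assms by (auto simp: j_def)
  have "[k+1..<m+1] ! j = k + 1 + j" using j by (subst nth_upt) auto
  then have "(zbar @ map (\<lambda>j. zz j p) [k+1..<m+1]) ! (i - 1) = zz i p"
    using j by (simp add: nth_append length_zbar del: upt_Suc)
  moreover have "entry sB (zbar @ map (\<lambda>j. zz j p) [k+1..<m+1]) i =
      sB (1 / fact i) ((zbar @ map (\<lambda>j. zz j p) [k+1..<m+1]) ! (i - 1))"
    using assms by (simp add: entry_def length_zbar del: upt_Suc)
  ultimately show ?thesis by (simp add: zz_def fact_scale(1))
qed

text \<open>The equation of order \<open>2 * k + 1\<close> has the value \<open>ysol p\<close>,
  which vanishes at \<open>\<epsilon> = 0\<close>; the equations up to order \<open>2 * k\<close>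
  hold at all points. This is the source of the two different memberships in the result.\<close>

lemma zz_Xbar:
  assumes m: "m \<le> 2 * k + 1" "k \<le> m" and n: "snd p \<in> P" and y: "m = 2 * k + 1 \<Longrightarrow> ysol p = 0"
  shows "zbar @ map (\<lambda>j. zz j p) [k+1..<m+1] \<in> Xbar sB sC G zbar m"
proof -
  let ?l = "zbar @ map (\<lambda>j. zz j p) [k+1..<m+1]"
  have "gam w1 i [] (entry sB ?l) = 0" if i: "i \<in> {1..m}" for i
  proof -
    have "gam w1 i [] (entry sB ?l) = gam w1 i [] (zeta (nv (snd p)) (ysol p))"
      using m i by (intro gam_cong entry_zz) auto
    also have "\<dots> = (if i = 2 * k + 1 then ysol p else 0)"
      using nv_N[OF n] m i by (intro gam_zeta) auto
    finally show ?thesis using y m i by auto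
  qed
  then have "?l \<in> X sB sC G m" using m by (simp add: X_iff_gam length_zbar del: upt_Suc)
  then show ?thesis by (simp add: Xbar_def length_zbar)
qed

text \<open>The components list the coefficients in descending order, index \<open>1\<close>
  belonging to number \<open>2 * k + 1\<close>; hence the subtractions from \<open>2*k+2\<close> and
  from \<open>k + 1\<close>.\<close>

definition Ihat :: "'b ^ 'n" where "Ihat = (\<chi> i. fact (2*k+2 - ix i) *\<^sub>R vhat (k + 1 - ix i))"

definition Mhat :: "'b ^ 'n \<Rightarrow> 'b ^ 'n" where
  "Mhat w = (\<chi> i. fact (2*k+2 - ix i) *\<^sub>R csol (nv w) (k + 1 - ix i))"

definition Lhat :: "'b ^ 'n \<Rightarrow> 'b ^ 'n" where "Lhat n = (\<chi> i. Lh (nv n) (ix i))"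

lemma csol_cong: "(\<And>l. l \<in> {1..k+1} \<Longrightarrow> w l = w' l) \<Longrightarrow> csol w s = csol w' s"
  unfolding csol_def by (intro sum.cong refl) auto

lemma zz_affine: "(\<chi> i. zz (2*k+2 - ix i) (e, n)) = Ihat + Mhat ((\<chi> i. ncomp i (e, n)) + Lhat n)"
proof (subst Finite_Cartesian_Product.vec_eq_iff, intro allI)
  fix i
  note r = ix_range[of i]
  have i: "2*k+2 - ix i - (k + 1) = k + 1 - ix i" "\<not> 2*k+2 - ix i \<le> k" "2*k+2 - ix i \<le> 2*k+1"
    using r by auto
  have "csol (nv ((\<chi> i. ncomp i (e, n)) + Lhat n)) s = csol (wvec (nv n) (ysol (e, n))) s" for s
    by (rule csol_cong) (simp add: nv_def[of "_ + _"] Lhat_def ncomp_def ix_inv wvec_def)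
  then show "(\<chi> i. zz (2*k+2 - ix i) (e, n)) $ i = (Ihat + Mhat ((\<chi> i. ncomp i (e, n)) + Lhat n)) $ i"
    unfolding zz_def zeta_def fst_conv snd_conv
    using i by (simp add: Ihat_def Mhat_def scaleR_add_right)
qed

lemma sum_ix_greater:
  "(\<Sum>l=ix i+1..k+1. f l) = (\<Sum>i' | ix i < ix i'. f (ix i'))" for f :: "nat \<Rightarrow> 'a::comm_monoid_add"
proof (rule sum.reindex_bij_witness[of _ ix "inv_into UNIV ix"])
  show "ix (inv_into UNIV ix l) = l" if "l \<in> {ix i+1..k+1}" for l
    using that by (intro ix_inv) auto
  then show "f (ix (inv_into UNIV ix l)) = f l" "inv_into UNIV ix l \<in> {i'. ix i < ix i'}"
    if "l \<in> {ix i+1..k+1}" for l using that by auto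
  show "ix i' \<in> {ix i+1..k+1}" if "i' \<in> {i'. ix i < ix i'}" for i'
    using that ix_range[of i'] by auto
qed (rule inv_ix)

lemma Lhat_GL: "Lhat \<in> GL sN"
proof -
  have "Lhat = (\<lambda>x. \<chi> i. x $ i + (\<Sum>i' | ix i < ix i'. corr (ix i) (ix i') (x $ i')))"
    by (rule ext) (simp only: Lhat_def Lh_def sum_ix_greater nv_def inv_ix)
  then show ?thesis
    using Z.GL_unitriangular[of "\<lambda>i i'. corr (ix i) (ix i')" ix "k + 1", OF corr_klinear[OF ix_range(2)] ix_range] by simp
qed

text \<open>Only levels \<open>l' \<ge> l\<close> reach position \<open>k + 1 - l\<close>, and level
  \<open>l\<close> itself arrives unchanged because \<open>E\<close> at index \<open>0\<close> is
  the identity. So \<open>Mhat\<close> is unitriangular up to factorials.\<close>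

lemma csol_eq:
  assumes "l \<in> {1..k+1}"
  shows "csol w (k + 1 - l) = w l + (\<Sum>l'=l+1..k+1. E (l' - 1) (l' - l) (w l'))"
proof -
  let ?g = "\<lambda>l'. if k + 1 - l' \<le> k + 1 - l then E (l' - 1) (k + 1 - l - (k + 1 - l')) (w l') else 0"
  have "csol w (k + 1 - l) = (\<Sum>l'=l..k+1. ?g l')"
    unfolding csol_def using assms by (intro sum.mono_neutral_right) auto
  also have "\<dots> = ?g l + (\<Sum>l'=l+1..k+1. ?g l')"
    using assms by (subst sum.atLeast_Suc_atMost) (simp_all del: sum.cl_ivl_Suc)
  also have "?g l = w l" by (simp add: E_0_index)
  also have "(\<Sum>l'=l+1..k+1. ?g l') = (\<Sum>l'=l+1..k+1. E (l' - 1) (l' - l) (w l'))"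
  proof (intro sum.cong refl)
    fix l' assume "l' \<in> {l+1..k+1}"
    then have "k + 1 - l - (k + 1 - l') = l' - l" "k + 1 - l' \<le> k + 1 - l" by auto
    then show "?g l' = E (l' - 1) (l' - l) (w l')" by simp
  qed
  finally show ?thesis .
qed

lemma Mhat_GL: "Mhat \<in> GL sN"
proof -
  let ?U = "\<lambda>x :: 'b ^ 'n. \<chi> i. x $ i + (\<Sum>i' | ix i < ix i'. E (ix i' - 1) (ix i' - ix i) (x $ i'))"
  let ?D = "\<lambda>x :: 'b ^ 'n. \<chi> i. sB (fact (2*k+2 - ix i)) (x $ i)"
  have f: "fact j *\<^sub>R x = sB (fact j) x" for j x using Z.scale_of_real[of "fact j" x] by simp
  have E: "bounded_klinear sB sB (E (ix i' - 1) (ix i' - ix i))" for i i'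
    using ix_range[of i'] by (intro E_klinear) auto
  have "?D \<circ> ?U \<in> GL sN"
    by (intro vN.GL_compose Z.GL_diagonal Z.GL_unitriangular[where K="k+1"] E ix_range) auto
  moreover have "Mhat = ?D \<circ> ?U"
  proof
    fix x
    have "csol (nv x) (k + 1 - ix i) = x $ i + (\<Sum>i' | ix i < ix i'. E (ix i' - 1) (ix i' - ix i) (x $ i'))" for i
      using csol_eq[of "ix i" "nv x"] ix_range[of i] unfolding sum_ix_greater by (simp add: nv_def inv_ix)
    then show "Mhat x = (?D \<circ> ?U) x"
      by (simp add: Mhat_def f Finite_Cartesian_Product.vec_eq_iff)
  qed
  ultimately show ?thesis by simp
qed

end

section \<open>Coordinates and determinants\<close>

context banach_over
begin

text \<open>Equivalence of norms, one basis vector at a time: the bound for \<open>S\<close> makes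
  its span closed, so the new vector \<open>a\<close> has positive distance \<delta> from it, and
  \<delta> controls the coordinate of \<open>a\<close>.\<close>

lemma representation_bounded:
  assumes "finite S" "independent S"
  shows "\<exists>K\<ge>0. \<forall>u. \<forall>a\<in>S. norm (u a) \<le> K * norm (\<Sum>v\<in>S. scale (u v) v)"
  using assms
proof (induction S rule: finite_induct)
  case empty then show ?case by (intro exI[of _ 0]) auto
next
  case (insert a S)
  have ind: "independent S" using insert.prems independent_mono by blast
  have aS: "a \<notin> span S" using insert.prems insert.hyps by (metis Diff_insert_absorb dependent_def insertI1)
  obtain K where K: "K \<ge> 0" "\<And>u b. b \<in> S \<Longrightarrow> norm (u b) \<le> K * norm (\<Sum>v\<in>S. scale (u v) v)"
    using insert.IH[OF ind] by auto
  have cl: "closed (span S)"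
    unfolding closed_sequential_limits
  proof (intro allI impI, elim conjE)
    fix x l assume x: "\<forall>n. x n \<in> span S" and lim: "x \<longlonglongrightarrow> l"
    have "\<forall>n. \<exists>u. x n = (\<Sum>v\<in>S. scale (u v) v)" using x span_finite[OF insert.hyps(1)] by auto
    then obtain u where u: "\<And>n. x n = (\<Sum>v\<in>S. scale (u n v) v)" by metis
    have "convergent (\<lambda>n. u n b)" if b: "b \<in> S" for b
    proof -
      have est: "norm (u n b - u m b) \<le> K * norm (x n - x m)" for n m
        using K(2)[OF b, of "\<lambda>v. u n v - u m v"] by (simp add: u scale_left_diff_distrib sum_subtractf)
      have "Cauchy (\<lambda>n. u n b)"
      proof (rule CauchyI)
        fix e :: real assume e: "e > 0"
        have "Cauchy x" using lim by (intro LIMSEQ_imp_Cauchy)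
        then obtain M where M: "\<And>m n. m \<ge> M \<Longrightarrow> n \<ge> M \<Longrightarrow> norm (x m - x n) < e / (K + 1)"
          using CauchyD[of x "e / (K + 1)"] divide_pos_pos[OF e, of "K + 1"] K(1) by auto
        have "norm (u m b - u n b) < e" if "m \<ge> M" "n \<ge> M" for m n
        proof -
          have "norm (u m b - u n b) \<le> (K + 1) * norm (x m - x n)"
            using est[of m n] norm_ge_zero[of "x m - x n"] unfolding distrib_right by linarith
          also have "\<dots> < (K + 1) * (e / (K + 1))" using M[OF that] K(1) by (intro mult_strict_left_mono) auto
          finally show ?thesis using K(1) by simp
        qed
        then show "\<exists>M. \<forall>m\<ge>M. \<forall>n\<ge>M. norm (u m b - u n b) < e" by blast
      qed
      then show ?thesis by (rule Cauchy_convergent)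
    qed
    then obtain w where w: "\<And>b. b \<in> S \<Longrightarrow> (\<lambda>n. u n b) \<longlonglongrightarrow> w b" unfolding convergent_def by metis
    have "x \<longlonglongrightarrow> (\<Sum>v\<in>S. scale (w v) v)"
      unfolding u[abs_def] by (intro tendsto_sum tendsto_scale w tendsto_const)
    then have "l = (\<Sum>v\<in>S. scale (w v) v)" using lim LIMSEQ_unique by blast
    then show "l \<in> span S" by (auto intro: span_sum span_scale span_base)
  qed
  define \<delta> where "\<delta> = infdist a (span S)"
  have ne: "span S \<noteq> {}" using span_zero by blast
  have \<delta>: "\<delta> > 0" unfolding \<delta>_def using aS cl ne in_closed_iff_infdist_zero[OF cl ne, of a] infdist_nonneg[of a "span S"]
    by linarith
  have ua: "norm (u a) \<le> 1 / \<delta> * norm (\<Sum>v\<in>insert a S. scale (u v) v)" for u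
  proof (cases "u a = 0")
    case True then show ?thesis using \<delta> by simp
  next
    case False
    define y where "y = (\<Sum>v\<in>S. scale (- (u v / u a)) v)"
    have yS: "y \<in> span S" unfolding y_def by (intro span_sum span_scale span_base)
    have "(\<Sum>v\<in>insert a S. scale (u v) v) = scale (u a) (a - y)"
      using insert.hyps False by (simp add: y_def scale_right_diff_distrib scale_right_distrib scale_sum_right sum_negf)
    then have "norm (\<Sum>v\<in>insert a S. scale (u v) v) = norm (u a) * dist a y" by (simp add: norm_scale dist_norm)
    moreover have "\<delta> \<le> dist a y" unfolding \<delta>_def by (rule infdist_le[OF yS])
    ultimately have "norm (u a) * \<delta> \<le> norm (\<Sum>v\<in>insert a S. scale (u v) v)" by (simp add: mult_left_mono)
    then show ?thesis using \<delta> by (simp add: field_simps)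
  qed
  have ub: "norm (u b) \<le> K * (1 + norm a / \<delta>) * norm (\<Sum>v\<in>insert a S. scale (u v) v)" if b: "b \<in> S" for u b
  proof -
    let ?x = "\<Sum>v\<in>insert a S. scale (u v) v"
    have s: "norm (scale (u a) a) \<le> (1 / \<delta> * norm ?x) * norm a"
      unfolding norm_scale by (rule mult_right_mono[OF ua norm_ge_zero])
    have "norm (u b) \<le> K * norm (\<Sum>v\<in>S. scale (u v) v)" by (rule K(2)[OF b])
    also have "(\<Sum>v\<in>S. scale (u v) v) = ?x - scale (u a) a" using insert.hyps by simp
    also have "K * norm (?x - scale (u a) a) \<le> K * (norm ?x + (1 / \<delta> * norm ?x) * norm a)"
      using K(1) by (intro mult_left_mono order_trans[OF norm_triangle_ineq4] add_left_mono s)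
    also have "\<dots> = K * (1 + norm a / \<delta>) * norm ?x" by (simp add: algebra_simps)
    finally show ?thesis .
  qed
  show ?case
  proof (intro exI[of _ "1 / \<delta> + K * (1 + norm a / \<delta>)"] conjI allI ballI)
    have pos: "0 \<le> 1 / \<delta>" "0 \<le> K * (1 + norm a / \<delta>)" using \<delta> K(1) by auto
    then show "0 \<le> 1 / \<delta> + K * (1 + norm a / \<delta>)" by simp
    fix u b assume "b \<in> insert a S"
    let ?n = "norm (\<Sum>v\<in>insert a S. scale (u v) v)"
    have "1 / \<delta> * ?n \<le> (1 / \<delta> + K * (1 + norm a / \<delta>)) * ?n" "K * (1 + norm a / \<delta>) * ?n \<le> (1 / \<delta> + K * (1 + norm a / \<delta>)) * ?n"
      by (rule mult_right_mono[OF _ norm_ge_zero], use pos in linarith)+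
    then show "norm (u b) \<le> (1 / \<delta> + K * (1 + norm a / \<delta>)) * ?n"
      using \<open>b \<in> insert a S\<close> order_trans[OF ua[of u]] order_trans[OF ub[of b u]] by (cases "b = a") blast+
  qed
qed

text \<open>One column of coordinates for each vector of the family; the determinants of different
  maps and bases are compared through products of such matrices.\<close>

definition cm :: "'b list \<Rightarrow> (nat \<Rightarrow> 'b) \<Rightarrow> 'k mat" where
  "cm cs w = mat (length cs) (length cs) (\<lambda>(i, j). representation (set cs) (w j) (cs ! i))"

lemma cm_carrier [simp]: "cm cs w \<in> carrier_mat (length cs) (length cs)"
  by (simp add: cm_def)

lemma cm_mult:
  assumes ind: "independent (set cs)" and h: "\<And>p. p < length cs \<Longrightarrow> h p \<in> span (set cs)"
    and Q: "Q \<in> carrier_mat (length cs) (length cs)"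
    and g: "\<And>j. j < length cs \<Longrightarrow> g j = (\<Sum>p<length cs. scale (Q $$ (p, j)) (h p))"
  shows "cm cs g = cm cs h * Q"
proof (rule eq_matI)
  fix i j assume "i < dim_row (cm cs h * Q)" "j < dim_col (cm cs h * Q)"
  then have ij: "i < length cs" "j < length cs" using Q by (auto simp: cm_def)
  have "representation (set cs) (g j) = (\<lambda>b. \<Sum>p<length cs. Q $$ (p, j) * representation (set cs) (h p) b)"
    unfolding g[OF ij(2)] using h
    by (subst representation_sum[OF ind]) (auto simp: span_scale representation_scale[OF ind] intro!: sum.cong)
  then show "cm cs g $$ (i, j) = (cm cs h * Q) $$ (i, j)"
    using ij Q by (auto simp: cm_def scalar_prod_def lessThan_atLeast0 mult.commute intro!: sum.cong)
qed (use Q in \<open>auto simp: cm_def\<close>)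

lemma cm_self:
  assumes "independent (set cs)" "distinct cs"
  shows "cm cs ((!) cs) = 1\<^sub>m (length cs)"
  using assms by (intro eq_matI) (auto simp: cm_def representation_basis nth_eq_iff_index_eq)

lemma representation_expand:
  assumes "independent (set cs)" "distinct cs" "v \<in> span (set cs)"
  shows "v = (\<Sum>p<length cs. scale (representation (set cs) v (cs ! p)) (cs ! p))"
proof -
  have "v = (\<Sum>b\<in>set cs. scale (representation (set cs) v b) b)"
    using sum_representation_eq[OF assms(1,3)] by simp
  also have "\<dots> = (\<Sum>p<length cs. scale (representation (set cs) v (cs ! p)) (cs ! p))"
    by (rule sum.reindex_bij_betw[symmetric]) (rule bij_betw_nth, use assms in auto)
  finally show ?thesis .
qed

text \<open>The expansions of the basis vectors in terms of \<open>w\<close> form a right inverse of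
  the matrix.\<close>

lemma det_cm_nonzero:
  assumes cs: "independent (set cs)" "distinct cs" and w: "\<And>p. p < length cs \<Longrightarrow> w p \<in> span (set cs)"
    and Q: "\<And>j. j < length cs \<Longrightarrow> \<exists>q. cs ! j = (\<Sum>p<length cs. scale (q p) (w p))"
  shows "Determinant.det (cm cs w) \<noteq> 0"
proof -
  obtain q where q: "\<And>j. j < length cs \<Longrightarrow> cs ! j = (\<Sum>p<length cs. scale (q j p) (w p))" using Q by metis
  define Q' where "Q' = mat (length cs) (length cs) (\<lambda>(p, j). q j p)"
  have Q': "Q' \<in> carrier_mat (length cs) (length cs)" by (simp add: Q'_def)
  have "cm cs ((!) cs) = cm cs w * Q'"
    by (rule cm_mult[OF cs(1) w Q']) (use q in \<open>auto simp: Q'_def\<close>)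
  then have "1\<^sub>m (length cs) = cm cs w * Q'" using cm_self[OF cs] by simp
  then have "Determinant.det (cm cs w) * Determinant.det Q' = 1"
    using det_mult[OF cm_carrier Q'] by (metis det_one)
  then show ?thesis by auto
qed

lemma det_cm_scale:
  assumes cs: "independent (set cs)" and w: "\<And>p. p < length cs \<Longrightarrow> w p \<in> span (set cs)"
  shows "Determinant.det (cm cs (\<lambda>j. scale (a j) (w j))) = Determinant.det (cm cs w) * (\<Prod>j<length cs. a j)"
proof -
  let ?n = "length cs"
  define Q where "Q = mat ?n ?n (\<lambda>(p, j). if p = j then a j else 0)"
  have Q: "Q \<in> carrier_mat ?n ?n" by (simp add: Q_def)
  have "cm cs (\<lambda>j. scale (a j) (w j)) = cm cs w * Q"
  proof (rule cm_mult[OF cs w Q])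
    fix j assume j: "j < ?n"
    have "(\<Sum>p<?n. scale (Q $$ (p, j)) (w p)) = (\<Sum>p<?n. if p = j then scale (a j) (w j) else 0)"
      using j by (intro sum.cong) (auto simp: Q_def)
    then show "scale (a j) (w j) = (\<Sum>p<?n. scale (Q $$ (p, j)) (w p))" using j by simp
  qed
  moreover have "Determinant.det Q = (\<Prod>j<?n. a j)"
  proof -
    have "upper_triangular Q" by (auto simp: Q_def)
    then have "Determinant.det Q = prod_list (diag_mat Q)" using Q by (rule det_upper_triangular)
    also have "diag_mat Q = map a [0..<?n]" by (auto simp: diag_mat_def Q_def)
    also have "prod_list (map a [0..<?n]) = (\<Prod>j<?n. a j)"
      by (subst prod.distinct_set_conv_list[symmetric]) (auto simp: lessThan_atLeast0)
    finally show ?thesis .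
  qed
  ultimately show ?thesis using det_mult[OF cm_carrier[of cs w] Q] by simp
qed

text \<open>Pairs keep vectors of different summands apart until injectivity is shown. A linear
  relation is collected summand by summand; the hypothesis on the maps makes each partial sum
  vanish, and independence within the summand finishes. It is used for the bases of the complements
  and for their defects.\<close>

lemma independent_family:
  fixes phi :: "nat \<Rightarrow> 'e::banach \<Rightarrow> 'b"
  assumes E: "banach_over sE" and fin: "finite L" "\<And>l. l \<in> L \<Longrightarrow> finite (Bs l)"
    and ind: "\<And>l. l \<in> L \<Longrightarrow> \<not> module.dependent sE (Bs l)"
    and sub: "\<And>l. l \<in> L \<Longrightarrow> Bs l \<subseteq> V l" "\<And>l. l \<in> L \<Longrightarrow> module.subspace sE (V l)"
    and lin: "\<And>l. l \<in> L \<Longrightarrow> bounded_klinear sE scale (phi l)"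
    and inj: "\<And>m. \<forall>l\<in>L. m l \<in> V l \<Longrightarrow> (\<Sum>l\<in>L. phi l (m l)) = 0 \<Longrightarrow> \<forall>l\<in>L. m l = 0"
  defines "I \<equiv> Sigma L Bs"
  shows "inj_on (\<lambda>(l, b). phi l b) I" "independent ((\<lambda>(l, b). phi l b) ` I)"
proof -
  interpret E: banach_over sE by fact
  have finI: "finite I" unfolding I_def using fin by blast
  have coeff: "u (l, b) = 0" if z: "(\<Sum>(l, b)\<in>I. scale (u (l, b)) (phi l b)) = 0" and lb: "(l, b) \<in> I" for u l b
  proof -
    define m where "m l = (\<Sum>b\<in>Bs l. sE (u (l, b)) b)" for l
    have mV: "m l \<in> V l" if "l \<in> L" for l
      unfolding m_def using sub[OF that] by (intro E.subspace_sum E.subspace_scale) auto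
    have "(\<Sum>(l, b)\<in>I. scale (u (l, b)) (phi l b)) = (\<Sum>l\<in>L. \<Sum>b\<in>Bs l. scale (u (l, b)) (phi l b))"
      unfolding I_def using fin by (subst sum.Sigma) auto
    also have "\<dots> = (\<Sum>l\<in>L. phi l (m l))"
      unfolding m_def by (intro sum.cong refl) (simp add: bounded_klinear_sum_distrib[OF lin] bounded_klinearD(3)[OF lin])
    finally have s0: "(\<Sum>l\<in>L. phi l (m l)) = 0" using z by (simp only:)
    have "m l = 0" if "l \<in> L" for l using inj[OF _ s0] mV that by blast
    then show ?thesis
      using lb ind[of l] E.dependent_finite[OF fin(2), of l] unfolding I_def m_def by auto
  qed
  show inj: "inj_on (\<lambda>(l, b). phi l b) I"
  proof (rule inj_onI, rule ccontr)
    fix p q assume p: "p \<in> I" and q: "q \<in> I" and eq: "(case p of (l, b) \<Rightarrow> phi l b) = (case q of (l, b) \<Rightarrow> phi l b)" and ne: "p \<noteq> q"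
    \<comment> \<open>Two equal images would give a relation with the coefficients \<open>1\<close>
      and \<open>- 1\<close>.\<close>
    define u where "u x = (if x = p then 1 else if x = q then - 1 else (0::'k))" for x
    have "(\<Sum>(l, b)\<in>I. scale (u (l, b)) (phi l b)) = (\<Sum>x\<in>I. scale (u x) (case x of (l, b) \<Rightarrow> phi l b))"
      by (intro sum.cong refl) auto
    also have "\<dots> = (\<Sum>x\<in>{p, q}. scale (u x) (case x of (l, b) \<Rightarrow> phi l b))"
      using p q finI by (intro sum.mono_neutral_right) (auto simp: u_def)
    also have "\<dots> = 0" using ne eq by (simp add: u_def)
    finally have "u p = 0" using coeff[of u "fst p" "snd p"] p by simp
    then show False by (simp add: u_def)
  qed
  show "independent ((\<lambda>(l, b). phi l b) ` I)"
  proof (rule independent_if_scalars_zero)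
    fix f x assume z: "(\<Sum>x\<in>(\<lambda>(l, b). phi l b) ` I. scale (f x) x) = 0" and x: "x \<in> (\<lambda>(l, b). phi l b) ` I"
    obtain l b where lb: "(l, b) \<in> I" "x = phi l b" using x by auto
    have "(\<Sum>(l, b)\<in>I. scale (f (phi l b)) (phi l b)) = 0"
      using z by (subst (asm) sum.reindex[OF inj]) (simp add: case_prod_unfold o_def)
    then have "(\<Sum>(l, b)\<in>I. scale ((\<lambda>(l, b). f (phi l b)) (l, b)) (phi l b)) = 0" by simp
    from coeff[OF this lb(1)] show "f x = 0" using lb by simp
  qed (use finI in auto)
qed

end

subsection \<open>First-order approximation\<close>

text \<open>\<open>f = a + O(\<epsilon>)\<close> uniformly on \<open>U\<close>, with \<epsilon> the
  first component of the point.\<close>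

definition near :: "('k::real_normed_field \<times> 'n) set \<Rightarrow> ('k \<times> 'n \<Rightarrow> 'k) \<Rightarrow> 'k \<Rightarrow> bool" where
  "near U f a \<longleftrightarrow> (\<exists>C. \<forall>p\<in>U. norm (f p - a) \<le> C * norm (fst p))"

lemma near_const: "near U (\<lambda>p. a) a"
  unfolding near_def by (rule exI[of _ 0]) simp

lemma near_add: assumes "near U f a" "near U g b" shows "near U (\<lambda>p. f p + g p) (a + b)"
proof -
  obtain C D where C: "\<And>p. p \<in> U \<Longrightarrow> norm (f p - a) \<le> C * norm (fst p)" "\<And>p. p \<in> U \<Longrightarrow> norm (g p - b) \<le> D * norm (fst p)"
    using assms unfolding near_def by blast
  have "norm (f p + g p - (a + b)) \<le> (C + D) * norm (fst p)" if "p \<in> U" for p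
    using C[OF that] norm_triangle_ineq[of "f p - a" "g p - b"] by (simp add: algebra_simps)
  then show ?thesis unfolding near_def by blast
qed

lemma near_mult:
  assumes "near U f a" "near U g b" and U: "\<And>p. p \<in> U \<Longrightarrow> norm (fst p) \<le> 1"
  shows "near U (\<lambda>p. f p * g p) (a * b)"
proof -
  obtain C D where C: "\<And>p. p \<in> U \<Longrightarrow> norm (f p - a) \<le> C * norm (fst p)" "\<And>p. p \<in> U \<Longrightarrow> norm (g p - b) \<le> D * norm (fst p)"
    using assms unfolding near_def by blast
  have "norm (f p * g p - a * b) \<le> ((norm a + \<bar>C\<bar>) * \<bar>D\<bar> + \<bar>C\<bar> * norm b) * norm (fst p)" if p: "p \<in> U" for p
  proof -
    have 1: "norm (f p - a) \<le> \<bar>C\<bar> * norm (fst p)" "norm (g p - b) \<le> \<bar>D\<bar> * norm (fst p)"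
      using C[OF p] by (meson abs_ge_self mult_right_mono norm_ge_zero order_trans)+
    have "\<bar>C\<bar> * norm (fst p) \<le> \<bar>C\<bar> * 1" using U[OF p] by (intro mult_left_mono) auto
    then have 2: "norm (f p) \<le> norm a + \<bar>C\<bar>"
      using 1(1) norm_triangle_sub[of "f p" a] by linarith
    have "f p * g p - a * b = f p * (g p - b) + (f p - a) * b" by (simp add: algebra_simps)
    then have "norm (f p * g p - a * b) \<le> norm (f p) * norm (g p - b) + norm (f p - a) * norm b"
      by (metis norm_mult norm_triangle_ineq)
    also have "\<dots> \<le> (norm a + \<bar>C\<bar>) * (\<bar>D\<bar> * norm (fst p)) + (\<bar>C\<bar> * norm (fst p)) * norm b"
      using 1 2 by (intro add_mono mult_mono) auto
    also have "\<dots> = ((norm a + \<bar>C\<bar>) * \<bar>D\<bar> + \<bar>C\<bar> * norm b) * norm (fst p)" by (simp add: algebra_simps)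
    finally show ?thesis .
  qed
  then show ?thesis unfolding near_def by blast
qed

lemma near_sum:
  "finite I \<Longrightarrow> (\<And>i. i \<in> I \<Longrightarrow> near U (f i) (a i)) \<Longrightarrow> near U (\<lambda>p. \<Sum>i\<in>I. f i p) (\<Sum>i\<in>I. a i)"
  by (induction I rule: finite_induct) (auto intro: near_const near_add)

lemma near_prod:
  assumes U: "\<And>p. p \<in> U \<Longrightarrow> norm (fst p) \<le> 1"
  shows "finite I \<Longrightarrow> (\<And>i. i \<in> I \<Longrightarrow> near U (f i) (a i)) \<Longrightarrow> near U (\<lambda>p. \<Prod>i\<in>I. f i p) (\<Prod>i\<in>I. a i)"
  by (induction I rule: finite_induct) (auto intro: near_const near_mult[OF _ _ U])

text \<open>By the Leibniz formula a determinant is a polynomial in its entries.\<close>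

lemma near_det:
  assumes U: "\<And>p. p \<in> U \<Longrightarrow> norm (fst p) \<le> 1"
    and M: "\<And>p. F p \<in> carrier_mat n n" "A \<in> carrier_mat n n"
    and near: "\<And>i j. i < n \<Longrightarrow> j < n \<Longrightarrow> near U (\<lambda>p. F p $$ (i, j)) (A $$ (i, j))"
  shows "near U (\<lambda>p. Determinant.det (F p)) (Determinant.det A)"
  unfolding det_def'[OF M(1)] det_def'[OF M(2)]
proof (intro near_sum near_mult near_const near_prod U near)
  show "finite {p. p permutes {0..<n}}" by (simp add: finite_permutations)
  fix p i assume p: "p \<in> {p. p permutes {0..<n}}" and i: "i \<in> {0..<n}"
  then show "p i < n" using permutes_in_image[of p "{0..<n}" i] by auto
qed auto

text \<open>An estimate in norm passes to the coordinates by \<open>representation_bounded\<close>,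
  and from them to the determinant.\<close>

lemma (in banach_over) near_det_cm:
  assumes cs: "independent (set cs)" and U: "\<And>p. p \<in> U \<Longrightarrow> norm (fst p) \<le> 1"
    and w: "\<And>p j. p \<in> U \<Longrightarrow> j < length cs \<Longrightarrow> w p j \<in> span (set cs)"
    and w0: "\<And>j. j < length cs \<Longrightarrow> w0 j \<in> span (set cs)"
    and est: "\<And>j. j < length cs \<Longrightarrow> \<exists>C. \<forall>p\<in>U. norm (w p j - w0 j) \<le> C * norm (fst p)"
  shows "near U (\<lambda>p. Determinant.det (cm cs (w p))) (Determinant.det (cm cs w0))"
proof (rule near_det[OF U cm_carrier cm_carrier])
  fix i j assume ij: "i < length cs" "j < length cs"
  obtain K where K: "K \<ge> 0" "\<And>u a. a \<in> set cs \<Longrightarrow> norm (u a) \<le> K * norm (\<Sum>v\<in>set cs. scale (u v) v)"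
    using representation_bounded[OF finite_set cs] by blast
  obtain C where C: "\<And>p. p \<in> U \<Longrightarrow> norm (w p j - w0 j) \<le> C * norm (fst p)" using est[OF ij(2)] by blast
  have "norm (cm cs (w p) $$ (i, j) - cm cs w0 $$ (i, j)) \<le> K * C * norm (fst p)" if p: "p \<in> U" for p
  proof -
    let ?d = "w p j - w0 j"
    have d: "?d \<in> span (set cs)" using w[OF p ij(2)] w0[OF ij(2)] by (rule span_diff)
    have "cm cs (w p) $$ (i, j) - cm cs w0 $$ (i, j) = representation (set cs) ?d (cs ! i)"
      using ij representation_diff[OF cs w0[OF ij(2)] w[OF p ij(2)]] by (simp add: cm_def)
    also have "norm \<dots> \<le> K * norm (\<Sum>v\<in>set cs. scale (representation (set cs) ?d v) v)"
      using ij by (intro K) auto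
    also have "(\<Sum>v\<in>set cs. scale (representation (set cs) ?d v) v) = ?d"
      using sum_representation_eq[OF cs d finite_set order_refl] .
    also have "K * norm ?d \<le> K * (C * norm (fst p))" by (intro mult_left_mono C p K)
    finally show ?thesis by (simp add: mult.assoc)
  qed
  then show "near U (\<lambda>p. cm cs (w p) $$ (i, j)) (cm cs w0 $$ (i, j))" unfolding near_def by blast
qed

context two_spaces
begin

lemma cm_transport:
  assumes f: "bounded_klinear sZ sF f" and cs: "F.independent (set cs)" "F.span (set cs) = UNIV"
    and bs: "Z.independent (set bs)" "distinct bs" "length bs = length cs"
    and w: "\<And>j. j < length bs \<Longrightarrow> w j \<in> Z.span (set bs)"
  shows "F.cm cs (\<lambda>j. f (w j)) = F.cm cs (\<lambda>j. f (bs ! j)) * Z.cm bs w"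
proof (rule F.cm_mult[OF cs(1)])
  show "f (bs ! p) \<in> F.span (set cs)" for p using cs(2) by simp
  show "Z.cm bs w \<in> carrier_mat (length cs) (length cs)" using Z.cm_carrier[of bs w] bs(3) by simp
  fix j assume j: "j < length cs"
  then have "f (w j) = f (\<Sum>p<length bs. sZ (Z.representation (set bs) (w j) (bs ! p)) (bs ! p))"
    using Z.representation_expand[OF bs(1,2) w] bs(3) by metis
  also have "\<dots> = (\<Sum>p<length cs. sF (Z.cm bs w $$ (p, j)) (f (bs ! p)))"
    using j bs(3) by (simp add: bounded_klinear_sum_distrib[OF f] bounded_klinearD(3)[OF f] Z.cm_def)
  finally show "f (w j) = (\<Sum>p<length cs. sF (Z.cm bs w $$ (p, j)) (f (bs ! p)))" .
qed

end

section \<open>The determinant of the linearization\<close>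

context kernel_chain
begin

lemma N_antimono: "i \<le> j \<Longrightarrow> j \<le> k + 1 \<Longrightarrow> N j \<subseteq> N i"
proof (induction j rule: dec_induct)
  case (step j) then show ?case using N_Suc_subset[of j] by simp
qed simp

text \<open>The summands after \<open>m i\<close> lie in \<open>N (Suc i)\<close>, which meets
  \<open>Nc (Suc i)\<close> only in \<open>0\<close>; so the \<open>m i\<close> vanish one after the
  other.\<close>

lemma Nc_independent:
  assumes m: "\<And>i. i \<le> k \<Longrightarrow> m i \<in> Nc (Suc i)" and sum: "(\<Sum>i=0..k. m i) = 0"
  shows "i \<le> k \<Longrightarrow> m i = 0"
proof (induction i rule: less_induct)
  case (less i)
  have "(\<Sum>i=0..k. m i) = (\<Sum>p=i..k. m p)"
    using less by (intro sum.mono_neutral_right) auto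
  also have "\<dots> = m i + (\<Sum>p=Suc i..k. m p)" using less.prems by (rule sum.atLeast_Suc_atMost)
  finally have eq: "m i + (\<Sum>p=Suc i..k. m p) = 0" using sum by simp
  have sub: "B.subspace (N (Suc i))" using N_subspace(1)[of "Suc i"] less.prems by simp
  have "m p \<in> N (Suc i)" if "p \<in> {Suc i..k}" for p
    using m[of p] Nc_subset[of p] N_antimono[of "Suc i" p] that by auto
  then have "- (\<Sum>p=Suc i..k. m p) \<in> N (Suc i)" by (intro B.subspace_neg[OF sub] B.subspace_sum[OF sub])
  moreover have "m i = - (\<Sum>p=Suc i..k. m p)" using eq by (simp add: eq_neg_iff_add_eq_0)
  ultimately have "m i \<in> Nc (Suc i) \<inter> N (Suc i)" using m[OF less.prems] by simp
  then show ?case using dec_at(7)[OF less.prems] unfolding direct_sum_def by blast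
qed

text \<open>\<open>J (k + 1)\<close> recovers every \<open>m i\<close> from the sum of the defects,
  and it maps \<open>0\<close> to \<open>0\<close>.\<close>

lemma rh_independent:
  assumes m: "\<And>i. i \<le> k \<Longrightarrow> m i \<in> Nc (Suc i)" and sum: "(\<Sum>i=0..k. rh i (m i)) = 0" and i: "i \<le> k"
  shows "m i = 0"
proof -
  have "(\<Sum>p=1..k+1. rh (p - 1) (m (p - 1))) = (\<Sum>i=0..k. rh i (m i))"
    using sum.shift_bounds_cl_Suc_ivl[of "\<lambda>p. rh (p - 1) (m (p - 1))" 0 k] by simp
  then have "J (k + 1) (Suc i) 0 = m (Suc i - 1)"
    using J_inverse[of "k + 1" "\<lambda>p. m (p - 1)" "Suc i"] sum i m[of "p - 1" for p]
    by (metis (no_types, lifting) One_nat_def Suc_eq_plus1 Suc_le_mono Suc_pred' atLeastAtMost_iff diff_Suc_1 le_refl less_eq_Suc_le zero_less_Suc)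
  then show ?thesis using bounded_klinearD(4)[OF J_klinear[of "k + 1"]] by simp
qed

end

context solution_setup
begin

abbreviation dG :: "'k \<times> ('b ^ 'n) \<Rightarrow> 'b \<Rightarrow> 'c" where
  "dG p \<equiv> frechet_derivative G (at (sol p))"

lemma dG_eq: assumes "p \<in> Wm m" shows "dG p = (\<lambda>u. ser G1 [u] (sol p))" "norm (sol p) \<le> r / 2"
proof -
  show "norm (sol p) \<le> r / 2" using cv_bound_Wm[OF assms] by (simp add: sol_def)
  then have "norm (sol p) < r" using half_r by linarith
  then show "dG p = (\<lambda>u. ser G1 [u] (sol p))" by (rule frechet_derivative_G)
qed

lemma dG_klinear:
  assumes p: "p \<in> Wm m" shows "bounded_klinear sB sC (dG p)"
proof -
  have "norm (sol p) < r" using dG_eq(2)[OF p] half_r by linarith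
  then have "bounded_linear (dG p)" unfolding dG_eq(1)[OF p] by (rule has_derivative_bounded_linear[OF G_has_derivative])
  moreover have "dG p (sB c u) = sC c (dG p u)" for c u
    using ser_scale[OF half_r admissible_weight_G1 dG_eq(2)[OF p], of 0 "[u]" c u] by (simp add: dG_eq(1)[OF p])
  ultimately show ?thesis by (simp add: bounded_klinear_def)
qed

text \<open>Up to order \<open>k\<close> the derivative along the solution has the same coefficients
  as along \<open>zbar\<close>, because these depend on the first \<open>k\<close> coefficients of
  the curve only. The remainder is uniform since all coefficients are bounded for points of
  \<open>Wm m\<close>.\<close>

lemma dG_expansion:
  obtains C where "C \<ge> 0" "\<And>p u. p \<in> Wm m \<Longrightarrow>
    norm (dG p u - (\<Sum>a=0..k. sC (fst p ^ a) (A a u))) \<le> C * norm (fst p) ^ (k + 1) * norm u"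
proof -
  interpret TB: tower_spaces sZ sB VZ by (rule tower_Z[OF Z.banach_over_axioms])
  have "\<exists>c\<ge>0. \<forall>x\<in>Om (dl m) (real m). norm (zc x i) \<le> c" for i
    using TB.bsmooth_bound[OF bsmooth_zc[of "dl m" "real m" i]] by metis
  then obtain c where c: "\<And>i. c i \<ge> 0" "\<And>i x. x \<in> Om (dl m) (real m) \<Longrightarrow> norm (zc x i) \<le> c i" by metis
  define c' where "c' = (\<Sum>i\<le>2*k+1. c i)"
  have zcb: "norm (zc x i) \<le> c'" if "x \<in> Om (dl m) (real m)" for x i
  proof (cases "i \<le> 2 * k + 1")
    case True
    then have "c i \<le> c'" unfolding c'_def by (intro member_le_sum c) auto
    then show ?thesis using c(2)[OF that, of i] by linarith
  next
    case False
    moreover have "0 \<le> c'" unfolding c'_def by (intro sum_nonneg c)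
    ultimately show ?thesis by (simp add: zeta_zero)
  qed
  obtain C where C: "C \<ge> 0" "\<And>e z vs. length vs = 1 \<Longrightarrow> norm e \<le> 1 \<Longrightarrow> (\<And>i. norm (z i) \<le> c') \<Longrightarrow>
      norm (pcurve (2 * k + 1) e z) \<le> r / 2 \<Longrightarrow>
      norm (rmd (2 * k + 1) e z G1 (k + 1) vs) \<le> C * prod_list (map norm vs)"
    using rmd_bound[OF half_r admissible_weight_G1, where m=1 and c=c' and n="2*k+1" and q="k+1"] by blast
  show ?thesis
  proof (rule that[OF C(1)])
    fix p u assume p: "p \<in> Wm m"
    define z where "z = zc (p, ysol p)"
    have b: "norm (pcurve (2 * k + 1) (fst p) z) \<le> r / 2" using dG_eq(2)[OF p] by (simp add: sol_def cv_def z_def)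
    have "norm (fst p) < dl m" using p by (cases p) (simp add: Wm_def dom_iff)
    then have e: "norm (fst p) \<le> 1" using dl(2)[of m] by linarith
    have "dG p u = ser G1 [u] (pcurve (2 * k + 1) (fst p) z)"
      unfolding dG_eq(1)[OF p] by (simp add: sol_def cv_def z_def)
    also have "\<dots> = (\<Sum>a<k+1. sC (fst p ^ a) (gam G1 a [u] z)) + sC (fst p ^ (k + 1)) (rmd (2 * k + 1) (fst p) z G1 (k + 1) [u])"
      by (rule ser_expansion[OF half_r b _ admissible_weight_G1]) (simp add: z_def zeta_zero)
    also have "(\<Sum>a<k+1. sC (fst p ^ a) (gam G1 a [u] z)) = (\<Sum>a=0..k. sC (fst p ^ a) (A a u))"
    proof (rule sum.cong)
      fix a assume "a \<in> {0..k}"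
      then have "gam G1 a [u] z = gam G1 a [u] z0" by (intro gam_cong) (auto simp: z_def zeta_def)
      then show "sC (fst p ^ a) (gam G1 a [u] z) = sC (fst p ^ a) (A a u)" by (simp add: A_eq)
    qed auto
    finally have "norm (dG p u - (\<Sum>a=0..k. sC (fst p ^ a) (A a u))) =
        norm (fst p) ^ (k + 1) * norm (rmd (2 * k + 1) (fst p) z G1 (k + 1) [u])"
      by (simp add: F.norm_scale norm_power norm_mult)
    also have "\<dots> \<le> norm (fst p) ^ (k + 1) * (C * norm u)"
      using C(2)[of "[u]" "fst p" z] e b zcb[OF ysol_Om[OF p]] by (intro mult_left_mono) (auto simp: z_def)
    finally show "norm (dG p u - (\<Sum>a=0..k. sC (fst p ^ a) (A a u))) \<le> C * norm (fst p) ^ (k + 1) * norm u"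
      by (simp add: mult_ac)
  qed
qed

text \<open>For \<open>i \<le> k\<close> the fixed upper bound \<open>k\<close> cuts nothing off, as
  \<open>E i j\<close> vanishes for \<open>j \<ge> max i 1\<close>.\<close>

definition theta :: "'k \<Rightarrow> nat \<Rightarrow> 'b \<Rightarrow> 'b" where
  "theta e i v = (\<Sum>j=0..k. sB (e ^ j) (E i j v))"

lemma norm_Wm: assumes "p \<in> Wm m" shows "norm (fst p) \<le> 1"
proof -
  have "norm (fst p) < dl m" using assms by (cases p) (simp add: Wm_def dom_iff)
  then show ?thesis using dl(2)[of m] by linarith
qed

lemma theta_near:
  obtains C where "C \<ge> 0" "\<And>e. norm e \<le> 1 \<Longrightarrow> norm (theta e i v - v) \<le> C * norm e"
    "\<And>e. norm e \<le> 1 \<Longrightarrow> norm (theta e i v) \<le> C"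
proof -
  define C where "C = (\<Sum>j=0..k. norm (E i j v))"
  have C: "C \<ge> 0" unfolding C_def by (intro sum_nonneg) auto
  show ?thesis
  proof (rule that[OF C])
    fix e :: 'k assume e: "norm e \<le> 1"
    have "theta e i v = v + (\<Sum>j=1..k. sB (e ^ j) (E i j v))"
      unfolding theta_def by (subst sum.atLeast_Suc_atMost) (auto simp: E_0_index)
    then have "norm (theta e i v - v) = norm (\<Sum>j=1..k. sB (e ^ j) (E i j v))" by simp
    also have "\<dots> \<le> (\<Sum>j=1..k. norm e * norm (E i j v))"
    proof (rule sum_norm_le)
      fix j assume "j \<in> {1..k}"
      then have "norm e ^ j \<le> norm e ^ 1" using e by (intro power_decreasing) auto
      then show "norm (sB (e ^ j) (E i j v)) \<le> norm e * norm (E i j v)"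
        by (simp add: Z.norm_scale norm_power mult_right_mono)
    qed
    also have "\<dots> \<le> (\<Sum>j=0..k. norm e * norm (E i j v))" by (intro sum_mono2) auto
    finally show "norm (theta e i v - v) \<le> C * norm e" unfolding C_def sum_distrib_left[symmetric] by (simp only: mult.commute)
    show "norm (theta e i v) \<le> C"
      unfolding theta_def C_def
    proof (rule sum_norm_le)
      fix j
      have "norm e ^ j \<le> 1" using e by (intro power_le_one) auto
      then show "norm (sB (e ^ j) (E i j v)) \<le> norm (E i j v)"
        using mult_right_mono[of "norm e ^ j" 1 "norm (E i j v)"] by (simp add: Z.norm_scale norm_power)
    qed
  qed
qed

text \<open>Products of total order up to \<open>i\<close> regroup into the rows of
  \<open>E i\<close>, all but the last of which vanish on \<open>N i\<close>. The finitely many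
  other products carry at least \<open>i + 1\<close> powers of \<epsilon>, as does the remainder of
  order \<open>k + 1\<close>.\<close>

lemma dG_theta:
  assumes i: "i \<le> k" and v: "v \<in> N i"
  obtains C where "\<And>p. p \<in> Wm m \<Longrightarrow>
    norm (dG p (theta (fst p) i v) - sC (fst p ^ i) (rh i v)) \<le> C * norm (fst p) ^ (i + 1)"
proof -
  obtain C1 where C1: "C1 \<ge> 0" "\<And>p u. p \<in> Wm m \<Longrightarrow>
    norm (dG p u - (\<Sum>a=0..k. sC (fst p ^ a) (A a u))) \<le> C1 * norm (fst p) ^ (k + 1) * norm u"
    using dG_expansion by blast
  obtain C2 where C2: "C2 \<ge> 0" "\<And>e. norm e \<le> 1 \<Longrightarrow> norm (theta e i v) \<le> C2" using theta_near by metis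
  let ?t = "\<lambda>(a, j). A a (E i j v)"
  let ?Q = "{0..k} \<times> {0..k}" and ?D = "{(a, j). a + j \<le> i}"
  define C3 where "C3 = (\<Sum>x\<in>?Q. norm (?t x))"
  have DQ: "?D \<subseteq> ?Q" using i by auto
  show ?thesis
  proof (rule that[of "C1 * C2 + C3"])
    fix p assume p: "p \<in> Wm m"
    define e where "e = fst p"
    have e: "norm e \<le> 1" using norm_Wm[OF p] by (simp add: e_def)
    let ?s = "\<lambda>(a, j). sC (e ^ (a + j)) (A a (E i j v))"
    have "(\<Sum>a=0..k. sC (e ^ a) (A a (theta e i v))) = (\<Sum>a=0..k. \<Sum>j=0..k. ?s (a, j))"
      unfolding theta_def
      by (intro sum.cong refl) (simp add: bounded_klinear_sum_distrib[OF A_lin] bounded_klinearD(3)[OF A_lin] F.scale_sum_right power_add)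
    also have "\<dots> = (\<Sum>x\<in>?Q. ?s x)" by (simp add: sum.cartesian_product case_prod_unfold)
    also have "\<dots> = (\<Sum>x\<in>?D. ?s x) + (\<Sum>x\<in>?Q - ?D. ?s x)"
      using sum.subset_diff[OF DQ, of ?s] by (simp add: add.commute)
    also have "(\<Sum>x\<in>?D. ?s x) = (\<Sum>s\<le>i. \<Sum>a\<le>s. sC (e ^ (a + (s - a))) (A a (E i (s - a) v)))"
      using sum.triangle_reindex_eq[of "\<lambda>a j. ?s (a, j)" i] by (simp add: case_prod_unfold)
    also have "\<dots> = (\<Sum>s\<le>i. sC (e ^ s) (row i s v))"
      unfolding row_def F.scale_sum_right atMost_atLeast0 by (intro sum.cong refl) auto
    also have "\<dots> = (\<Sum>s\<le>i. if s = i then sC (e ^ i) (rh i v) else 0)"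
    proof (intro sum.cong refl)
      fix s assume "s \<in> {..i}"
      then show "sC (e ^ s) (row i s v) = (if s = i then sC (e ^ i) (rh i v) else 0)"
        using row_zero[of i v s] i v by (cases "s = i") auto
    qed
    also have "\<dots> = sC (e ^ i) (rh i v)" by simp
    finally have main: "(\<Sum>a=0..k. sC (e ^ a) (A a (theta e i v))) - sC (e ^ i) (rh i v) = (\<Sum>x\<in>?Q - ?D. ?s x)" by simp
    have "norm (\<Sum>x\<in>?Q - ?D. ?s x) \<le> (\<Sum>x\<in>?Q - ?D. norm e ^ (i + 1) * norm (?t x))"
    proof (rule sum_norm_le)
      fix x assume x: "x \<in> ?Q - ?D"
      then have "norm e ^ (fst x + snd x) \<le> norm e ^ (i + 1)" using e by (intro power_decreasing) auto
      then show "norm (?s x) \<le> norm e ^ (i + 1) * norm (?t x)"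
        by (simp add: case_prod_unfold F.norm_scale norm_power mult_right_mono)
    qed
    also have "\<dots> \<le> (\<Sum>x\<in>?Q. norm e ^ (i + 1) * norm (?t x))" by (intro sum_mono2) auto
    also have "\<dots> = C3 * norm e ^ (i + 1)" by (simp add: C3_def sum_distrib_left[symmetric] mult.commute)
    finally have 1: "norm ((\<Sum>a=0..k. sC (e ^ a) (A a (theta e i v))) - sC (e ^ i) (rh i v)) \<le> C3 * norm e ^ (i + 1)"
      by (simp only: main)
    have "norm (dG p (theta e i v) - (\<Sum>a=0..k. sC (e ^ a) (A a (theta e i v)))) \<le> C1 * norm e ^ (k + 1) * norm (theta e i v)"
      using C1(2)[OF p] by (simp add: e_def)
    also have "\<dots> \<le> C1 * norm e ^ (i + 1) * C2"
      using C1(1) C2(2)[OF e] e i by (intro mult_mono power_decreasing mult_nonneg_nonneg) auto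
    finally have 2: "norm (dG p (theta e i v) - (\<Sum>a=0..k. sC (e ^ a) (A a (theta e i v)))) \<le> C1 * C2 * norm e ^ (i + 1)"
      by (simp add: mult_ac)
    show "norm (dG p (theta (fst p) i v) - sC (fst p ^ i) (rh i v)) \<le> (C1 * C2 + C3) * norm (fst p) ^ (i + 1)"
      using norm_diff_triangle_le[OF 2 1] by (simp add: e_def distrib_right)
  qed
qed

text \<open>At \<open>\<epsilon> = 0\<close> the quotient would be the junk value \<open>0\<close>; the limit takes its place.\<close>

definition Yv :: "nat \<Rightarrow> 'b \<Rightarrow> 'k \<times> ('b ^ 'n) \<Rightarrow> 'c" where
  "Yv i v p = (if fst p = 0 then rh i v else sC (inverse (fst p ^ i)) (dG p (theta (fst p) i v)))"

lemma Yv: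
  assumes i: "i \<le> k" and v: "v \<in> N i"
  shows "p \<in> Wm m \<Longrightarrow> dG p (theta (fst p) i v) = sC (fst p ^ i) (Yv i v p)"
    and "\<exists>C. \<forall>p\<in>Wm m. norm (Yv i v p - rh i v) \<le> C * norm (fst p)"
proof -
  obtain C where C: "\<And>p. p \<in> Wm m \<Longrightarrow>
    norm (dG p (theta (fst p) i v) - sC (fst p ^ i) (rh i v)) \<le> C * norm (fst p) ^ (i + 1)"
    using dG_theta[OF i v] by blast
  show eq: "dG p (theta (fst p) i v) = sC (fst p ^ i) (Yv i v p)" if p: "p \<in> Wm m" for p
  proof (cases "fst p = 0")
    \<comment> \<open>At \<open>\<epsilon> = 0\<close> the error bound is \<open>0\<close>, its
      exponent \<open>i + 1\<close> being positive, so the factorization holds there as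
      well.\<close>
    case True
    then show ?thesis using C[OF p] by (simp add: Yv_def)
  qed (simp add: Yv_def)
  have "norm (Yv i v p - rh i v) \<le> \<bar>C\<bar> * norm (fst p)" if p: "p \<in> Wm m" for p
  proof (cases "fst p = 0")
    case False
    have "norm (fst p) ^ i * norm (Yv i v p - rh i v) \<le> norm (fst p) ^ i * (C * norm (fst p))"
      using C[OF p] unfolding eq[OF p] by (simp add: F.scale_right_diff_distrib[symmetric] F.norm_scale norm_power mult_ac)
    then have "norm (Yv i v p - rh i v) \<le> C * norm (fst p)" using False by (simp add: mult_le_cancel_left)
    also have "\<dots> \<le> \<bar>C\<bar> * norm (fst p)" by (intro mult_right_mono) auto
    finally show ?thesis .
  qed (simp add: Yv_def)
  then show "\<exists>C. \<forall>p\<in>Wm m. norm (Yv i v p - rh i v) \<le> C * norm (fst p)" by blast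
qed

lemma theta_NC: assumes "i \<le> k" "v \<in> Nc (Suc i)" shows "theta e i v \<in> NC"
  unfolding theta_def
proof (intro Z.subspace_sum[OF NC_subspace] Z.subspace_scale[OF NC_subspace])
  fix j show "E i j v \<in> NC"
    using E_NC[of i j v] Nc_NC[of "Suc i" v] assms E_0_index[of i v] by (cases j) auto
qed

abbreviation chi :: nat where "chi \<equiv> (\<Sum>i=1..k. i * Z.dim (Nc (i + 1)))"

lemma NC_decompose:
  assumes "v \<in> NC"
  obtains m where "v = (\<Sum>i=0..k. m i)" "\<And>i. i \<le> k \<Longrightarrow> m i \<in> Nc (Suc i)"
proof -
  obtain u where u: "v = (\<Sum>l=1..k+1. u l)" "\<And>l. l \<in> {1..k+1} \<Longrightarrow> u l \<in> Nc l"
    using assms unfolding NC_def subspace_sum_def by blast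
  have "v = (\<Sum>i=0..k. u (Suc i))" using u(1) sum.shift_bounds_cl_Suc_ivl[of u 0 k] by simp
  then show ?thesis using u(2) by (intro that[of "\<lambda>i. u (Suc i)"]) auto
qed

text \<open>Every basis vector is listed with its level, which becomes the power of \<epsilon> in
  its column of the determinant. The defects span because \<open>Jt_sum\<close> writes any vector as
  a sum of defects, and they are independent by \<open>rh_independent\<close>.\<close>

lemma adapted_basis:
  assumes fin: "finite_dim sB NC"
  obtains pl where "\<forall>x\<in>set pl. fst x \<le> k \<and> snd x \<in> Nc (Suc (fst x))"
    "Z.independent (set (map snd pl))" "distinct (map snd pl)" "Z.span (set (map snd pl)) = NC"
    "F.independent (set (map (\<lambda>(i, b). rh i b) pl))" "distinct (map (\<lambda>(i, b). rh i b) pl)"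
    "F.span (set (map (\<lambda>(i, b). rh i b) pl)) = UNIV" "sum_list (map fst pl) = chi"
proof -
  obtain B0 where B0: "finite B0" "NC \<subseteq> Z.span B0" using fin unfolding finite_dim_def by blast
  have "\<exists>D. D \<subseteq> Nc (Suc i) \<and> Z.independent D \<and> Nc (Suc i) \<subseteq> Z.span D \<and> card D = Z.dim (Nc (Suc i))" for i
    using Z.basis_exists by metis
  then obtain D where D: "\<And>i. D i \<subseteq> Nc (Suc i)" "\<And>i. Z.independent (D i)" "\<And>i. Nc (Suc i) \<subseteq> Z.span (D i)"
    "\<And>i. card (D i) = Z.dim (Nc (Suc i))" by metis
  have finD: "finite (D i)" if i: "i \<in> {0..k}" for i
  proof -
    have "D i \<subseteq> NC" using D(1)[of i] Nc_NC[of "Suc i"] i by auto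
    then show ?thesis using Z.independent_span_bound[OF B0(1) D(2)] B0(2) by blast
  qed
  define I where "I = Sigma {0..k} D"
  have "finite I" unfolding I_def using finD by blast
  then obtain pl where pl: "set pl = I" "distinct pl" using finite_distinct_list by metis
  note fam = Z.banach_over_axioms finite_atLeastAtMost finD D(2) D(1)
  have sub: "Z.subspace (Nc (Suc i))" if "i \<in> {0..k}" for i using Nc_subspace(1) that by auto
  have inj1: "\<forall>i\<in>{0..k}. m i = 0" if "\<forall>i\<in>{0..k}. m i \<in> Nc (Suc i)" "(\<Sum>i\<in>{0..k}. m i) = 0" for m
    using Nc_independent[of m] that by simp
  have inj2: "\<forall>i\<in>{0..k}. m i = 0" if "\<forall>i\<in>{0..k}. m i \<in> Nc (Suc i)" "(\<Sum>i\<in>{0..k}. rh i (m i)) = 0" for m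
    using rh_independent[of m] that by simp
  have lin: "bounded_klinear sB sC (rh i)" if "i \<in> {0..k}" for i using that by (intro rh_klinear) auto
  note inj = Z.independent_family[where phi="\<lambda>i b. b" and L="{0..k}" and Bs=D and V="\<lambda>i. Nc (Suc i)" and sE=sB, OF fam sub bounded_klinear_ident inj1, folded I_def]
  note rinj = F.independent_family[where phi=rh and L="{0..k}" and Bs=D and V="\<lambda>i. Nc (Suc i)" and sE=sB, OF fam sub lin inj2, folded I_def]
  have Dsp: "D i \<subseteq> (\<lambda>(i, b). b) ` I" if "i \<le> k" for i using that by (force simp: I_def)
  have snd_eq: "(\<lambda>(i, b). b) = (snd :: nat \<times> 'b \<Rightarrow> 'b)" by auto
  show ?thesis
  proof (rule that[of pl])
    show "\<forall>x\<in>set pl. fst x \<le> k \<and> snd x \<in> Nc (Suc (fst x))"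
    proof
      fix x assume "x \<in> set pl"
      then show "fst x \<le> k \<and> snd x \<in> Nc (Suc (fst x))"
        using pl(1) D(1)[of "fst x"] by (auto simp: I_def)
    qed
    show "Z.independent (set (map snd pl))" "distinct (map snd pl)"
      using inj pl unfolding snd_eq by (simp_all only: distinct_map set_map simp_thms)
    show "F.independent (set (map (\<lambda>(i, b). rh i b) pl))" "distinct (map (\<lambda>(i, b). rh i b) pl)"
      using rinj pl by (simp_all only: distinct_map set_map simp_thms)
    show "Z.span (set (map snd pl)) = NC"
    proof (rule antisym)
      have "b \<in> NC" if "i \<le> k" "b \<in> D i" for i b using Nc_NC[of "Suc i" b] D(1)[of i] that by auto
      then have "snd ` I \<subseteq> NC" by (auto simp: I_def)
      then show "Z.span (set (map snd pl)) \<subseteq> NC" using Z.span_minimal[OF _ NC_subspace] pl(1) by simp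
      show "NC \<subseteq> Z.span (set (map snd pl))"
      proof
        fix v assume "v \<in> NC"
        then obtain m where m: "v = (\<Sum>i=0..k. m i)" "\<And>i. i \<le> k \<Longrightarrow> m i \<in> Nc (Suc i)" using NC_decompose by blast
        have "m i \<in> Z.span (snd ` I)" if "i \<in> {0..k}" for i
          using m(2)[of i] D(3)[of i] Z.span_mono[OF Dsp[of i]] that unfolding snd_eq by auto
        then show "v \<in> Z.span (set (map snd pl))" unfolding m(1) pl(1) set_map by (intro Z.span_sum)
      qed
    qed
    have rhsp: "rh i v \<in> F.span ((\<lambda>(i, b). rh i b) ` I)" if i: "i \<le> k" and v: "v \<in> Z.span (D i)" for i v
      using v
    proof (induction rule: Z.span_induct_alt)
      have lin: "bounded_klinear sB sC (rh i)" using i by (intro rh_klinear) auto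
      case base show ?case using F.span_zero by (simp add: bounded_klinearD(4)[OF lin])
      case (step c x y)
      have "rh i x \<in> F.span ((\<lambda>(i, b). rh i b) ` I)" using step(1) i by (intro F.span_base) (force simp: I_def)
      then show ?case using step(2)
        by (simp add: bounded_klinearD(2,3)[OF lin] F.span_add F.span_scale)
    qed
    have "y \<in> F.span ((\<lambda>(i, b). rh i b) ` I)" for y
    proof -
      have "rh (l - 1) (Jt l y) \<in> F.span ((\<lambda>(i, b). rh i b) ` I)" if "l \<in> {1..k+1}" for l
        using Jt_mem[OF that, of y] D(3)[of "l - 1"] that by (intro rhsp) auto
      then have "(\<Sum>l=1..k+1. rh (l - 1) (Jt l y)) \<in> F.span ((\<lambda>(i, b). rh i b) ` I)" by (rule F.span_sum)
      then show ?thesis by (simp only: Jt_sum)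
    qed
    then show "F.span (set (map (\<lambda>(i, b). rh i b) pl)) = UNIV" using pl(1) by auto
    have "sum_list (map fst pl) = (\<Sum>x\<in>I. fst x)" using pl by (simp add: sum_list_distinct_conv_sum_set)
    also have "\<dots> = (\<Sum>i=0..k. \<Sum>b\<in>D i. i)"
      unfolding I_def using finD by (subst sum.Sigma) (auto simp: case_prod_unfold)
    also have "\<dots> = (\<Sum>i=0..k. i * Z.dim (Nc (i + 1)))" by (intro sum.cong) (auto simp: D(4))
    also have "\<dots> = chi" by (subst sum.atLeast_Suc_atMost) auto
    finally show "sum_list (map fst pl) = chi" .
  qed
qed

lemma finite_dim_codomain:
  assumes "finite_dim sB NC"
  shows "finite_dim sC UNIV" "F.dim UNIV = Z.dim NC"
proof -
  obtain pl where pl: "\<forall>x\<in>set pl. fst x \<le> k \<and> snd x \<in> Nc (Suc (fst x))"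
    "Z.independent (set (map snd pl))" "distinct (map snd pl)" "Z.span (set (map snd pl)) = NC"
    "F.independent (set (map (\<lambda>(i, b). rh i b) pl))" "distinct (map (\<lambda>(i, b). rh i b) pl)"
    "F.span (set (map (\<lambda>(i, b). rh i b) pl)) = UNIV" "sum_list (map fst pl) = chi"
    by (rule adapted_basis[OF assms]) (rule that)
  show "finite_dim sC UNIV" unfolding finite_dim_def by (intro exI[of _ "set (map (\<lambda>(i, b). rh i b) pl)"]) (simp only: pl(7) List.finite_set subset_UNIV simp_thms)
  have "Z.dim NC = length pl"
    using Z.dim_span_eq_card_independent[OF pl(2)] distinct_card[OF pl(3)] unfolding pl(4) length_map by (simp only:)
  moreover have "F.dim UNIV = length pl"
    using F.dim_span_eq_card_independent[OF pl(5)] distinct_card[OF pl(6)] unfolding pl(7) length_map by (simp only:)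
  ultimately show "F.dim UNIV = Z.dim NC" by simp
qed

text \<open>On the perturbed adapted basis the linearization has determinant \<open>y p\<close>
  times a power of \<epsilon>. Dividing by the transition determinant \<open>x p\<close> of the
  perturbation gives the value on the adapted basis, and the factor \<open>q\<close> passes to the
  given basis.\<close>

lemma determinant_expansion:
  assumes fin: "finite_dim sB NC" and bs: "is_basis sB NC bs" and cs: "is_basis sC UNIV cs"
  shows "\<exists>c. c \<noteq> 0 \<and> (\<forall>m. \<exists>C. \<exists>\<epsilon>0>0. \<forall>p\<in>Wm m. norm (fst p) < \<epsilon>0 \<longrightarrow>
    norm (det_wrt sC bs cs (dG p) - c * fst p ^ chi) \<le> C * norm (fst p) ^ (chi + 1))"
proof -
  obtain pl where pl: "\<forall>x\<in>set pl. fst x \<le> k \<and> snd x \<in> Nc (Suc (fst x))"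
    "Z.independent (set (map snd pl))" "distinct (map snd pl)" "Z.span (set (map snd pl)) = NC"
    "F.independent (set (map (\<lambda>(i, b). rh i b) pl))" "distinct (map (\<lambda>(i, b). rh i b) pl)"
    "F.span (set (map (\<lambda>(i, b). rh i b) pl)) = UNIV" "sum_list (map fst pl) = chi"
    by (rule adapted_basis[OF fin]) (rule that)
  define bl where "bl = map snd pl"
  define lv where "lv j = fst (pl ! j)" for j
  note bl = pl(2-4)[folded bl_def]
  have cs': "distinct cs" "F.independent (set cs)" "F.span (set cs) = UNIV" using cs by (auto simp: is_basis_def)
  have bs': "distinct bs" "Z.independent (set bs)" "Z.span (set bs) = NC" using bs by (auto simp: is_basis_def)
  define d where "d = length pl"
  have len: "length bl = d" by (simp add: bl_def d_def)
  have "Z.dim NC = d"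
    using Z.dim_span_eq_card_independent[OF bl(1)] bl(3) distinct_card[OF bl(2)] len by simp
  then have lenbs: "length bs = d"
    using Z.dim_span_eq_card_independent[OF bs'(2)] bs'(3) distinct_card[OF bs'(1)] by simp
  have lencs: "length cs = d"
    using F.dim_span_eq_card_independent[OF cs'(2)] cs'(3) distinct_card[OF cs'(1)]
      finite_dim_codomain(2)[OF fin] \<open>Z.dim NC = d\<close> by simp
  have lv: "lv j \<le> k" "bl ! j \<in> Nc (Suc (lv j))" "bl ! j \<in> N (lv j)" if "j < d" for j
  proof -
    have "pl ! j \<in> set pl" using that by (simp add: d_def)
    then show 1: "lv j \<le> k" "bl ! j \<in> Nc (Suc (lv j))" using pl(1) that by (auto simp: lv_def bl_def d_def)
    then show "bl ! j \<in> N (lv j)" using Nc_subset by blast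
  qed
  define rb where "rb j = rh (lv j) (bl ! j)" for j
  have rb: "rb j = map (\<lambda>(i, b). rh i b) pl ! j" if "j < d" for j
    using that by (simp add: rb_def lv_def bl_def d_def case_prod_unfold)
  define y0 where "y0 = Determinant.det (F.cm cs rb)"
  define q where "q = Determinant.det (Z.cm bl ((!) bs))"
  have y0: "y0 \<noteq> 0"
    unfolding y0_def
  proof (rule F.det_cm_nonzero[OF cs'(2,1)])
    show "rb p \<in> F.span (set cs)" for p using cs'(3) by simp
    fix j
    let ?cl = "map (\<lambda>(i, b). rh i b) pl"
    have "cs ! j = (\<Sum>p<length ?cl. sC (F.representation (set ?cl) (cs ! j) (?cl ! p)) (?cl ! p))"
      by (rule F.representation_expand[OF pl(5,6)]) (use pl(7) in simp)
    also have "\<dots> = (\<Sum>p<length cs. sC (F.representation (set ?cl) (cs ! j) (?cl ! p)) (rb p))"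
      by (intro sum.cong) (use rb lencs in \<open>auto simp: d_def\<close>)
    finally show "\<exists>q. cs ! j = (\<Sum>p<length cs. sC (q p) (rb p))" by (intro exI)
  qed
  have q: "q \<noteq> 0"
    unfolding q_def
  proof (rule Z.det_cm_nonzero[OF bl(1,2)])
    show "bs ! p \<in> Z.span (set bl)" if "p < length bl" for p
      using that len lenbs bl(3) bs'(3) Z.span_base[of "bs ! p" "set bs"] by auto
    fix j assume "j < length bl"
    then have "bl ! j \<in> Z.span (set bs)" using bl(3) bs'(3) Z.span_base[of "bl ! j" "set bl"] by auto
    from Z.representation_expand[OF bs'(2,1) this]
    show "\<exists>q. bl ! j = (\<Sum>p<length bl. sB (q p) (bs ! p))" unfolding len lenbs by (intro exI)
  qed
  show ?thesis
  proof (intro exI[of _ "y0 * q"] conjI allI)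
    show "y0 * q \<noteq> 0" using y0 q by simp
    fix m
    define x where "x p = Determinant.det (Z.cm bl (\<lambda>j. theta (fst p) (lv j) (bl ! j)))" for p :: "'k \<times> ('b ^ 'n)"
    define y where "y p = Determinant.det (F.cm cs (\<lambda>j. Yv (lv j) (bl ! j) p))" for p
    define f where "f p = Determinant.det (F.cm cs (\<lambda>j. dG p (bl ! j)))" for p
    have thsp: "theta e (lv j) (bl ! j) \<in> Z.span (set bl)" if "j < d" for e j
      using theta_NC[OF lv(1,2)[OF that]] bl(3) by simp
    have nx: "near (Wm m) x 1"
    proof -
      have "near (Wm m) x (Determinant.det (Z.cm bl ((!) bl)))"
        unfolding x_def[abs_def]
      proof (rule Z.near_det_cm[OF bl(1) norm_Wm])
        fix j assume j: "j < length bl"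
        show "bl ! j \<in> Z.span (set bl)" using j by (intro Z.span_base) auto
        show "theta (fst p) (lv j) (bl ! j) \<in> Z.span (set bl)" for p using thsp j len by simp
        obtain C where "\<And>e. norm e \<le> 1 \<Longrightarrow> norm (theta e (lv j) (bl ! j) - bl ! j) \<le> C * norm e"
          using theta_near by metis
        then show "\<exists>C. \<forall>p\<in>Wm m. norm (theta (fst p) (lv j) (bl ! j) - bl ! j) \<le> C * norm (fst p)"
          using norm_Wm by metis
      qed
      then show ?thesis by (simp add: Z.cm_self[OF bl(1,2)])
    qed
    have ny: "near (Wm m) y y0"
      unfolding y_def[abs_def] y0_def
      by (rule F.near_det_cm[OF cs'(2) norm_Wm]) (use cs'(3) Yv(2)[OF lv(1,3)] lencs in \<open>auto simp: rb_def\<close>)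
    have fx: "f p * x p = y p * fst p ^ chi" if p: "p \<in> Wm m" for p
    proof -
      note lin = dG_klinear[OF p]
      have "F.cm cs (\<lambda>j. dG p (theta (fst p) (lv j) (bl ! j))) =
          F.cm cs (\<lambda>j. dG p (bl ! j)) * Z.cm bl (\<lambda>j. theta (fst p) (lv j) (bl ! j))"
        by (rule cm_transport[OF lin cs'(2,3) bl(1,2)]) (use len lencs thsp in auto)
      then have "f p * x p = Determinant.det (F.cm cs (\<lambda>j. dG p (theta (fst p) (lv j) (bl ! j))))"
        unfolding f_def x_def using det_mult[OF F.cm_carrier, of "Z.cm bl (\<lambda>j. theta (fst p) (lv j) (bl ! j))" cs]
          Z.cm_carrier[of bl] len lencs by simp
      also have "F.cm cs (\<lambda>j. dG p (theta (fst p) (lv j) (bl ! j))) = F.cm cs (\<lambda>j. sC (fst p ^ lv j) (Yv (lv j) (bl ! j) p))"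
        using Yv(1)[OF lv(1,3) p] lencs by (intro eq_matI) (auto simp: F.cm_def)
      also have "Determinant.det \<dots> = y p * (\<Prod>j<length cs. fst p ^ lv j)"
        unfolding y_def by (rule F.det_cm_scale[OF cs'(2)]) (use cs'(3) in simp)
      also have "(\<Prod>j<length cs. fst p ^ lv j) = fst p ^ (\<Sum>j<d. lv j)" by (simp add: lencs power_sum)
      also have "(\<Sum>j<d. lv j) = sum_list (map fst pl)"
        by (simp add: sum_list_sum_nth d_def lv_def lessThan_atLeast0)
      finally show ?thesis by (simp add: pl(8))
    qed
    have fq: "det_wrt sC bs cs (dG p) = f p * q" if p: "p \<in> Wm m" for p
    proof -
      have "det_wrt sC bs cs (dG p) = Determinant.det (F.cm cs (\<lambda>j. dG p (bs ! j)))"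
        by (simp add: det_wrt_def F.cm_def lencs lenbs)
      also have "F.cm cs (\<lambda>j. dG p (bs ! j)) = F.cm cs (\<lambda>j. dG p (bl ! j)) * Z.cm bl ((!) bs)"
      proof (rule cm_transport[OF dG_klinear[OF p] cs'(2,3) bl(1,2)])
        show "bs ! j \<in> Z.span (set bl)" if "j < length bl" for j
          using that len lenbs bl(3) bs'(3) Z.span_base[of "bs ! j" "set bs"] by auto
      qed (simp add: len lencs)
      finally show ?thesis
        unfolding f_def q_def using det_mult[OF F.cm_carrier, of "Z.cm bl ((!) bs)" cs]
          Z.cm_carrier[of bl] len lencs by simp
    qed
    \<comment> \<open>The two estimates are combined before the division by \<open>x p\<close>,
      after which a lower bound on \<open>x p\<close> is all that remains to be found.\<close>
    have "near (Wm m) (\<lambda>p. y p + (- y0) * x p) (y0 + (- y0) * 1)"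
      by (intro near_add near_mult near_const ny nx norm_Wm)
    then obtain C1 where C1: "\<And>p. p \<in> Wm m \<Longrightarrow> norm (y p - y0 * x p) \<le> C1 * norm (fst p)"
      unfolding near_def by auto
    obtain C2 where C2: "\<And>p. p \<in> Wm m \<Longrightarrow> norm (x p - 1) \<le> C2 * norm (fst p)" using nx unfolding near_def by blast
    \<comment> \<open>Below this radius \<open>x p\<close> differs from \<open>1\<close> by at most
      one half.\<close>
    define e0 where "e0 = 1 / (2 * (\<bar>C2\<bar> + 1))"
    show "\<exists>C. \<exists>\<epsilon>0>0. \<forall>p\<in>Wm m. norm (fst p) < \<epsilon>0 \<longrightarrow>
      norm (det_wrt sC bs cs (dG p) - y0 * q * fst p ^ chi) \<le> C * norm (fst p) ^ (chi + 1)"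
    proof (rule exI[of _ "2 * C1 * norm q"], rule exI[of _ e0], intro conjI ballI impI)
      show "e0 > 0" by (simp add: e0_def add_nonneg_pos)
      fix p assume p: "p \<in> Wm m" and e: "norm (fst p) < e0"
      have "norm (x p - 1) \<le> (\<bar>C2\<bar> + 1) * norm (fst p)"
        using C2[OF p] by (rule order_trans) (intro mult_right_mono, auto)
      also have "\<dots> \<le> (\<bar>C2\<bar> + 1) * e0" using e by (intro mult_left_mono) auto
      also have "\<dots> = 1 / 2" by (simp add: e0_def field_simps)
      finally have "norm (x p) \<ge> 1 / 2" using norm_triangle_ineq2[of 1 "1 - x p"] by (simp add: norm_minus_commute)
      then have "norm (f p - y0 * fst p ^ chi) * (1 / 2) \<le> norm (f p - y0 * fst p ^ chi) * norm (x p)"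
        by (intro mult_left_mono) auto
      also have "\<dots> = norm (y p - y0 * x p) * norm (fst p) ^ chi"
      proof -
        have "(f p - y0 * fst p ^ chi) * x p = f p * x p - y0 * x p * fst p ^ chi" unfolding left_diff_distrib by (simp only: mult.assoc mult.commute[of _ "x p"])
        also have "\<dots> = (y p - y0 * x p) * fst p ^ chi" by (simp only: fx[OF p] left_diff_distrib)
        finally show ?thesis by (simp only: norm_mult[symmetric] norm_power[symmetric])
      qed
      also have "\<dots> \<le> C1 * norm (fst p) * norm (fst p) ^ chi" using C1[OF p] by (intro mult_right_mono) auto
      finally have 1: "norm (f p - y0 * fst p ^ chi) \<le> 2 * C1 * norm (fst p) ^ (chi + 1)" by (simp add: mult_ac)
      have "det_wrt sC bs cs (dG p) - y0 * q * fst p ^ chi = (f p - y0 * fst p ^ chi) * q"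
        unfolding fq[OF p] left_diff_distrib by (simp only: mult.assoc mult.commute[of q])
      then show "norm (det_wrt sC bs cs (dG p) - y0 * q * fst p ^ chi) \<le> 2 * C1 * norm q * norm (fst p) ^ (chi + 1)"
        using mult_right_mono[OF 1 norm_ge_zero[of q]] by (simp only: norm_mult mult.assoc mult.commute[of "norm q"])
    qed
  qed
qed

end

theorem theorem1:
  fixes sB :: "'k::{real_normed_field,euclidean_space} \<Rightarrow> 'b::banach \<Rightarrow> 'b"
    and sC :: "'k \<Rightarrow> 'c::banach \<Rightarrow> 'c"
    and G :: "'b \<Rightarrow> 'c"
    and k :: nat
    and ix :: "'n::finite \<Rightarrow> nat"
    and zbar :: "'b list"
    and S :: "nat \<Rightarrow> 'b \<Rightarrow> 'c"
    and N Nc :: "nat \<Rightarrow> 'b set"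
    and R Rc :: "nat \<Rightarrow> 'c set"
  assumes "banach_over sB" and "banach_over sC"
    and "analytic_near sB sC G 0" and "G 0 = 0"
    and "k \<ge> 1"
    and "bij_betw ix (UNIV :: 'n set) {1..k+1}"
    and "zbar \<in> take k ` X sB sC G (2 * k)"
    and "decomposition sB sC (expansion_coeff sB sC G zbar) k S N Nc R Rc"
    and "{(\<Sum>i=1..k+1. S i (n (i - 1))) | n. \<forall>i\<in>{0..k}. n i \<in> N i} = UNIV"
  shows "\<exists>(W :: ('k \<times> ('b ^ 'n)) set) (z :: 'k \<times> ('b ^ 'n) \<Rightarrow> 'b)
            (zz :: nat \<Rightarrow> 'k \<times> ('b ^ 'n) \<Rightarrow> 'b) (nc :: 'n \<Rightarrow> 'k \<times> ('b ^ 'n) \<Rightarrow> 'b)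
            (Ihat :: 'b ^ 'n) (Mhat :: 'b ^ 'n \<Rightarrow> 'b ^ 'n) (Lhat :: 'b ^ 'n \<Rightarrow> 'b ^ 'n).
       \<comment> \<open>the domain W, a relatively open subset of \<open>K \<times> N\<^sub>1 \<times> \<dots> \<times> N\<^bsub>k+1\<^esub>\<close>\<close>
       W \<subseteq> UNIV \<times> param_space ix N \<and>
       (\<forall>Q. bounded Q \<and> Q \<subseteq> param_space ix N \<longrightarrow> (\<exists>\<epsilon>0>0. {\<epsilon>. norm \<epsilon> < \<epsilon>0} \<times> Q \<subseteq> W)) \<and>
       smooth_on_subspace (scale_prod (scale_vec sB)) sB (UNIV \<times> param_space ix N) W z \<and>
       (\<forall>p\<in>W. G (z p) = 0) \<and>
       \<comment> \<open>(i)\<close>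
       (\<forall>j\<in>{k+1..2*k+1}. smooth_on_subspace (scale_prod (scale_vec sB)) sB (UNIV \<times> param_space ix N) W (zz j)) \<and>
       (\<forall>(\<epsilon>, n)\<in>W. z (\<epsilon>, n) =
          (\<Sum>j=1..k. sB (\<epsilon> ^ j / fact j) (zbar ! (j - 1))) +
          (\<Sum>j=k+1..2*k+1. sB (\<epsilon> ^ j / fact j) (zz j (\<epsilon>, n)))) \<and>
       \<comment> \<open>(ii)\<close>
       (\<forall>n\<in>param_space ix N. zbar @ map (\<lambda>j. zz j (0, n)) [k+1..<2*k+2] \<in> Xbar sB sC G zbar (2*k+1)) \<and>
       (\<forall>p\<in>W. zbar @ map (\<lambda>j. zz j p) [k+1..<2*k+1] \<in> Xbar sB sC G zbar (2*k)) \<and>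
       \<comment> \<open>(iii)\<close>
       Mhat \<in> GL (scale_vec sB) \<and> Lhat \<in> GL (scale_vec sB) \<and>
       (\<forall>i. smooth_on_subspace (scale_prod (scale_vec sB)) sB (UNIV \<times> param_space ix N) W (nc i) \<and>
            (\<forall>p\<in>W. nc i p \<in> Nc (ix i)) \<and>
            (\<forall>n\<in>param_space ix N. nc i (0, n) = 0)) \<and>
       (\<forall>(\<epsilon>, n)\<in>W. (\<chi> i. zz (2*k+2 - ix i) (\<epsilon>, n)) =
          Ihat + Mhat ((\<chi> i. nc i (\<epsilon>, n)) + Lhat n)) \<and>
       \<comment> \<open>(iv)\<close>
       (finite_dim sB (subspace_sum {1..k+1} Nc) \<longrightarrow>
          finite_dim sC (UNIV :: 'c set) \<and>
          vector_space.dim sC (UNIV :: 'c set) = vector_space.dim sB (subspace_sum {1..k+1} Nc) \<and>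
          (\<forall>bs cs. is_basis sB (subspace_sum {1..k+1} Nc) bs \<and> is_basis sC UNIV cs \<longrightarrow>
            (\<exists>c. c \<noteq> 0 \<and>
              (\<forall>Q. bounded Q \<and> Q \<subseteq> param_space ix N \<longrightarrow>
                (\<exists>C. \<exists>\<epsilon>0>0. {\<epsilon>. norm \<epsilon> < \<epsilon>0} \<times> Q \<subseteq> W \<and>
                  (\<forall>\<epsilon> n. norm \<epsilon> < \<epsilon>0 \<and> n \<in> Q \<longrightarrow>
                    norm (det_wrt sC bs cs (frechet_derivative G (at (z (\<epsilon>, n))))
                        - c * \<epsilon> ^ (\<Sum>i=1..k. i * vector_space.dim sB (Nc (i + 1))))
                      \<le> C * norm \<epsilon> ^ ((\<Sum>i=1..k. i * vector_space.dim sB (Nc (i + 1))) + 1)))))))"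
proof -
  obtain U where "0 \<in> U" "\<forall>y\<in>U. analytic_at_point sB sC G y"
    using assms(3) unfolding analytic_near_def by blast
  then have "analytic_at_point sB sC G 0" by blast
  then obtain a r C where r: "r > 0" and a_lin: "\<forall>m. bounded_multilinear_on sB sC UNIV m (a m)"
    and a_sym: "\<forall>m vs ws. length vs = m \<and> mset vs = mset ws \<longrightarrow> a m vs = a m ws"
    and a_bound: "\<forall>m vs. length vs = m \<longrightarrow> norm (a m vs) \<le> C / r ^ m * prod_list (map norm vs)"
    and a_sums: "\<forall>h. norm h < r \<longrightarrow> (\<lambda>m. a m (replicate m h)) sums G (0 + h)"
    unfolding analytic_at_point_def by (elim exE conjE) (rule that)
  \<comment> \<open>The forms of all degrees are merged into one function of lists, the degree being
    the length of the list.\<close>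
  define al where "al vs = a (length vs) vs" for vs
  define M where "M = max C 0"
  interpret power_series sB sC al r M
  proof (intro power_series.intro two_spaces.intro power_series_axioms.intro)
    show "banach_over sB" "banach_over sC" "r > 0" by fact+
    show "0 \<le> M" by (simp add: M_def)
    show "al (vs[i := x + y]) = al (vs[i := x]) + al (vs[i := y])" if "i < length vs" for i vs x y
      using a_lin[rule_format, of "length vs"] that unfolding bounded_multilinear_on_def al_def by simp
    show "al (vs[i := sB c x]) = sC c (al (vs[i := x]))" if "i < length vs" for i vs c x
      using a_lin[rule_format, of "length vs"] that unfolding bounded_multilinear_on_def al_def by simp
    show "al vs = al ws" if "mset vs = mset ws" for vs ws
      using a_sym[rule_format, OF conjI[OF refl that]] mset_eq_length[OF that] by (simp add: al_def)
    show "norm (al vs) \<le> M / r ^ length vs * prod_list (map norm vs)" for vs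
    proof -
      have "norm (al vs) \<le> C / r ^ length vs * prod_list (map norm vs)" unfolding al_def by (rule a_bound[rule_format]) (rule refl)
      also have "\<dots> \<le> M / r ^ length vs * prod_list (map norm vs)"
        using r by (intro mult_right_mono divide_right_mono prod_list_nonneg) (auto simp: M_def)
      finally show ?thesis .
    qed
  qed
  interpret analytic_map sB sC al r M G
  proof
    show "G x = ser (\<lambda>m. 1) [] x" if "norm x < r" for x
      using sums_unique[OF a_sums[rule_format, OF that]] by (simp add: ser_def al_def)
  qed
  interpret solution_setup sB sC al r M G "expansion_coeff sB sC G zbar" S N Nc R Rc k zbar ix
  proof (intro solution_setup.intro kernel_chain.intro kernel_chain_axioms.intro solution_setup_axioms.intro
      analytic_map_axioms assms expansion_coeff_eq_gam)
    show "bounded_klinear sB sC (expansion_coeff sB sC G zbar j)" for j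
      unfolding expansion_coeff_eq_gam[abs_def] by (rule bounded_klinear_gam)
    show "Rc (k + 1) = {0}" by (rule complement_zero_of_surjective[OF assms(2,8,9)])
  qed
  have Wm_WW: "Wm m \<subseteq> WW" for m by (auto simp: WW_def)
  have bnd: "\<exists>\<epsilon>0>0. {\<epsilon>. norm \<epsilon> < \<epsilon>0} \<times> Q \<subseteq> WW" if Q: "bounded Q" "Q \<subseteq> P" for Q
  proof -
    obtain m where "{\<epsilon>. norm \<epsilon> < dl m} \<times> Q \<subseteq> Wm m" by (rule WW_bounded_subset[OF Q]) (rule that)
    then have "{\<epsilon>. norm \<epsilon> < dl m} \<times> Q \<subseteq> WW" using Wm_WW by (rule subset_trans)
    then show ?thesis by (intro exI[of _ "dl m"] conjI dl(1))
  qed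
  have det: "\<exists>c. c \<noteq> 0 \<and> (\<forall>Q. bounded Q \<and> Q \<subseteq> P \<longrightarrow> (\<exists>C. \<exists>\<epsilon>0>0. {\<epsilon>. norm \<epsilon> < \<epsilon>0} \<times> Q \<subseteq> WW \<and>
      (\<forall>\<epsilon> n. norm \<epsilon> < \<epsilon>0 \<and> n \<in> Q \<longrightarrow>
        norm (det_wrt sC bs cs (dG (\<epsilon>, n)) - c * \<epsilon> ^ chi) \<le> C * norm \<epsilon> ^ (chi + 1))))"
    if fin: "finite_dim sB NC" and bc: "is_basis sB NC bs" "is_basis sC UNIV cs" for bs cs
  proof -
    obtain c where c: "c \<noteq> 0" "\<forall>m. \<exists>C. \<exists>\<epsilon>0>0. \<forall>p\<in>Wm m. norm (fst p) < \<epsilon>0 \<longrightarrow>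
        norm (det_wrt sC bs cs (dG p) - c * fst p ^ chi) \<le> C * norm (fst p) ^ (chi + 1)"
      using determinant_expansion[OF fin bc] by (elim exE conjE) (rule that)
    show ?thesis
    proof (intro exI[of _ c] conjI c(1) allI impI)
      fix Q assume Q: "bounded Q \<and> Q \<subseteq> P"
      obtain m where m: "{\<epsilon>. norm \<epsilon> < dl m} \<times> Q \<subseteq> Wm m"
        by (rule WW_bounded_subset[OF conjunct1[OF Q] conjunct2[OF Q]]) (rule that)
      obtain C e0 where C: "e0 > 0" "\<forall>p\<in>Wm m. norm (fst p) < e0 \<longrightarrow>
        norm (det_wrt sC bs cs (dG p) - c * fst p ^ chi) \<le> C * norm (fst p) ^ (chi + 1)" using spec[OF c(2), of m] by (elim exE conjE) (rule that)
      show "\<exists>C. \<exists>\<epsilon>0>0. {\<epsilon>. norm \<epsilon> < \<epsilon>0} \<times> Q \<subseteq> WW \<and>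
        (\<forall>\<epsilon> n. norm \<epsilon> < \<epsilon>0 \<and> n \<in> Q \<longrightarrow>
          norm (det_wrt sC bs cs (dG (\<epsilon>, n)) - c * \<epsilon> ^ chi) \<le> C * norm \<epsilon> ^ (chi + 1))"
      proof (rule exI[of _ C], rule exI[of _ "min (dl m) e0"], intro conjI allI impI)
        show "min (dl m) e0 > 0" using dl(1)[of m] C(1) by simp
        show "{\<epsilon>. norm \<epsilon> < min (dl m) e0} \<times> Q \<subseteq> WW" using m Wm_WW[of m] by auto
        fix \<epsilon> :: 'k and n :: "'b ^ 'n" assume "norm \<epsilon> < min (dl m) e0 \<and> n \<in> Q"
        then have "(\<epsilon>, n) \<in> Wm m" "norm (fst (\<epsilon>, n)) < e0" using m by auto
        from C(2)[rule_format, OF this] show "norm (det_wrt sC bs cs (dG (\<epsilon>, n)) - c * \<epsilon> ^ chi) \<le> C * norm \<epsilon> ^ (chi + 1)"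
          by (simp only: fst_conv)
      qed
    qed
  qed
  have low: "zbar @ map (\<lambda>j. zz j p) [k+1..<2*k+1] \<in> Xbar sB sC G zbar (2*k)" if "p \<in> WW" for p
    by (rule zz_Xbar) (use WW_subset that in auto)
  have top: "zbar @ map (\<lambda>j. zz j (0, n)) [k+1..<2*k+2] \<in> Xbar sB sC G zbar (2*k+1)" if "n \<in> P" for n
  proof -
    have "zbar @ map (\<lambda>j. zz j (0, n)) [k+1..<(2*k+1)+1] \<in> Xbar sB sC G zbar (2*k+1)"
      by (rule zz_Xbar) (use that ysol_zero in auto)
    moreover have "(2*k+1)+1 = 2*k+2" by simp
    ultimately show ?thesis by (simp only:)
  qed
  show ?thesis
  proof (rule exI[of _ WW], rule exI[of _ sol], rule exI[of _ zz], rule exI[of _ ncomp],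
      rule exI[of _ Ihat], rule exI[of _ Mhat], rule exI[of _ Lhat], intro conjI)
    show "WW \<subseteq> UNIV \<times> P" by (rule WW_subset)
    show "\<forall>Q. bounded Q \<and> Q \<subseteq> P \<longrightarrow> (\<exists>\<epsilon>0>0. {\<epsilon>. norm \<epsilon> < \<epsilon>0} \<times> Q \<subseteq> WW)"
      using bnd by blast
    show "smooth_on_subspace (scale_prod sN) sB (UNIV \<times> P) WW sol" by (rule smooth_sol)
    show "\<forall>p\<in>WW. G (sol p) = 0" using G_sol by blast
    show "\<forall>j\<in>{k+1..2*k+1}. smooth_on_subspace (scale_prod sN) sB (UNIV \<times> P) WW (zz j)" using smooth_zz by blast
    show "\<forall>(\<epsilon>, n)\<in>WW. sol (\<epsilon>, n) = (\<Sum>j=1..k. sB (\<epsilon> ^ j / fact j) (zbar ! (j - 1))) +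
        (\<Sum>j=k+1..2*k+1. sB (\<epsilon> ^ j / fact j) (zz j (\<epsilon>, n)))"
      unfolding sol_expansion by blast
    show "\<forall>n\<in>P. zbar @ map (\<lambda>j. zz j (0, n)) [k+1..<2*k+2] \<in> Xbar sB sC G zbar (2*k+1)" using top by blast
    show "\<forall>p\<in>WW. zbar @ map (\<lambda>j. zz j p) [k+1..<2*k+1] \<in> Xbar sB sC G zbar (2*k)" using low by blast
    show "Mhat \<in> GL sN" "Lhat \<in> GL sN" by (rule Mhat_GL, rule Lhat_GL)
    show "\<forall>i. smooth_on_subspace (scale_prod sN) sB (UNIV \<times> P) WW (ncomp i) \<and>
        (\<forall>p\<in>WW. ncomp i p \<in> Nc (ix i)) \<and> (\<forall>n\<in>P. ncomp i (0, n) = 0)"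
      using smooth_ncomp ncomp_mem ncomp_zero by blast
    show "\<forall>(\<epsilon>, n)\<in>WW. (\<chi> i. zz (2*k+2 - ix i) (\<epsilon>, n)) = Ihat + Mhat ((\<chi> i. ncomp i (\<epsilon>, n)) + Lhat n)"
      unfolding zz_affine by blast
  qed (unfold NC_def[symmetric], use finite_dim_codomain det in blast)
qed

end
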